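(* Let $l\ge1$, $n\ge0$, and let $c$ be a parameter for the groups $G(l,1,m)$ with $c_0=-\frac1l$ and such that there exists $k\in\mathbb{C}$ with $lk_i\in\mathbb{Z}+k$ for every $i$. Set $\mathbf{k'}=(k'_1,\ldots,k'_l)\in\mathbb{Z}^l$ with $k'_d=lk_{1-d}-k$ for $1\le d\le l$. Then the set of Jucys--Murphy cellular characters of $G(l,1,n)$ for the parameter $c$ coincides with the set of characters $\gamma_v$ obtained by evaluation at $q=1$ of the quasimonomial vectors $v$ of $\mathcal{F}^n_{\mathbf{k'}}$.
   Context: **The group and parameters.** Let $\zeta=\exp(2i\pi/l)$. $G(l,1,n)\subset\mathrm{GL}_n(\mathbb{C})$ is the group of monomial matrices with nonzero entries in $\mu_l=\langle\zeta\rangle$, acting on $\mathbb{C}^n$ with basis $(y_i)$; $G(l,1,0)$ is the trivial group, and $G(l,1,i)\subset G(l,1,n)$ for $i\le n$ is the subgroup fixing $y_{i+1},\dots,y_n$. Let $s_{i,j}$ exchange $y_i,y_j$ and fix the other basis vectors, and let $\sigma_i$ send $y_i$ to $\zeta y_i$ and fix the other basis vectors. The set $\mathrm{Ref}(G(l,1,n))$ of reflections is the union of the classes $S_0=\{\sigma_j^ts_{i,j}\sigma_j^{-t}:1\le i\ne j\le n,\ 0\le t<l\}$ and $S_m=\{\sigma_i^m:1\le i\le n\}$, $1\le m\le l-1$. A parameter $c$ is a tuple $(c_0,\dots,c_{l-1})\in\mathbb{C}^l$; put $c_s=c_m$ for $s\in S_m$. Define $k_i=\frac1l\sum_{j=1}^{l-1}\zeta^{j(1-i)}c_j$,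 with indices $i$ taken modulo $l$. **Jucys--Murphy cellular characters.** For $1\le i\le n$ let $$J_i=\sum_{s\in\mathrm{Ref}(G(l,1,i))\setminus\mathrm{Ref}(G(l,1,i-1))}c_s\det(s)\,s\in\mathbb{C}[G(l,1,n)].$$ These elements generate a commutative subalgebra $\mathrm{JM}_c(l,n)$ of $\mathbb{C}[G(l,1,n)]$. For an irreducible representation $L$ of $\mathrm{JM}_c(l,n)$, the Jucys--Murphy cellular character associated with $L$ is $\gamma_L^{\mathrm{JM}}=\sum_{\chi\in\mathrm{Irr}(G(l,1,n))}[\mathrm{Res}_{\mathrm{JM}_c(l,n)}^{\mathbb{C}[G(l,1,n)]}(V_\chi):L]\,\chi$, where $V_\chi$ is a simple module affording $\chi$ and $[M:L]$ is the multiplicity of $L$ as a composition factor of $M$. **$l$-partitions.** An $l$-partition of $n$ is an $l$-tuple $\lambda=(\lambda^{(1)},\dots,\lambda^{(l)})$ of partitions of total size $n$. Its Young diagram is $[\lambda]=\{(a,b,d): a,b\ge1,\ 1\le d\le l,\ b\le\lambda^{(d)}_a\}$; its elements are boxes. A box of $[\lambda]$ is removable if removing it leaves the diagram of an $l$-partition; a box not in $[\lambda]$ is addable if adding it gives the diagram of an $l$-partition. Irreducible characters of $G(l,1,n)$ are parametrized by $l$-partitions of $n$: $\chi_\lambda$ is the character of the module induced from $\prod_dG(l,1,|\lambda^{(d)}|)$ of the external tensor product of the modules $S^{\lambda^{(d)}}\otimes\delta^{d-1}$, where $S^\mu$ is the Specht module of the symmetric group inflated to $G(l,1,|\mu|)$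 (with $S^{(m)}$ trivial) and $\delta$ is the linear character with $\delta(\sigma_i)=\zeta$, $\delta(s_{i,j})=1$. With this convention $J_i$ acts on the line of $V_\lambda$ attached to a standard tableau $\mathfrak{t}$ by $l(k_{1-d}-c_0(b-a))$, where $\mathfrak{t}(a,b,d)=i$. **Fock space.** Let $q$ be an indeterminate and $\mathbf{s}=(s_1,\dots,s_l)\in\mathbb{Z}^l$. The Fock space $\mathcal{F}_{\mathbf{s}}$ is the $\mathbb{Q}(q)$-vector space with basis $|\lambda,\mathbf{s}\rangle$, $\lambda$ running over all $l$-partitions of integers, and $\mathcal{F}^n_{\mathbf{s}}$ is the span of those with $\lambda$ an $l$-partition of $n$. The charged content of a box $(a,b,d)$ is $b-a+s_d$. For boxes $\gamma=(a,b,d)$, $\gamma'=(a',b',d')$ of the same charged content write $\gamma'\succ_{\mathbf{s}}\gamma$ if $d'>d$. For $i\in\mathbb{Z}$, the generator $F_i$ of $U_q(\mathfrak{sl}_\infty)$ acts by $$F_i\cdot|\lambda,\mathbf{s}\rangle=\sum_{\mu}q^{N_i^{\succ}(\lambda,\mu)}|\mu,\mathbf{s}\rangle,$$ the sum over $\mu$ with $[\mu]=[\lambda]\cup\{\gamma\}$, $\gamma$ an addable box of charged content $i$, where $N_i^{\succ}(\lambda,\mu)$ is the number of addable boxes $\gamma'\succ_{\mathbf{s}}\gamma$ of $\lambda$ of charged content $i$ minus the number of removable boxes $\gamma'\succ_{\mathbf{s}}\gamma$ of $\lambda$ of charged content $i$. **Quasimonomial vectors.** A nonzero $v\in\mathcal{F}^n_{\mathbf{s}}$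 is quasimonomial if $v=F_{i_n}\cdots F_{i_1}\cdot|\emptyset,\mathbf{s}\rangle$ for some integers $i_1,\dots,i_n$. Writing $v=\sum_\lambda a_\lambda(q)|\lambda,\mathbf{s}\rangle$ (with $a_\lambda(q)\in\mathbb{N}[q,q^{-1}]$), one sets $\gamma_v=\sum_\lambda a_\lambda(1)\chi_\lambda$. *)

theory Defs
  imports
    "Jordan_Normal_Form.Determinant"
    "HOL-Library.Function_Algebras"
    "HOL-Combinatorics.Combinatorics"
    "HOL-Computational_Algebra.Computational_Algebra"
begin

section \<open>Matrix representations and their characters\<close>

text \<open>
  Vectors are complex-valued functions on an index set \<open>X\<close> (extended by \<open>0\<close>), and a matrix with
  rows and columns indexed by \<open>X\<close> is a function \<open>'x \<Rightarrow> 'x \<Rightarrow> complex\<close> of which only the values on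
  \<open>X \<times> X\<close> matter.  Subspaces, spans and coordinates come from the library theory of vector
  spaces, applied to the pointwise scalar multiplication.
\<close>

definition fscale :: "complex \<Rightarrow> ('x \<Rightarrow> complex) \<Rightarrow> 'x \<Rightarrow> complex" where
  "fscale a f = (\<lambda>x. a * f x)"

global_interpretation fn: vector_space "fscale :: complex \<Rightarrow> ('x \<Rightarrow> complex) \<Rightarrow> 'x \<Rightarrow> complex"
  by unfold_locales (auto simp: fscale_def fun_eq_iff algebra_simps)

definition coord_space :: "'x set \<Rightarrow> ('x \<Rightarrow> complex) set" where
  "coord_space X = {v. \<forall>x. x \<notin> X \<longrightarrow> v x = 0}"

definition mat_act :: "'x set \<Rightarrow> ('x \<Rightarrow> 'x \<Rightarrow> complex) \<Rightarrow> ('x \<Rightarrow> complex) \<Rightarrow> 'x \<Rightarrow> complex" where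
  "mat_act X M v = (\<lambda>x. if x \<in> X then (\<Sum>y\<in>X. M x y * v y) else 0)"

definition is_rep :: "'g monoid \<Rightarrow> 'x set \<Rightarrow> ('g \<Rightarrow> 'x \<Rightarrow> 'x \<Rightarrow> complex) \<Rightarrow> bool" where
  "is_rep G X \<rho> \<longleftrightarrow> finite X \<and>
     (\<forall>x\<in>X. \<forall>y\<in>X. \<rho> \<one>\<^bsub>G\<^esub> x y = (if x = y then 1 else 0)) \<and>
     (\<forall>g\<in>carrier G. \<forall>h\<in>carrier G. \<forall>x\<in>X. \<forall>y\<in>X.
        \<rho> (g \<otimes>\<^bsub>G\<^esub> h) x y = (\<Sum>z\<in>X. \<rho> g x z * \<rho> h z y))"

definition rep_char :: "'g monoid \<Rightarrow> 'x set \<Rightarrow> ('g \<Rightarrow> 'x \<Rightarrow> 'x \<Rightarrow> complex) \<Rightarrow> 'g \<Rightarrow> complex" where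
  "rep_char G X \<rho> = (\<lambda>g. if g \<in> carrier G then (\<Sum>x\<in>X. \<rho> g x x) else 0)"

text \<open>Submodules and irreducibility, for the action of an arbitrary set \<open>A\<close> of operators
  (the elements of a group or of an algebra).\<close>

definition submod :: "'a set \<Rightarrow> 'x set \<Rightarrow> ('a \<Rightarrow> 'x \<Rightarrow> 'x \<Rightarrow> complex) \<Rightarrow> ('x \<Rightarrow> complex) set \<Rightarrow> bool" where
  "submod A X \<rho> W \<longleftrightarrow> fn.subspace W \<and> W \<subseteq> coord_space X \<and>
     (\<forall>a\<in>A. \<forall>w\<in>W. mat_act X (\<rho> a) w \<in> W)"

definition irreducible_on :: "'a set \<Rightarrow> 'x set \<Rightarrow> ('a \<Rightarrow> 'x \<Rightarrow> 'x \<Rightarrow> complex) \<Rightarrow> bool" where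
  "irreducible_on A X \<rho> \<longleftrightarrow> X \<noteq> {} \<and>
     (\<forall>W. submod A X \<rho> W \<longrightarrow> W = {0} \<or> W = coord_space X)"

text \<open>Up to isomorphism it is no restriction to take representations on \<open>\<complex>\<^sup>d\<close>, that is, with index set
  \<open>{..<d}\<close>; this applies to the representations of the Jucys--Murphy algebra below as well.\<close>

definition affords :: "'g monoid \<Rightarrow> nat \<Rightarrow> ('g \<Rightarrow> nat \<Rightarrow> nat \<Rightarrow> complex) \<Rightarrow> ('g \<Rightarrow> complex) \<Rightarrow> bool" where
  "affords G d \<rho> \<chi> \<longleftrightarrow> is_rep G {..<d} \<rho> \<and> irreducible_on (carrier G) {..<d} \<rho> \<and>
     \<chi> = rep_char G {..<d} \<rho>"

definition Irr :: "'g monoid \<Rightarrow> ('g \<Rightarrow> complex) set" where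
  "Irr G = {\<chi>. \<exists>d \<rho>. affords G d \<rho> \<chi>}"

definition irr_rep :: "'g monoid \<Rightarrow> ('g \<Rightarrow> complex) \<Rightarrow> nat \<times> ('g \<Rightarrow> nat \<Rightarrow> nat \<Rightarrow> complex)" where
  "irr_rep G \<chi> = (SOME (d, \<rho>). affords G d \<rho> \<chi>)"

section \<open>The group algebra and its subalgebras\<close>

text \<open>An element \<open>\<Sum>g. a g \<cdot> g\<close> of the group algebra is the function \<open>a\<close>, vanishing off the group.
  Subalgebras contain the unit.\<close>

definition galg_one :: "'g monoid \<Rightarrow> 'g \<Rightarrow> complex" where
  "galg_one G = (\<lambda>g. if g = \<one>\<^bsub>G\<^esub> then 1 else 0)"

definition galg_mult :: "'g monoid \<Rightarrow> ('g \<Rightarrow> complex) \<Rightarrow> ('g \<Rightarrow> complex) \<Rightarrow> 'g \<Rightarrow> complex" where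
  "galg_mult G a b = (\<lambda>g. if g \<in> carrier G
     then (\<Sum>h\<in>carrier G. a h * b (inv\<^bsub>G\<^esub> h \<otimes>\<^bsub>G\<^esub> g)) else 0)"

inductive_set generated_subalgebra :: "'g monoid \<Rightarrow> ('g \<Rightarrow> complex) set \<Rightarrow> ('g \<Rightarrow> complex) set"
  for G S where
  one: "galg_one G \<in> generated_subalgebra G S"
| gen: "a \<in> S \<Longrightarrow> a \<in> generated_subalgebra G S"
| scale: "a \<in> generated_subalgebra G S \<Longrightarrow> fscale z a \<in> generated_subalgebra G S"
| add: "a \<in> generated_subalgebra G S \<Longrightarrow> b \<in> generated_subalgebra G S \<Longrightarrow>
    a + b \<in> generated_subalgebra G S"
| mult: "a \<in> generated_subalgebra G S \<Longrightarrow> b \<in> generated_subalgebra G S \<Longrightarrow>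
    galg_mult G a b \<in> generated_subalgebra G S"

definition is_alg_rep ::
  "'g monoid \<Rightarrow> ('g \<Rightarrow> complex) set \<Rightarrow> 'x set \<Rightarrow> (('g \<Rightarrow> complex) \<Rightarrow> 'x \<Rightarrow> 'x \<Rightarrow> complex) \<Rightarrow> bool" where
  "is_alg_rep G A X \<tau> \<longleftrightarrow> finite X \<and> (\<forall>x\<in>X. \<forall>y\<in>X.
     \<tau> (galg_one G) x y = (if x = y then 1 else 0) \<and>
     (\<forall>a\<in>A. \<forall>z. \<tau> (fscale z a) x y = z * \<tau> a x y) \<and>
     (\<forall>a\<in>A. \<forall>b\<in>A. \<tau> (a + b) x y = \<tau> a x y + \<tau> b x y) \<and>
     (\<forall>a\<in>A. \<forall>b\<in>A. \<tau> (galg_mult G a b) x y = (\<Sum>z\<in>X. \<tau> a x z * \<tau> b z y)))"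

definition alg_ext ::
  "'g monoid \<Rightarrow> ('g \<Rightarrow> 'x \<Rightarrow> 'x \<Rightarrow> complex) \<Rightarrow> ('g \<Rightarrow> complex) \<Rightarrow> 'x \<Rightarrow> 'x \<Rightarrow> complex" where
  "alg_ext G \<rho> a x y = (\<Sum>g\<in>carrier G. a g * \<rho> g x y)"

definition composition_series ::
  "'a set \<Rightarrow> 'x set \<Rightarrow> ('a \<Rightarrow> 'x \<Rightarrow> 'x \<Rightarrow> complex) \<Rightarrow> ('x \<Rightarrow> complex) set list \<Rightarrow> bool" where
  "composition_series A X \<rho> Ws \<longleftrightarrow>
     Ws \<noteq> [] \<and> hd Ws = {0} \<and> last Ws = coord_space X \<and> (\<forall>W\<in>set Ws. submod A X \<rho> W) \<and>
     (\<forall>i. Suc i < length Ws \<longrightarrow> Ws ! i \<subset> Ws ! Suc i \<and>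
        (\<forall>U. submod A X \<rho> U \<and> Ws ! i \<subseteq> U \<and> U \<subseteq> Ws ! Suc i \<longrightarrow> U = Ws ! i \<or> U = Ws ! Suc i))"

text \<open>\<open>W / W'\<close> is isomorphic to the module \<open>(Y, \<tau>)\<close>: there is an equivariant linear surjection from
  \<open>W\<close> with kernel \<open>W'\<close>.\<close>

definition quotient_iso ::
  "'a set \<Rightarrow> 'x set \<Rightarrow> ('a \<Rightarrow> 'x \<Rightarrow> 'x \<Rightarrow> complex) \<Rightarrow> ('x \<Rightarrow> complex) set \<Rightarrow> ('x \<Rightarrow> complex) set \<Rightarrow>
   'y set \<Rightarrow> ('a \<Rightarrow> 'y \<Rightarrow> 'y \<Rightarrow> complex) \<Rightarrow> bool" where
  "quotient_iso A X \<rho> W' W Y \<tau> \<longleftrightarrow> (\<exists>\<phi>.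
     (\<forall>u\<in>W. \<forall>v\<in>W. \<phi> (u + v) = \<phi> u + \<phi> v) \<and>
     (\<forall>u\<in>W. \<forall>z. \<phi> (fscale z u) = fscale z (\<phi> u)) \<and>
     \<phi> ` W = coord_space Y \<and> {w \<in> W. \<phi> w = 0} = W' \<and>
     (\<forall>a\<in>A. \<forall>w\<in>W. \<phi> (mat_act X (\<rho> a) w) = mat_act Y (\<tau> a) (\<phi> w)))"

text \<open>Well defined by the Jordan--Hoelder theorem.\<close>

definition comp_mult ::
  "'a set \<Rightarrow> 'x set \<Rightarrow> ('a \<Rightarrow> 'x \<Rightarrow> 'x \<Rightarrow> complex) \<Rightarrow> 'y set \<Rightarrow> ('a \<Rightarrow> 'y \<Rightarrow> 'y \<Rightarrow> complex) \<Rightarrow> nat" where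
  "comp_mult A X \<rho> Y \<tau> = (THE m. \<exists>Ws. composition_series A X \<rho> Ws \<and>
     m = card {i. Suc i < length Ws \<and> quotient_iso A X \<rho> (Ws ! i) (Ws ! Suc i) Y \<tau>})"

section \<open>The group G(l,1,n) and its Jucys--Murphy elements\<close>

definition zeta :: "nat \<Rightarrow> complex" where
  "zeta l = exp (2 * \<i> * of_real pi / of_nat l)"

text \<open>The basis vectors \<open>y\<^sub>1, \<dots>, y\<^sub>n\<close> correspond to the matrix indices \<open>0, \<dots>, n - 1\<close>.\<close>

definition Gl1 :: "nat \<Rightarrow> nat \<Rightarrow> complex mat monoid" where
  "Gl1 l n = \<lparr>carrier = {A \<in> carrier_mat n n.
       (\<forall>i<n. \<exists>!j. j < n \<and> A $$ (i, j) \<noteq> 0) \<and>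
       (\<forall>j<n. \<exists>!i. i < n \<and> A $$ (i, j) \<noteq> 0) \<and>
       (\<forall>i<n. \<forall>j<n. A $$ (i, j) \<noteq> 0 \<longrightarrow> (\<exists>t. A $$ (i, j) = zeta l ^ t))},
     mult = (*), one = 1\<^sub>m n\<rparr>"

definition s_mat :: "nat \<Rightarrow> nat \<Rightarrow> nat \<Rightarrow> complex mat" where
  "s_mat n i j = mat n n (\<lambda>(a, b). if a = Transposition.transpose i j b then 1 else 0)"

definition sigma_mat :: "nat \<Rightarrow> nat \<Rightarrow> nat \<Rightarrow> complex mat" where
  "sigma_mat l n i = mat n n (\<lambda>(a, b). if a = b then (if a = i then zeta l else 1) else 0)"

text \<open>\<open>refl_class l n r m\<close> is the class \<open>S\<^sub>m\<close> of reflections of \<open>G(l,1,r)\<close>, regarded as a subset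
  of \<open>G(l,1,n)\<close>, where \<open>r \<le> n\<close>.\<close>

definition refl_class :: "nat \<Rightarrow> nat \<Rightarrow> nat \<Rightarrow> nat \<Rightarrow> complex mat set" where
  "refl_class l n r m =
    (if m = 0 then
       {sigma_mat l n j [^]\<^bsub>Gl1 l n\<^esub> t \<otimes>\<^bsub>Gl1 l n\<^esub> s_mat n i j \<otimes>\<^bsub>Gl1 l n\<^esub>
          inv\<^bsub>Gl1 l n\<^esub> (sigma_mat l n j [^]\<^bsub>Gl1 l n\<^esub> t) |
        (i::nat) (j::nat) (t::nat). i < r \<and> j < r \<and> i \<noteq> j \<and> t < l}
     else {sigma_mat l n i [^]\<^bsub>Gl1 l n\<^esub> m | i. i < r})"

definition reflections :: "nat \<Rightarrow> nat \<Rightarrow> nat \<Rightarrow> complex mat set" where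
  "reflections l n r = (\<Union>m<l. refl_class l n r m)"

text \<open>A parameter is a function \<open>c :: nat \<Rightarrow> complex\<close> of which only \<open>c 0, \<dots>, c (l - 1)\<close> are used.\<close>

definition refl_param :: "nat \<Rightarrow> nat \<Rightarrow> (nat \<Rightarrow> complex) \<Rightarrow> complex mat \<Rightarrow> complex" where
  "refl_param l n c s = c (THE m. m < l \<and> s \<in> refl_class l n n m)"

definition k_param :: "nat \<Rightarrow> (nat \<Rightarrow> complex) \<Rightarrow> int \<Rightarrow> complex" where
  "k_param l c i = (1 / of_nat l) * (\<Sum>j=1..l-1. zeta l powi (int j * (1 - i)) * c j)"

definition jm_element :: "nat \<Rightarrow> nat \<Rightarrow> (nat \<Rightarrow> complex) \<Rightarrow> nat \<Rightarrow> complex mat \<Rightarrow> complex" where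
  "jm_element l n c i = (\<lambda>s. if s \<in> reflections l n i - reflections l n (i - 1)
     then refl_param l n c s * det s else 0)"

definition JM :: "nat \<Rightarrow> nat \<Rightarrow> (nat \<Rightarrow> complex) \<Rightarrow> (complex mat \<Rightarrow> complex) set" where
  "JM l n c = generated_subalgebra (Gl1 l n) (jm_element l n c ` {1..n})"

definition jm_char ::
  "nat \<Rightarrow> nat \<Rightarrow> (nat \<Rightarrow> complex) \<Rightarrow> nat \<Rightarrow> ((complex mat \<Rightarrow> complex) \<Rightarrow> nat \<Rightarrow> nat \<Rightarrow> complex) \<Rightarrow>
   complex mat \<Rightarrow> complex" where
  "jm_char l n c e \<tau> = (\<lambda>g. \<Sum>\<chi>\<in>Irr (Gl1 l n).
     (case irr_rep (Gl1 l n) \<chi> of (d, \<rho>) \<Rightarrow>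
        of_nat (comp_mult (JM l n c) {..<d} (alg_ext (Gl1 l n) \<rho>) {..<e} \<tau>)) * \<chi> g)"

definition jm_cellular_characters ::
  "nat \<Rightarrow> nat \<Rightarrow> (nat \<Rightarrow> complex) \<Rightarrow> (complex mat \<Rightarrow> complex) set" where
  "jm_cellular_characters l n c = {jm_char l n c e \<tau> | e \<tau>.
     is_alg_rep (Gl1 l n) (JM l n c) {..<e} \<tau> \<and> irreducible_on (JM l n c) {..<e} \<tau>}"

section \<open>Partitions and multipartitions\<close>

definition is_partition :: "nat list \<Rightarrow> bool" where
  "is_partition \<mu> \<longleftrightarrow> sorted_wrt (\<ge>) \<mu> \<and> 0 \<notin> set \<mu>"

definition ydiag :: "nat list \<Rightarrow> (nat \<times> nat) set" where
  "ydiag \<mu> = {(a, b). 1 \<le> a \<and> a \<le> length \<mu> \<and> 1 \<le> b \<and> b \<le> \<mu> ! (a - 1)}"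

definition is_lpart :: "nat \<Rightarrow> nat list list \<Rightarrow> bool" where
  "is_lpart l lam \<longleftrightarrow> length lam = l \<and> (\<forall>\<mu>\<in>set lam. is_partition \<mu>)"

definition lpart_size :: "nat list list \<Rightarrow> nat" where
  "lpart_size lam = sum_list (map sum_list lam)"

definition lparts :: "nat \<Rightarrow> nat \<Rightarrow> nat list list set" where
  "lparts l n = {lam. is_lpart l lam \<and> lpart_size lam = n}"

type_synonym box = "nat \<times> nat \<times> nat"

definition ldiag :: "nat list list \<Rightarrow> box set" where
  "ldiag lam = {(a, b, d). 1 \<le> d \<and> d \<le> length lam \<and> (a, b) \<in> ydiag (lam ! (d - 1))}"

definition addable :: "nat \<Rightarrow> nat list list \<Rightarrow> box \<Rightarrow> bool" where
  "addable l lam \<gamma> \<longleftrightarrow> \<gamma> \<notin> ldiag lam \<and> (\<exists>mu. is_lpart l mu \<and> ldiag mu = ldiag lam \<union> {\<gamma>})"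

definition removable :: "nat \<Rightarrow> nat list list \<Rightarrow> box \<Rightarrow> bool" where
  "removable l lam \<gamma> \<longleftrightarrow> \<gamma> \<in> ldiag lam \<and> (\<exists>mu. is_lpart l mu \<and> ldiag mu = ldiag lam - {\<gamma>})"

section \<open>Specht modules\<close>

text \<open>
  A tableau of shape \<open>\<mu>\<close> (with \<open>m = sum_list \<mu>\<close>) is a bijection \<open>t\<close> from the entries \<open>{..<m}\<close> to the
  boxes of \<open>\<mu>\<close>, giving the position of each entry; a permutation \<open>p\<close> sends it to \<open>t \<circ> p\<inverse>\<close>.
  A tabloid is recorded as the map from entries to row numbers (\<open>0\<close> off \<open>{..<m}\<close>), and the
  permutation module consists of the functions on tabloids, \<open>w\<close> acting by
  \<open>(w \<cdot> f) T = f (w\<inverse> \<cdot> T) = f (T \<circ> w)\<close>.  The Specht module is the span of the polytabloids.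
\<close>

type_synonym tabloid = "nat \<Rightarrow> nat"

definition tabloid_of :: "nat \<Rightarrow> (nat \<Rightarrow> nat \<times> nat) \<Rightarrow> tabloid" where
  "tabloid_of m t = (\<lambda>x. if x < m then fst (t x) else 0)"

definition column_stabilizer :: "nat \<Rightarrow> (nat \<Rightarrow> nat \<times> nat) \<Rightarrow> (nat \<Rightarrow> nat) set" where
  "column_stabilizer m t = {p. p permutes {..<m} \<and> (\<forall>x<m. snd (t (p x)) = snd (t x))}"

definition polytabloid :: "nat \<Rightarrow> (nat \<Rightarrow> nat \<times> nat) \<Rightarrow> tabloid \<Rightarrow> complex" where
  "polytabloid m t = (\<lambda>T. \<Sum>p\<in>column_stabilizer m t.
     of_int (sign p) * (if T = tabloid_of m (t \<circ> inv_into UNIV p) then 1 else 0))"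

definition specht_module :: "nat list \<Rightarrow> (tabloid \<Rightarrow> complex) set" where
  "specht_module \<mu> =
     fn.span {polytabloid (sum_list \<mu>) t | t. bij_betw t {..<sum_list \<mu>} (ydiag \<mu>)}"

text \<open>The matrix representation afforded by the Specht module, in some basis which serves as the
  index set.\<close>

definition specht_basis :: "nat list \<Rightarrow> (tabloid \<Rightarrow> complex) set" where
  "specht_basis \<mu> = (SOME B. fn.independent B \<and> fn.span B = specht_module \<mu>)"

definition specht_matrix ::
  "nat list \<Rightarrow> (nat \<Rightarrow> nat) \<Rightarrow> (tabloid \<Rightarrow> complex) \<Rightarrow> (tabloid \<Rightarrow> complex) \<Rightarrow> complex" where
  "specht_matrix \<mu> w b b' = fn.representation (specht_basis \<mu>) (\<lambda>T. b' (T \<circ> w)) b"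

section \<open>The characters attached to multipartitions\<close>

text \<open>The permutation underlying a monomial matrix \<open>g\<close>: \<open>g y\<^sub>j\<close> is a multiple of \<open>y\<^bsub>w j\<^esub>\<close>.\<close>

definition mon_perm :: "complex mat \<Rightarrow> nat \<Rightarrow> nat" where
  "mon_perm g j = (if j < dim_col g then THE i. i < dim_row g \<and> g $$ (i, j) \<noteq> 0 else j)"

text \<open>The linear character \<open>\<delta>\<close> is the product of the nonzero entries; it is \<open>\<zeta>\<close> on \<open>\<sigma>\<^sub>i\<close> and \<open>1\<close> on
  the transpositions \<open>s\<^bsub>i,j\<^esub>\<close>.\<close>

definition delta_char :: "complex mat \<Rightarrow> complex" where
  "delta_char g = (\<Prod>j<dim_col g. g $$ (mon_perm g j, j))"

definition twisted_specht ::
  "nat list \<Rightarrow> nat \<Rightarrow> complex mat \<Rightarrow> (tabloid \<Rightarrow> complex) \<Rightarrow> (tabloid \<Rightarrow> complex) \<Rightarrow> complex" where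
  "twisted_specht \<mu> e g b b' = delta_char g ^ e * specht_matrix \<mu> (mon_perm g) b b'"

text \<open>The external tensor product (Kronecker product of matrices) of the modules
  \<open>S\<^bsup>\<lambda>(d)\<^esup> \<otimes> \<delta>\<^bsup>d-1\<^esup>\<close>, on tuples of group elements; list index \<open>e\<close> stands for \<open>d - 1\<close>.\<close>

definition tensor_index :: "nat list list \<Rightarrow> (tabloid \<Rightarrow> complex) list set" where
  "tensor_index lam = listset (map specht_basis lam)"

definition tensor_matrix ::
  "nat list list \<Rightarrow> complex mat list \<Rightarrow> (tabloid \<Rightarrow> complex) list \<Rightarrow> (tabloid \<Rightarrow> complex) list \<Rightarrow> complex"
  where
  "tensor_matrix lam gs bs bs' =
     (\<Prod>e<length lam. twisted_specht (lam ! e) e (gs ! e) (bs ! e) (bs' ! e))"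

definition block_tuples :: "nat \<Rightarrow> nat list list \<Rightarrow> complex mat list set" where
  "block_tuples l lam = listset (map (\<lambda>\<mu>. carrier (Gl1 l (sum_list \<mu>))) lam)"

definition block_subgroup :: "nat \<Rightarrow> nat list list \<Rightarrow> complex mat set" where
  "block_subgroup l lam = diag_block_mat ` block_tuples l lam"

definition block_matrix ::
  "nat \<Rightarrow> nat list list \<Rightarrow> complex mat \<Rightarrow> (tabloid \<Rightarrow> complex) list \<Rightarrow> (tabloid \<Rightarrow> complex) list \<Rightarrow> complex"
  where
  "block_matrix l lam h = tensor_matrix lam (inv_into (block_tuples l lam) diag_block_mat h)"

text \<open>Induction of a matrix representation \<open>(X, \<sigma>)\<close> of a subgroup \<open>H\<close>: the induced module has basis
  \<open>t \<otimes> x\<close>, for \<open>t\<close> in a set of representatives of the cosets \<open>tH\<close> and \<open>x\<close> in \<open>X\<close>, and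
  \<open>g (t' \<otimes> x) = t \<otimes> (t\<inverse> g t') x\<close> for the representative \<open>t\<close> with \<open>t\<inverse> g t' \<in> H\<close>.\<close>

definition transversal :: "'g monoid \<Rightarrow> 'g set \<Rightarrow> 'g set" where
  "transversal G H = (SOME T. T \<subseteq> carrier G \<and>
     (\<forall>g\<in>carrier G. \<exists>!t. t \<in> T \<and> inv\<^bsub>G\<^esub> t \<otimes>\<^bsub>G\<^esub> g \<in> H))"

definition induced_matrix ::
  "'g monoid \<Rightarrow> 'g set \<Rightarrow> ('g \<Rightarrow> 'x \<Rightarrow> 'x \<Rightarrow> complex) \<Rightarrow> 'g \<Rightarrow> 'g \<times> 'x \<Rightarrow> 'g \<times> 'x \<Rightarrow> complex" where
  "induced_matrix G H \<sigma> g = (\<lambda>(t, x) (t', x').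
     let h = inv\<^bsub>G\<^esub> t \<otimes>\<^bsub>G\<^esub> g \<otimes>\<^bsub>G\<^esub> t' in if h \<in> H then \<sigma> h x x' else 0)"

definition chi :: "nat \<Rightarrow> nat list list \<Rightarrow> complex mat \<Rightarrow> complex" where
  "chi l lam = (let G = Gl1 l (lpart_size lam); H = block_subgroup l lam in
     rep_char G (transversal G H \<times> tensor_index lam) (induced_matrix G H (block_matrix l lam)))"

section \<open>The Fock space\<close>

text \<open>The field \<open>\<rat>(q)\<close> is the fraction field of the rational polynomials.  Fock space vectors are
  finitely supported coefficient functions on multipartitions.\<close>

type_synonym ratfun = "rat poly fract"

type_synonym fock = "nat list list \<Rightarrow> ratfun"

definition q_ind :: ratfun where
  "q_ind = to_fract [:0, 1:]"

definition ket :: "nat list list \<Rightarrow> fock" where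
  "ket lam = (\<lambda>mu. if mu = lam then 1 else 0)"

definition fock_space :: "nat \<Rightarrow> nat \<Rightarrow> fock set" where
  "fock_space l n = {v. finite {lam. v lam \<noteq> 0} \<and> (\<forall>lam. v lam \<noteq> 0 \<longrightarrow> lam \<in> lparts l n)}"

fun charged_content :: "(nat \<Rightarrow> int) \<Rightarrow> box \<Rightarrow> int" where
  "charged_content s (a, b, d) = int b - int a + s d"

fun box_succ :: "(nat \<Rightarrow> int) \<Rightarrow> box \<Rightarrow> box \<Rightarrow> bool" where
  "box_succ s (a', b', d') (a, b, d) \<longleftrightarrow>
     charged_content s (a', b', d') = charged_content s (a, b, d) \<and> d' > d"

definition N_succ :: "nat \<Rightarrow> (nat \<Rightarrow> int) \<Rightarrow> int \<Rightarrow> nat list list \<Rightarrow> box \<Rightarrow> int" where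
  "N_succ l s i lam \<gamma> =
     int (card {\<gamma>'. addable l lam \<gamma>' \<and> charged_content s \<gamma>' = i \<and> box_succ s \<gamma>' \<gamma>}) -
     int (card {\<gamma>'. removable l lam \<gamma>' \<and> charged_content s \<gamma>' = i \<and> box_succ s \<gamma>' \<gamma>})"

definition F_ket :: "nat \<Rightarrow> (nat \<Rightarrow> int) \<Rightarrow> int \<Rightarrow> nat list list \<Rightarrow> fock" where
  "F_ket l s i lam = (\<lambda>mu.
     if is_lpart l mu \<and>
        (\<exists>\<gamma>. addable l lam \<gamma> \<and> charged_content s \<gamma> = i \<and> ldiag mu = ldiag lam \<union> {\<gamma>})
     then q_ind powi N_succ l s i lam (the_elem (ldiag mu - ldiag lam)) else 0)"

definition fock_F :: "nat \<Rightarrow> (nat \<Rightarrow> int) \<Rightarrow> int \<Rightarrow> fock \<Rightarrow> fock" where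
  "fock_F l s i v = (\<lambda>mu. \<Sum>lam | v lam \<noteq> 0. v lam * F_ket l s i lam mu)"

text \<open>The list \<open>is\<close> is \<open>[i\<^sub>1, \<dots>, i\<^sub>n]\<close>; its head is applied first.\<close>

definition quasimonomial :: "nat \<Rightarrow> (nat \<Rightarrow> int) \<Rightarrow> nat \<Rightarrow> fock \<Rightarrow> bool" where
  "quasimonomial l s n v \<longleftrightarrow> v \<in> fock_space l n \<and> v \<noteq> (\<lambda>_. 0) \<and>
     (\<exists>is :: int list. length is = n \<and> v = fold (fock_F l s) is (ket (replicate l [])))"

text \<open>The value at \<open>q = 1\<close> of a rational function without pole there.\<close>

definition at_one :: "ratfun \<Rightarrow> rat" where
  "at_one a = (THE r. \<exists>f g. poly g 1 \<noteq> 0 \<and> a = Fract f g \<and> r = poly f 1 / poly g 1)"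

definition gamma_char :: "nat \<Rightarrow> nat \<Rightarrow> fock \<Rightarrow> complex mat \<Rightarrow> complex" where
  "gamma_char l n v = (\<lambda>g. \<Sum>lam\<in>lparts l n. of_rat (at_one (v lam)) * chi l lam g)"

end

theory Submission
  imports Defs
begin

text \<open>
  The Jucys--Murphy elements are simultaneously diagonalizable, with one line for each standard
  tableau, so both sets of characters count standard tableaux with a prescribed sequence of charged
  contents.

  All modules are realised inside the functions on tabloids whose entries carry a row and a component.
  There the vector of the column reading tableau is a joint eigenvector by a Garnir relation, and
  intertwiners for adjacent transpositions transport it to every standard tableau.  These vectors are
  orthogonal, and the identity \<open>\<Sum> f\<^sub>\<lambda>\<^sup>2 = l\<^sup>n n!\<close> for the numbers \<open>f\<^sub>\<lambda>\<close> of standard tableaux shows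
  that their matrix coefficients form a basis of the functions on \<open>G(l,1,n)\<close>.  Hence they give all
  irreducible characters, and the trace over the vectors of one shape is the trace of the induced
  module.  A simple module of the Jucys--Murphy algebra is a joint eigenvalue; on the vector of a
  tableau this is, up to the shift by \<open>k\<close>, the sequence of charged contents of its boxes.  On the
  Fock space side, at \<open>q = 1\<close> applying the operators with indices \<open>i\<^sub>1, \<dots>, i\<^sub>n\<close> to the
  vacuum produces each \<open>\<lambda>\<close> with the number of standard tableaux of shape \<open>\<lambda>\<close> whose boxes have charged
  contents \<open>i\<^sub>1, \<dots>, i\<^sub>n\<close> as its coefficient.
\<close>

section \<open>Monomial matrices\<close>

text \<open>Specht bases, transversals and irreducible representations are fixed in the definitions
  only by choice operators, so no argument may depend on a particular matrix form; everything is
  compared through traces on subspaces of one finite-dimensional Hermitian space of functions. The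
  group has at most \<open>l^n n!\<close> elements, so that many independent matrix coefficients are
  a basis of the functions on it, and expanding an arbitrary representation in this basis yields
  matrix units acting on it.

  The Jucys--Murphy elements for the given parameter need not separate standard tableaux: the
  tableaux with equal eigenvalues are what makes a cellular character reducible. Independence is
  therefore proved with finer, parameter-free operators, the truncated transposition sums
  \<open>jm_op\<close> and the diagonal matrices, which detect content and component separately. The
  value \<open>c 0 = -1/l\<close> makes the coefficient of \<open>jm_op\<close> in a Jucys--Murphy
  element equal to 1, whence eigenvalues that are integers up to the shift k. The powers of q in the
  Fock space all take the value 1 at q = 1, so the order on boxes leaves no trace there.\<close>

lemma sum_rotate: "(\<Sum>x\<in>A. \<Sum>y\<in>B. \<Sum>z\<in>C. f x y z) = (\<Sum>y\<in>B. \<Sum>z\<in>C. \<Sum>x\<in>A. f x y z)"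
  by (subst sum.swap) (rule sum.cong[OF refl], rule sum.swap)

type_synonym tvec = "(nat \<Rightarrow> nat \<times> nat) \<Rightarrow> complex"

abbreviation swp :: "nat \<Rightarrow> nat \<Rightarrow> nat \<Rightarrow> nat" where
  "swp \<equiv> Transposition.transpose"

abbreviation GL :: "nat \<Rightarrow> nat \<Rightarrow> complex mat set" where
  "GL l n \<equiv> carrier (Gl1 l n)"

abbreviation pinv :: "(nat \<Rightarrow> nat) \<Rightarrow> nat \<Rightarrow> nat" where
  "pinv w \<equiv> inv_into UNIV w"

text \<open>Phases are indexed by the row: column j carries \<open>y (w j)\<close> in row
  \<open>w j\<close>. With this choice the phase at i pairs directly with the component of entry i
  in \<open>act\<close>, and a product has the phase \<open>y i * y' (pinv w i)\<close>.\<close>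

definition mon :: "nat \<Rightarrow> (nat \<Rightarrow> nat) \<Rightarrow> (nat \<Rightarrow> complex) \<Rightarrow> complex mat" where
  "mon n w y = mat n n (\<lambda>(i, j). if i = w j then y i else 0)"

text \<open>For a monomial matrix the row sum is the nonzero entry of the row.\<close>

definition row_entry :: "complex mat \<Rightarrow> nat \<Rightarrow> complex" where
  "row_entry g i = (\<Sum>j<dim_col g. g $$ (i, j))"

lemma zeta_cis: "zeta l = cis (2 * pi / real l)"
  unfolding zeta_def cis_conv_exp by (rule arg_cong[where f = exp]) (simp add: field_simps)

lemma zeta_power: "zeta l ^ t = cis (2 * pi * real t / real l)"
  by (simp add: zeta_cis DeMoivre field_simps)

lemma zeta_pow_l: "1 \<le> l \<Longrightarrow> zeta l ^ l = 1"
  by (simp add: zeta_power)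

lemma zeta_nonzero [simp]: "zeta l \<noteq> 0"
  by (simp add: zeta_def)

lemma bij_zeta: "1 \<le> l \<Longrightarrow> bij_betw (\<lambda>t. zeta l ^ t) {..<l} {z. z ^ l = 1}"
  unfolding zeta_power using bij_betw_roots_unity[of l] by simp

lemma zeta_pow_inj: "1 \<le> l \<Longrightarrow> a < l \<Longrightarrow> b < l \<Longrightarrow> zeta l ^ a = zeta l ^ b \<Longrightarrow> a = b"
  using bij_betw_imp_inj_on[OF bij_zeta[of l]] by (simp add: inj_on_def)

lemma root_unity_iff: "1 \<le> l \<Longrightarrow> z ^ l = 1 \<longleftrightarrow> (\<exists>t. z = zeta l ^ t)"
proof
  assume l: "1 \<le> l" and z: "z ^ l = 1"
  then have "z \<in> (\<lambda>t. zeta l ^ t) ` {..<l}"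
    using bij_betw_imp_surj_on[OF bij_zeta[OF l]] by simp
  then show "\<exists>t. z = zeta l ^ t" by blast
next
  assume "1 \<le> l" "\<exists>t. z = zeta l ^ t"
  then show "z ^ l = 1" using zeta_pow_l by (metis power_commutes power_mult power_one mult.commute)
qed

text \<open>The summand is the t-th power of \<open>zeta l ^ a / zeta l ^ b\<close>, an l-th root of
  unity, so the sum is geometric. The exponent \<open>l - t\<close> plays the role of -t and keeps
  all powers natural.\<close>

lemma zeta_orthogonal:
  assumes "1 \<le> l" "a < l" "b < l"
  shows "(\<Sum>t<l. zeta l ^ (t * a) * zeta l ^ ((l - t) * b)) = (if a = b then of_nat l else 0)"
proof -
  define z where "z = zeta l ^ a / zeta l ^ b"
  have "zeta l ^ (t * a) * zeta l ^ ((l - t) * b) = z ^ t" if "t < l" for t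
  proof -
    have "zeta l ^ ((l - t) * b) * zeta l ^ (t * b) = zeta l ^ (l * b)"
      using that by (simp flip: power_add add: algebra_simps)
    also have "\<dots> = 1" using zeta_pow_l[OF assms(1)] by (simp add: power_mult)
    finally have "zeta l ^ ((l - t) * b) = 1 / zeta l ^ (t * b)" by (simp add: field_simps)
    then show ?thesis by (simp add: z_def power_divide mult.commute power_mult)
  qed
  then have "(\<Sum>t<l. zeta l ^ (t * a) * zeta l ^ ((l - t) * b)) = (\<Sum>t<l. z ^ t)" by simp
  also have "\<dots> = (if a = b then of_nat l else 0)"
  proof (cases "a = b")
    case False
    then have "z \<noteq> 1" using zeta_pow_inj[OF assms] by (auto simp: z_def)
    moreover have "z ^ l = 1"
    proof -
      have "(zeta l ^ c) ^ l = 1" for c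
        using zeta_pow_l[OF assms(1)] by (metis power_commutes power_mult power_one mult.commute)
      then show ?thesis by (simp add: z_def power_divide)
    qed
    ultimately show ?thesis using False by (simp add: sum_gp_strict)
  qed (simp add: z_def)
  finally show ?thesis .
qed

lemma mon_carrier [simp]: "mon n w y \<in> carrier_mat n n"
  by (simp add: mon_def)

lemma mon_dim [simp]: "dim_row (mon n w y) = n" "dim_col (mon n w y) = n"
  by (simp_all add: mon_def)

lemma mon_index [simp]: "i < n \<Longrightarrow> j < n \<Longrightarrow> mon n w y $$ (i, j) = (if i = w j then y i else 0)"
  by (simp add: mon_def)

lemma mon_cong: "(\<And>i. i < n \<Longrightarrow> y i = y' i) \<Longrightarrow> mon n w y = mon n w y'"
  by (rule eq_matI) auto

lemma permutes_lt: "w permutes {..<n} \<Longrightarrow> j < n \<Longrightarrow> w j < n"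
  using permutes_in_image[of w "{..<n}" j] by simp

lemma mon_mult:
  assumes "w permutes {..<n}" "w' permutes {..<n}"
  shows "mon n w y * mon n w' y' = mon n (w \<circ> w') (\<lambda>i. y i * y' (pinv w i))"
proof (rule eq_matI)
  fix i j assume "i < dim_row (mon n (w \<circ> w') (\<lambda>i. y i * y' (pinv w i)))"
    "j < dim_col (mon n (w \<circ> w') (\<lambda>i. y i * y' (pinv w i)))"
  then have ij: "i < n" "j < n" by simp_all
  have "(mon n w y * mon n w' y') $$ (i, j) = (\<Sum>k\<in>{0..<n}. mon n w y $$ (i, k) * mon n w' y' $$ (k, j))"
    using ij by (simp add: scalar_prod_def)
  also have "\<dots> = (\<Sum>k\<in>{0..<n}. if k = w' j then (if i = w k then y i * y' k else 0) else 0)"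
    using ij by (intro sum.cong) auto
  also have "\<dots> = (if i = w (w' j) then y i * y' (w' j) else 0)"
    using ij permutes_lt[OF assms(2)] by simp
  also have "\<dots> = mon n (w \<circ> w') (\<lambda>i. y i * y' (pinv w i)) $$ (i, j)"
    using ij by (simp add: permutes_inverses(2)[OF assms(1)])
  finally show "(mon n w y * mon n w' y') $$ (i, j) = mon n (w \<circ> w') (\<lambda>i. y i * y' (pinv w i)) $$ (i, j)" .
qed auto

lemma mon_one: "1\<^sub>m n = mon n id (\<lambda>_. 1)"
  by (rule eq_matI) auto

lemma mon_perm_mon:
  assumes "w permutes {..<n}" "\<And>i. i < n \<Longrightarrow> y i \<noteq> 0"
  shows "mon_perm (mon n w y) = w"
proof
  fix j
  show "mon_perm (mon n w y) j = w j"
  proof (cases "j < n")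
    case True
    then have "(THE i. i < n \<and> mon n w y $$ (i, j) \<noteq> 0) = w j"
      using permutes_lt[OF assms(1) True] assms(2) by (intro the_equality) (auto split: if_splits)
    then show ?thesis using True by (simp add: mon_perm_def)
  next
    case False
    then show ?thesis using permutes_not_in[OF assms(1), of j] by (simp add: mon_perm_def)
  qed
qed

lemma row_entry_mon:
  assumes "w permutes {..<n}" "i < n"
  shows "row_entry (mon n w y) i = y i"
proof -
  have "row_entry (mon n w y) i = (\<Sum>j<n. if j = pinv w i then y i else 0)"
    unfolding row_entry_def using assms(2)
    by (intro sum.cong) (auto simp: permutes_inverses[OF assms(1)])
  also have "pinv w i < n" using permutes_lt[OF permutes_inv[OF assms(1)] assms(2)] .
  then have "(\<Sum>j<n. if j = pinv w i then y i else 0) = y i" by simp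
  finally show ?thesis .
qed

lemma det_mon:
  assumes "w permutes {..<n}"
  shows "det (mon n w y) = of_int (sign w) * (\<Prod>i<n. y i)"
proof -
  have P: "{0..<n} = {..<n}" by auto
  have "det (mon n w y) = (\<Sum>p\<in>{p. p permutes {..<n}}. signof p * (\<Prod>i<n. mon n w y $$ (i, p i)))"
    using det_def'[of "mon n w y" n] by (simp add: P)
  \<comment> \<open>The expansion picks the entries \<open>(i, p i)\<close>, and the nonzero entry
    of row i sits in column \<open>pinv w i\<close>.\<close>
  also have "\<dots> = (\<Sum>p\<in>{p. p permutes {..<n}}. if p = pinv w then of_int (sign w) * (\<Prod>i<n. y i) else 0)"
  proof (rule sum.cong[OF refl])
    fix p assume "p \<in> {p. p permutes {..<n}}"
    then have p: "p permutes {..<n}" by simp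
    show "signof p * (\<Prod>i<n. mon n w y $$ (i, p i)) = (if p = pinv w then of_int (sign w) * (\<Prod>i<n. y i) else 0)"
    proof (cases "p = pinv w")
      case True
      have "mon n w y $$ (i, p i) = y i" if "i < n" for i
        using that permutes_lt[OF p that] by (simp add: True permutes_inverses[OF assms])
      moreover have "sign p = sign w"
        unfolding True using assms permutation_permutes by (intro sign_inverse) blast
      ultimately show ?thesis using True by simp
    next
      case False
      then obtain i where i: "p i \<noteq> pinv w i" by blast
      have "i < n"
      proof (rule ccontr)
        assume "\<not> i < n"
        then show False using i permutes_not_in[OF p, of i] permutes_not_in[OF permutes_inv[OF assms], of i] by simp
      qed
      moreover have "mon n w y $$ (i, p i) = 0"
        using i \<open>i < n\<close> permutes_lt[OF p \<open>i < n\<close>] permutes_inverses(2)[OF assms, of "p i"] by auto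
      ultimately have "(\<Prod>i<n. mon n w y $$ (i, p i)) = 0" by (intro prod_zero) auto
      then show ?thesis using False by simp
    qed
  qed
  also have "\<dots> = of_int (sign w) * (\<Prod>i<n. y i)"
    using permutes_inv[OF assms] by (simp add: finite_permutations)
  finally show ?thesis .
qed

lemma Gl1_mult [simp]: "x \<otimes>\<^bsub>Gl1 l n\<^esub> y = x * y"
  by (simp add: Gl1_def)

lemma Gl1_one: "\<one>\<^bsub>Gl1 l n\<^esub> = 1\<^sub>m n"
  by (simp add: Gl1_def)

lemma mon_in_Gl1:
  assumes l: "1 \<le> l" and w: "w permutes {..<n}" and y: "\<And>i. i < n \<Longrightarrow> y i ^ l = 1"
  shows "mon n w y \<in> GL l n"
proof -
  have nz: "y i \<noteq> 0" if "i < n" for i using y[OF that] l by (metis not_one_le_zero power_0_left zero_neq_one)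
  have "\<exists>!j. j < n \<and> mon n w y $$ (i, j) \<noteq> 0" if "i < n" for i
    using permutes_lt[OF permutes_inv[OF w] that] that nz
    by (intro ex1I[of _ "pinv w i"]) (auto simp: permutes_inverses[OF w] split: if_splits)
  moreover have "\<exists>!i. i < n \<and> mon n w y $$ (i, j) \<noteq> 0" if "j < n" for j
    using permutes_lt[OF w that] that nz by (intro ex1I[of _ "w j"]) (auto split: if_splits)
  moreover have "\<exists>t. mon n w y $$ (i, j) = zeta l ^ t" if "i < n" "j < n" "mon n w y $$ (i, j) \<noteq> 0" for i j
    using that root_unity_iff[OF l, of "y i"] y[of i] by (auto split: if_splits)
  ultimately show ?thesis unfolding Gl1_def by simp
qed

text \<open>Every later computation in the group goes through this normal form. Uniqueness of the
  nonzero entry in each column defines w, uniqueness in each row makes it injective, and the phase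
  at i is the nonzero entry of row i.\<close>

lemma Gl1_cases:
  assumes l: "1 \<le> l" and g: "g \<in> GL l n"
  obtains w y where "g = mon n w y" "w permutes {..<n}" "\<And>i. i < n \<Longrightarrow> y i ^ l = 1"
proof -
  have gc: "g \<in> carrier_mat n n"
    and row: "\<And>i. i < n \<Longrightarrow> \<exists>!j. j < n \<and> g $$ (i, j) \<noteq> 0"
    and col: "\<And>j. j < n \<Longrightarrow> \<exists>!i. i < n \<and> g $$ (i, j) \<noteq> 0"
    and rt: "\<And>i j. i < n \<Longrightarrow> j < n \<Longrightarrow> g $$ (i, j) \<noteq> 0 \<Longrightarrow> \<exists>t. g $$ (i, j) = zeta l ^ t"
    using g by (simp_all add: Gl1_def)
  define w where "w = (\<lambda>j. if j < n then (THE i. i < n \<and> g $$ (i, j) \<noteq> 0) else j)"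
  have w: "w j < n" "g $$ (w j, j) \<noteq> 0" if "j < n" for j
    using theI'[OF col[OF that]] that by (simp_all add: w_def)
  have wu: "i = w j" if "i < n" "j < n" "g $$ (i, j) \<noteq> 0" for i j
    using col[OF that(2)] w[OF that(2)] that by blast
  have "inj_on w {..<n}"
  proof (rule inj_onI)
    fix i j assume "i \<in> {..<n}" "j \<in> {..<n}" "w i = w j"
    then show "i = j" using row[of "w i"] w[of i] w[of j] by auto
  qed
  moreover have "w ` {..<n} \<subseteq> {..<n}" using w by auto
  ultimately have "bij_betw w {..<n} {..<n}" by (simp add: bij_betw_def endo_inj_surj)
  then have wp: "w permutes {..<n}" by (rule bij_imp_permutes) (simp add: w_def)
  define y where "y = (\<lambda>i. g $$ (i, pinv w i))"
  show thesis
  proof (rule that[of w y])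
    show "g = mon n w y"
    proof (rule eq_matI)
      fix i j assume "i < dim_row (mon n w y)" "j < dim_col (mon n w y)"
      then have ij: "i < n" "j < n" by simp_all
      show "g $$ (i, j) = mon n w y $$ (i, j)"
        using ij wu[OF ij] by (auto simp: y_def permutes_inverses[OF wp])
    qed (use gc in auto)
    show "y i ^ l = 1" if "i < n" for i
      using rt[OF that permutes_lt[OF permutes_inv[OF wp] that]] w(2)[OF permutes_lt[OF permutes_inv[OF wp] that]]
      unfolding y_def root_unity_iff[OF l] by (simp add: permutes_inverses[OF wp])
  qed (rule wp)
qed

lemma root_nonzero: "1 \<le> l \<Longrightarrow> (z::complex) ^ l = 1 \<Longrightarrow> z \<noteq> 0"
  by (metis not_one_le_zero power_0_left zero_neq_one)

lemma mon_inverse: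
  assumes "1 \<le> l" "w permutes {..<n}" "\<And>i. i < n \<Longrightarrow> y i ^ l = 1"
  shows "mon n (pinv w) (\<lambda>i. inverse (y (w i))) * mon n w y = 1\<^sub>m n"
    "mon n (pinv w) (\<lambda>i. inverse (y (w i))) \<in> GL l n"
proof -
  have wi: "pinv w permutes {..<n}" by (rule permutes_inv[OF assms(2)])
  have "mon n (pinv w) (\<lambda>i. inverse (y (w i))) * mon n w y =
    mon n (pinv w \<circ> w) (\<lambda>i. inverse (y (w i)) * y (pinv (pinv w) i))"
    by (rule mon_mult[OF wi assms(2)])
  also have "\<dots> = mon n id (\<lambda>_. 1)"
    unfolding permutes_inv_inv[OF assms(2)] permutes_inv_o(2)[OF assms(2)]
    using root_nonzero[OF assms(1) assms(3)[OF permutes_lt[OF assms(2)]]] by (intro mon_cong) simp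
  finally show "mon n (pinv w) (\<lambda>i. inverse (y (w i))) * mon n w y = 1\<^sub>m n" by (simp add: mon_one)
  show "mon n (pinv w) (\<lambda>i. inverse (y (w i))) \<in> GL l n"
    using assms(3)[OF permutes_lt[OF assms(2)]]
    by (intro mon_in_Gl1[OF assms(1) wi]) (simp add: power_inverse)
qed

lemma Gl1_carrier_mat: "g \<in> GL l n \<Longrightarrow> g \<in> carrier_mat n n"
  by (simp add: Gl1_def)

lemma group_Gl1:
  assumes l: "1 \<le> l"
  shows "group (Gl1 l n)"
proof (rule groupI)
  show "\<one>\<^bsub>Gl1 l n\<^esub> \<in> GL l n"
    unfolding Gl1_one mon_one by (rule mon_in_Gl1[OF l]) (auto intro: permutes_id)
next
  fix x y assume x: "x \<in> GL l n" and y: "y \<in> GL l n"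
  obtain w a where 1: "x = mon n w a" "w permutes {..<n}" "\<And>i. i < n \<Longrightarrow> a i ^ l = 1" by (rule Gl1_cases[OF l x]) blast
  obtain w' b where 2: "y = mon n w' b" "w' permutes {..<n}" "\<And>i. i < n \<Longrightarrow> b i ^ l = 1" by (rule Gl1_cases[OF l y]) blast
  show "x \<otimes>\<^bsub>Gl1 l n\<^esub> y \<in> GL l n"
    unfolding 1(1) 2(1) Gl1_mult mon_mult[OF 1(2) 2(2)]
    using 1(3) 2(3)[OF permutes_lt[OF permutes_inv[OF 1(2)]]]
    by (intro mon_in_Gl1[OF l permutes_compose[OF 2(2) 1(2)]]) (simp add: power_mult_distrib)
next
  fix x assume x: "x \<in> GL l n"
  obtain w a where 1: "x = mon n w a" "w permutes {..<n}" "\<And>i. i < n \<Longrightarrow> a i ^ l = 1" by (rule Gl1_cases[OF l x]) blast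
  show "\<exists>y\<in>GL l n. y \<otimes>\<^bsub>Gl1 l n\<^esub> x = \<one>\<^bsub>Gl1 l n\<^esub>"
    unfolding Gl1_mult Gl1_one 1(1) using mon_inverse[of l w n a, OF l 1(2) 1(3)] by blast
qed (use Gl1_carrier_mat[of _ l n] in \<open>simp_all add: Gl1_one assoc_mult_mat[of _ n n _ n _ n] left_mult_one_mat[of _ n n]\<close>)

lemma inv_mon:
  assumes "1 \<le> l" "w permutes {..<n}" "\<And>i. i < n \<Longrightarrow> y i ^ l = 1"
  shows "inv\<^bsub>Gl1 l n\<^esub> (mon n w y) = mon n (pinv w) (\<lambda>i. inverse (y (w i)))"
  using mon_inverse[OF assms] mon_in_Gl1[OF assms]
  by (intro group.inv_equality[OF group_Gl1[OF assms(1)]]) (simp_all add: Gl1_one)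

text \<open>The order is bounded from above by the number of pairs (permutation, phases). The bound
  is an inequality because the \<open>l^n n!\<close> independent functions constructed later supply
  the other direction.\<close>

lemma Gl1_finite_card:
  assumes l: "1 \<le> l"
  shows "finite (GL l n)" "card (GL l n) \<le> l ^ n * fact n"
proof -
  let ?W = "{w. w permutes {..<n}}" and ?Y = "{..<n} \<rightarrow>\<^sub>E {z::complex. z ^ l = 1}"
  have fin: "finite ?W" "finite ?Y" using l by (auto intro!: finite_permutations finite_PiE finite_roots_unity)
  have sub: "GL l n \<subseteq> (\<lambda>(w, y). mon n w y) ` (?W \<times> ?Y)"
  proof
    fix g assume g: "g \<in> GL l n"
    obtain w y where 1: "g = mon n w y" "w permutes {..<n}" "\<And>i. i < n \<Longrightarrow> y i ^ l = 1" by (rule Gl1_cases[OF l g]) blast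
    have "g = mon n w (restrict y {..<n})"
      unfolding 1(1) using mon_cong[of n y "restrict y {..<n}" w] by simp
    moreover have "restrict y {..<n} \<in> ?Y" using 1(3) by auto
    ultimately show "g \<in> (\<lambda>(w, y). mon n w y) ` (?W \<times> ?Y)" using 1(2) by (intro image_eqI[of _ _ "(w, restrict y {..<n})"]) simp_all
  qed
  show "finite (GL l n)" using finite_subset[OF sub] fin by blast
  have "card (GL l n) \<le> card (?W \<times> ?Y)"
    using card_mono[OF _ sub] card_image_le[of "?W \<times> ?Y" "\<lambda>(w, y). mon n w y"] fin
    by (meson finite_SigmaI finite_imageI le_trans)
  also have "\<dots> = l ^ n * fact n"
    using l by (simp add: card_cartesian_product card_permutations card_PiE card_roots_unity_eq)
  finally show "card (GL l n) \<le> l ^ n * fact n" .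
qed

lemma delta_char_mon:
  assumes "w permutes {..<n}" "\<And>i. i < n \<Longrightarrow> y i \<noteq> 0"
  shows "delta_char (mon n w y) = (\<Prod>i<n. y i)"
proof -
  have "delta_char (mon n w y) = (\<Prod>j<n. y (w j))"
    using permutes_lt[OF assms(1)] by (simp add: delta_char_def mon_perm_mon[of w n y, OF assms(1) assms(2)])
  also have "\<dots> = (\<Prod>i<n. y i)"
    using prod.permute[OF assms(1), of y] by (simp add: comp_def)
  finally show ?thesis .
qed

text \<open>Functions on tabloids \<open>T\<close>, where \<open>T x\<close> is the pair (row, component) of entry \<open>x\<close>.  All modules
  for \<open>G(l,1,n)\<close> below are submodules of the functions supported on \<open>omega l n\<close>; a monomial matrix acts
  by permuting the entries and by the power \<open>d - 1\<close> of its nonzero entries in component \<open>d\<close>.\<close>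

definition omega :: "nat \<Rightarrow> nat \<Rightarrow> (nat \<Rightarrow> nat \<times> nat) set" where
  "omega l n = {T. (\<forall>x<n. T x \<in> {1..n} \<times> {1..l}) \<and> (\<forall>x\<ge>n. T x = (0, 0))}"

definition act :: "nat \<Rightarrow> complex mat \<Rightarrow> tvec \<Rightarrow> tvec" where
  "act n g f = (\<lambda>T. (\<Prod>i<n. row_entry g i ^ (snd (T i) - 1)) * f (T \<circ> mon_perm g))"

definition ip :: "nat \<Rightarrow> nat \<Rightarrow> tvec \<Rightarrow> tvec \<Rightarrow> complex" where
  "ip l n f h = (\<Sum>T\<in>omega l n. f T * cnj (h T))"

text \<open>Up to the factor \<open>- c 0 * l\<close>, this is the contribution of the class
  \<open>S_0\<close> to the Jucys--Murphy element of index \<open>Suc i\<close>: summing over the l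
  conjugates of a transposition leaves 0 at tabloids whose two entries lie in different components,
  see \<open>sum_act_swap_refl\<close>.\<close>

definition jm_op :: "nat \<Rightarrow> tvec \<Rightarrow> tvec" where
  "jm_op i f = (\<lambda>T. \<Sum>j<i. if snd (T j) = snd (T i) then f (T \<circ> swp i j) else 0)"

definition sigma_pow :: "nat \<Rightarrow> nat \<Rightarrow> nat \<Rightarrow> nat \<Rightarrow> complex mat" where
  "sigma_pow l n i m = mon n id (\<lambda>x. if x = i then zeta l ^ m else 1)"

text \<open>The normal form of \<open>sigma_j^t s_ij sigma_j^(-t)\<close>, see
  \<open>conj_swap\<close>; \<open>l - t\<close> stands for -t modulo l.\<close>

definition swap_refl :: "nat \<Rightarrow> nat \<Rightarrow> nat \<Rightarrow> nat \<Rightarrow> nat \<Rightarrow> complex mat" where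
  "swap_refl l n i j t = mon n (swp i j)
     (\<lambda>x. if x = j then zeta l ^ t else if x = i then zeta l ^ (l - t) else 1)"

lemma finite_omega [simp]: "finite (omega l n)"
proof (rule finite_subset)
  show "omega l n \<subseteq> {T. \<forall>x. (x \<in> {..<n} \<longrightarrow> T x \<in> {1..n} \<times> {1..l}) \<and> (x \<notin> {..<n} \<longrightarrow> T x = (0, 0))}"
    by (auto simp: omega_def)
  show "finite \<dots>" by (rule finite_set_of_finite_funs) auto
qed

lemma omega_snd: "T \<in> omega l n \<Longrightarrow> i < n \<Longrightarrow> 1 \<le> snd (T i) \<and> snd (T i) \<le> l"
  unfolding omega_def by (simp add: mem_Times_iff)

lemma omega_permute:
  assumes "w permutes {..<n}"
  shows "T \<circ> w \<in> omega l n \<longleftrightarrow> T \<in> omega l n"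
proof -
  have *: "T \<circ> v \<in> omega l n" if "v permutes {..<n}" "T \<in> omega l n" for T v
    using that permutes_lt[OF that(1)] permutes_not_in[OF that(1)] by (simp add: omega_def)
  show ?thesis
  proof
    assume "T \<circ> w \<in> omega l n"
    from *[OF permutes_inv[OF assms] this] show "T \<in> omega l n"
      using permutes_inv_o(1)[OF assms] by (simp add: comp_assoc)
  qed (rule *[OF assms])
qed

lemma sum_omega_permute:
  assumes "w permutes {..<n}"
  shows "(\<Sum>T\<in>omega l n. F (T \<circ> w)) = (\<Sum>T\<in>omega l n. F T)"
proof (rule sum.reindex_bij_betw, rule bij_betw_byWitness[where f' = "\<lambda>T. T \<circ> pinv w"])
  show "\<forall>T\<in>omega l n. T \<circ> w \<circ> pinv w = T" "\<forall>T\<in>omega l n. T \<circ> pinv w \<circ> w = T"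
    using permutes_inv_o[OF assms] by (simp_all add: comp_assoc)
  show "(\<lambda>T. T \<circ> w) ` omega l n \<subseteq> omega l n"
    unfolding image_subset_iff by (simp only: omega_permute[OF assms]) blast
  show "(\<lambda>T. T \<circ> pinv w) ` omega l n \<subseteq> omega l n"
    unfolding image_subset_iff by (simp only: omega_permute[OF permutes_inv[OF assms]]) blast
qed

lemma act_mon:
  assumes "w permutes {..<n}" "\<And>i. i < n \<Longrightarrow> y i \<noteq> 0"
  shows "act n (mon n w y) f T = (\<Prod>i<n. y i ^ (snd (T i) - 1)) * f (T \<circ> w)"
proof -
  have "(\<Prod>i<n. row_entry (mon n w y) i ^ (snd (T i) - 1)) = (\<Prod>i<n. y i ^ (snd (T i) - 1))"
    using row_entry_mon[OF assms(1)] by simp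
  then show ?thesis by (simp add: act_def mon_perm_mon[OF assms])
qed

lemma act_mult:
  assumes l: "1 \<le> l" and g: "g \<in> GL l n" and h: "h \<in> GL l n"
  shows "act n (g * h) f = act n g (act n h f)"
proof
  fix T
  obtain w a where 1: "g = mon n w a" "w permutes {..<n}" "\<And>i. i < n \<Longrightarrow> a i ^ l = 1"
    by (rule Gl1_cases[OF l g]) blast
  obtain v b where 2: "h = mon n v b" "v permutes {..<n}" "\<And>i. i < n \<Longrightarrow> b i ^ l = 1"
    by (rule Gl1_cases[OF l h]) blast
  have a: "a i \<noteq> 0" if "i < n" for i using root_nonzero[OF l 1(3)[OF that]] .
  have b: "b i \<noteq> 0" if "i < n" for i using root_nonzero[OF l 2(3)[OF that]] .
  have b': "b (pinv w i) \<noteq> 0" if "i < n" for i using b permutes_lt[OF permutes_inv[OF 1(2)] that] by blast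
  have "act n (g * h) f T = (\<Prod>i<n. (a i * b (pinv w i)) ^ (snd (T i) - 1)) * f (T \<circ> (w \<circ> v))"
    unfolding 1(1) 2(1) mon_mult[OF 1(2) 2(2)] by (rule act_mon[OF permutes_compose[OF 2(2) 1(2)]]) (use a b' in simp)
  also have "(\<Prod>i<n. (a i * b (pinv w i)) ^ (snd (T i) - 1)) =
    (\<Prod>i<n. a i ^ (snd (T i) - 1)) * (\<Prod>i<n. b (pinv w i) ^ (snd (T i) - 1))"
    by (simp add: power_mult_distrib prod.distrib)
  \<comment> \<open>Reindexing by w turns the phases of h into those for the tabloid
    \<open>T o w\<close>, at which the action of g evaluates the function.\<close>
  also have "(\<Prod>i<n. b (pinv w i) ^ (snd (T i) - 1)) = (\<Prod>i<n. b i ^ (snd (T (w i)) - 1))"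
    using prod.permute[OF 1(2), of "\<lambda>i. b (pinv w i) ^ (snd (T i) - 1)"]
    by (simp add: comp_def permutes_inverses[OF 1(2)])
  finally show "act n (g * h) f T = act n g (act n h f) T"
    unfolding 1(1) 2(1)
  proof -
    have "act n (mon n w a) F T = (\<Prod>i<n. a i ^ (snd (T i) - 1)) * F (T \<circ> w)" for F T
      by (rule act_mon[OF 1(2) a])
    moreover have "act n (mon n v b) F T = (\<Prod>i<n. b i ^ (snd (T i) - 1)) * F (T \<circ> v)" for F T
      by (rule act_mon[OF 2(2) b])
    ultimately show "act n (mon n w a * mon n v b) f T =
        (\<Prod>i<n. a i ^ (snd (T i) - 1)) * (\<Prod>i<n. b i ^ (snd (T (w i)) - 1)) * f (T \<circ> (w \<circ> v)) \<Longrightarrow>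
        act n (mon n w a * mon n v b) f T = act n (mon n w a) (act n (mon n v b) f) T"
      by (simp only: comp_assoc comp_apply mult.assoc)
  qed
qed

lemma act_one: "act n (1\<^sub>m n) f = f"
proof
  fix T
  have "act n (mon n id (\<lambda>_. 1)) f T = f T"
    by (subst act_mon) (auto intro: permutes_id)
  then show "act n (1\<^sub>m n) f T = f T" by (simp only: mon_one)
qed

lemma act_add: "act n g (f + h) = act n g f + act n g h"
  by (simp add: act_def fun_eq_iff algebra_simps)

lemma act_scale: "act n g (fscale a f) = fscale a (act n g f)"
  by (simp add: act_def fscale_def fun_eq_iff)

lemma act_diff: "act n g (f - h) = act n g f - act n g h"
  by (simp add: act_def fun_eq_iff algebra_simps)

lemma act_zero [simp]: "act n g 0 = 0"
  by (simp add: act_def fun_eq_iff)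

lemma act_sum: "act n g (\<Sum>x\<in>A. F x) = (\<Sum>x\<in>A. act n g (F x))"
  by (induction A rule: infinite_finite_induct) (simp_all only: sum.infinite sum.empty sum.insert not_False_eq_True act_zero act_add)

lemma act_coord:
  assumes l: "1 \<le> l" and g: "g \<in> GL l n" and f: "f \<in> coord_space (omega l n)"
  shows "act n g f \<in> coord_space (omega l n)"
proof -
  obtain w a where 1: "g = mon n w a" "w permutes {..<n}" "\<And>i. i < n \<Longrightarrow> a i ^ l = 1"
    by (rule Gl1_cases[OF l g]) blast
  have a: "a i \<noteq> 0" if "i < n" for i using root_nonzero[OF l 1(3)[OF that]] .
  have "act n g f T = 0" if "T \<notin> omega l n" for T
    unfolding 1(1) by (subst act_mon[OF 1(2) a]) (use f that omega_permute[OF 1(2), of T l] in \<open>simp_all add: coord_space_def\<close>)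
  then show ?thesis by (simp add: coord_space_def)
qed

text \<open>Unitarity: the phases of a group element are roots of unity, so their product has
  modulus one, and composition with its permutation only reorders \<open>omega l n\<close>.\<close>

lemma ip_act:
  assumes l: "1 \<le> l" and g: "g \<in> GL l n"
  shows "ip l n (act n g f) (act n g h) = ip l n f h"
proof -
  obtain w a where 1: "g = mon n w a" "w permutes {..<n}" "\<And>i. i < n \<Longrightarrow> a i ^ l = 1"
    by (rule Gl1_cases[OF l g]) blast
  have a: "a i \<noteq> 0" if "i < n" for i using root_nonzero[OF l 1(3)[OF that]] .
  have a1: "cmod (a i) = 1" if "i < n" for i
  proof -
    have "cmod (a i) ^ l = 1" using 1(3)[OF that] by (metis norm_one norm_power)
    then show ?thesis using l power_eq_imp_eq_base[of "cmod (a i)" l 1] by simp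
  qed
  have ph: "(\<Prod>i<n. a i ^ (snd (T i) - 1)) * cnj (\<Prod>i<n. a i ^ (snd (T i) - 1)) = 1" for T :: "nat \<Rightarrow> nat \<times> nat"
  proof -
    have "cmod (\<Prod>i<n. a i ^ (snd (T i) - 1)) = 1"
      unfolding prod_norm[symmetric] by (rule prod.neutral) (simp add: norm_power a1)
    then show ?thesis by (simp only: complex_norm_square[symmetric]) simp
  qed
  have "act n g f T * cnj (act n g h T) = f (T \<circ> w) * cnj (h (T \<circ> w))" for T
  proof -
    have "act n g f T * cnj (act n g h T) =
      ((\<Prod>i<n. a i ^ (snd (T i) - 1)) * cnj (\<Prod>i<n. a i ^ (snd (T i) - 1))) * (f (T \<circ> w) * cnj (h (T \<circ> w)))"
      unfolding 1(1) by (subst (1 2) act_mon[OF 1(2) a]) (simp_all only: complex_cnj_mult mult_ac)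
    then show ?thesis by (simp only: ph) simp
  qed
  then show ?thesis
    unfolding ip_def using sum_omega_permute[OF 1(2), of "\<lambda>T. f T * cnj (h T)" l] by simp
qed

lemma ip_add: "ip l n (f + f') h = ip l n f h + ip l n f' h"
  by (simp add: ip_def distrib_right sum.distrib)

lemma ip_diff: "ip l n (f - f') h = ip l n f h - ip l n f' h"
  by (simp add: ip_def left_diff_distrib sum_subtractf)

lemma ip_scale: "ip l n (fscale a f) h = a * ip l n f h"
  by (simp add: ip_def fscale_def sum_distrib_left mult.assoc)

lemma ip_zero [simp]: "ip l n 0 h = 0"
  by (simp add: ip_def)

lemma ip_sum: "ip l n (\<Sum>x\<in>A. F x) h = (\<Sum>x\<in>A. ip l n (F x) h)"
  by (induction A rule: infinite_finite_induct) (simp_all only: sum.infinite sum.empty sum.insert not_False_eq_True ip_zero ip_add)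

lemma ip_cnj: "ip l n f h = cnj (ip l n h f)"
  by (simp add: ip_def mult.commute)

lemma ip_self:
  assumes "f \<in> coord_space (omega l n)" "ip l n f f = 0"
  shows "f = 0"
proof
  fix T
  have "(\<Sum>T\<in>omega l n. (cmod (f T))\<^sup>2) = 0"
  proof -
    have "complex_of_real (\<Sum>T\<in>omega l n. (cmod (f T))\<^sup>2) = ip l n f f"
      by (simp only: ip_def complex_norm_square[symmetric] of_real_sum)
    then show ?thesis using assms(2) by (simp only: of_real_eq_0_iff)
  qed
  then have "\<forall>T\<in>omega l n. f T = 0" by (simp add: sum_nonneg_eq_0_iff)
  then show "f T = 0 T" using assms(1) by (cases "T \<in> omega l n") (auto simp: coord_space_def)
qed

lemma ip_act_swap:
  assumes l: "1 \<le> l" and g: "g \<in> GL l n"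
  shows "ip l n (act n g f) h = ip l n f (act n (inv\<^bsub>Gl1 l n\<^esub> g) h)"
proof -
  interpret group "Gl1 l n" by (rule group_Gl1[OF l])
  have "act n g (act n (inv\<^bsub>Gl1 l n\<^esub> g) h) = h"
    using act_mult[OF l g inv_closed[OF g], of h] r_inv[OF g] by (simp add: Gl1_one act_one)
  then show ?thesis using ip_act[OF l g, of f "act n (inv\<^bsub>Gl1 l n\<^esub> g) h"] by simp
qed

lemma jm_op_add: "jm_op i (f + h) = jm_op i f + jm_op i h"
  unfolding jm_op_def fun_eq_iff plus_fun_apply sum.distrib[symmetric] by (auto intro!: sum.cong)

lemma jm_op_scale: "jm_op i (fscale a f) = fscale a (jm_op i f)"
  by (simp add: jm_op_def fscale_def fun_eq_iff sum_distrib_left) (auto intro!: sum.cong)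

lemma transpose_permutes: "i < n \<Longrightarrow> j < n \<Longrightarrow> swp i j permutes {..<n}"
  by (rule permutes_swap_id) auto

text \<open>Each transposition is an involution and its side condition is symmetric in the two
  entries, so every summand is its own adjoint. This is what makes weight vectors of different
  contents orthogonal.\<close>

lemma jm_op_self_adjoint:
  assumes "i < n"
  shows "ip l n (jm_op i f) h = ip l n f (jm_op i h)"
proof -
  let ?s = "\<lambda>j. swp i j"
  let ?F = "\<lambda>j T. (if snd (T j) = snd (T i) then f (T \<circ> ?s j) * cnj (h T) else 0)"
  let ?H = "\<lambda>j T. (if snd (T j) = snd (T i) then f T * cnj (h (T \<circ> ?s j)) else 0)"
  have "ip l n (jm_op i f) h = (\<Sum>T\<in>omega l n. \<Sum>j<i. ?F j T)"
    unfolding ip_def jm_op_def sum_distrib_right by (intro sum.cong refl) simp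
  also have "\<dots> = (\<Sum>j<i. \<Sum>T\<in>omega l n. ?F j T)" by (rule sum.swap)
  also have "\<dots> = (\<Sum>j<i. \<Sum>T\<in>omega l n. ?H j T)"
  proof (rule sum.cong[OF refl])
    fix j assume "j \<in> {..<i}"
    then have p: "?s j permutes {..<n}" using assms by (intro transpose_permutes) auto
    have "(\<Sum>T\<in>omega l n. ?F j T) = (\<Sum>T\<in>omega l n. ?F j (T \<circ> ?s j))"
      by (rule sum_omega_permute[OF p, symmetric])
    also have "\<dots> = (\<Sum>T\<in>omega l n. ?H j T)"
      by (rule sum.cong[OF refl]) (auto simp: comp_assoc)
    finally show "(\<Sum>T\<in>omega l n. ?F j T) = (\<Sum>T\<in>omega l n. ?H j T)" .
  qed
  also have "\<dots> = (\<Sum>T\<in>omega l n. \<Sum>j<i. ?H j T)" by (rule sum.swap)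
  also have "\<dots> = ip l n f (jm_op i h)"
    unfolding ip_def jm_op_def cnj_sum sum_distrib_left by (intro sum.cong refl) simp
  finally show ?thesis .
qed

lemma sigma_pow_carrier: "1 \<le> l \<Longrightarrow> sigma_pow l n i m \<in> GL l n"
  unfolding sigma_pow_def using root_unity_iff[of l "zeta l ^ m"]
  by (intro mon_in_Gl1) (auto intro: permutes_id)

lemma swap_refl_carrier: "1 \<le> l \<Longrightarrow> i < n \<Longrightarrow> j < n \<Longrightarrow> swap_refl l n i j t \<in> GL l n"
  unfolding swap_refl_def using root_unity_iff[of l "zeta l ^ t"] root_unity_iff[of l "zeta l ^ (l - t)"]
  by (intro mon_in_Gl1 transpose_permutes) auto

lemma act_sigma_pow:
  assumes "i < n"
  shows "act n (sigma_pow l n i m) f T = zeta l ^ (m * (snd (T i) - 1)) * f T"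
proof -
  have "act n (sigma_pow l n i m) f T = (\<Prod>x<n. (if x = i then zeta l ^ m else 1) ^ (snd (T x) - 1)) * f T"
    unfolding sigma_pow_def by (subst act_mon) (auto intro: permutes_id)
  also have "(\<Prod>x<n. (if x = i then zeta l ^ m else 1) ^ (snd (T x) - 1)) =
     (\<Prod>x<n. if x = i then zeta l ^ (m * (snd (T i) - 1)) else 1)"
    by (rule prod.cong) (auto simp: power_mult)
  also have "\<dots> = zeta l ^ (m * (snd (T i) - 1))" using assms by simp
  finally show ?thesis .
qed

lemma act_swap_refl:
  assumes "i < n" "j < n" "i \<noteq> j"
  shows "act n (swap_refl l n i j t) f T =
    zeta l ^ (t * (snd (T j) - 1)) * zeta l ^ ((l - t) * (snd (T i) - 1)) * f (T \<circ> swp i j)"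
proof -
  let ?y = "\<lambda>x. if x = j then zeta l ^ t else if x = i then zeta l ^ (l - t) else 1"
  have "act n (swap_refl l n i j t) f T = (\<Prod>x<n. ?y x ^ (snd (T x) - 1)) * f (T \<circ> swp i j)"
    unfolding swap_refl_def by (subst act_mon) (auto intro: transpose_permutes assms)
  also have "(\<Prod>x<n. ?y x ^ (snd (T x) - 1)) = (\<Prod>x\<in>{i, j}. ?y x ^ (snd (T x) - 1))"
    using assms by (intro prod.mono_neutral_right) auto
  also have "\<dots> = zeta l ^ (t * (snd (T j) - 1)) * zeta l ^ ((l - t) * (snd (T i) - 1))"
    using assms(3) by (simp add: power_mult)
  finally show ?thesis .
qed

text \<open>For fixed j the phases summed over t are a pairing of two characters of the l-th roots
  of unity, hence l or 0 according to whether the two components agree.\<close>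

lemma sum_act_swap_refl:
  assumes l: "1 \<le> l" and i: "i < n" and T: "T \<in> omega l n"
  shows "(\<Sum>j<i. \<Sum>t<l. act n (swap_refl l n i j t) f T) = of_nat l * jm_op i f T"
proof -
  have "(\<Sum>t<l. act n (swap_refl l n i j t) f T) =
    of_nat l * (if snd (T j) = snd (T i) then f (T \<circ> swp i j) else 0)" if "j < i" for j
  proof -
    have "(\<Sum>t<l. act n (swap_refl l n i j t) f T) =
      (\<Sum>t<l. zeta l ^ (t * (snd (T j) - 1)) * zeta l ^ ((l - t) * (snd (T i) - 1))) * f (T \<circ> swp i j)"
      using that i by (simp add: act_swap_refl sum_distrib_right)
    also have "(\<Sum>t<l. zeta l ^ (t * (snd (T j) - 1)) * zeta l ^ ((l - t) * (snd (T i) - 1))) =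
      (if snd (T j) - 1 = snd (T i) - 1 then of_nat l else 0)"
      using omega_snd[OF T i] omega_snd[OF T, of j] that i by (intro zeta_orthogonal[OF l]) auto
    also have "snd (T j) - 1 = snd (T i) - 1 \<longleftrightarrow> snd (T j) = snd (T i)"
      using omega_snd[OF T i] omega_snd[OF T, of j] that i by auto
    finally show ?thesis by (auto simp only: if_True if_False mult_zero_left mult_zero_right split: if_split)
  qed
  then show ?thesis by (simp add: jm_op_def sum_distrib_left)
qed

section \<open>The Jucys--Murphy elements as operators\<close>

lemma sigma_mat_pow:
  assumes "1 \<le> l"
  shows "sigma_mat l n i [^]\<^bsub>Gl1 l n\<^esub> (m::nat) = sigma_pow l n i m"
proof (induction m)
  case 0
  have "mon n id (\<lambda>_. 1) = mon n id (\<lambda>x. if x = i then zeta l ^ 0 else 1)" by (rule mon_cong) simp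
  then show ?case by (simp only: Gl1_one sigma_pow_def mon_one nat_pow_0)
next
  case (Suc m)
  have s: "sigma_mat l n i = sigma_pow l n i 1"
    by (rule eq_matI) (auto simp: sigma_mat_def sigma_pow_def)
  have "sigma_pow l n i m * sigma_pow l n i 1 = sigma_pow l n i (Suc m)"
    unfolding sigma_pow_def by (subst mon_mult) (auto intro!: permutes_id mon_cong)
  then show ?case using Suc s by (simp add: nat_pow_Suc)
qed

lemma conj_swap:
  assumes l: "1 \<le> l" and ij: "i < n" "j < n" "i \<noteq> j" and t: "t \<le> l"
  shows "sigma_mat l n j [^]\<^bsub>Gl1 l n\<^esub> t \<otimes>\<^bsub>Gl1 l n\<^esub> s_mat n i j \<otimes>\<^bsub>Gl1 l n\<^esub>
          inv\<^bsub>Gl1 l n\<^esub> (sigma_mat l n j [^]\<^bsub>Gl1 l n\<^esub> t) = swap_refl l n i j t"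
proof -
  let ?w = "swp i j"
  have w: "?w permutes {..<n}" using ij by (intro transpose_permutes)
  have s: "s_mat n i j = mon n ?w (\<lambda>_. 1)"
    by (rule eq_matI) (auto simp: s_mat_def)
  have root: "(if x = j then zeta l ^ t else 1) ^ l = 1" for x
    using root_unity_iff[OF l, of "zeta l ^ t"] by auto
  have "inv\<^bsub>Gl1 l n\<^esub> (sigma_pow l n j t) = mon n id (\<lambda>x. inverse (if x = j then zeta l ^ t else 1))"
    unfolding sigma_pow_def by (subst inv_mon[OF l permutes_id root]) simp
  moreover have "sigma_pow l n j t * mon n ?w (\<lambda>_. 1) = mon n ?w (\<lambda>x. if x = j then zeta l ^ t else 1)"
    unfolding sigma_pow_def by (subst mon_mult[OF permutes_id w]) simp
  moreover have "mon n ?w (\<lambda>x. if x = j then zeta l ^ t else 1) * mon n id (\<lambda>x. inverse (if x = j then zeta l ^ t else 1))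
    = mon n ?w (\<lambda>x. (if x = j then zeta l ^ t else 1) * inverse (if pinv ?w x = j then zeta l ^ t else 1))"
    by (subst mon_mult[OF w permutes_id]) simp
  moreover have "\<dots> = swap_refl l n i j t"
    unfolding swap_refl_def
  proof (rule mon_cong)
    fix x
    have "zeta l ^ (l - t) * zeta l ^ t = 1"
      using t zeta_pow_l[OF l] by (simp flip: power_add)
    then have "inverse (zeta l ^ t) = zeta l ^ (l - t)" by (simp add: field_simps)
    moreover have "pinv ?w x = ?w x" by (simp add: inv_swap_id)
    ultimately show "(if x = j then zeta l ^ t else 1) * inverse (if pinv ?w x = j then zeta l ^ t else 1) =
      (if x = j then zeta l ^ t else if x = i then zeta l ^ (l - t) else 1)"
      using ij(3) by (auto simp: Transposition.transpose_def)
  qed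
  ultimately show ?thesis by (simp add: sigma_mat_pow[OF l] s)
qed

lemma refl_class_0:
  assumes "1 \<le> l" "r \<le> n"
  shows "refl_class l n r 0 = {swap_refl l n i j t | i j t. i < r \<and> j < r \<and> i \<noteq> j \<and> t < l}"
proof (intro subset_antisym subsetI)
  fix g assume "g \<in> refl_class l n r 0"
  then obtain i j t where "g = sigma_mat l n j [^]\<^bsub>Gl1 l n\<^esub> t \<otimes>\<^bsub>Gl1 l n\<^esub> s_mat n i j \<otimes>\<^bsub>Gl1 l n\<^esub>
          inv\<^bsub>Gl1 l n\<^esub> (sigma_mat l n j [^]\<^bsub>Gl1 l n\<^esub> t)" "i < r" "j < r" "i \<noteq> j" "t < l"
    unfolding refl_class_def by auto
  then show "g \<in> {swap_refl l n i j t | i j t. i < r \<and> j < r \<and> i \<noteq> j \<and> t < l}"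
    using conj_swap[OF assms(1), of i n j t] assms(2) by auto
next
  fix g assume "g \<in> {swap_refl l n i j t | i j t. i < r \<and> j < r \<and> i \<noteq> j \<and> t < l}"
  then obtain i j t where ij: "g = swap_refl l n i j t" "i < r" "j < r" "i \<noteq> j" "t < l" by auto
  then have "g = sigma_mat l n j [^]\<^bsub>Gl1 l n\<^esub> t \<otimes>\<^bsub>Gl1 l n\<^esub> s_mat n i j \<otimes>\<^bsub>Gl1 l n\<^esub>
          inv\<^bsub>Gl1 l n\<^esub> (sigma_mat l n j [^]\<^bsub>Gl1 l n\<^esub> t)"
    using conj_swap[OF assms(1), of i n j t] assms(2) by auto
  then show "g \<in> refl_class l n r 0" using ij(2-) unfolding refl_class_def by (simp only: if_True simp_thms) blast
qed

lemma refl_class_pos: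
  assumes "1 \<le> l" "0 < m"
  shows "refl_class l n r m = {sigma_pow l n i m | i. i < r}"
  using assms by (simp add: refl_class_def sigma_mat_pow[OF assms(1)])

lemma mon_perm_swap_refl: "i < n \<Longrightarrow> j < n \<Longrightarrow> mon_perm (swap_refl l n i j t) = swp i j"
  unfolding swap_refl_def by (rule mon_perm_mon) (auto intro: transpose_permutes)

lemma mon_perm_sigma_pow: "mon_perm (sigma_pow l n i m) = id"
  unfolding sigma_pow_def by (rule mon_perm_mon) (auto intro: permutes_id)

lemma row_entry_sigma_pow: "x < n \<Longrightarrow> row_entry (sigma_pow l n i m) x = (if x = i then zeta l ^ m else 1)"
  unfolding sigma_pow_def by (rule row_entry_mon) (auto intro: permutes_id)

lemma row_entry_swap_refl:
  "i < n \<Longrightarrow> j < n \<Longrightarrow> x < n \<Longrightarrow> row_entry (swap_refl l n i j t) x =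
    (if x = j then zeta l ^ t else if x = i then zeta l ^ (l - t) else 1)"
  unfolding swap_refl_def by (rule row_entry_mon) (auto intro: transpose_permutes)

lemma zeta_pow_ne_1: "1 \<le> l \<Longrightarrow> 0 < m \<Longrightarrow> m < l \<Longrightarrow> zeta l ^ m \<noteq> 1"
  using zeta_pow_inj[of l m 0] by auto

text \<open>Exchanging the roles of the two basis vectors inverts the phase. This allows every
  reflection that moves the basis vector i to be written with i in first position.\<close>

lemma swap_refl_commute:
  assumes "1 \<le> l" "t \<le> l" "i \<noteq> j"
  shows "swap_refl l n i j t = swap_refl l n j i (l - t)"
  using assms unfolding swap_refl_def
  by (subst transpose_commute) (rule mon_cong, auto)

lemma reflections_eq:
  assumes "1 \<le> l" "r \<le> n"
  shows "reflections l n r = {swap_refl l n i j t | i j t. i < r \<and> j < r \<and> i \<noteq> j \<and> t < l} \<union>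
    {sigma_pow l n i m | i m. i < r \<and> 0 < m \<and> m < l}"
proof -
  have "{..<l} = insert 0 {m. 0 < m \<and> m < l}" using assms(1) by auto
  then have "reflections l n r = refl_class l n r 0 \<union> (\<Union>m\<in>{m. 0 < m \<and> m < l}. refl_class l n r m)"
    unfolding reflections_def by simp
  also have "(\<Union>m\<in>{m. 0 < m \<and> m < l}. refl_class l n r m) = {sigma_pow l n i m | i m. i < r \<and> 0 < m \<and> m < l}"
    using refl_class_pos[OF assms(1)] by auto
  finally show ?thesis by (simp only: refl_class_0[OF assms])
qed

definition new_refls :: "nat \<Rightarrow> nat \<Rightarrow> nat \<Rightarrow> complex mat set" where
  "new_refls l n i = (\<lambda>(j, t). swap_refl l n i j t) ` ({..<i} \<times> {..<l}) \<union> sigma_pow l n i ` {1..<l}"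

lemma reflections_diff:
  assumes l: "1 \<le> l" and i: "i < n"
  shows "reflections l n (Suc i) - reflections l n i = new_refls l n i"
proof (intro subset_antisym subsetI)
  fix g assume g: "g \<in> reflections l n (Suc i) - reflections l n i"
  then consider (a) a b t where "g = swap_refl l n a b t" "a < Suc i" "b < Suc i" "a \<noteq> b" "t < l"
    | (b) a m where "g = sigma_pow l n a m" "a < Suc i" "0 < m" "m < l"
    using reflections_eq[OF l, of "Suc i" n] i by auto
  then show "g \<in> new_refls l n i"
  proof cases
    case a
    have "\<not> (a < i \<and> b < i)" using g reflections_eq[OF l, of i n] i a by (simp; blast)
    then consider "a = i" "b < i" | "b = i" "a < i" using a by linarith
    then show ?thesis
    proof cases
      case 1
      then show ?thesis using a unfolding new_refls_def by auto
    next
      case 2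
      \<comment> \<open>The reduction modulo l only changes the case t = 0, where the exponent l is
        replaced by 0 to stay in the range of \<open>new_refls\<close>.\<close>
      have "g = swap_refl l n i a ((l - t) mod l)"
      proof (cases "t = 0")
        case True
        then have "g = swap_refl l n i a l" using swap_refl_commute[OF l, of 0 a i n] a 2 by simp
        moreover have "swap_refl l n i a l = swap_refl l n i a 0"
          unfolding swap_refl_def using zeta_pow_l[OF l] by (intro mon_cong) auto
        ultimately show ?thesis using True by simp
      next
        case False
        then show ?thesis using swap_refl_commute[OF l, of t a i n] a 2 by simp
      qed
      moreover have "(l - t) mod l < l" using l by simp
      ultimately show ?thesis using 2 unfolding new_refls_def by blast
    qed
  next
    case b
    have "\<not> a < i" using g reflections_eq[OF l, of i n] i b by (simp; blast)
    then have "a = i" using b by simp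
    then show ?thesis using b unfolding new_refls_def by auto
  qed
next
  fix g assume g: "g \<in> new_refls l n i"
  \<comment> \<open>Old reflections fix the basis vector with index i, whereas a new one either
    moves it or multiplies it by a root of unity other than 1.\<close>
  have fixi: "mon_perm h i = i \<and> row_entry h i = 1" if "h \<in> reflections l n i" for h
    using that reflections_eq[OF l, of i n] i
    by (auto simp: mon_perm_swap_refl mon_perm_sigma_pow row_entry_swap_refl row_entry_sigma_pow)
  from g consider (a) j t where "g = swap_refl l n i j t" "j < i" "t < l" | (b) m where "g = sigma_pow l n i m" "0 < m" "m < l"
    unfolding new_refls_def by (auto simp: Suc_le_eq)
  then show "g \<in> reflections l n (Suc i) - reflections l n i"
  proof cases
    case a
    have "i \<noteq> j" "i < Suc i" "j < Suc i" using a by auto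
    then have "g \<in> reflections l n (Suc i)"
      unfolding reflections_eq[OF l Suc_leI[OF i]] using a(1,3) by blast
    moreover have "mon_perm g i \<noteq> i" using a i by (simp add: mon_perm_swap_refl)
    ultimately show ?thesis using fixi by blast
  next
    case b
    have "g \<in> reflections l n (Suc i)"
      unfolding reflections_eq[OF l Suc_leI[OF i]] using b by blast
    moreover have "row_entry g i \<noteq> 1" using b i zeta_pow_ne_1[OF l] by (simp add: row_entry_sigma_pow)
    ultimately show ?thesis using fixi by blast
  qed
qed

lemma refl_param_swap:
  assumes l: "1 \<le> l" and ij: "i < n" "j < n" "i \<noteq> j" "t < l"
  shows "refl_param l n c (swap_refl l n i j t) = c 0"
proof -
  have "(THE m. m < l \<and> swap_refl l n i j t \<in> refl_class l n n m) = 0"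
  proof (rule the_equality)
    show "0 < l \<and> swap_refl l n i j t \<in> refl_class l n n 0"
      using l ij refl_class_0[OF l, of n n] by auto
    fix m assume m: "m < l \<and> swap_refl l n i j t \<in> refl_class l n n m"
    show "m = 0"
    proof (rule ccontr)
      assume "m \<noteq> 0"
      then obtain a where "swap_refl l n i j t = sigma_pow l n a m"
        using m refl_class_pos[OF l, of m n n] by auto
      then have "swp i j = id"
        using mon_perm_swap_refl[OF ij(1,2), of l t] mon_perm_sigma_pow[of l n a m] by simp
      then show False using ij(3) by (metis id_apply transpose_apply_first)
    qed
  qed
  then show ?thesis by (simp add: refl_param_def)
qed

lemma refl_param_sigma:
  assumes l: "1 \<le> l" and i: "i < n" "0 < m" "m < l"
  shows "refl_param l n c (sigma_pow l n i m) = c m"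
proof -
  have "(THE m'. m' < l \<and> sigma_pow l n i m \<in> refl_class l n n m') = m"
  proof (rule the_equality)
    show "m < l \<and> sigma_pow l n i m \<in> refl_class l n n m"
      using l i refl_class_pos[OF l, of m n n] by auto
    fix m' assume m: "m' < l \<and> sigma_pow l n i m \<in> refl_class l n n m'"
    show "m' = m"
    proof (cases "m' = 0")
      case True
      then obtain a b t where ab: "sigma_pow l n i m = swap_refl l n a b t" "a < n" "b < n" "a \<noteq> b"
        using m refl_class_0[OF l, of n n] by auto
      then have "swp a b = id"
        using mon_perm_swap_refl[OF ab(2,3), of l t] mon_perm_sigma_pow[of l n i m] by simp
      then show ?thesis using ab(4) by (metis id_apply transpose_apply_first)
    next
      case False
      then obtain a where a: "sigma_pow l n i m = sigma_pow l n a m'"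
        using m refl_class_pos[OF l, of m' n n] by auto
      have "zeta l ^ m = (if i = a then zeta l ^ m' else 1)"
        using row_entry_sigma_pow[OF i(1), of l i m] row_entry_sigma_pow[OF i(1), of l a m'] a by simp
      then have "zeta l ^ m = zeta l ^ m'" using zeta_pow_ne_1[OF l i(2,3)] by (auto split: if_splits)
      then show ?thesis using zeta_pow_inj[OF l, of m' m] m i by simp
    qed
  qed
  then show ?thesis by (simp add: refl_param_def)
qed

lemma det_swap_refl:
  assumes l: "1 \<le> l" and ij: "i < n" "j < n" "i \<noteq> j" "t \<le> l"
  shows "det (swap_refl l n i j t) = -1"
proof -
  let ?y = "\<lambda>x. if x = j then zeta l ^ t else if x = i then zeta l ^ (l - t) else 1"
  have "det (swap_refl l n i j t) = of_int (sign (swp i j)) * (\<Prod>x<n. ?y x)"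
    unfolding swap_refl_def by (rule det_mon[OF transpose_permutes[OF ij(1,2)]])
  also have "(\<Prod>x<n. ?y x) = (\<Prod>x\<in>{i, j}. ?y x)"
    using ij by (intro prod.mono_neutral_right) auto
  also have "\<dots> = zeta l ^ (l - t) * zeta l ^ t" using ij(3) by simp
  also have "\<dots> = 1" using ij(4) zeta_pow_l[OF l] by (simp flip: power_add)
  finally show ?thesis using ij(3) by (simp add: sign_swap_id)
qed

lemma det_sigma_pow:
  assumes "i < n"
  shows "det (sigma_pow l n i m) = zeta l ^ m"
  unfolding sigma_pow_def by (subst det_mon[OF permutes_id]) (use assms in \<open>simp add: sign_id\<close>)

text \<open>This is \<open>l k_(1-d)\<close>, see \<open>jm_weight_k_param\<close>. The exponent is
  \<open>m * d\<close> and not \<open>m * (d - 1)\<close> because the determinant of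
  \<open>sigma_i^m\<close> contributes one more factor \<open>zeta l ^ m\<close>.\<close>

definition jm_weight :: "nat \<Rightarrow> (nat \<Rightarrow> complex) \<Rightarrow> nat \<Rightarrow> complex" where
  "jm_weight l c d = (\<Sum>m=1..<l. c m * zeta l ^ (m * d))"

text \<open>Indices are shifted by one: the Jucys--Murphy element \<open>Suc i\<close> belongs to
  the matrix index i. The sign in front of \<open>c 0\<close> is the determinant of a reflection of
  class \<open>S_0\<close>.\<close>

lemma sum_jm_element:
  assumes l: "1 \<le> l" and i: "i < n"
  shows "(\<Sum>g\<in>GL l n. jm_element l n c (Suc i) g * F g) =
    (\<Sum>j<i. \<Sum>t<l. - c 0 * F (swap_refl l n i j t)) + (\<Sum>m=1..<l. c m * zeta l ^ m * F (sigma_pow l n i m))"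
proof -
  let ?R = "new_refls l n i"
  have el: "jm_element l n c (Suc i) g = (if g \<in> ?R then refl_param l n c g * det g else 0)" for g
    unfolding jm_element_def using reflections_diff[OF l i] by simp
  have sub: "?R \<subseteq> GL l n"
    using i swap_refl_carrier[OF l] sigma_pow_carrier[OF l] by (auto simp: new_refls_def)
  have "(\<Sum>g\<in>GL l n. jm_element l n c (Suc i) g * F g) = (\<Sum>g\<in>?R. refl_param l n c g * det g * F g)"
    unfolding el using sub Gl1_finite_card(1)[OF l]
    by (intro sum.mono_neutral_cong_right) auto
  also have "\<dots> = (\<Sum>g\<in>(\<lambda>(j, t). swap_refl l n i j t) ` ({..<i} \<times> {..<l}). refl_param l n c g * det g * F g) +
     (\<Sum>g\<in>sigma_pow l n i ` {1..<l}. refl_param l n c g * det g * F g)"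
    unfolding new_refls_def
  proof (rule sum.union_disjoint)
    show "(\<lambda>(j, t). swap_refl l n i j t) ` ({..<i} \<times> {..<l}) \<inter> sigma_pow l n i ` {1..<l} = {}"
    proof (rule ccontr)
      assume "\<not> ?thesis"
      then obtain j t m where "j < i" "swap_refl l n i j t = sigma_pow l n i m" by auto
      then have "swp i j = id"
        using mon_perm_swap_refl[OF i, of j l t] mon_perm_sigma_pow[of l n i m] i by simp
      then show False using \<open>j < i\<close> by (metis id_apply transpose_apply_first less_irrefl)
    qed
  qed auto
  also have "(\<Sum>g\<in>(\<lambda>(j, t). swap_refl l n i j t) ` ({..<i} \<times> {..<l}). refl_param l n c g * det g * F g) =
    (\<Sum>p\<in>{..<i} \<times> {..<l}. case p of (j, t) \<Rightarrow> - c 0 * F (swap_refl l n i j t))"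
  proof (subst sum.reindex)
    show "inj_on (\<lambda>(j, t). swap_refl l n i j t) ({..<i} \<times> {..<l})"
    proof (rule inj_onI)
      fix p q assume pq: "p \<in> {..<i} \<times> {..<l}" "q \<in> {..<i} \<times> {..<l}"
        "(\<lambda>(j, t). swap_refl l n i j t) p = (\<lambda>(j, t). swap_refl l n i j t) q"
      obtain j t j' t' where p: "p = (j, t)" "q = (j', t')" by (cases p, cases q)
      have e: "swap_refl l n i j t = swap_refl l n i j' t'" using pq p by simp
      have jn: "j < n" "j' < n" "j < i" "j' < i" "t < l" "t' < l" using pq p i by auto
      have "swp i j = swp i j'"
        using mon_perm_swap_refl[OF i jn(1), of l t] mon_perm_swap_refl[OF i jn(2), of l t'] e by simp
      then have j: "j = j'" by (metis transpose_apply_first)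
      have "zeta l ^ t = zeta l ^ t'"
        using row_entry_swap_refl[OF i jn(1) jn(1), of l t] row_entry_swap_refl[OF i jn(2) jn(2), of l t'] e j by simp
      then show "p = q" using zeta_pow_inj[OF l jn(5,6)] j p by simp
    qed
    show "sum ((\<lambda>g. refl_param l n c g * det g * F g) \<circ> (\<lambda>(j, t). swap_refl l n i j t)) ({..<i} \<times> {..<l}) =
      (\<Sum>p\<in>{..<i} \<times> {..<l}. case p of (j, t) \<Rightarrow> - c 0 * F (swap_refl l n i j t))"
    proof (rule sum.cong[OF refl])
      fix p assume "p \<in> {..<i} \<times> {..<l}"
      then obtain j t where p: "p = (j, t)" "j < i" "t < l" by auto
      then have "j < n" "i \<noteq> j" "t \<le> l" using i by auto
      then show "((\<lambda>g. refl_param l n c g * det g * F g) \<circ> (\<lambda>(j, t). swap_refl l n i j t)) p =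
        (case p of (j, t) \<Rightarrow> - c 0 * F (swap_refl l n i j t))"
        using p i refl_param_swap[OF l i, of j t c] det_swap_refl[OF l i, of j t] by simp
    qed
  qed
  also have "\<dots> = (\<Sum>j<i. \<Sum>t<l. - c 0 * F (swap_refl l n i j t))" by (rule sum.cartesian_product[symmetric])
  also have "(\<Sum>g\<in>sigma_pow l n i ` {1..<l}. refl_param l n c g * det g * F g) =
    (\<Sum>m=1..<l. c m * zeta l ^ m * F (sigma_pow l n i m))"
  proof (subst sum.reindex)
    show "inj_on (sigma_pow l n i) {1..<l}"
    proof (rule inj_onI)
      fix m m' assume m: "m \<in> {1..<l}" "m' \<in> {1..<l}" "sigma_pow l n i m = sigma_pow l n i m'"
      then have "zeta l ^ m = zeta l ^ m'"
        using row_entry_sigma_pow[OF i, of l i m] row_entry_sigma_pow[OF i, of l i m'] by simp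
      then show "m = m'" using zeta_pow_inj[OF l, of m m'] m by auto
    qed
  qed (use refl_param_sigma[OF l i, of _ c] det_sigma_pow[OF i, of l] in auto)
  finally show ?thesis .
qed

text \<open>The value of \<open>c 0\<close> cancels both the determinant -1 and the factor l
  produced by summing over conjugates, so \<open>jm_op\<close> appears with coefficient 1. The
  diagonal reflections contribute a scalar that depends only on the component of entry i.\<close>

lemma jm_element_acts:
  assumes l: "1 \<le> l" and i: "i < n" and T: "T \<in> omega l n" and c0: "c 0 = - 1 / of_nat l"
  shows "(\<Sum>g\<in>GL l n. jm_element l n c (Suc i) g * act n g f T) =
    jm_weight l c (snd (T i)) * f T + jm_op i f T"
proof -
  have "(\<Sum>j<i. \<Sum>t<l. - c 0 * act n (swap_refl l n i j t) f T) = - c 0 * (of_nat l * jm_op i f T)"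
    unfolding sum_act_swap_refl[OF l i T, symmetric] by (simp only: sum_distrib_left)
  also have "\<dots> = jm_op i f T" using c0 l by simp
  finally have 1: "(\<Sum>j<i. \<Sum>t<l. - c 0 * act n (swap_refl l n i j t) f T) = jm_op i f T" .
  have "c m * zeta l ^ m * act n (sigma_pow l n i m) f T = c m * zeta l ^ (m * snd (T i)) * f T" for m
  proof -
    have "zeta l ^ m * zeta l ^ (m * (snd (T i) - 1)) = zeta l ^ (m * snd (T i))"
      using omega_snd[OF T i] by (cases "snd (T i)") (auto simp flip: power_add)
    then show ?thesis by (simp only: act_sigma_pow[OF i] mult.assoc[symmetric]) (simp only: mult.assoc)
  qed
  then have "(\<Sum>m=1..<l. c m * zeta l ^ m * act n (sigma_pow l n i m) f T) = jm_weight l c (snd (T i)) * f T"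
    by (simp only: jm_weight_def sum_distrib_right)
  then show ?thesis unfolding sum_jm_element[OF l i] 1 by simp
qed

lemma jm_weight_k_param:
  assumes "1 \<le> l"
  shows "of_nat l * k_param l c (1 - int d) = jm_weight l c d"
proof -
  have "{1..l - 1} = {1..<l}" using assms by auto
  moreover have "zeta l powi (int j * (1 - (1 - int d))) = zeta l ^ (j * d)" for j
    by (simp add: power_int_def flip: of_nat_mult)
  ultimately show ?thesis
    using assms by (simp add: k_param_def jm_weight_def mult.commute)
qed

section \<open>Young diagrams as an l-differential poset, and the number of standard
  tableaux\<close>

declare split_paired_Ex [simp del] split_paired_All [simp del]

text \<open>Sets of boxes replace lists of partitions, so that adding, removing, uniting and
  intersecting diagrams become set operations; \<open>bij_ldiag\<close> gives the translation
  back.\<close>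

definition is_diag :: "nat \<Rightarrow> box set \<Rightarrow> bool" where
  "is_diag l D \<longleftrightarrow> finite D \<and> (\<forall>a b d. (a, b, d) \<in> D \<longrightarrow> 1 \<le> a \<and> 1 \<le> b \<and> 1 \<le> d \<and> d \<le> l \<and>
     (\<forall>a' b'. 1 \<le> a' \<longrightarrow> a' \<le> a \<longrightarrow> 1 \<le> b' \<longrightarrow> b' \<le> b \<longrightarrow> (a', b', d) \<in> D))"

definition diags :: "nat \<Rightarrow> nat \<Rightarrow> box set set" where
  "diags l n = {D. is_diag l D \<and> card D = n}"

definition up_diags :: "nat \<Rightarrow> box set \<Rightarrow> box set set" where
  "up_diags l D = {E. is_diag l E \<and> (\<exists>\<gamma>. \<gamma> \<notin> D \<and> E = insert \<gamma> D)}"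

definition down_diags :: "nat \<Rightarrow> box set \<Rightarrow> box set set" where
  "down_diags l D = {E. is_diag l E \<and> (\<exists>\<gamma>. \<gamma> \<in> D \<and> E = D - {\<gamma>})}"

lemma is_diagD:
  assumes "is_diag l D" "(a, b, d) \<in> D"
  shows "1 \<le> a" "1 \<le> b" "1 \<le> d" "d \<le> l"
    and "\<And>a' b'. 1 \<le> a' \<Longrightarrow> a' \<le> a \<Longrightarrow> 1 \<le> b' \<Longrightarrow> b' \<le> b \<Longrightarrow> (a', b', d) \<in> D"
  using assms unfolding is_diag_def by blast+

lemma is_diagI:
  assumes "finite D"
    and "\<And>a b d. (a, b, d) \<in> D \<Longrightarrow> 1 \<le> a \<and> 1 \<le> b \<and> 1 \<le> d \<and> d \<le> l"
    and "\<And>a b d a' b'. (a, b, d) \<in> D \<Longrightarrow> 1 \<le> a' \<Longrightarrow> a' \<le> a \<Longrightarrow> 1 \<le> b' \<Longrightarrow> b' \<le> b \<Longrightarrow> (a', b', d) \<in> D"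
  shows "is_diag l D"
  unfolding is_diag_def
proof (intro conjI allI impI)
  fix a b d assume x: "(a, b, d) \<in> D"
  show "1 \<le> a" "1 \<le> b" "1 \<le> d" "d \<le> l" using assms(2)[OF x] by blast+
  fix a' b' assume "1 \<le> a'" "a' \<le> a" "1 \<le> b'" "b' \<le> b"
  then show "(a', b', d) \<in> D" by (rule assms(3)[OF x])
qed (rule assms(1))

lemma is_diag_finite: "is_diag l D \<Longrightarrow> finite D"
  by (simp add: is_diag_def)

lemma is_diag_empty [simp]: "is_diag l {}"
  by (simp add: is_diag_def)

lemma is_diag_Un: "is_diag l D \<Longrightarrow> is_diag l E \<Longrightarrow> is_diag l (D \<union> E)"
  unfolding is_diag_def by (metis UnCI UnE finite_UnI)

lemma is_diag_Int: "is_diag l D \<Longrightarrow> is_diag l E \<Longrightarrow> is_diag l (D \<inter> E)"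
  unfolding is_diag_def by (metis IntI IntD1 IntD2 finite_Int)

lemma diag_box_le:
  assumes "is_diag l D" "(a, b, d) \<in> D"
  shows "a \<le> card D" "b \<le> card D"
proof -
  have fin: "finite D" using assms is_diag_finite by auto
  have "(\<lambda>a'. (a', b, d)) ` {1..a} \<subseteq> D"
    using is_diagD[OF assms] by auto
  from card_mono[OF fin this] show "a \<le> card D"
    by (subst (asm) card_image) (auto simp: inj_on_def)
  have "(\<lambda>b'. (a, b', d)) ` {1..b} \<subseteq> D"
    using is_diagD[OF assms] by auto
  from card_mono[OF fin this] show "b \<le> card D"
    by (subst (asm) card_image) (auto simp: inj_on_def)
qed

lemma diag_subset_grid:
  "is_diag l D \<Longrightarrow> card D \<le> n \<Longrightarrow> D \<subseteq> {1..n} \<times> {1..n} \<times> {1..l}"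
proof
  fix x assume D: "is_diag l D" "card D \<le> n" "x \<in> D"
  obtain a b d where x: "x = (a, b, d)" by (cases x)
  show "x \<in> {1..n} \<times> {1..n} \<times> {1..l}"
    using is_diagD(1-4)[of l D a b d] diag_box_le[of l D a b d] D by (simp add: x)
qed

lemma finite_diags [simp]: "finite (diags l n)"
proof (rule finite_subset)
  show "diags l n \<subseteq> Pow ({1..n} \<times> {1..n} \<times> {1..l})"
    using diag_subset_grid[of l _ n] by (force simp: diags_def)
qed simp

lemma down_diags_subset: "D \<in> diags l (Suc n) \<Longrightarrow> down_diags l D \<subseteq> diags l n"
  by (auto simp: diags_def down_diags_def dest: is_diag_finite)

lemma up_diags_subset: "D \<in> diags l n \<Longrightarrow> up_diags l D \<subseteq> diags l (Suc n)"
  by (auto simp: diags_def up_diags_def dest: is_diag_finite)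

lemma finite_down_diags: "is_diag l D \<Longrightarrow> finite (down_diags l D)"
  by (rule finite_subset[of _ "Pow D"]) (auto simp: down_diags_def dest: is_diag_finite)

lemma finite_up_diags: "is_diag l D \<Longrightarrow> finite (up_diags l D)"
  using finite_subset[OF up_diags_subset[of D l "card D"] finite_diags] by (simp add: diags_def)

lemma down_diags_empty [simp]: "down_diags l {} = {}"
  by (auto simp: down_diags_def)

lemma up_down_iff:
  assumes "is_diag l D" "is_diag l E"
  shows "D \<in> down_diags l E \<longleftrightarrow> E \<in> up_diags l D"
proof
  assume "D \<in> down_diags l E"
  then obtain g where "g \<in> E" "D = E - {g}" by (auto simp: down_diags_def)
  then have "g \<notin> D" "E = insert g D" by auto
  then show "E \<in> up_diags l D" using assms by (auto simp: up_diags_def)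
next
  assume "E \<in> up_diags l D"
  then obtain g where "g \<notin> D" "E = insert g D" by (auto simp: up_diags_def)
  then have "g \<in> E" "D = E - {g}" by auto
  then show "D \<in> down_diags l E" using assms by (auto simp: down_diags_def)
qed

definition row_len :: "box set \<Rightarrow> nat \<Rightarrow> nat \<Rightarrow> nat" where
  "row_len D d a = card {b. (a, b, d) \<in> D}"

lemma down_closed_nat:
  fixes S :: "nat set"
  assumes "finite S" "\<And>x y. x \<in> S \<Longrightarrow> 1 \<le> y \<Longrightarrow> y \<le> x \<Longrightarrow> y \<in> S" "0 \<notin> S"
  shows "S = {1..card S}"
proof (cases "S = {}")
  case False
  have "S = {1..Max S}"
  proof
    show "S \<subseteq> {1..Max S}" using assms(1,3) by (auto simp: Suc_le_eq intro: gr0I)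
    show "{1..Max S} \<subseteq> S" using assms(2)[OF Max_in[OF assms(1) False]] by auto
  qed
  then show ?thesis
    by (metis card_atLeastAtMost diff_Suc_1)
qed simp

lemma row_eq: "is_diag l D \<Longrightarrow> {b. (a, b, d) \<in> D} = {1..row_len D d a}"
  unfolding row_len_def
proof (rule down_closed_nat)
  assume D: "is_diag l D"
  have "{b. (a, b, d) \<in> D} \<subseteq> (fst \<circ> snd) ` D" by force
  then show "finite {b. (a, b, d) \<in> D}"
    using is_diag_finite[OF D] finite_surj by blast
  show "y \<in> {b. (a, b, d) \<in> D}" if "x \<in> {b. (a, b, d) \<in> D}" "1 \<le> y" "y \<le> x" for x y
    using is_diagD(1,5)[OF D, of a x d] that by simp
  show "0 \<notin> {b. (a, b, d) \<in> D}" using is_diagD(2)[OF D, of a 0 d] by auto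
qed

lemma in_diag_iff: "is_diag l D \<Longrightarrow> (a, b, d) \<in> D \<longleftrightarrow> 1 \<le> b \<and> b \<le> row_len D d a"
  using row_eq[of l D a d] unfolding set_eq_iff by simp

lemma row_len_antimono:
  assumes "is_diag l D" "1 \<le> a" "a \<le> a'"
  shows "row_len D d a' \<le> row_len D d a"
proof (cases "row_len D d a' = 0")
  case False
  then have "(a', row_len D d a', d) \<in> D" by (simp add: in_diag_iff[OF assms(1)])
  then have "(a, row_len D d a', d) \<in> D" using is_diagD(2,5)[OF assms(1)] assms by blast
  then show ?thesis by (simp add: in_diag_iff[OF assms(1)])
qed simp

text \<open>A box can be added only at the end of a row that is strictly shorter than the row above.
  Row 0 is empty in this encoding, hence the separate case \<open>a = 1\<close>.\<close>

lemma insert_diag_iff: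
  assumes D: "is_diag l D"
  shows "(a, b, d) \<notin> D \<and> is_diag l (insert (a, b, d) D) \<longleftrightarrow>
    1 \<le> a \<and> 1 \<le> d \<and> d \<le> l \<and> b = Suc (row_len D d a) \<and> (a = 1 \<or> row_len D d a < row_len D d (a - 1))"
    (is "?L \<longleftrightarrow> ?R")
proof (intro iffI)
  assume L: ?L
  let ?E = "insert (a, b, d) D"
  have E: "is_diag l ?E" and n: "(a, b, d) \<notin> D" using L by auto
  have in_E: "(a, b, d) \<in> ?E" by simp
  note E' = is_diagD[OF E in_E]
  have b: "row_len D d a < b" using n E'(2) by (simp add: in_diag_iff[OF D])
  have "b = Suc (row_len D d a)"
  proof (rule ccontr)
    assume "b \<noteq> Suc (row_len D d a)"
    then have "(a, Suc (row_len D d a), d) \<in> D"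
      using b E'(5)[of a "Suc (row_len D d a)"] E'(1) by auto
    then show False by (simp add: in_diag_iff[OF D])
  qed
  moreover have "a = 1 \<or> row_len D d a < row_len D d (a - 1)"
  proof (rule disjCI)
    assume *: "\<not> row_len D d a < row_len D d (a - 1)"
    show "a = 1"
    proof (rule ccontr)
      assume "a \<noteq> 1"
      then have "1 \<le> a - 1" "a - 1 \<noteq> a" using E'(1) by auto
      then have "(a - 1, b, d) \<in> D" using E'(5)[of "a - 1" b] E'(2) by simp
      then have "b \<le> row_len D d (a - 1)" by (simp add: in_diag_iff[OF D])
      then show False using b * by auto
    qed
  qed
  ultimately show ?R using E'(1,3,4) by simp
next
  assume R: ?R
  have n: "(a, b, d) \<notin> D" using R by (simp add: in_diag_iff[OF D])
  have in_ins: "(a', b', d) \<in> insert (a, b, d) D" if "1 \<le> a'" "a' \<le> a" "1 \<le> b'" "b' \<le> b" for a' b'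
  proof (cases "a' = a")
    case True
    then show ?thesis using that R by (auto simp: in_diag_iff[OF D])
  next
    case False
    then have "a \<noteq> 1" "a' \<le> a - 1" using that by auto
    then have "row_len D d (a - 1) \<le> row_len D d a'" using row_len_antimono[OF D that(1), of "a - 1" d] by simp
    then have "b' \<le> row_len D d a'" using R \<open>a \<noteq> 1\<close> that by auto
    then show ?thesis using that by (simp add: in_diag_iff[OF D])
  qed
  have "is_diag l (insert (a, b, d) D)"
  proof (rule is_diagI)
    fix a' b' d' a'' b'' assume 1: "(a', b', d') \<in> insert (a, b, d) D" "1 \<le> a''" "a'' \<le> a'" "1 \<le> b''" "b'' \<le> b'"
    show "(a'', b'', d') \<in> insert (a, b, d) D"
    proof (cases "(a', b', d') = (a, b, d)")
      case False
      then have "(a', b', d') \<in> D" using 1(1) by blast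
      from is_diagD(5)[OF D this 1(2-5)] show ?thesis by simp
    next
      case True
      then show ?thesis using in_ins[OF 1(2) _ 1(4)] 1(3,5) by simp
    qed
  next
    fix a' b' d' assume "(a', b', d') \<in> insert (a, b, d) D"
    then show "1 \<le> a' \<and> 1 \<le> b' \<and> 1 \<le> d' \<and> d' \<le> l"
      using is_diagD(1-4)[OF D, of a' b' d'] R by auto
  qed (use is_diag_finite[OF D] in simp)
  then show ?L by (rule conjI[OF n])
qed

lemma remove_diag_iff:
  assumes D: "is_diag l D"
  shows "(a, b, d) \<in> D \<and> is_diag l (D - {(a, b, d)}) \<longleftrightarrow>
    1 \<le> a \<and> 1 \<le> d \<and> d \<le> l \<and> b = row_len D d a \<and> row_len D d (Suc a) < row_len D d a"
    (is "?L \<longleftrightarrow> ?R")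
proof
  assume L: ?L
  let ?E = "D - {(a, b, d)}"
  have E: "is_diag l ?E" and n: "(a, b, d) \<in> D" using L by auto
  note D' = is_diagD[OF D n]
  have b: "1 \<le> b" "b \<le> row_len D d a" using n by (simp_all add: in_diag_iff[OF D])
  have "b = row_len D d a"
  proof (rule ccontr)
    assume "b \<noteq> row_len D d a"
    then have "(a, Suc b, d) \<in> ?E" using b by (simp add: in_diag_iff[OF D])
    from is_diagD(5)[OF E this, of a b] show False using b D' by auto
  qed
  moreover have "row_len D d (Suc a) < row_len D d a"
  proof (rule ccontr)
    assume "\<not> row_len D d (Suc a) < row_len D d a"
    then have "(Suc a, b, d) \<in> ?E" using b by (simp add: in_diag_iff[OF D])
    from is_diagD(5)[OF E this, of a b] show False using b D' by auto
  qed
  ultimately show ?R using D' by auto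
next
  assume R: ?R
  have n: "(a, b, d) \<in> D" using R by (simp add: in_diag_iff[OF D])
  have mx: False if "(a', b', d) \<in> D" "(a', b') \<noteq> (a, b)" "a \<le> a'" "b \<le> b'" for a' b'
  proof (cases "a' = a")
    case True
    then show False using that R by (simp add: in_diag_iff[OF D])
  next
    case False
    then have "row_len D d a' \<le> row_len D d (Suc a)" using row_len_antimono[OF D, of "Suc a" a' d] that by simp
    moreover have "b' \<le> row_len D d a'" using that by (simp add: in_diag_iff[OF D])
    ultimately show False using that R by auto
  qed
  have "is_diag l (D - {(a, b, d)})"
  proof (rule is_diagI)
    fix a' b' d' a'' b'' assume 1: "(a', b', d') \<in> D - {(a, b, d)}" "1 \<le> a''" "a'' \<le> a'" "1 \<le> b''" "b'' \<le> b'"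
    then have "(a'', b'', d') \<in> D" using is_diagD(5)[OF D, of a' b' d'] by simp
    moreover have "(a'', b'', d') \<noteq> (a, b, d)" using 1 mx[of a' b'] by auto
    ultimately show "(a'', b'', d') \<in> D - {(a, b, d)}" by simp
  next
    fix a' b' d' assume "(a', b', d') \<in> D - {(a, b, d)}"
    then show "1 \<le> a' \<and> 1 \<le> b' \<and> 1 \<le> d' \<and> d' \<le> l"
      using is_diagD(1-4)[OF D, of a' b' d'] by auto
  qed (use is_diag_finite[OF D] in simp)
  then show ?L by (rule conjI[OF n])
qed

lemma ex_down_diag:
  assumes "is_diag l D" "D \<noteq> {}"
  shows "down_diags l D \<noteq> {}"
proof -
  have fin: "finite D" using assms is_diag_finite by auto
  \<comment> \<open>A box maximizing a + b has no box to its right or below it in its component, so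
    it can be removed.\<close>
  let ?h = "\<lambda>(a::nat, b::nat, d::nat). a + b"
  have "Max (?h ` D) \<in> ?h ` D" using fin assms(2) by (intro Max_in) blast+
  then obtain g where "g \<in> D" and mg: "Max (?h ` D) = ?h g" by blast
  then have g: "g \<in> D" "\<And>x. x \<in> D \<Longrightarrow> ?h x \<le> ?h g"
    unfolding mg[symmetric] using fin by (blast intro: Max_ge)+
  obtain a b d where abd: "g = (a, b, d)" by (cases g)
  have "is_diag l (D - {g})"
  proof (rule is_diagI)
    fix a' b' d' a'' b'' assume 1: "(a', b', d') \<in> D - {g}" "1 \<le> a''" "a'' \<le> a'" "1 \<le> b''" "b'' \<le> b'"
    then have "(a'', b'', d') \<in> D" using is_diagD(5)[OF assms(1)] by auto
    moreover have "(a'', b'', d') \<noteq> g"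
      using 1 g(2)[of "(a', b', d')"] abd by auto
    ultimately show "(a'', b'', d') \<in> D - {g}" by simp
  next
    fix a' b' d' assume "(a', b', d') \<in> D - {g}"
    then show "1 \<le> a' \<and> 1 \<le> b' \<and> 1 \<le> d' \<and> d' \<le> l"
      using is_diagD(1-4)[OF assms(1), of a' b' d'] by auto
  qed (use fin in simp)
  then show ?thesis using g unfolding down_diags_def by auto
qed

text \<open>In every component there is exactly one more addable than removable box. With
  \<open>card_common_up_down\<close> this says that the diagrams form an l-differential
  poset.\<close>

lemma card_up_diags:
  assumes D: "is_diag l D"
  shows "card (up_diags l D) = card (down_diags l D) + l"
proof -
  define A where "A = {(a, d). 1 \<le> a \<and> 1 \<le> d \<and> d \<le> l \<and> (a = 1 \<or> row_len D d a < row_len D d (a - 1))}"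
  define R where "R = {(a, d). 1 \<le> a \<and> 1 \<le> d \<and> d \<le> l \<and> row_len D d (Suc a) < row_len D d a}"
  have up: "up_diags l D = (\<lambda>(a, d). insert (a, Suc (row_len D d a), d) D) ` A"
  proof (intro subset_antisym subsetI)
    fix E assume "E \<in> up_diags l D"
    then obtain g where g: "is_diag l E" "g \<notin> D" "E = insert g D" unfolding up_diags_def by blast
    obtain a b d where "g = (a, b, d)" by (cases g)
    then show "E \<in> (\<lambda>(a, d). insert (a, Suc (row_len D d a), d) D) ` A"
      using g insert_diag_iff[OF D, of a b d] unfolding A_def by (intro image_eqI[of _ _ "(a, d)"]) simp_all
  next
    fix E assume "E \<in> (\<lambda>(a, d). insert (a, Suc (row_len D d a), d) D) ` A"
    then obtain a d where ad: "(a, d) \<in> A" "E = insert (a, Suc (row_len D d a), d) D" by force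
    have "(a, Suc (row_len D d a), d) \<notin> D \<and> is_diag l E"
      using ad insert_diag_iff[OF D, of a "Suc (row_len D d a)" d] unfolding A_def by simp
    then show "E \<in> up_diags l D" unfolding up_diags_def using ad(2) by blast
  qed
  have dn: "down_diags l D = (\<lambda>(a, d). D - {(a, row_len D d a, d)}) ` R"
  proof (intro subset_antisym subsetI)
    fix E assume "E \<in> down_diags l D"
    then obtain g where g: "is_diag l E" "g \<in> D" "E = D - {g}" unfolding down_diags_def by blast
    obtain a b d where "g = (a, b, d)" by (cases g)
    then show "E \<in> (\<lambda>(a, d). D - {(a, row_len D d a, d)}) ` R"
      using g remove_diag_iff[OF D, of a b d] unfolding R_def by (intro image_eqI[of _ _ "(a, d)"]) simp_all
  next
    fix E assume "E \<in> (\<lambda>(a, d). D - {(a, row_len D d a, d)}) ` R"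
    then obtain a d where ad: "(a, d) \<in> R" "E = D - {(a, row_len D d a, d)}" by force
    have "(a, row_len D d a, d) \<in> D \<and> is_diag l E"
      using ad remove_diag_iff[OF D, of a "row_len D d a" d] unfolding R_def by simp
    then show "E \<in> down_diags l D" unfolding down_diags_def using ad(2) by blast
  qed
  have "inj_on (\<lambda>(a, d). insert (a, Suc (row_len D d a), d) D) A"
  proof (rule inj_onI)
    fix p q assume "p \<in> A" "q \<in> A" and
      eq: "(\<lambda>(a, d). insert (a, Suc (row_len D d a), d) D) p = (\<lambda>(a, d). insert (a, Suc (row_len D d a), d) D) q"
    obtain a d a' d' where pq: "p = (a, d)" "q = (a', d')" by (cases p, cases q)
    have "insert (a, Suc (row_len D d a), d) D = insert (a', Suc (row_len D d' a'), d') D"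
      using eq unfolding pq by simp
    moreover have "(a, Suc (row_len D d a), d) \<notin> D" by (simp add: in_diag_iff[OF D])
    ultimately show "p = q" unfolding pq by blast
  qed
  then have cu: "card (up_diags l D) = card A" unfolding up by (rule card_image)
  have "inj_on (\<lambda>(a, d). D - {(a, row_len D d a, d)}) R"
  proof (rule inj_onI)
    fix p q assume p: "p \<in> R" "q \<in> R" and
      eq: "(\<lambda>(a, d). D - {(a, row_len D d a, d)}) p = (\<lambda>(a, d). D - {(a, row_len D d a, d)}) q"
    obtain a d a' d' where pq: "p = (a, d)" "q = (a', d')" by (cases p, cases q)
    have "D - {(a, row_len D d a, d)} = D - {(a', row_len D d' a', d')}"
      using eq unfolding pq by simp
    moreover have "(a, row_len D d a, d) \<in> D" using p(1) unfolding pq by (simp add: R_def in_diag_iff[OF D])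
    ultimately show "p = q" unfolding pq by blast
  qed
  then have cd: "card (down_diags l D) = card R" unfolding dn by (rule card_image)
  \<comment> \<open>Row \<open>Suc a\<close> can take a box exactly when row a can lose one, and the
    first row of each component can always take one.\<close>
  have A: "A = (\<lambda>d. (1, d)) ` {1..l} \<union> (\<lambda>(a, d). (Suc a, d)) ` R"
  proof (intro subset_antisym subsetI)
    fix x assume x: "x \<in> A"
    obtain a d where ad: "x = (a, d)" by (cases x)
    show "x \<in> (\<lambda>d. (1, d)) ` {1..l} \<union> (\<lambda>(a, d). (Suc a, d)) ` R"
    proof (cases "a = 1")
      case True
      then show ?thesis using x ad unfolding A_def by auto
    next
      case False
      then have "(a - 1, d) \<in> R" "x = (Suc (a - 1), d)" using x ad unfolding A_def R_def by auto
      then show ?thesis by force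
    qed
  qed (auto simp: A_def R_def)
  have "finite R"
  proof (rule finite_subset)
    show "R \<subseteq> (\<lambda>(a, b, d). (a, d)) ` D"
    proof
      fix x assume "x \<in> R"
      then obtain a d where x: "x = (a, d)" "(a, row_len D d a, d) \<in> D"
        using in_diag_iff[OF D] unfolding R_def by force
      then show "x \<in> (\<lambda>(a, b, d). (a, d)) ` D" by (force simp: image_iff)
    qed
  qed (use D is_diag_finite in auto)
  moreover have "0 \<notin> fst ` R" by (auto simp: R_def)
  ultimately have "card A = l + card R"
  proof -
    have "card A = card ((\<lambda>d. (1::nat, d)) ` {1..l}) + card ((\<lambda>(a, d). (Suc a, d)) ` R)"
      unfolding A using \<open>finite R\<close> \<open>0 \<notin> fst ` R\<close> by (intro card_Un_disjoint) force+
    also have "card ((\<lambda>(a, d). (Suc a, d)) ` R) = card R"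
      by (rule card_image) (auto intro!: inj_onI)
    also have "card ((\<lambda>d. (1::nat, d)) ` {1..l}) = l"
      by (subst card_image) (auto intro: inj_onI)
    finally show ?thesis .
  qed
  then show ?thesis using cu cd by simp
qed

text \<open>Both sides are 0 or 1: the union is the only possible common upper neighbour, the
  intersection the only possible common lower one, and since their sizes add up to 2n, one exists
  exactly when the other does.\<close>

lemma card_common_up_down:
  assumes D: "D \<in> diags l n" and E: "E \<in> diags l n" and "D \<noteq> E"
  shows "card (up_diags l D \<inter> up_diags l E) = card (down_diags l D \<inter> down_diags l E)"
proof -
  have fD: "finite D" "finite E" "card D = n" "card E = n" "is_diag l D" "is_diag l E"
    using D E is_diag_finite by (auto simp: diags_def)
  have c: "card (D \<union> E) + card (D \<inter> E) = 2 * n" using fD card_Un_Int by fastforce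
  have *: "\<exists>x. x \<in> C \<and> x \<notin> A \<and> A = C - {x} \<and> C = insert x A"
    if "A \<subseteq> C" "card C = Suc (card A)" "finite C" for A C :: "box set"
  proof -
    have "card (C - A) = 1" using that by (simp add: card_Diff_subset finite_subset)
    then obtain x where "C - A = {x}" by (auto simp: card_1_singleton_iff)
    then show ?thesis using that(1) by (intro exI[of _ x]) blast
  qed
  have u: "up_diags l D \<inter> up_diags l E = (if card (D \<union> E) = Suc n then {D \<union> E} else {})"
  proof -
    have "F = D \<union> E \<and> card (D \<union> E) = Suc n" if F: "F \<in> up_diags l D" "F \<in> up_diags l E" for F
    proof -
      obtain x y where "x \<notin> D" "F = insert x D" "y \<notin> E" "F = insert y E"
        using F unfolding up_diags_def by blast
      moreover from this have "x \<noteq> y" using \<open>D \<noteq> E\<close> insert_ident[of x D E] by blast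
      moreover from calculation have "F = D \<union> E" by blast
      ultimately show ?thesis using fD by (metis card_insert_disjoint)
    qed
    moreover have "D \<union> E \<in> up_diags l D \<inter> up_diags l E" if "card (D \<union> E) = Suc n"
      using *[of D "D \<union> E"] *[of E "D \<union> E"] that fD is_diag_Un
      by (auto simp: up_diags_def)
    ultimately show ?thesis by (auto split: if_splits)
  qed
  have d: "down_diags l D \<inter> down_diags l E = (if card (D \<inter> E) + 1 = n then {D \<inter> E} else {})"
  proof -
    have "F = D \<inter> E \<and> card (D \<inter> E) + 1 = n" if F: "F \<in> down_diags l D" "F \<in> down_diags l E" for F
    proof -
      obtain x y where "x \<in> D" "F = D - {x}" "y \<in> E" "F = E - {y}"
        using F unfolding down_diags_def by blast
      moreover from this have "F = D \<inter> E" using \<open>D \<noteq> E\<close> by blast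
      ultimately show ?thesis using fD by (metis Suc_eq_plus1 card_Suc_Diff1)
    qed
    moreover have "D \<inter> E \<in> down_diags l D \<inter> down_diags l E" if "card (D \<inter> E) + 1 = n"
      using *[of "D \<inter> E" D] *[of "D \<inter> E" E] that fD is_diag_Int
      by (auto simp: down_diags_def)
    ultimately show ?thesis by (auto split: if_splits)
  qed
  have "n \<noteq> 0 \<or> D = E" using fD by auto
  then have "card (D \<union> E) = Suc n \<longleftrightarrow> card (D \<inter> E) + 1 = n" using c \<open>D \<noteq> E\<close> by auto
  then show ?thesis unfolding u d by simp
qed

text \<open>A standard tableau is a function \<open>t\<close> listing the boxes in order of their entries; entry \<open>x\<close>
  of the paper is \<open>x - 1\<close> here, and \<open>(0, 0, 0)\<close> is a junk value outside the range of entries.\<close>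

definition Std :: "nat \<Rightarrow> nat \<Rightarrow> (nat \<Rightarrow> box) set" where
  "Std l n = {t. inj_on t {..<n} \<and> (\<forall>x\<le>n. is_diag l (t ` {..<x})) \<and> (\<forall>x\<ge>n. t x = (0, 0, 0))}"

definition shape :: "nat \<Rightarrow> (nat \<Rightarrow> box) \<Rightarrow> box set" where
  "shape n t = t ` {..<n}"

lemma shape_in_diags: "t \<in> Std l n \<Longrightarrow> shape n t \<in> diags l n"
  by (auto simp: Std_def shape_def diags_def card_image)

lemma finite_Std [simp]: "finite (Std l n)"
proof (rule finite_subset)
  show "Std l n \<subseteq> {t. \<forall>x. (x \<in> {..<n} \<longrightarrow> t x \<in> {1..n} \<times> {1..n} \<times> {1..l}) \<and> (x \<notin> {..<n} \<longrightarrow> t x = (0,0,0))}"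
  proof (intro subsetI, simp, intro allI impI conjI)
    fix t x assume t: "t \<in> Std l n" and "x < n"
    then have "t x \<in> shape n t" by (auto simp: shape_def)
    then show "t x \<in> {Suc 0..n} \<times> {Suc 0..n} \<times> {Suc 0..l}"
      using shape_in_diags[OF t] diag_subset_grid[of l "shape n t" n] by (auto simp: diags_def)
  qed (auto simp: Std_def)
  show "finite \<dots>" by (rule finite_set_of_finite_funs) auto
qed

lemma Std_0: "Std l 0 = {\<lambda>_. (0, 0, 0)}"
  by (auto simp: Std_def)

lemma Std_restrict:
  assumes "t \<in> Std l (Suc n)"
  shows "t(n := (0,0,0)) \<in> Std l n" "shape n (t(n := (0,0,0))) \<in> down_diags l (shape (Suc n) t)"
    "t n = the_elem (shape (Suc n) t - shape n (t(n := (0,0,0))))"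
proof -
  have im: "(t(n := (0,0,0))) ` {..<x} = t ` {..<x}" if "x \<le> n" for x using that by (intro image_cong) auto
  have inj: "inj_on t {..<Suc n}" and dg: "\<And>x. x \<le> Suc n \<Longrightarrow> is_diag l (t ` {..<x})"
    and z: "\<And>x. x \<ge> Suc n \<Longrightarrow> t x = (0,0,0)" using assms by (auto simp: Std_def)
  show "t(n := (0,0,0)) \<in> Std l n"
    unfolding Std_def using inj dg z im by (auto simp: inj_on_def Suc_le_eq)
  have tn: "t n \<notin> t ` {..<n}" using inj by (simp add: lessThan_Suc)
  have sh: "shape (Suc n) t = insert (t n) (t ` {..<n})" by (auto simp: shape_def lessThan_Suc)
  have sh': "shape n (t(n := (0,0,0))) = t ` {..<n}" unfolding shape_def by (rule im) simp
  show "shape n (t(n := (0,0,0))) \<in> down_diags l (shape (Suc n) t)"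
    unfolding sh sh' down_diags_def using tn dg[of n] by auto
  show "t n = the_elem (shape (Suc n) t - shape n (t(n := (0,0,0))))"
    unfolding sh sh' using tn by (simp add: insert_Diff_if)
qed

lemma Std_extend:
  assumes "t \<in> Std l n" "shape n t \<in> down_diags l E" "is_diag l E"
  shows "t(n := the_elem (E - shape n t)) \<in> Std l (Suc n)"
    "shape (Suc n) (t(n := the_elem (E - shape n t))) = E" "(t(n := the_elem (E - shape n t)))(n := (0,0,0)) = t"
proof -
  obtain g where g: "g \<in> E" "shape n t = E - {g}" using assms by (auto simp: down_diags_def)
  have te: "the_elem (E - shape n t) = g" using g by (simp add: Diff_Diff_Int)
  have im: "(t(n := g)) ` {..<x} = t ` {..<x}" if "x \<le> n" for x using that by (intro image_cong) auto
  have inj: "inj_on t {..<n}" and dg: "\<And>x. x \<le> n \<Longrightarrow> is_diag l (t ` {..<x})"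
    and z: "\<And>x. x \<ge> n \<Longrightarrow> t x = (0,0,0)" using assms by (auto simp: Std_def)
  have full: "(t(n := g)) ` {..<Suc n} = E"
    using im[of n] g by (auto simp: lessThan_Suc shape_def)
  show "shape (Suc n) (t(n := the_elem (E - shape n t))) = E"
    unfolding te using full by (simp only: shape_def)
  have "g \<notin> t ` {..<n}" using g by (auto simp: shape_def)
  then have "inj_on (t(n := g)) {..<Suc n}"
    using inj by (simp add: lessThan_Suc inj_on_fun_updI)
  moreover have "is_diag l ((t(n := g)) ` {..<x})" if "x \<le> Suc n" for x
    using that full im dg assms(3) by (cases "x = Suc n") auto
  ultimately show "t(n := the_elem (E - shape n t)) \<in> Std l (Suc n)"
    unfolding te Std_def using z by auto
  show "(t(n := the_elem (E - shape n t)))(n := (0,0,0)) = t" using z[of n] by auto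
qed

text \<open>Deleting the last entry is a bijection, inverted by putting it into the unique box of E
  outside D. The predicate P is carried along because the same recursion also counts tableaux with
  prescribed charged contents.\<close>

lemma card_Std_Suc:
  assumes E: "E \<in> diags l (Suc n)"
  shows "card {t \<in> Std l (Suc n). shape (Suc n) t = E \<and> P t} =
    (\<Sum>D\<in>down_diags l E. card {t \<in> Std l n. shape n t = D \<and> P (t(n := the_elem (E - D)))})"
proof -
  have dE: "is_diag l E" using E by (simp add: diags_def)
  have "card {t \<in> Std l (Suc n). shape (Suc n) t = E \<and> P t} =
    card (SIGMA D:down_diags l E. {t \<in> Std l n. shape n t = D \<and> P (t(n := the_elem (E - D)))})"
  proof (rule bij_betw_same_card[where f = "\<lambda>t. (shape n (t(n := (0,0,0))), t(n := (0,0,0)))"],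
      rule bij_betw_byWitness[where f' = "\<lambda>(D, t). t(n := the_elem (E - D))"])
    have restore: "(t(n := (0,0,0)))(n := the_elem (E - shape n (t(n := (0,0,0))))) = t"
      if "t \<in> Std l (Suc n)" "shape (Suc n) t = E" for t
      using Std_restrict(3)[OF that(1)] that(2) by (metis fun_upd_triv fun_upd_upd)
    show "\<forall>t\<in>{t \<in> Std l (Suc n). shape (Suc n) t = E \<and> P t}.
        (case (shape n (t(n := (0,0,0))), t(n := (0,0,0))) of (D, t) \<Rightarrow> t(n := the_elem (E - D))) = t"
    proof
      fix t assume "t \<in> {t \<in> Std l (Suc n). shape (Suc n) t = E \<and> P t}"
      then have "t \<in> Std l (Suc n)" "shape (Suc n) t = E" by blast+
      from restore[OF this] show "(case (shape n (t(n := (0,0,0))), t(n := (0,0,0))) of (D, t) \<Rightarrow> t(n := the_elem (E - D))) = t"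
        by (simp only: prod.case)
    qed
    show "\<forall>p\<in>(SIGMA D:down_diags l E. {t \<in> Std l n. shape n t = D \<and> P (t(n := the_elem (E - D)))}).
        (shape n ((case p of (D, t) \<Rightarrow> t(n := the_elem (E - D)))(n := (0,0,0))),
         (case p of (D, t) \<Rightarrow> t(n := the_elem (E - D)))(n := (0,0,0))) = p"
    proof
      fix p assume "p \<in> (SIGMA D:down_diags l E. {t \<in> Std l n. shape n t = D \<and> P (t(n := the_elem (E - D)))})"
      then obtain D t where p: "p = (D, t)" "D \<in> down_diags l E" "t \<in> Std l n" "shape n t = D" by auto
      show "(shape n ((case p of (D, t) \<Rightarrow> t(n := the_elem (E - D)))(n := (0,0,0))),
         (case p of (D, t) \<Rightarrow> t(n := the_elem (E - D)))(n := (0,0,0))) = p"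
        using Std_extend(3)[OF p(3) _ dE] p by (simp del: fun_upd_upd)
    qed
    show "(\<lambda>t. (shape n (t(n := (0,0,0))), t(n := (0,0,0)))) ` {t \<in> Std l (Suc n). shape (Suc n) t = E \<and> P t}
      \<subseteq> (SIGMA D:down_diags l E. {t \<in> Std l n. shape n t = D \<and> P (t(n := the_elem (E - D)))})"
    proof
      fix p assume "p \<in> (\<lambda>t. (shape n (t(n := (0,0,0))), t(n := (0,0,0)))) ` {t \<in> Std l (Suc n). shape (Suc n) t = E \<and> P t}"
      then obtain t where t: "t \<in> Std l (Suc n)" "shape (Suc n) t = E" "P t"
        and p: "p = (shape n (t(n := (0,0,0))), t(n := (0,0,0)))" by blast
      show "p \<in> (SIGMA D:down_diags l E. {t \<in> Std l n. shape n t = D \<and> P (t(n := the_elem (E - D)))})"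
        unfolding p using Std_restrict(1,2)[OF t(1)] t restore[OF t(1,2)] by (simp del: fun_upd_upd fun_upd_apply)
    qed
    show "(\<lambda>(D, t). t(n := the_elem (E - D))) ` (SIGMA D:down_diags l E. {t \<in> Std l n. shape n t = D \<and> P (t(n := the_elem (E - D)))})
      \<subseteq> {t \<in> Std l (Suc n). shape (Suc n) t = E \<and> P t}"
    proof
      fix t' assume "t' \<in> (\<lambda>(D, t). t(n := the_elem (E - D))) ` (SIGMA D:down_diags l E. {t \<in> Std l n. shape n t = D \<and> P (t(n := the_elem (E - D)))})"
      then obtain t where t: "t \<in> Std l n" "shape n t \<in> down_diags l E"
        "P (t(n := the_elem (E - shape n t)))" "t' = t(n := the_elem (E - shape n t))" by auto
      show "t' \<in> {t \<in> Std l (Suc n). shape (Suc n) t = E \<and> P t}"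
        unfolding t(4) using Std_extend(1,2)[OF t(1,2) dE] t(3) by (simp del: fun_upd_apply)
    qed
  qed
  also have "\<dots> = (\<Sum>D\<in>down_diags l E. card {t \<in> Std l n. shape n t = D \<and> P (t(n := the_elem (E - D)))})"
    using finite_down_diags[OF dE] by (intro card_SigmaI) auto
  finally show ?thesis .
qed

definition nstd :: "nat \<Rightarrow> box set \<Rightarrow> nat" where
  "nstd l D = card {t \<in> Std l (card D). shape (card D) t = D}"

lemma nstd_Suc:
  assumes E: "E \<in> diags l (Suc n)"
  shows "nstd l E = (\<Sum>D\<in>down_diags l E. nstd l D)"
proof -
  have "card E = Suc n" using E by (simp add: diags_def)
  then have "nstd l E = (\<Sum>D\<in>down_diags l E. card {t \<in> Std l n. shape n t = D})"
    using card_Std_Suc[OF E, of "\<lambda>_. True"] by (simp add: nstd_def)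
  also have "\<dots> = (\<Sum>D\<in>down_diags l E. nstd l D)"
  proof (rule sum.cong[OF refl])
    fix D assume "D \<in> down_diags l E"
    then have "card D = n" using down_diags_subset[OF E] by (auto simp: diags_def)
    then show "card {t \<in> Std l n. shape n t = D} = nstd l D" by (simp add: nstd_def)
  qed
  finally show ?thesis .
qed

lemma diags_0: "diags l 0 = {{}}"
  by (auto simp: diags_def dest: is_diag_finite)

lemma nstd_empty: "nstd l {} = 1"
  by (simp add: nstd_def Std_0 shape_def)

lemma nstd_pos: "is_diag l D \<Longrightarrow> 0 < nstd l D"
proof (induction "card D" arbitrary: D)
  case 0
  then show ?case using nstd_empty is_diag_finite by auto
next
  case (Suc n)
  then have D: "D \<in> diags l (Suc n)" by (simp add: diags_def)
  have "D \<noteq> {}" using Suc by auto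
  then obtain E where E: "E \<in> down_diags l D" using ex_down_diag Suc by blast
  then have "E \<in> diags l n" using down_diags_subset[OF D] by auto
  then have "0 < nstd l E" using Suc.hyps(1)[of E] by (simp add: diags_def)
  then show ?case unfolding nstd_Suc[OF D] using E finite_down_diags[OF Suc.prems]
    by (metis bot_nat_0.not_eq_extremum sum_eq_0_iff)
qed

lemma sum_double_card:
  fixes f :: "'b \<Rightarrow> nat"
  assumes "finite A" "finite B" "\<And>a. a \<in> A \<Longrightarrow> N a \<subseteq> B"
  shows "(\<Sum>a\<in>A. \<Sum>b\<in>N a. f b) = (\<Sum>b\<in>B. card {a \<in> A. b \<in> N a} * f b)"
proof -
  have "(\<Sum>b\<in>N a. f b) = (\<Sum>b\<in>B. if b \<in> N a then f b else 0)" if "a \<in> A" for a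
    using assms(2) assms(3)[OF that] by (simp add: sum.If_cases Int_absorb1)
  then have "(\<Sum>a\<in>A. \<Sum>b\<in>N a. f b) = (\<Sum>a\<in>A. \<Sum>b\<in>B. if b \<in> N a then f b else 0)" by simp
  also have "\<dots> = (\<Sum>b\<in>B. \<Sum>a\<in>A. if b \<in> N a then f b else 0)" by (rule sum.swap)
  also have "\<dots> = (\<Sum>b\<in>B. card {a \<in> A. b \<in> N a} * f b)"
    using assms(1) by (intro sum.cong refl) (simp add: sum.If_cases Int_def)
  finally show ?thesis .
qed

text \<open>The commutation relation of the up and down operators of an l-differential poset, whose
  commutator is the scalar l, evaluated on the numbers of standard tableaux.\<close>

lemma sum_up_nstd: "D \<in> diags l n \<Longrightarrow> (\<Sum>E\<in>up_diags l D. nstd l E) = l * Suc n * nstd l D"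
proof (induction n arbitrary: D)
  case (0 D)
  then have [simp]: "D = {}" by (simp add: diags_0)
  have "(\<Sum>E\<in>up_diags l D. nstd l E) = (\<Sum>E\<in>up_diags l D. 1)"
  proof (rule sum.cong[OF refl])
    fix E assume E: "E \<in> up_diags l D"
    then have "E \<in> diags l (Suc 0)" using up_diags_subset[OF 0] by auto
    moreover have "down_diags l E = {{}}" using E by (auto simp: up_diags_def down_diags_def)
    ultimately show "nstd l E = 1" by (simp add: nstd_Suc nstd_empty)
  qed
  then show ?case using card_up_diags[of l "{}"] by (simp add: nstd_empty)
next
  case (Suc n D)
  have D: "is_diag l D" "card D = Suc n" using Suc.prems by (auto simp: diags_def)
  have fD: "finite (up_diags l D)" "finite (down_diags l D)"
    using D finite_up_diags finite_down_diags by auto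
  have "(\<Sum>E\<in>up_diags l D. nstd l E) = (\<Sum>E\<in>up_diags l D. \<Sum>F\<in>down_diags l E. nstd l F)"
    by (rule sum.cong[OF refl]) (use nstd_Suc up_diags_subset[OF Suc.prems] in blast)
  also have "\<dots> = (\<Sum>F\<in>diags l (Suc n). card {E \<in> up_diags l D. F \<in> down_diags l E} * nstd l F)"
    using up_diags_subset[OF Suc.prems] fD(1) by (intro sum_double_card finite_diags down_diags_subset) blast+
  also have "\<dots> = (\<Sum>F\<in>diags l (Suc n). card (up_diags l D \<inter> up_diags l F) * nstd l F)"
  proof (rule sum.cong[OF refl])
    fix F assume "F \<in> diags l (Suc n)"
    then have "{E \<in> up_diags l D. F \<in> down_diags l E} = up_diags l D \<inter> up_diags l F"
      using up_down_iff[of l F] by (auto simp: diags_def) (auto simp: up_diags_def)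
    then show "card {E \<in> up_diags l D. F \<in> down_diags l E} * nstd l F = card (up_diags l D \<inter> up_diags l F) * nstd l F" by simp
  qed
  \<comment> \<open>The term F = D is split off: for every other F the common upper and lower
    neighbours are equally many, while D itself has l more upper than lower ones.\<close>
  also have "\<dots> = card (up_diags l D) * nstd l D +
      (\<Sum>F\<in>diags l (Suc n) - {D}. card (up_diags l D \<inter> up_diags l F) * nstd l F)"
    using Suc.prems by (subst sum.remove[of _ D]) auto
  also have "(\<Sum>F\<in>diags l (Suc n) - {D}. card (up_diags l D \<inter> up_diags l F) * nstd l F) =
     (\<Sum>F\<in>diags l (Suc n) - {D}. card (down_diags l D \<inter> down_diags l F) * nstd l F)"
    by (rule sum.cong[OF refl]) (use card_common_up_down[OF Suc.prems] in auto)
  also have "card (up_diags l D) * nstd l D + \<dots> = l * nstd l D + (card (down_diags l D) * nstd l D + \<dots>)"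
    using card_up_diags[OF D(1)] by (simp add: algebra_simps)
  also have "card (down_diags l D) * nstd l D + (\<Sum>F\<in>diags l (Suc n) - {D}. card (down_diags l D \<inter> down_diags l F) * nstd l F)
     = (\<Sum>F\<in>diags l (Suc n). card (down_diags l D \<inter> down_diags l F) * nstd l F)"
    using Suc.prems by (subst sum.remove[of _ D "\<lambda>F. card (down_diags l D \<inter> down_diags l F) * nstd l F"]) auto
  also have "\<dots> = (\<Sum>F\<in>diags l (Suc n). card {E \<in> down_diags l D. F \<in> up_diags l E} * nstd l F)"
  proof (rule sum.cong[OF refl])
    fix F assume "F \<in> diags l (Suc n)"
    then have "{E \<in> down_diags l D. F \<in> up_diags l E} = down_diags l D \<inter> down_diags l F"
      using up_down_iff[of l _ F] by (auto simp: diags_def) (auto simp: down_diags_def)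
    then show "card (down_diags l D \<inter> down_diags l F) * nstd l F = card {E \<in> down_diags l D. F \<in> up_diags l E} * nstd l F" by simp
  qed
  also have "\<dots> = (\<Sum>E\<in>down_diags l D. \<Sum>F\<in>up_diags l E. nstd l F)"
    using down_diags_subset[OF Suc.prems] fD(2) by (intro sum_double_card[symmetric] finite_diags up_diags_subset) blast+
  \<comment> \<open>The induction hypothesis for the lower neighbours gives the factor
    \<open>l * Suc n\<close>; together with the l split off above this is
    \<open>l * Suc (Suc n)\<close>.\<close>
  also have "\<dots> = (\<Sum>E\<in>down_diags l D. l * Suc n * nstd l E)"
    by (rule sum.cong[OF refl]) (use Suc.IH down_diags_subset[OF Suc.prems] in blast)
  also have "\<dots> = l * Suc n * nstd l D"
    by (simp add: nstd_Suc[OF Suc.prems] sum_distrib_left)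
  finally show ?case by (simp add: algebra_simps)
qed

text \<open>One factor is expanded over the lower neighbours, the double sum is read from the lower
  level, and \<open>sum_up_nstd\<close> produces the factor \<open>l * Suc n\<close> of the next
  level. The total is the order of the group.\<close>

lemma sum_nstd_squares: "(\<Sum>D\<in>diags l n. nstd l D * nstd l D) = l ^ n * fact n"
proof (induction n)
  case 0
  then show ?case by (simp add: diags_0 nstd_empty)
next
  case (Suc n)
  have "(\<Sum>D\<in>diags l (Suc n). nstd l D * nstd l D) = (\<Sum>D\<in>diags l (Suc n). \<Sum>E\<in>down_diags l D. nstd l D * nstd l E)"
    by (rule sum.cong[OF refl]) (simp add: nstd_Suc[of _ l n] sum_distrib_left)
  also have "\<dots> = (\<Sum>D\<in>diags l (Suc n). \<Sum>E\<in>diags l n. if E \<in> down_diags l D then nstd l D * nstd l E else 0)"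
    by (intro sum.cong[OF refl]) (use down_diags_subset in \<open>simp add: sum.If_cases Int_absorb1\<close>)
  also have "\<dots> = (\<Sum>E\<in>diags l n. \<Sum>D\<in>diags l (Suc n). if E \<in> down_diags l D then nstd l D * nstd l E else 0)"
    by (rule sum.swap)
  also have "\<dots> = (\<Sum>E\<in>diags l n. \<Sum>D\<in>diags l (Suc n). if D \<in> up_diags l E then nstd l D * nstd l E else 0)"
    by (intro sum.cong refl) (use up_down_iff in \<open>auto simp: diags_def\<close>)
  also have "\<dots> = (\<Sum>E\<in>diags l n. (\<Sum>D\<in>up_diags l E. nstd l D) * nstd l E)"
    by (intro sum.cong[OF refl]) (use up_diags_subset in \<open>simp add: sum.If_cases Int_absorb1 sum_distrib_right\<close>)
  also have "\<dots> = (\<Sum>E\<in>diags l n. l * Suc n * (nstd l E * nstd l E))"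
    by (intro sum.cong[OF refl]) (simp add: sum_up_nstd)
  also have "\<dots> = l ^ Suc n * fact (Suc n)"
    by (simp only: sum_distrib_left[symmetric] Suc.IH) (simp add: algebra_simps)
  finally show ?case .
qed

section \<open>Weight vectors and intertwiners\<close>

text \<open>Lagrange interpolation: the indicator of the points that R cannot separate from
  \<open>i0\<close> is a product of affine factors, one for each separated point. R is an arbitrary
  unital algebra of functions because it serves both for translations on the left of an inner
  product and for the weights of the Jucys--Murphy algebra.\<close>

lemma separating_idempotent:
  fixes R :: "('i \<Rightarrow> complex) set"
  assumes fin: "finite I" and i0: "i0 \<in> I"
    and one: "(\<lambda>_. 1) \<in> R"
    and scale: "\<And>r z. r \<in> R \<Longrightarrow> (\<lambda>i. z * r i) \<in> R"
    and add: "\<And>r s. r \<in> R \<Longrightarrow> s \<in> R \<Longrightarrow> (\<lambda>i. r i + s i) \<in> R"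
    and mult: "\<And>r s. r \<in> R \<Longrightarrow> s \<in> R \<Longrightarrow> (\<lambda>i. r i * s i) \<in> R"
  shows "\<exists>r\<in>R. \<forall>i\<in>I. r i = (if \<forall>s\<in>R. s i = s i0 then 1 else 0)"
proof -
  define N where "N = {i \<in> I. \<not> (\<forall>s\<in>R. s i = s i0)}"
  have "finite N" using fin by (simp add: N_def)
  moreover have "N \<subseteq> N" by simp
  ultimately have "\<exists>r\<in>R. r i0 = 1 \<and> (\<forall>i\<in>N. r i = 0)"
  proof (induction N rule: finite_subset_induct')
    case empty
    show ?case using one by (intro bexI[of _ "\<lambda>_. 1"]) auto
  next
    case (insert a J)
    then obtain r where r: "r \<in> R" "r i0 = 1" "\<forall>i\<in>J. r i = 0" by blast
    from insert(2) obtain s where s: "s \<in> R" "s a \<noteq> s i0" by (auto simp: N_def)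
    \<comment> \<open>Normalizes the factor vanishing at a to the value 1 at
      \<open>i0\<close>.\<close>
    define c where "c = 1 / (s i0 - s a)"
    have "(\<lambda>i. r i * (c * s i + (- (c * s a)) * 1)) \<in> R"
      by (intro mult add scale r s one)
    moreover have "r i0 * (c * s i0 + (- (c * s a)) * 1) = 1"
    proof -
      have "c * (s i0 - s a) = 1" using s(2) by (simp add: c_def)
      then show ?thesis using r(2) by (simp add: algebra_simps)
    qed
    moreover have "\<forall>i\<in>insert a J. r i * (c * s i + (- (c * s a)) * 1) = 0"
      using r(3) by simp
    ultimately show ?case by (intro bexI[of _ "\<lambda>i. r i * (c * s i + (- (c * s a)) * 1)"]) blast+
  qed
  then obtain r where r: "r \<in> R" "r i0 = 1" "\<forall>i\<in>N. r i = 0" by blast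
  have "r i = (if \<forall>s\<in>R. s i = s i0 then 1 else 0)" if "i \<in> I" for i
  proof (cases "\<forall>s\<in>R. s i = s i0")
    case True
    then have "r i = r i0" using r(1) by blast
    then show ?thesis using True r(2) by simp
  next
    case False
    then show ?thesis using that r(3) unfolding N_def by simp
  qed
  then show ?thesis using r(1) by blast
qed

text \<open>A joint eigenvector condition: the first clause stands for the diagonal matrices, which
  act through the component of each entry, the second one for the transposition sums.\<close>

definition is_wt :: "nat \<Rightarrow> tvec \<Rightarrow> (nat \<Rightarrow> nat) \<Rightarrow> (nat \<Rightarrow> complex) \<Rightarrow> bool" where
  "is_wt n f \<delta> c \<longleftrightarrow> (\<forall>T. f T \<noteq> 0 \<longrightarrow> (\<forall>i<n. snd (T i) = \<delta> i)) \<and> (\<forall>i<n. jm_op i f = fscale (c i) f)"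

lemma swp_conj: "inj s \<Longrightarrow> swp (s a) (s b) (s x) = s (swp a b x)"
  by (simp add: Transposition.transpose_def inj_eq)

text \<open>Conjugation by s permutes the transpositions of k with smaller entries among
  themselves.\<close>

lemma jm_op_commute:
  assumes s: "bij s" "s ` {..<k} = {..<k}" and sk: "s k = k"
  shows "jm_op k (\<lambda>T. f (T \<circ> s)) T = jm_op k f (T \<circ> s)"
proof -
  have bs: "bij_betw s {..<k} {..<k}"
    using s by (simp add: bij_betw_def bij_def inj_on_def)
  have tr: "swp k (s j) \<circ> s = s \<circ> swp k j" for j
  proof
    fix x show "(swp k (s j) \<circ> s) x = (s \<circ> swp k j) x"
      using swp_conj[OF bij_is_inj[OF s(1)], of k j x] sk by simp
  qed
  have "jm_op k (\<lambda>T. f (T \<circ> s)) T =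
    (\<Sum>j<k. if snd (T (s j)) = snd (T k) then f (T \<circ> (swp k (s j) \<circ> s)) else 0)"
    unfolding jm_op_def comp_assoc by (rule sum.reindex_bij_betw[OF bs, symmetric])
  also have "\<dots> = jm_op k f (T \<circ> s)"
    unfolding jm_op_def tr by (simp only: comp_apply sk comp_assoc)
  finally show ?thesis .
qed

text \<open>The relation \<open>J_(i+1) = s_i J_i s_i + s_i\<close>, with the last term cut down to
  tabloids whose entries i and i + 1 share a component.\<close>

lemma jm_op_Suc:
  "jm_op (Suc i) f T = (if snd (T i) = snd (T (Suc i)) then f (T \<circ> swp i (Suc i)) else 0) +
     jm_op i (\<lambda>T. f (T \<circ> swp i (Suc i))) (T \<circ> swp i (Suc i))"
proof -
  let ?s = "swp i (Suc i)"
  have tr: "T \<circ> ?s \<circ> swp i j \<circ> ?s = T \<circ> swp (Suc i) j" if "j < i" for j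
  proof
    fix x show "(T \<circ> ?s \<circ> swp i j \<circ> ?s) x = (T \<circ> swp (Suc i) j) x"
      using that by (auto simp: Transposition.transpose_def)
  qed
  have "jm_op i (\<lambda>T. f (T \<circ> ?s)) (T \<circ> ?s) =
    (\<Sum>j<i. if snd (T j) = snd (T (Suc i)) then f (T \<circ> swp (Suc i) j) else 0)"
    unfolding jm_op_def
  proof (rule sum.cong[OF refl])
    fix j assume "j \<in> {..<i}"
    then have "j < i" by simp
    then have "?s j = j" by (simp add: Transposition.transpose_def)
    then show "(if snd ((T \<circ> ?s) j) = snd ((T \<circ> ?s) i) then f (T \<circ> ?s \<circ> swp i j \<circ> ?s) else 0) =
      (if snd (T j) = snd (T (Suc i)) then f (T \<circ> swp (Suc i) j) else 0)"
      using tr[OF \<open>j < i\<close>] by simp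
  qed
  moreover have "jm_op (Suc i) f T = (\<Sum>j<i. if snd (T j) = snd (T (Suc i)) then f (T \<circ> swp (Suc i) j) else 0)
     + (if snd (T i) = snd (T (Suc i)) then f (T \<circ> swp (Suc i) i) else 0)"
    by (simp only: jm_op_def sum.lessThan_Suc)
  ultimately show ?thesis by (simp only: transpose_commute[of "Suc i" i] add.commute)
qed

text \<open>The coefficient makes the intertwiner swap the two weights: \<open>a (c\<^sub>i\<^sub>+\<^sub>1 - c\<^sub>i)\<close> is \<open>1\<close> if the
  components of the entries \<open>i\<close>, \<open>i + 1\<close> agree and \<open>0\<close> otherwise.\<close>

lemma is_wt_intertwiner:
  assumes f: "is_wt n f \<delta> c" and i: "Suc i < n"
    and a: "a * (c (Suc i) - c i) = (if \<delta> i = \<delta> (Suc i) then 1 else 0)" and a0: "\<delta> i \<noteq> \<delta> (Suc i) \<Longrightarrow> a = 0"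
  shows "is_wt n (\<lambda>T. f (T \<circ> swp i (Suc i)) - a * f T)
    (\<delta> \<circ> swp i (Suc i)) (c \<circ> swp i (Suc i))"
proof -
  let ?s = "swp i (Suc i)"
  let ?S = "\<lambda>f :: (nat \<Rightarrow> nat \<times> nat) \<Rightarrow> complex. \<lambda>T. f (T \<circ> ?s)"
  define h where "h = ?S f - fscale a f"
  have h: "(\<lambda>T. f (T \<circ> ?s) - a * f T) = h" by (simp add: h_def fscale_def fun_eq_iff)
  have supp: "\<And>T j. f T \<noteq> 0 \<Longrightarrow> j < n \<Longrightarrow> snd (T j) = \<delta> j"
    and eig: "\<And>k. k < n \<Longrightarrow> jm_op k f = fscale (c k) f" using f by (auto simp: is_wt_def)
  have ss: "T \<circ> ?s \<circ> ?s = T" for T :: "nat \<Rightarrow> nat \<times> nat" by (simp add: comp_assoc)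
  have SS: "?S (?S f) = f" by (rule ext) (simp only: ss)
  let ?e = "if \<delta> i = \<delta> (Suc i) then 1 else 0 :: complex"
  \<comment> \<open>On the support of f the components of the entries are those of
    \<open>\<delta>\<close>, so the side condition becomes the constant \<open>?e\<close>.\<close>
  have ef: "(if snd (T i) = snd (T (Suc i)) then f T else 0) = ?e * f T" for T
    by (cases "f T = 0") (use supp[of T i] supp[of T "Suc i"] i in simp_all)
  have jm_h: "jm_op k h = jm_op k (?S f) - fscale a (jm_op k f)" for k
  proof -
    have "jm_op k (?S f) = jm_op k (h + fscale a f)" by (simp add: h_def)
    also have "\<dots> = jm_op k h + fscale a (jm_op k f)" by (simp only: jm_op_add jm_op_scale)
    finally show ?thesis by simp
  qed
  have Suc_eig: "jm_op (Suc i) (?S f) T = ?e * f T + c i * f (T \<circ> ?s)" for T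
  proof -
    have "jm_op (Suc i) (?S f) T = (if snd (T i) = snd (T (Suc i)) then f T else 0) + jm_op i f (T \<circ> ?s)"
      unfolding jm_op_Suc[of i "?S f"] by (simp only: ss SS)
    then show ?thesis using i by (simp only: ef eig[of i] fscale_def Suc_lessD)
  qed
  have i_eig: "jm_op i (?S f) T = c (Suc i) * f (T \<circ> ?s) - ?e * f T" for T
  proof -
    have "jm_op (Suc i) f (T \<circ> ?s) = (if snd (T (Suc i)) = snd (T i) then f T else 0) + jm_op i (?S f) T"
      unfolding jm_op_Suc[of i f] by (simp only: ss comp_apply transpose_apply_first transpose_apply_second)
    also have "(if snd (T (Suc i)) = snd (T i) then f T else 0) = ?e * f T" using ef[of T] by (simp only: eq_commute)
    finally have "?e * f T + jm_op i (?S f) T = c (Suc i) * f (T \<circ> ?s)"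
      using i by (simp only: eig[of "Suc i"] fscale_def)
    then show ?thesis by (metis add_diff_cancel_left')
  qed
  have hT: "h T = f (T \<circ> ?s) - a * f T" for T by (simp add: h_def fscale_def)
  have "jm_op k h = fscale ((c \<circ> ?s) k) h" if k: "k < n" for k
  proof
    fix T
    consider "k = i" | "k = Suc i" | "k \<noteq> i" "k \<noteq> Suc i" by blast
    then show "jm_op k h T = fscale ((c \<circ> ?s) k) h T"
    proof cases
      case 1
      have "jm_op k h T = c (Suc i) * f (T \<circ> ?s) - ?e * f T - a * (c i * f T)"
        using 1 k by (simp add: jm_h i_eig eig fscale_def)
      also have "?e = a * (c (Suc i) - c i)" by (rule a[symmetric])
      finally have J: "jm_op k h T = c (Suc i) * f (T \<circ> ?s) - a * (c (Suc i) - c i) * f T - a * (c i * f T)" .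
      have "(c \<circ> ?s) k = c (Suc i)" using 1 by simp
      then show ?thesis unfolding fscale_def J hT by (simp only: algebra_simps)
    next
      case 2
      have "jm_op k h T = ?e * f T + c i * f (T \<circ> ?s) - a * (c (Suc i) * f T)"
        using 2 k by (simp add: jm_h Suc_eig eig fscale_def)
      also have "?e = a * (c (Suc i) - c i)" by (rule a[symmetric])
      finally have J: "jm_op k h T = a * (c (Suc i) - c i) * f T + c i * f (T \<circ> ?s) - a * (c (Suc i) * f T)" .
      have "(c \<circ> ?s) k = c i" using 2 by simp
      then show ?thesis unfolding fscale_def J hT by (simp only: algebra_simps)
    next
      case 3
      then have sk: "?s k = k" by (simp add: Transposition.transpose_def)
      have "?s ` {..<k} = {..<k}"
      proof (cases "k < i")
        case True
        have "?s ` {..<k} = id ` {..<k}" using True by (intro image_cong) (auto simp: Transposition.transpose_def)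
        then show ?thesis by simp
      next
        case False
        then show ?thesis using 3 by (intro permutes_image transpose_permutes) auto
      qed
      then have "jm_op k (?S f) T = jm_op k f (T \<circ> ?s)"
        by (intro jm_op_commute sk) simp_all
      also have "\<dots> = c k * f (T \<circ> ?s)" using k by (simp only: eig fscale_def)
      finally have "jm_op k h T = c k * f (T \<circ> ?s) - a * (c k * f T)"
        using k by (simp only: jm_h minus_apply eig fscale_def)
      then show ?thesis unfolding fscale_def hT comp_apply sk by (simp only: algebra_simps)
    qed
  qed
  moreover have "snd (T j) = (\<delta> \<circ> ?s) j" if "h T \<noteq> 0" "j < n" for T j
  proof (cases "f (T \<circ> ?s) = 0")
    case True
    \<comment> \<open>Here T itself lies in the support of f; \<open>a0\<close> then makes the two
      components equal, so the swap does not change \<open>\<delta>\<close>.\<close>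
    then have "a \<noteq> 0" "f T \<noteq> 0" using that(1) by (auto simp: h_def fscale_def)
    then have "\<delta> i = \<delta> (Suc i)" using a0 by blast
    then have "(\<delta> \<circ> ?s) j = \<delta> j" by (simp add: Transposition.transpose_def)
    then show ?thesis using supp[OF \<open>f T \<noteq> 0\<close> that(2)] by simp
  next
    case False
    have "?s j < n" using that(2) i by (auto simp: Transposition.transpose_def)
    from supp[OF False this] show ?thesis by simp
  qed
  ultimately show ?thesis unfolding h is_wt_def by blast
qed

section \<open>Contents, descents and the column reading order of standard tableaux\<close>

fun content :: "box \<Rightarrow> int" where
  "content (a, b, d) = int b - int a"

fun bcomp :: "box \<Rightarrow> nat" where
  "bcomp (a, b, d) = d"

text \<open>Lexicographic order by component, column and row, for boxes with coordinates below \<open>N\<close>.\<close>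

fun key :: "nat \<Rightarrow> box \<Rightarrow> nat" where
  "key N (a, b, d) = (d * N + b) * N + a"

lemma key_less:
  assumes "a < N" "b < N" "a' < N" "b' < N"
  shows "key N (a, b, d) < key N (a', b', d') \<longleftrightarrow> d < d' \<or> d = d' \<and> (b < b' \<or> b = b' \<and> a < a')"
proof -
  have *: "x * N + a < x' * N + a' \<longleftrightarrow> x < x' \<or> x = x' \<and> a < a'" if "a < N" "a' < N" for x x' a a' :: nat
  proof -
    have **: "x * N + a < x' * N + a'" if "x < x'" "a < N" for x x' a a'
    proof -
      have "x * N + N \<le> x' * N" using that(1) mult_le_mono1[of "Suc x" x' N] by simp
      then show ?thesis using that(2) by linarith
    qed
    show ?thesis using **[of x x' a a'] **[of x' x a' a] that by (metis add_less_cancel_left linorder_neqE_nat not_less_iff_gr_or_eq)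
  qed
  show ?thesis unfolding key.simps *[OF assms(1,3)]
    using *[OF assms(2,4), of d d'] *[OF assms(2,4), of d d'] mult_right_cancel[of N] assms
    by (metis (no_types, lifting) *[OF assms(4,2), of d' d] less_irrefl linorder_neqE_nat)
qed

lemma Std_box:
  assumes "t \<in> Std l n" "x < n" "t x = (a, b, d)"
  shows "1 \<le> a" "a \<le> n" "1 \<le> b" "b \<le> n" "1 \<le> d" "d \<le> l"
proof -
  have "shape n t \<in> diags l n" by (rule shape_in_diags[OF assms(1)])
  moreover have "(a, b, d) \<in> shape n t" using assms(2,3) unfolding shape_def by (metis imageI lessThan_iff)
  ultimately show "1 \<le> a" "a \<le> n" "1 \<le> b" "b \<le> n" "1 \<le> d" "d \<le> l"
    using is_diagD(1-4)[of l "shape n t" a b d] diag_box_le[of l "shape n t" a b d] unfolding diags_def by simp_all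
qed

lemma Std_le:
  assumes t: "t \<in> Std l n" and "x < n" "y < n" "t x = (a, b, d)" "t y = (a', b', d)" "a \<le> a'" "b \<le> b'"
  shows "x \<le> y"
proof -
  have "is_diag l (t ` {..<Suc y})" using t \<open>y < n\<close> by (simp add: Std_def)
  moreover have "(a', b', d) \<in> t ` {..<Suc y}" using assms(5) by (metis imageI lessThan_iff lessI)
  ultimately have "(a, b, d) \<in> t ` {..<Suc y}"
    using is_diagD(5)[of l "t ` {..<Suc y}" a' b' d a b] Std_box(1,3)[OF t assms(2,4)] assms(6,7) by blast
  then obtain z where z: "z < Suc y" "t z = t x" using assms(4) by auto
  moreover have "inj_on t {..<n}" using t by (simp add: Std_def)
  ultimately have "z = x" using assms(2,3) by (simp add: inj_on_def)
  then show ?thesis using z by simp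
qed

lemma Std_swap:
  assumes t: "t \<in> Std l n" and i: "Suc i < n"
    and inc: "t i = (a, b, d)" "t (Suc i) = (a', b', d')" "\<not> (d = d' \<and> a \<le> a' \<and> b \<le> b')"
  shows "t \<circ> swp i (Suc i) \<in> Std l n"
    "shape n (t \<circ> swp i (Suc i)) = shape n t"
proof -
  let ?s = "swp i (Suc i)"
  have inj: "inj_on t {..<n}" and dg: "\<And>x. x \<le> n \<Longrightarrow> is_diag l (t ` {..<x})"
    and z: "\<And>x. x \<ge> n \<Longrightarrow> t x = (0,0,0)" using t by (auto simp: Std_def)
  \<comment> \<open>Only the prefix of length \<open>Suc i\<close> changes; there the box of entry i
    is replaced by that of entry i + 1.\<close>
  have im: "(t \<circ> ?s) ` {..<x} = t ` {..<x}" if "x \<noteq> Suc i" for x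
  proof -
    have "?s ` {..<x} = {..<x}"
    proof (cases "x \<le> i")
      case True
      have "?s ` {..<x} = id ` {..<x}" using True by (intro image_cong) (auto simp: Transposition.transpose_def)
      then show ?thesis by simp
    next
      case False
      then show ?thesis using that by (intro permutes_image transpose_permutes) auto
    qed
    then show ?thesis by (metis image_comp)
  qed
  show "shape n (t \<circ> ?s) = shape n t" unfolding shape_def using i by (intro im) simp
  have "is_diag l ((t \<circ> ?s) ` {..<Suc i})"
  proof (rule is_diagI)
    have e: "(t \<circ> ?s) ` {..<Suc i} = insert (t (Suc i)) (t ` {..<i})"
    proof -
      have "(t \<circ> ?s) ` {..<Suc i} = insert ((t \<circ> ?s) i) ((t \<circ> ?s) ` {..<i})" by (simp add: lessThan_Suc)
      then show ?thesis using im[of i] by simp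
    qed
    show "finite ((t \<circ> ?s) ` {..<Suc i})" by simp
    fix p q r assume p: "(p, q, r) \<in> (t \<circ> ?s) ` {..<Suc i}"
    then have p2: "(p, q, r) \<in> t ` {..<Suc (Suc i)}" unfolding e by (auto simp: lessThan_Suc)
    show "1 \<le> p \<and> 1 \<le> q \<and> 1 \<le> r \<and> r \<le> l" using is_diagD(1-4)[OF dg p2] i by simp
    fix p' q' assume le: "1 \<le> p'" "p' \<le> p" "1 \<le> q'" "q' \<le> q"
    show "(p', q', r) \<in> (t \<circ> ?s) ` {..<Suc i}"
    proof (cases "(p, q, r) \<in> t ` {..<i}")
      case True
      then show ?thesis using is_diagD(5)[OF dg True le] i unfolding e by simp
    next
      case False
      then have pq: "(p, q, r) = (a', b', d')" using p inc(2) unfolding e by simp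
      have "(p', q', r) \<in> t ` {..<Suc (Suc i)}" using is_diagD(5)[OF dg p2 le] i by simp
      moreover have "(p', q', r) \<noteq> (a, b, d)" using inc(3) pq le by auto
      ultimately show ?thesis using inc(1) unfolding e by (auto simp: lessThan_Suc)
    qed
  qed
  then have "is_diag l ((t \<circ> ?s) ` {..<x})" if "x \<le> n" for x
    using im[of x] dg[OF that] by (cases "x = Suc i") simp_all
  moreover have "inj_on (t \<circ> ?s) {..<n}"
    using inj i by (intro comp_inj_on permutes_inj_on[OF transpose_permutes[of _ n]])
      (simp_all add: permutes_image[OF transpose_permutes])
  moreover have "(t \<circ> ?s) x = (0,0,0)" if "x \<ge> n" for x
    using z[OF that] that i by (simp add: Transposition.transpose_def)
  ultimately show "t \<circ> ?s \<in> Std l n" by (simp add: Std_def)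
qed

text \<open>The box of the later entry comes first in column reading order but cannot lie weakly
  north-west of the other one. Within one component it is therefore strictly to the left and
  strictly below, which gives the gap of at least 2 in content.\<close>

lemma Std_descent:
  assumes t: "t \<in> Std l n" and i: "Suc i < n" and desc: "key (Suc n) (t (Suc i)) < key (Suc n) (t i)"
  shows "t \<circ> swp i (Suc i) \<in> Std l n"
    "shape n (t \<circ> swp i (Suc i)) = shape n t"
    "bcomp (t i) = bcomp (t (Suc i)) \<Longrightarrow> content (t i) \<ge> content (t (Suc i)) + 2"
proof -
  obtain a b d where b1: "t i = (a, b, d)" by (cases "t i")
  obtain a' b' d' where b2: "t (Suc i) = (a', b', d')" by (cases "t (Suc i)")
  note B1 = Std_box[OF t Suc_lessD[OF i] b1] and B2 = Std_box[OF t i b2]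
  have k: "d' < d \<or> d' = d \<and> (b' < b \<or> b' = b \<and> a' < a)"
    using desc key_less[of a' "Suc n" b' a b d' d] B1 B2 unfolding b1 b2 by simp
  have nle: "\<not> (d' = d \<and> a' \<le> a \<and> b' \<le> b)"
    using Std_le[OF t i Suc_lessD[OF i], of a' b' d' a b] b1 b2 by auto
  have "\<not> (d = d' \<and> a \<le> a' \<and> b \<le> b')" using k nle by auto
  from Std_swap[OF t i b1 b2 this]
  show "t \<circ> swp i (Suc i) \<in> Std l n"
    "shape n (t \<circ> swp i (Suc i)) = shape n t" .
  assume "bcomp (t i) = bcomp (t (Suc i))"
  then show "content (t i) \<ge> content (t (Suc i)) + 2" using k nle unfolding b1 b2 by auto
qed

text \<open>By induction both tableaux agree before entry x, and a diagram has at most one addable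
  box on each diagonal of each component. Contents and components together thus separate standard
  tableaux, whatever the parameter is.\<close>

lemma Std_eqI:
  assumes t: "t \<in> Std l n" and u: "u \<in> Std l n"
    and eq: "\<And>x. x < n \<Longrightarrow> bcomp (t x) = bcomp (u x) \<and> content (t x) = content (u x)"
  shows "t = u"
proof -
  have "t x = u x" if "x < n" for x
    using that
  proof (induction x rule: less_induct)
    case (less x)
    then have pre: "t ` {..<x} = u ` {..<x}" by (intro image_cong) auto
    obtain a b d where b1: "t x = (a, b, d)" by (cases "t x")
    obtain a' b' d' where b2: "u x = (a', b', d')" by (cases "u x")
    have d: "d = d'" "int b - int a = int b' - int a'" using eq[OF less.prems] b1 b2 by auto
    \<comment> \<open>Of two boxes on one diagonal the upper one lies north-west of the lower one,
      so it would already be occupied by an entry before x.\<close>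
    have key: False if tt: "t \<in> Std l n" "u \<in> Std l n" "t ` {..<x} = u ` {..<x}"
      "t x = (a, b, d)" "u x = (a', b', d)" "int b - int a = int b' - int a'" "a < a'" for t u a b a' b'
    proof -
      have dg: "is_diag l (u ` {..<Suc x})" using tt(2) less.prems by (simp add: Std_def)
      have "(a', b', d) \<in> u ` {..<Suc x}" using tt(5) by (metis imageI lessThan_iff lessI)
      from is_diagD(5)[OF dg this, of a b] have "(a, b, d) \<in> u ` {..<Suc x}"
        using Std_box(1,3)[OF tt(1) less.prems tt(4)] tt(6,7) by simp
      then have "(a, b, d) \<in> u ` {..<x}" using tt(5,7) by (auto simp: lessThan_Suc)
      then have "t x \<in> t ` {..<x}" using tt(3,4) by simp
      then obtain z where z: "z < x" "t x = t z" by blast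
      have "inj_on t {..<n}" using tt(1) by (simp add: Std_def)
      from inj_onD[OF this z(2)] z(1) less.prems show False by simp
    qed
    note b2' = b2[folded d(1)]
    have "a = a'" using key[OF t u pre b1 b2' d(2)] key[OF u t pre[symmetric] b2' b1 d(2)[symmetric]]
      by (meson linorder_neqE_nat)
    then show ?case using b1 b2 d by simp
  qed
  moreover have "t x = u x" if "\<not> x < n" for x using t u that by (simp add: Std_def)
  ultimately show ?thesis by blast
qed

lemma Std_key_increasing_unique:
  assumes t: "t \<in> Std l n" and inc: "\<And>i. Suc i < n \<Longrightarrow> key N (t i) < key N (t (Suc i))"
    and u: "\<And>x y. x < y \<Longrightarrow> y < n \<Longrightarrow> key N (u x) < key N (u y)" "u ` {..<n} = shape n t"
    "\<And>x. x \<ge> n \<Longrightarrow> u x = (0, 0, 0)" and inj: "inj_on (key N) (shape n t)"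
  shows "t = u"
proof -
  have ti: "key N (t x) < key N (t y)" if "x < y" "y < n" for x y
    using that
  proof (induction y)
    case (Suc y)
    then show ?case using inc[of y] by (cases "x = y") auto
  qed simp
  have srt: "sorted (map f [0..<n]) \<and> distinct (map f [0..<n])" if "\<And>x y. x < y \<Longrightarrow> y < n \<Longrightarrow> f x < f y" for f :: "nat \<Rightarrow> nat"
  proof
    show "sorted (map f [0..<n])" using that by (auto simp: sorted_iff_nth_mono_less less_imp_le)
    show "distinct (map f [0..<n])"
      unfolding distinct_map using that by (auto simp: inj_on_def) (metis less_irrefl linorder_neqE_nat)
  qed
  have set: "set (map (\<lambda>x. key N (t x)) [0..<n]) = set (map (\<lambda>x. key N (u x)) [0..<n])"
  proof -
    have "(\<lambda>x. key N (f x)) ` {0..<n} = key N ` (f ` {..<n})" for f by (simp add: image_image lessThan_atLeast0)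
    then show ?thesis using u(2) by (simp add: shape_def)
  qed
  have "map (\<lambda>x. key N (t x)) [0..<n] = map (\<lambda>x. key N (u x)) [0..<n]"
    by (rule sorted_distinct_set_unique[OF _ _ _ _ set])
      (use srt[of "\<lambda>x. key N (t x)"] srt[of "\<lambda>x. key N (u x)"] ti u(1) in blast)+
  then have "key N (t x) = key N (u x)" if "x < n" for x using that by (simp add: list_eq_iff_nth_eq)
  moreover have "t x \<in> shape n t" "u x \<in> shape n t" if "x < n" for x
    using that u(2) by (auto simp: shape_def)
  ultimately have "t x = u x" if "x < n" for x using inj that by (simp add: inj_on_def)
  moreover have "t x = u x" if "\<not> x < n" for x using t u(3) that by (simp add: Std_def)
  ultimately show ?thesis by blast
qed

section \<open>Submodules generated by one vector, and weight vectors for all standard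
  tableaux\<close>

definition gspan :: "nat \<Rightarrow> nat \<Rightarrow> tvec \<Rightarrow> tvec set" where
  "gspan l n f = fn.span ((\<lambda>g. act n g f) ` GL l n)"

lemma act_in_gspan: "g \<in> GL l n \<Longrightarrow> act n g f \<in> gspan l n f"
  unfolding gspan_def by (intro fn.span_base) simp

lemma self_in_gspan: "1 \<le> l \<Longrightarrow> f \<in> gspan l n f"
  using act_in_gspan[of "1\<^sub>m n" l n f] group.is_monoid[OF group_Gl1[of l n]]
  by (metis Gl1_one act_one monoid.one_closed)

lemma subspace_gspan: "fn.subspace (gspan l n f)"
  unfolding gspan_def by (rule fn.subspace_span)

lemma act_stable_span:
  assumes "\<And>b. b \<in> B \<Longrightarrow> act n g b \<in> V" "fn.subspace V" "h \<in> fn.span B"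
  shows "act n g h \<in> V"
  using assms(3)
proof (induction rule: fn.span_induct_alt)
  case base
  show ?case using fn.subspace_0[OF assms(2)] by (simp only: act_zero)
next
  case (step c x y)
  then show ?case using assms(1,2) by (simp only: act_add act_scale) (blast intro: fn.subspace_add fn.subspace_scale)
qed

lemma act_gspan:
  assumes l: "1 \<le> l" and h: "h \<in> gspan l n f" and g: "g \<in> GL l n"
  shows "act n g h \<in> gspan l n f"
proof (rule act_stable_span[OF _ subspace_gspan h[unfolded gspan_def]])
  fix b assume "b \<in> (\<lambda>g. act n g f) ` GL l n"
  then obtain g' where g': "g' \<in> GL l n" "b = act n g' f" by blast
  have "g * g' \<in> GL l n"
    using monoid.m_closed[OF group.is_monoid[OF group_Gl1[OF l]] g g'(1)] by simp
  then show "act n g b \<in> gspan l n f"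
    unfolding g'(2) act_mult[OF l g g'(1), symmetric] by (rule act_in_gspan)
qed

lemma gspan_minimal:
  assumes "\<And>g h. g \<in> GL l n \<Longrightarrow> h \<in> V \<Longrightarrow> act n g h \<in> V" "fn.subspace V" "f \<in> V"
  shows "gspan l n f \<subseteq> V"
  unfolding gspan_def using assms by (intro fn.span_minimal) auto

lemma gspan_trans: "1 \<le> l \<Longrightarrow> h \<in> gspan l n f \<Longrightarrow> gspan l n h \<subseteq> gspan l n f"
  by (intro gspan_minimal act_gspan subspace_gspan)

lemma subspace_coord_space: "fn.subspace (coord_space X)"
  by (auto simp: fn.subspace_def coord_space_def fscale_def)

lemma gspan_coord: "1 \<le> l \<Longrightarrow> f \<in> coord_space (omega l n) \<Longrightarrow> gspan l n f \<subseteq> coord_space (omega l n)"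
  by (intro gspan_minimal act_coord subspace_coord_space)

definition wt_of :: "nat \<Rightarrow> (nat \<Rightarrow> box) \<Rightarrow> tvec \<Rightarrow> bool" where
  "wt_of n t v \<longleftrightarrow> is_wt n v (\<lambda>x. bcomp (t x)) (\<lambda>x. of_int (content (t x)))"

lemma key_inj_on_diag:
  assumes "D \<in> diags l n"
  shows "inj_on (key (Suc n)) D"
proof (rule inj_onI)
  fix p q assume pq: "p \<in> D" "q \<in> D" "key (Suc n) p = key (Suc n) q"
  obtain a b d where p: "p = (a, b, d)" by (cases p)
  obtain a' b' d' where q: "q = (a', b', d')" by (cases q)
  have "a \<le> n" "b \<le> n" "a' \<le> n" "b' \<le> n"
    using diag_box_le[of l D] pq p q assms unfolding diags_def by auto
  then show "p = q" using pq(3) key_less[of a "Suc n" b a' b' d d'] key_less[of a' "Suc n" b' a b d' d]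
    unfolding p q by (metis less_Suc_eq_le less_irrefl linorder_neqE_nat)
qed

text \<open>Starting from the weight vector of the column reading tableau, the intertwiners attached to
  descents produce a weight vector for every standard tableau of the same shape.\<close>

lemma ex_weight_vector:
  assumes l: "1 \<le> l" and v0: "wt_of n t0 v0" "v0 \<noteq> 0"
    and t0: "\<And>x y. x < y \<Longrightarrow> y < n \<Longrightarrow> key (Suc n) (t0 x) < key (Suc n) (t0 y)" "\<And>x. x \<ge> n \<Longrightarrow> t0 x = (0, 0, 0)"
    and t: "t \<in> Std l n" "shape n t = t0 ` {..<n}"
  shows "\<exists>v. wt_of n t v \<and> v \<noteq> 0 \<and> v \<in> gspan l n v0 \<and> v0 \<in> gspan l n v"
  using t
\<comment> \<open>The factors \<open>n - x\<close> decrease with x, so moving the smaller key to the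
  front at a descent lowers this sum.\<close>
proof (induction "\<Sum>x<n. (n - x) * key (Suc n) (t x)" arbitrary: t rule: less_induct)
  case less
  show ?case
  proof (cases "\<exists>i. Suc i < n \<and> key (Suc n) (t (Suc i)) < key (Suc n) (t i)")
    case False
    have inj: "inj_on (key (Suc n)) (shape n t)" by (rule key_inj_on_diag[OF shape_in_diags[OF less.prems(1)]])
    have "key (Suc n) (t i) < key (Suc n) (t (Suc i))" if i: "Suc i < n" for i
    proof -
      have "inj_on t {..<n}" using less.prems(1) by (simp add: Std_def)
      then have "t i \<noteq> t (Suc i)" using inj_onD[of t "{..<n}" i "Suc i"] i by auto
      moreover have "t i \<in> shape n t" "t (Suc i) \<in> shape n t" using i by (auto simp: shape_def)
      ultimately have "key (Suc n) (t i) \<noteq> key (Suc n) (t (Suc i))" using inj by (auto simp: inj_on_def)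
      then show ?thesis using False i by (meson linorder_neqE_nat)
    qed
    then have "t = t0"
      by (rule Std_key_increasing_unique[OF less.prems(1) _ t0(1) less.prems(2)[symmetric] t0(2) inj])
    then show ?thesis using v0 self_in_gspan[OF l] by blast
  next
    case True
    then obtain i where i: "Suc i < n" and desc: "key (Suc n) (t (Suc i)) < key (Suc n) (t i)" by blast
    let ?s = "swp i (Suc i)"
    define u where "u = t \<circ> ?s"
    note D = Std_descent[OF less.prems(1) i desc]
    have u: "u \<in> Std l n" "shape n u = t0 ` {..<n}" using D(1,2) less.prems(2) by (simp_all add: u_def)
    have "(\<Sum>x<n. (n - x) * key (Suc n) (u x)) < (\<Sum>x<n. (n - x) * key (Suc n) (t x))"
    proof -
      have split: "(\<Sum>x<n. F x) = F i + F (Suc i) + (\<Sum>x\<in>{..<n} - {i, Suc i}. F x)" for F :: "nat \<Rightarrow> nat"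
        using i by (subst sum.subset_diff[of "{i, Suc i}"]) auto
      have "(n - i) * key (Suc n) (u i) + (n - Suc i) * key (Suc n) (u (Suc i)) <
        (n - i) * key (Suc n) (t i) + (n - Suc i) * key (Suc n) (t (Suc i))"
      proof -
        have ni: "n - i = Suc (n - Suc i)" using i by simp
        show ?thesis using desc unfolding ni by (simp add: u_def)
      qed
      moreover have "(\<Sum>x\<in>{..<n} - {i, Suc i}. (n - x) * key (Suc n) (u x)) =
        (\<Sum>x\<in>{..<n} - {i, Suc i}. (n - x) * key (Suc n) (t x))"
        by (rule sum.cong) (auto simp: u_def Transposition.transpose_def)
      ultimately show ?thesis unfolding split by linarith
    qed
    from less.hyps[OF this u] obtain v where v: "wt_of n u v" "v \<noteq> 0" "v \<in> gspan l n v0" "v0 \<in> gspan l n v" by blast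
    define c where "c = (\<lambda>x. complex_of_int (content (u x)))"
    \<comment> \<open>The coefficient required by \<open>is_wt_intertwiner\<close>: within one
      component the two contents differ by \<open>gap\<close>, so the division is
      legitimate.\<close>
    define a where "a = (if bcomp (u i) = bcomp (u (Suc i)) then 1 / (c (Suc i) - c i) else 0)"
    have gap: "content (u (Suc i)) \<ge> content (u i) + 2" if "bcomp (u i) = bcomp (u (Suc i))"
      using D(3) that by (simp add: u_def)
    have a: "a * (c (Suc i) - c i) = (if bcomp (u i) = bcomp (u (Suc i)) then 1 else 0)"
    proof (cases "bcomp (u i) = bcomp (u (Suc i))")
      case True
      from gap[OF True] have "c (Suc i) - c i \<noteq> 0" by (simp add: c_def)
      then show ?thesis using True by (simp add: a_def)
    qed (simp add: a_def)
    \<comment> \<open>A content gap of at least 2 keeps a away from 1 and -1.\<close>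
    have a2: "a * a \<noteq> 1"
    proof (cases "bcomp (u i) = bcomp (u (Suc i))")
      case True
      define m where "m = content (u (Suc i)) - content (u i)"
      have m: "m \<ge> 2" using gap[OF True] by (simp add: m_def)
      have "a = 1 / of_int m" using True by (simp add: a_def c_def m_def)
      moreover have "(of_int m :: complex) * of_int m \<noteq> 1"
      proof -
        have "m * m \<noteq> 1" using m by (metis less_irrefl pos_zmult_eq_1_iff one_add_one order.strict_trans2 zero_less_one zless_add1_eq le_less_trans not_le zero_less_numeral)
        then show ?thesis by (metis of_int_1 of_int_eq_iff of_int_mult)
      qed
      ultimately show ?thesis by auto
    qed (simp add: a_def)
    define h where "h = (\<lambda>T. v (T \<circ> ?s) - a * v T)"
    have st: "act n (mon n ?s (\<lambda>_. 1)) f = (\<lambda>T. f (T \<circ> ?s))" for f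
      by (rule ext, subst act_mon) (use i in \<open>auto intro!: transpose_permutes\<close>)
    have sc: "mon n ?s (\<lambda>_. 1) \<in> GL l n"
      using i by (intro mon_in_Gl1[OF l] transpose_permutes) auto
    have hS: "h = act n (mon n ?s (\<lambda>_. 1)) v - fscale a v" unfolding st h_def by (simp add: fscale_def fun_eq_iff)
    have "h \<in> gspan l n v"
      unfolding hS by (intro fn.subspace_diff[OF subspace_gspan] act_in_gspan sc fn.subspace_scale[OF subspace_gspan] self_in_gspan l)
    \<comment> \<open>With s the swap, \<open>s^2 = 1\<close> gives
      \<open>(s + a)(s - a) = 1 - a^2\<close>: the intertwiner is invertible, so h is nonzero and
      generates the same submodule as v.\<close>
    have vh: "v = fscale (1 / (1 - a * a)) (act n (mon n ?s (\<lambda>_. 1)) h + fscale a h)"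
    proof
      fix T
      have "(act n (mon n ?s (\<lambda>_. 1)) h + fscale a h) T = (1 - a * a) * v T"
        unfolding st by (simp add: h_def fscale_def comp_assoc algebra_simps)
      then show "v T = fscale (1 / (1 - a * a)) (act n (mon n ?s (\<lambda>_. 1)) h + fscale a h) T"
        using a2 by (simp add: fscale_def)
    qed
    have "v \<in> gspan l n h"
      by (subst vh) (intro fn.subspace_scale[OF subspace_gspan] fn.subspace_add[OF subspace_gspan] act_in_gspan sc self_in_gspan l)
    have "h \<noteq> 0"
    proof
      assume "h = 0"
      then have "v = 0" by (subst vh) (simp only: act_zero fn.scale_zero_right add_0)
      then show False using v(2) by blast
    qed
    moreover have "wt_of n t h"
    proof -
      have us: "u \<circ> ?s = t" by (simp add: u_def comp_assoc)
      have "is_wt n h ((\<lambda>x. bcomp (u x)) \<circ> ?s) (c \<circ> ?s)"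
        unfolding h_def using v(1) a i
        by (intro is_wt_intertwiner) (simp_all add: wt_of_def c_def a_def)
      moreover have "(\<lambda>x. bcomp (u x)) \<circ> ?s = (\<lambda>x. bcomp (t x))" "c \<circ> ?s = (\<lambda>x. of_int (content (t x)))"
        unfolding us[symmetric] c_def by (simp_all add: fun_eq_iff)
      ultimately show ?thesis by (simp add: wt_of_def)
    qed
    moreover have "h \<in> gspan l n v0" using gspan_trans[OF l v(3)] \<open>h \<in> gspan l n v\<close> by blast
    moreover have "v0 \<in> gspan l n h" using gspan_trans[OF l \<open>v \<in> gspan l n h\<close>] v(4) by blast
    ultimately show ?thesis by blast
  qed
qed

section \<open>Multipartitions and their diagrams\<close>

text \<open>Numbering of the components starts at \<open>Suc e\<close>, which permits recursion on
  the list of partitions; \<open>ldiag\<close> is the case e = 0.\<close>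

definition ldiag_from :: "nat \<Rightarrow> nat list list \<Rightarrow> box set" where
  "ldiag_from e mus = {(a, b, d). Suc e \<le> d \<and> d - Suc e < length mus \<and> (a, b) \<in> ydiag (mus ! (d - Suc e))}"

lemma ldiag_eq_from: "ldiag lam = ldiag_from 0 lam"
  unfolding ldiag_def ldiag_from_def by (intro Collect_cong) auto

lemma ldiag_from_Nil [simp]: "ldiag_from e [] = {}"
  by (simp add: ldiag_from_def)

lemma ldiag_from_Cons: "ldiag_from e (\<mu> # mus) = (\<lambda>(a, b). (a, b, Suc e)) ` ydiag \<mu> \<union> ldiag_from (Suc e) mus"
proof (intro subset_antisym subsetI)
  fix p assume p: "p \<in> ldiag_from e (\<mu> # mus)"
  obtain a b d where abd: "p = (a, b, d)" by (cases p)
  show "p \<in> (\<lambda>(a, b). (a, b, Suc e)) ` ydiag \<mu> \<union> ldiag_from (Suc e) mus"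
  proof (cases "d = Suc e")
    case True
    then have "(a, b) \<in> ydiag \<mu>" using p abd by (simp add: ldiag_from_def)
    then show ?thesis using abd True by force
  next
    case False
    then have "d - Suc e = Suc (d - Suc (Suc e))" "Suc (Suc e) \<le> d" using p abd by (auto simp: ldiag_from_def)
    then show ?thesis using p abd by (simp add: ldiag_from_def)
  qed
next
  fix p assume "p \<in> (\<lambda>(a, b). (a, b, Suc e)) ` ydiag \<mu> \<union> ldiag_from (Suc e) mus"
  then consider (1) a b where "p = (a, b, Suc e)" "(a, b) \<in> ydiag \<mu>" | (2) "p \<in> ldiag_from (Suc e) mus" by auto
  then show "p \<in> ldiag_from e (\<mu> # mus)"
  proof cases
    case 2
    obtain a b d where abd: "p = (a, b, d)" by (cases p)
    have "Suc (Suc e) \<le> d" using 2 abd by (simp add: ldiag_from_def)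
    then have "d - Suc e = Suc (d - Suc (Suc e))" by simp
    then show ?thesis using 2 abd by (simp add: ldiag_from_def)
  qed (simp add: ldiag_from_def)
qed

lemma ldiag_from_comp: "(a, b, d) \<in> ldiag_from e mus \<Longrightarrow> Suc e \<le> d"
  by (simp add: ldiag_from_def)

lemma ydiag_Sigma: "ydiag \<mu> = (SIGMA a:{1..length \<mu>}. {1..\<mu> ! (a - 1)})"
  by (auto simp: ydiag_def)

lemma finite_ydiag [simp]: "finite (ydiag \<mu>)"
  by (simp add: ydiag_Sigma)

lemma card_ydiag: "card (ydiag \<mu>) = sum_list \<mu>"
proof -
  have "card (ydiag \<mu>) = (\<Sum>a\<in>{1..length \<mu>}. \<mu> ! (a - 1))"
    unfolding ydiag_Sigma by (subst card_SigmaI) auto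
  also have "\<dots> = (\<Sum>i\<in>{0..<length \<mu>}. \<mu> ! i)"
    by (rule sum.reindex_bij_witness[of _ "\<lambda>i. Suc i" "\<lambda>a. a - 1"]) auto
  finally show ?thesis by (simp add: sum_list_sum_nth)
qed

lemma finite_ldiag_from: "finite (ldiag_from e mus)"
  by (induction mus arbitrary: e) (simp_all add: ldiag_from_Cons)

lemma card_ldiag_from: "card (ldiag_from e mus) = lpart_size mus"
proof (induction mus arbitrary: e)
  case (Cons \<mu> mus)
  have "card (ldiag_from e (\<mu> # mus)) = card ((\<lambda>(a, b). (a, b, Suc e)) ` ydiag \<mu>) + card (ldiag_from (Suc e) mus)"
    unfolding ldiag_from_Cons using finite_ldiag_from ldiag_from_comp
    by (intro card_Un_disjoint) fastforce+
  also have "card ((\<lambda>(a, b). (a, b, Suc e)) ` ydiag \<mu>) = sum_list \<mu>"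
    by (subst card_image) (auto simp: inj_on_def card_ydiag)
  finally show ?case using Cons by (simp add: lpart_size_def)
qed (simp add: lpart_size_def)

lemma partition_antimono:
  assumes "is_partition \<mu>" "i \<le> j" "j < length \<mu>"
  shows "\<mu> ! j \<le> \<mu> ! i"
proof (cases "i = j")
  case False
  then show ?thesis using sorted_wrt_nth_less[of "(\<ge>)" \<mu> i j] assms by (simp add: is_partition_def)
qed simp

lemma ydiag_down:
  assumes "is_partition \<mu>" "(a, b) \<in> ydiag \<mu>" "1 \<le> a'" "a' \<le> a" "1 \<le> b'" "b' \<le> b"
  shows "(a', b') \<in> ydiag \<mu>"
proof -
  have "\<mu> ! (a - 1) \<le> \<mu> ! (a' - 1)" using assms by (intro partition_antimono) (auto simp: ydiag_def)
  then show ?thesis using assms by (auto simp: ydiag_def)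
qed

lemma is_diag_ldiag:
  assumes "is_lpart l lam"
  shows "is_diag l (ldiag lam)"
proof (rule is_diagI)
  show "finite (ldiag lam)" by (simp add: ldiag_eq_from finite_ldiag_from)
  fix a b d assume abd: "(a, b, d) \<in> ldiag lam"
  then show "1 \<le> a \<and> 1 \<le> b \<and> 1 \<le> d \<and> d \<le> l"
    using assms by (auto simp: ldiag_def ydiag_def is_lpart_def)
  fix a' b' assume "1 \<le> a'" "a' \<le> a" "1 \<le> b'" "b' \<le> b"
  moreover have "is_partition (lam ! (d - 1))" using abd assms by (auto simp: ldiag_def is_lpart_def)
  ultimately show "(a', b', d) \<in> ldiag lam" using abd ydiag_down unfolding ldiag_def by fastforce
qed

lemma ldiag_in_diags: "lam \<in> lparts l n \<Longrightarrow> ldiag lam \<in> diags l n"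
  using is_diag_ldiag[of l lam] card_ldiag_from[of 0 lam] by (simp add: lparts_def diags_def ldiag_eq_from)

lemma ydiag_inj:
  assumes "is_partition \<mu>" "is_partition \<nu>" "ydiag \<mu> = ydiag \<nu>"
  shows "\<mu> = \<nu>"
proof (rule nth_equalityI)
  have len: "{a. (a, 1) \<in> ydiag \<mu>} = {1..length \<mu>}" if "is_partition \<mu>" for \<mu>
  proof -
    have "1 \<le> \<mu> ! (a - 1)" if "1 \<le> a" "a \<le> length \<mu>" for a
    proof -
      have "\<mu> ! (a - 1) \<in> set \<mu>" using that by simp
      then have "\<mu> ! (a - 1) \<noteq> 0" using \<open>is_partition \<mu>\<close> unfolding is_partition_def by metis
      then show ?thesis by simp
    qed
    then show ?thesis by (auto simp: ydiag_def)
  qed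
  have "{1..length \<mu>} = {1..length \<nu>}" using len[OF assms(1)] len[OF assms(2)] assms(3) by simp
  then show l: "length \<mu> = length \<nu>" by (metis card_atLeastAtMost diff_Suc_1)
  fix i assume i: "i < length \<mu>"
  have "{b. (Suc i, b) \<in> ydiag \<mu>} = {1..\<mu> ! i}" "{b. (Suc i, b) \<in> ydiag \<nu>} = {1..\<nu> ! i}"
    using i l by (auto simp: ydiag_def)
  then have "card {b. (Suc i, b) \<in> ydiag \<mu>} = \<mu> ! i" "card {b. (Suc i, b) \<in> ydiag \<nu>} = \<nu> ! i"
    by (simp_all only: card_atLeastAtMost diff_Suc_1)
  then show "\<mu> ! i = \<nu> ! i" using assms(3) by simp
qed

lemma ldiag_inj:
  assumes "is_lpart l lam" "is_lpart l mu" "ldiag lam = ldiag mu"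
  shows "lam = mu"
proof (rule nth_equalityI)
  show "length lam = length mu" using assms by (simp add: is_lpart_def)
  fix i assume i: "i < length lam"
  have *: "ydiag (lam ! i) = {(a, b). (a, b, Suc i) \<in> ldiag lam}" if "i < length lam" for lam
    using that by (auto simp: ldiag_def)
  have "ydiag (lam ! i) = ydiag (mu ! i)"
    using *[of lam] *[of mu] i assms by (simp add: is_lpart_def)
  then show "lam ! i = mu ! i" using ydiag_inj assms(1,2) i by (auto simp: is_lpart_def)
qed

lemma ldiag_surj:
  assumes D: "is_diag l D"
  shows "\<exists>lam. is_lpart l lam \<and> ldiag lam = D"
proof -
  \<comment> \<open>The length of the first column, that is, the number of nonempty rows of
    component d.\<close>
  define h where "h = (\<lambda>d. card {a. (a, 1, d) \<in> D})"
  have H: "{a. (a, 1, d) \<in> D} = {1..h d}" for d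
    unfolding h_def
  proof (rule down_closed_nat)
    have "{a. (a, 1, d) \<in> D} \<subseteq> fst ` D" by force
    then show "finite {a. (a, 1, d) \<in> D}" using is_diag_finite[OF D] finite_surj by blast
    show "y \<in> {a. (a, 1, d) \<in> D}" if "x \<in> {a. (a, 1, d) \<in> D}" "1 \<le> y" "y \<le> x" for x y
      using is_diagD(5)[OF D, of x 1 d y 1] that by simp
    show "0 \<notin> {a. (a, 1, d) \<in> D}" using is_diagD(1)[OF D, of 0 1 d] by auto
  qed
  have row0: "row_len D d a = 0 \<longleftrightarrow> \<not> (1 \<le> a \<and> a \<le> h d)" for d a
    using in_diag_iff[OF D, of a 1 d] H[of d] by (simp add: set_eq_iff) (metis One_nat_def Suc_le_eq le0 le_antisym not_less_eq_eq)
  define part where "part = (\<lambda>d. map (row_len D d) [1..<Suc (h d)])"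
  have pt: "is_partition (part d)" for d
    unfolding is_partition_def
  proof
    show "sorted_wrt (\<ge>) (part d)"
      unfolding part_def sorted_wrt_map
      by (rule sorted_wrt_mono_rel[OF _ sorted_wrt_upt]) (use row_len_antimono[OF D] in auto)
    show "0 \<notin> set (part d)"
    proof
      assume "0 \<in> set (part d)"
      then obtain a where "1 \<le> a" "a \<le> h d" "row_len D d a = 0" unfolding part_def by auto
      then show False using row0 by blast
    qed
  qed
  have yd: "(a, b) \<in> ydiag (part d) \<longleftrightarrow> (a, b, d) \<in> D" for a b d
  proof -
    have "(a, b) \<in> ydiag (part d) \<longleftrightarrow> 1 \<le> a \<and> a \<le> h d \<and> 1 \<le> b \<and> b \<le> row_len D d a"
      by (auto simp: ydiag_def part_def simp del: upt_Suc)
    also have "\<dots> \<longleftrightarrow> (a, b, d) \<in> D"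
      unfolding in_diag_iff[OF D] using row0[of d a] by (metis le_zero_eq not_one_le_zero)
    finally show ?thesis .
  qed
  have "ldiag (map part [1..<Suc l]) = D"
  proof (intro subset_antisym subsetI)
    fix p assume p: "p \<in> ldiag (map part [1..<Suc l])"
    obtain a b d where abd: "p = (a, b, d)" by (cases p)
    then have "1 \<le> d" "d \<le> l" "(a, b) \<in> ydiag (part d)" using p by (auto simp: ldiag_def simp del: upt_Suc)
    then show "p \<in> D" using yd abd by simp
  next
    fix p assume p: "p \<in> D"
    obtain a b d where abd: "p = (a, b, d)" by (cases p)
    then have "1 \<le> d" "d \<le> l" "(a, b) \<in> ydiag (part d)" using p yd is_diagD(3,4)[OF D, of a b d] by simp_all
    then show "p \<in> ldiag (map part [1..<Suc l])" using abd by (auto simp: ldiag_def simp del: upt_Suc)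
  qed
  moreover have "is_lpart l (map part [1..<Suc l])" using pt by (auto simp: is_lpart_def)
  ultimately show ?thesis by blast
qed

lemma bij_ldiag: "bij_betw ldiag (lparts l n) (diags l n)"
  unfolding bij_betw_def
proof
  show "inj_on ldiag (lparts l n)" using ldiag_inj by (auto intro!: inj_onI simp: lparts_def)
  show "ldiag ` lparts l n = diags l n"
  proof (intro subset_antisym subsetI)
    fix D assume D: "D \<in> diags l n"
    then obtain lam where lam: "is_lpart l lam" "ldiag lam = D" using ldiag_surj unfolding diags_def by blast
    then have "lpart_size lam = n" using card_ldiag_from[of 0 lam] D by (simp add: diags_def ldiag_eq_from)
    then show "D \<in> ldiag ` lparts l n" using lam by (auto simp: lparts_def)
  qed (use ldiag_in_diags in blast)
qed

section \<open>Polytabloids\<close>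

lemma tabloid_of_comp: "v permutes {..<m} \<Longrightarrow> tabloid_of m (t \<circ> v) = tabloid_of m t \<circ> v"
  using permutes_in_image[of v "{..<m}"] by (auto simp: tabloid_of_def fun_eq_iff)

lemma comp_pinv_eq_iff:
  assumes "v permutes {..<m}"
  shows "R \<circ> pinv v = Q \<longleftrightarrow> R = Q \<circ> v"
  using permutes_inv_o[OF assms] by (metis comp_assoc comp_id)

lemma column_stabilizerD:
  assumes "p \<in> column_stabilizer m t"
  shows "p permutes {..<m}" "x < m \<Longrightarrow> snd (t (p x)) = snd (t x)" "x < m \<Longrightarrow> snd (t (pinv p x)) = snd (t x)"
proof -
  show p: "p permutes {..<m}" and 1: "x < m \<Longrightarrow> snd (t (p x)) = snd (t x)" for x
    using assms by (simp_all add: column_stabilizer_def)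
  assume "x < m"
  then have "pinv p x < m" by (rule permutes_lt[OF permutes_inv[OF p]])
  from 1[OF this] show "snd (t (pinv p x)) = snd (t x)" by (simp add: permutes_inverses[OF p])
qed

lemma finite_column_stabilizer [simp]: "finite (column_stabilizer m t)"
  by (rule finite_subset[of _ "{p. p permutes {..<m}}"]) (auto simp: column_stabilizer_def finite_permutations)

text \<open>Left multiplication by the transposition permutes the column stabilizer and changes
  every sign.\<close>

lemma polytabloid_antisym:
  assumes x: "x < m" and y: "y < m" and "x \<noteq> y" and col: "snd (t x) = snd (t y)"
  shows "polytabloid m t (R \<circ> swp x y) = - polytabloid m t R"
proof -
  let ?s = "swp x y"
  have s: "?s permutes {..<m}" using x y by (rule transpose_permutes)
  have cs: "snd (t (?s z)) = snd (t z)" for z using col by (auto simp: Transposition.transpose_def)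
  have sC: "?s \<circ> p \<in> column_stabilizer m t" if "p \<in> column_stabilizer m t" for p
    using column_stabilizerD(1,2)[OF that] cs permutes_compose[OF _ s] by (simp add: column_stabilizer_def)
  have ss: "?s \<circ> (?s \<circ> p) = p" for p :: "nat \<Rightarrow> nat" by (simp add: fun_eq_iff)
  let ?F = "\<lambda>R p. of_int (sign p) * (if R = tabloid_of m (t \<circ> pinv p) then 1 else 0 :: complex)"
  have "polytabloid m t (R \<circ> ?s) = (\<Sum>p\<in>column_stabilizer m t. ?F (R \<circ> ?s) (?s \<circ> p))"
    unfolding polytabloid_def
    by (rule sum.reindex_bij_witness[of _ "\<lambda>p. ?s \<circ> p" "\<lambda>p. ?s \<circ> p"]) (use sC ss in auto)
  also have "\<dots> = (\<Sum>p\<in>column_stabilizer m t. - ?F R p)"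
  proof (rule sum.cong[OF refl])
    fix p assume p: "p \<in> column_stabilizer m t"
    note pp = column_stabilizerD(1)[OF p]
    have "pinv (?s \<circ> p) = pinv p \<circ> ?s"
      using o_inv_distrib[OF permutes_bij[OF s] permutes_bij[OF pp]] by (simp add: inv_swap_id)
    then have "tabloid_of m (t \<circ> pinv (?s \<circ> p)) = tabloid_of m (t \<circ> pinv p) \<circ> ?s"
      using tabloid_of_comp[OF s, of "t \<circ> pinv p"] by (simp only: comp_assoc)
    moreover have "R \<circ> ?s = Q \<circ> ?s \<longleftrightarrow> R = Q" for Q
      using comp_pinv_eq_iff[OF s, of R "Q \<circ> ?s"] by (simp add: inv_swap_id comp_assoc)
    moreover have "sign (?s \<circ> p) = - sign p"
      using sign_compose[of ?s p] pp \<open>x \<noteq> y\<close> permutation_permutes[of p] by (auto simp: sign_swap_id permutation_swap_id)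
    ultimately show "?F (R \<circ> ?s) (?s \<circ> p) = - ?F R p" by simp
  qed
  also have "\<dots> = - polytabloid m t R" by (simp add: polytabloid_def sum_negf)
  finally show ?thesis .
qed

text \<open>A column permutation moves entries only within columns, so the row recorded in R
  together with the original column of x is again a box.\<close>

lemma polytabloid_support:
  assumes t: "bij_betw t {..<m} (ydiag \<mu>)" and R: "polytabloid m t R \<noteq> 0"
  shows "x \<ge> m \<Longrightarrow> R x = 0" "x < m \<Longrightarrow> (R x, snd (t x)) \<in> ydiag \<mu>"
proof -
  obtain p where p: "p \<in> column_stabilizer m t" "R = tabloid_of m (t \<circ> pinv p)"
  proof -
    have "\<exists>p\<in>column_stabilizer m t. of_int (sign p) * (if R = tabloid_of m (t \<circ> pinv p) then 1 else 0 :: complex) \<noteq> 0"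
      using R sum.not_neutral_contains_not_neutral unfolding polytabloid_def by blast
    then show thesis using that by (auto split: if_splits)
  qed
  show "x \<ge> m \<Longrightarrow> R x = 0" by (simp add: p(2) tabloid_of_def)
  assume x: "x < m"
  have "t (pinv p x) \<in> ydiag \<mu>"
    using permutes_lt[OF permutes_inv[OF column_stabilizerD(1)[OF p(1)]] x] t by (auto simp: bij_betw_def)
  moreover have "t (pinv p x) = (R x, snd (t x))"
    using x column_stabilizerD(3)[OF p(1) x] by (simp add: p(2) tabloid_of_def prod_eq_iff)
  ultimately show "(R x, snd (t x)) \<in> ydiag \<mu>" by simp
qed

text \<open>A column permutation that also preserves all rows fixes every box, so only the identity
  contributes.\<close>

lemma polytabloid_diagonal:
  assumes t: "inj_on t {..<m}"
  shows "polytabloid m t (tabloid_of m t) = 1"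
proof -
  have "(\<Sum>p\<in>column_stabilizer m t. of_int (sign p) * (if tabloid_of m t = tabloid_of m (t \<circ> pinv p) then 1 else 0 :: complex)) =
    (\<Sum>p\<in>column_stabilizer m t. if p = id then 1 else 0)"
  proof (rule sum.cong[OF refl])
    fix p assume p: "p \<in> column_stabilizer m t"
    note pp = column_stabilizerD(1)[OF p]
    have "p = id" if eq: "tabloid_of m t = tabloid_of m (t \<circ> pinv p)"
    proof
      fix x
      show "p x = id x"
      proof (cases "x < m")
        case True
        have px: "pinv p x < m" by (rule permutes_lt[OF permutes_inv[OF pp] True])
        have "fst (t x) = fst (t (pinv p x))" using fun_cong[OF eq, of x] True by (simp add: tabloid_of_def)
        then have "t (pinv p x) = t x" using column_stabilizerD(3)[OF p True] by (simp add: prod_eq_iff)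
        then have "pinv p x = x" using t True px by (simp add: inj_on_def)
        then show ?thesis using permutes_inverses(1)[OF pp, of x] by simp
      qed (use permutes_not_in[OF pp] in simp)
    qed
    then show "of_int (sign p) * (if tabloid_of m t = tabloid_of m (t \<circ> pinv p) then 1 else 0 :: complex) =
      (if p = id then 1 else 0)" by (auto simp: sign_id)
  qed
  also have "\<dots> = 1"
  proof -
    have "id \<in> column_stabilizer m t" by (simp add: column_stabilizer_def permutes_id)
    then show ?thesis by simp
  qed
  finally show ?thesis by (simp add: polytabloid_def)
qed

text \<open>The column stabilizers of t and of \<open>t o v\<close> are conjugate under v, and
  conjugation preserves signs.\<close>

lemma polytabloid_translate:
  assumes v: "v permutes {..<m}"
  shows "polytabloid m (t \<circ> v) R = polytabloid m t (R \<circ> pinv v)"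
proof -
  have vi: "pinv v permutes {..<m}" by (rule permutes_inv[OF v])
  have io: "v \<circ> pinv v = id" "pinv v \<circ> v = id" using permutes_inv_o[OF v] .
  have 1: "pinv v \<circ> q \<circ> v \<in> column_stabilizer m (t \<circ> v)" if q: "q \<in> column_stabilizer m t" for q
    using column_stabilizerD(1,2)[OF q] permutes_lt[OF v] permutes_compose[OF v permutes_compose[OF _ vi]]
    by (simp add: column_stabilizer_def permutes_inverses[OF v] comp_assoc)
  have 2: "v \<circ> p \<circ> pinv v \<in> column_stabilizer m t" if p: "p \<in> column_stabilizer m (t \<circ> v)" for p
  proof -
    have "snd (t (v (p (pinv v x)))) = snd (t x)" if "x < m" for x
      using column_stabilizerD(2)[OF p permutes_lt[OF vi that]] by (simp add: permutes_inverses[OF v])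
    then show ?thesis
      using column_stabilizerD(1)[OF p] permutes_compose[OF vi permutes_compose[OF _ v]]
      by (simp add: column_stabilizer_def comp_assoc)
  qed
  have canc: "v \<circ> (pinv v \<circ> q \<circ> v) \<circ> pinv v = q" "pinv v \<circ> (v \<circ> q \<circ> pinv v) \<circ> v = q" for q
    using io by (simp_all add: fun_eq_iff)
  let ?F = "\<lambda>t R p. of_int (sign p) * (if R = tabloid_of m (t \<circ> pinv p) then 1 else 0 :: complex)"
  have "polytabloid m t (R \<circ> pinv v) = (\<Sum>q\<in>column_stabilizer m t. ?F t (R \<circ> pinv v) q)"
    by (simp add: polytabloid_def)
  also have "\<dots> = (\<Sum>p\<in>column_stabilizer m (t \<circ> v). ?F (t \<circ> v) R p)"
  proof (rule sum.reindex_bij_witness[of _ "\<lambda>p. v \<circ> p \<circ> pinv v" "\<lambda>q. pinv v \<circ> q \<circ> v"])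
    fix q assume q: "q \<in> column_stabilizer m t"
    note qq = column_stabilizerD(1)[OF q]
    have "pinv (pinv v \<circ> q \<circ> v) = pinv v \<circ> pinv q \<circ> v"
      using o_inv_distrib[OF bij_comp[OF permutes_bij[OF v] permutes_bij[OF qq]] permutes_bij[OF vi]]
        o_inv_distrib[OF permutes_bij[OF qq] permutes_bij[OF v]]
        o_inv_distrib[OF bij_comp[OF permutes_bij[OF qq] permutes_bij[OF vi]] permutes_bij[OF v]]
        o_inv_distrib[OF permutes_bij[OF vi] permutes_bij[OF qq]] permutes_inv_inv[OF v]
        o_inv_distrib[OF bij_comp[OF permutes_bij[OF v] permutes_bij[OF qq]] permutes_bij[OF vi]]
        permutes_bij[OF qq] permutes_bij[OF v] permutes_bij[OF vi]
      by (metis (no_types, lifting) comp_assoc bij_comp o_inv_distrib)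
    then have "(t \<circ> v) \<circ> pinv (pinv v \<circ> q \<circ> v) = (t \<circ> pinv q) \<circ> v"
      using io by (simp add: fun_eq_iff)
    then have "tabloid_of m ((t \<circ> v) \<circ> pinv (pinv v \<circ> q \<circ> v)) = tabloid_of m (t \<circ> pinv q) \<circ> v"
      by (simp only: tabloid_of_comp[OF v])
    moreover have "sign (pinv v \<circ> q \<circ> v) = sign q"
    proof -
      have p: "permutation v" "permutation q" "permutation (pinv v)"
        using v qq vi permutation_permutes by blast+
      then show ?thesis
        using sign_compose[of "pinv v \<circ> q" v] sign_compose[of "pinv v" q] sign_inverse[of v]
        by (simp add: permutation_compose sign_def)
    qed
    ultimately show "?F (t \<circ> v) R (pinv v \<circ> q \<circ> v) = ?F t (R \<circ> pinv v) q"
      using comp_pinv_eq_iff[OF v, of R] by simp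
  qed (use 1 2 canc in auto)
  also have "\<dots> = polytabloid m (t \<circ> v) R" by (simp add: polytabloid_def)
  finally show ?thesis by simp
qed

section \<open>The weight vector of the column reading tableau\<close>

text \<open>Garnir relation for one entry: the antisymmetrization of \<open>v\<close> over the entries of column \<open>b'\<close>
  and one entry \<open>k\<close> of a later column vanishes, since these entries do not fit into distinct rows.\<close>

lemma garnir:
  fixes v :: tvec
  assumes D: "is_diag l D" and G: "bij_betw G {..<n} D"
    and anti: "\<And>x y T a a' b d. x < n \<Longrightarrow> y < n \<Longrightarrow> x \<noteq> y \<Longrightarrow> G x = (a, b, d) \<Longrightarrow> G y = (a', b, d) \<Longrightarrow>
      v (T \<circ> swp x y) = - v T"
    and supp: "\<And>T x a b d. v T \<noteq> 0 \<Longrightarrow> x < n \<Longrightarrow> G x = (a, b, d) \<Longrightarrow> snd (T x) = d \<and> (fst (T x), b, d) \<in> D"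
    and k: "k < n" "G k = (a, b, d)" and b': "1 \<le> b'" "b' < b"
  shows "(\<Sum>j | j < n \<and> (\<exists>a'. G j = (a', b', d)). v (T \<circ> swp k j)) = v T"
proof -
  define C where "C = {j. j < n \<and> (\<exists>a'. G j = (a', b', d))}"
  have finC: "finite C" by (rule finite_subset[of _ "{..<n}"]) (auto simp: C_def)
  have kC: "k \<notin> C" using k b' by (auto simp: C_def)
  \<comment> \<open>Since v already alternates on C, this is, up to a factorial, the
    antisymmetrization of v over \<open>insert k C\<close>.\<close>
  define h where "h = (\<lambda>T. v T - (\<Sum>j\<in>C. v (T \<circ> swp k j)))"
  have swap_eq: "T \<circ> swp x y = T" if "T x = T y" for T :: "nat \<Rightarrow> nat \<times> nat" and x y
    using that by (auto simp: Transposition.transpose_def fun_eq_iff)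
  have antiC: "v (T \<circ> swp x y) = - v T" if "x \<in> C" "y \<in> C" "x \<noteq> y" for x y T
    using that anti[of x y _ b' d] by (auto simp: C_def)
  have hC: "h (T \<circ> swp x y) = - h T" if xy: "x \<in> C" "y \<in> C" "x \<noteq> y" for x y T
  proof -
    let ?s = "swp x y"
    have "(\<Sum>j\<in>C. v (T \<circ> ?s \<circ> swp k j)) = (\<Sum>j\<in>C. - v (T \<circ> swp k j))"
    proof (rule sum.reindex_bij_witness[of _ ?s ?s])
      fix j assume j: "j \<in> C"
      show "?s (?s j) = j" by simp
      show "?s j \<in> C" using j xy by (auto simp: Transposition.transpose_def)
      have "T \<circ> ?s \<circ> swp k j = T \<circ> swp k (?s j) \<circ> ?s"
      proof
        fix z show "(T \<circ> ?s \<circ> swp k j) z = (T \<circ> swp k (?s j) \<circ> ?s) z"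
          using j xy kC by (auto simp: Transposition.transpose_def)
      qed
      then show "- v (T \<circ> swp k (?s j)) = v (T \<circ> ?s \<circ> swp k j)"
        using antiC[OF xy] by simp
    qed (use xy in \<open>auto simp: Transposition.transpose_def\<close>)
    then show ?thesis using antiC[OF xy, of T] by (simp add: h_def sum_negf)
  qed
  have hk: "h (T \<circ> swp k x) = - h T" if x: "x \<in> C" for x T
  proof -
    let ?s = "swp k x"
    have "(\<Sum>j\<in>C. v (T \<circ> ?s \<circ> swp k j)) =
      v (T \<circ> ?s \<circ> ?s) + (\<Sum>j\<in>C - {x}. v (T \<circ> ?s \<circ> swp k j))"
      using finC x by (rule sum.remove)
    also have "(\<Sum>j\<in>C - {x}. v (T \<circ> ?s \<circ> swp k j)) =
      (\<Sum>j\<in>C - {x}. - v (T \<circ> swp k j))"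
    proof (rule sum.cong[OF refl])
      fix j assume j: "j \<in> C - {x}"
      have "T \<circ> ?s \<circ> swp k j = T \<circ> swp k j \<circ> swp j x"
      proof
        fix z show "(T \<circ> ?s \<circ> swp k j) z = (T \<circ> swp k j \<circ> swp j x) z"
          using j x kC by (auto simp: Transposition.transpose_def)
      qed
      then show "v (T \<circ> ?s \<circ> swp k j) = - v (T \<circ> swp k j)"
        using antiC[of j x] j x by simp
    qed
    also have "T \<circ> ?s \<circ> ?s = T" by (simp add: comp_assoc)
    also have "(\<Sum>j\<in>C - {x}. - v (T \<circ> swp k j)) =
      v (T \<circ> ?s) - (\<Sum>j\<in>C. v (T \<circ> swp k j))"
      using sum.remove[OF finC x, of "\<lambda>j. v (T \<circ> swp k j)"] by (simp add: sum_negf)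
    finally have E: "(\<Sum>j\<in>C. v (T \<circ> ?s \<circ> swp k j)) =
      v T + (v (T \<circ> ?s) - (\<Sum>j\<in>C. v (T \<circ> swp k j)))" .
    show ?thesis unfolding h_def E by simp
  qed
  define S where "S = insert k C"
  \<comment> \<open>Column b' of the diagram has as many rows as C has entries, one less than the
    number of entries in S.\<close>
  have cardC: "card {r. \<exists>a'. r = (a', d) \<and> (a', b', d) \<in> D} = card C"
  proof -
    have "card C = card (G ` C)"
      using bij_betw_imp_inj_on[OF G] by (intro card_image[symmetric]) (auto simp: C_def inj_on_def)
    also have "G ` C = (\<lambda>(a', d). (a', b', d)) ` {r. \<exists>a'. r = (a', d) \<and> (a', b', d) \<in> D}"
    proof (intro subset_antisym subsetI)
      fix p assume "p \<in> G ` C"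
      then obtain j a' where "j < n" "G j = (a', b', d)" "p = G j" by (auto simp: C_def)
      then have "(a', b', d) \<in> D" "p = (a', b', d)" using bij_betw_imp_surj_on[OF G] by (metis imageI lessThan_iff, simp)
      then show "p \<in> (\<lambda>(a', d). (a', b', d)) ` {r. \<exists>a'. r = (a', d) \<and> (a', b', d) \<in> D}" by force
    next
      fix p assume "p \<in> (\<lambda>(a', d). (a', b', d)) ` {r. \<exists>a'. r = (a', d) \<and> (a', b', d) \<in> D}"
      then obtain a' where a': "p = (a', b', d)" "(a', b', d) \<in> D" by force
      then obtain j where "j < n" "G j = (a', b', d)" using bij_betw_imp_surj_on[OF G] by (metis imageE lessThan_iff)
      then show "p \<in> G ` C" using a' by (force simp: C_def)
    qed
    also have "card \<dots> = card {r. \<exists>a'. r = (a', d) \<and> (a', b', d) \<in> D}"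
      by (rule card_image) (auto simp: inj_on_def)
    finally show ?thesis by simp
  qed
  have finR: "finite {r. \<exists>a'. r = (a', d) \<and> (a', b', d) \<in> D}"
    by (rule finite_surj[OF is_diag_finite[OF D], of _ "\<lambda>(a', b', d). (a', d)"]) force
  \<comment> \<open>Pigeonhole: where v does not vanish, all entries of S lie in rows of column b'.
    For k this uses that a row reaching column b also reaches the earlier column b'.\<close>
  have noinj: "\<not> inj_on T S" if "v T \<noteq> 0" for T
  proof
    assume "inj_on T S"
    have "T ` S \<subseteq> {r. \<exists>a'. r = (a', d) \<and> (a', b', d) \<in> D}"
    proof
      fix r assume "r \<in> T ` S"
      then obtain j where j: "j \<in> S" "r = T j" by blast
      show "r \<in> {r. \<exists>a'. r = (a', d) \<and> (a', b', d) \<in> D}"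
      proof (cases "j = k")
        case True
        have 1: "snd (T k) = d" "(fst (T k), b, d) \<in> D" using supp[OF that k] by auto
        have "(fst (T k), b', d) \<in> D" using is_diagD(5)[OF D 1(2), of "fst (T k)" b'] is_diagD(1)[OF D 1(2)] b' by simp
        then show ?thesis using j True 1(1) by (metis (mono_tags, lifting) mem_Collect_eq prod.collapse)
      next
        case False
        then obtain a' where "j < n" "G j = (a', b', d)" using j by (auto simp: S_def C_def)
        from supp[OF that this] show ?thesis using j by (metis (mono_tags, lifting) mem_Collect_eq prod.collapse)
      qed
    qed
    from card_mono[OF finR this] have "card S \<le> card C" using card_image[OF \<open>inj_on T S\<close>] cardC by simp
    then show False using finC kC by (simp add: S_def)
  qed
  \<comment> \<open>If T repeats a value on S, the corresponding swap fixes T while h changes sign;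
    if T is injective on S, so are all its swaps and every term vanishes.\<close>
  have "h T = 0"
  proof (cases "inj_on T S")
    case False
    then obtain x y where xy: "x \<in> S" "y \<in> S" "x \<noteq> y" "T x = T y" by (auto simp: inj_on_def)
    have "h T = - h T"
    proof -
      consider "x = k" "y \<in> C" | "y = k" "x \<in> C" | "x \<in> C" "y \<in> C" using xy by (auto simp: S_def)
      then show ?thesis
      proof cases
        case 1
        then show ?thesis using hk[of y T] swap_eq[of T k y] xy by simp
      next
        case 2
        then show ?thesis using hk[of x T] swap_eq[of T k x] xy by simp
      next
        case 3
        then show ?thesis using hC[of x y T] swap_eq[of T x y] xy by simp
      qed
    qed
    then show ?thesis by simp
  next
    case True
    have "v T = 0" using noinj True by blast
    moreover have "v (T \<circ> swp k j) = 0" if j: "j \<in> C" for j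
    proof -
      have "bij_betw (swp k j) S S"
        using j permutes_imp_bij[OF permutes_swap_id[of k S j]] by (simp add: S_def)
      then have "inj_on (T \<circ> swp k j) S"
        using True by (intro comp_inj_on) (auto simp: bij_betw_def)
      then show ?thesis using noinj by blast
    qed
    ultimately show ?thesis by (simp add: h_def)
  qed
  then show ?thesis by (simp add: h_def C_def)
qed

text \<open>Only entries before k in the same component matter. Each of the a - 1 entries above k
  contributes -1 by antisymmetry, and each of the b - 1 earlier columns contributes 1 by
  \<open>garnir\<close>; the eigenvalue is \<open>(b - 1) - (a - 1)\<close>, the content.\<close>

lemma column_reading_weight:
  assumes D: "D \<in> diags l n" and G: "bij_betw G {..<n} D"
    and inc: "\<And>x y. x < y \<Longrightarrow> y < n \<Longrightarrow> key (Suc n) (G x) < key (Suc n) (G y)"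
    and anti: "\<And>x y T a a' b d. x < n \<Longrightarrow> y < n \<Longrightarrow> x \<noteq> y \<Longrightarrow> G x = (a, b, d) \<Longrightarrow> G y = (a', b, d) \<Longrightarrow>
      v (T \<circ> swp x y) = - v T"
    and supp: "\<And>T x a b d. v T \<noteq> 0 \<Longrightarrow> x < n \<Longrightarrow> G x = (a, b, d) \<Longrightarrow> snd (T x) = d \<and> (fst (T x), b, d) \<in> D"
  shows "wt_of n G v"
proof -
  have dD: "is_diag l D" "card D = n" using D by (auto simp: diags_def)
  have inD: "G x \<in> D" if "x < n" for x using bij_betw_imp_surj_on[OF G] that by blast
  have bcS: "snd (T x) = bcomp (G x)" if "v T \<noteq> 0" "x < n" for T x
    using supp[OF that, of "fst (G x)" "fst (snd (G x))" "snd (snd (G x))"] by (cases "G x") simp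
  have less_iff: "x < y \<longleftrightarrow> key (Suc n) (G x) < key (Suc n) (G y)" if "x < n" "y < n" for x y
    using inc[of x y] inc[of y x] that by (metis less_asym linorder_neqE_nat)
  have "jm_op k v T = of_int (content (G k)) * v T" if k: "k < n" for k T
  proof -
    obtain a b d where g: "G k = (a, b, d)" by (cases "G k")
    have gD: "(a, b, d) \<in> D" using inD[OF k] g by simp
    note ab = is_diagD[OF dD(1) gD] diag_box_le[OF dD(1) gD]
    let ?w = "\<lambda>j. v (T \<circ> swp k j)"
    \<comment> \<open>Where a summand does not vanish, the support condition forces the components
      of T at j and k, so the side condition can be read off from G.\<close>
    have "jm_op k v T = (\<Sum>j<k. if bcomp (G j) = d then ?w j else 0)"
      unfolding jm_op_def
    proof (rule sum.cong[OF refl])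
      fix j assume "j \<in> {..<k}"
      then have j: "j < k" "j < n" using k by auto
      show "(if snd (T j) = snd (T k) then ?w j else 0) = (if bcomp (G j) = d then ?w j else 0)"
      proof (cases "?w j = 0")
        case False
        from bcS[OF False j(2)] bcS[OF False k] show ?thesis using g by (simp add: eq_commute)
      qed simp
    qed
    also have "\<dots> = (\<Sum>j | j < k \<and> bcomp (G j) = d. ?w j)"
      by (simp add: sum.If_cases Int_def)
    also have "{j. j < k \<and> bcomp (G j) = d} = {j. j < n \<and> (\<exists>a'. a' < a \<and> G j = (a', b, d))} \<union>
        (\<Union>b'\<in>{1..<b}. {j. j < n \<and> (\<exists>a'. G j = (a', b', d))})" (is "?J = ?J1 \<union> ?J2")
    proof -
      have "j \<in> ?J \<longleftrightarrow> j \<in> ?J1 \<union> ?J2" if j: "j < n" for j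
      proof -
        obtain a' b' d' where g': "G j = (a', b', d')" by (cases "G j")
        have g'D: "(a', b', d') \<in> D" using inD[OF j] g' by simp
        note ab' = is_diagD[OF dD(1) g'D] diag_box_le[OF dD(1) g'D]
        have "j < k \<longleftrightarrow> d' < d \<or> d' = d \<and> (b' < b \<or> b' = b \<and> a' < a)"
          unfolding less_iff[OF j k] g g' using ab ab' dD(2) by (intro key_less) auto
        then show ?thesis using j g' ab'(2) by auto
      qed
      moreover have "?J \<subseteq> {..<n}" "?J1 \<union> ?J2 \<subseteq> {..<n}" using k by auto
      ultimately show ?thesis by blast
    qed
    also have "(\<Sum>j\<in>?J1 \<union> ?J2. ?w j) = (\<Sum>j\<in>?J1. ?w j) + (\<Sum>j\<in>?J2. ?w j)"
      by (rule sum.union_disjoint) auto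
    also have "(\<Sum>j\<in>?J1. ?w j) = (\<Sum>j\<in>?J1. - v T)"
    proof (rule sum.cong[OF refl])
      fix j assume "j \<in> ?J1"
      then obtain a' where j: "j < n" "a' < a" "G j = (a', b, d)" by blast
      then have "k \<noteq> j" using g by auto
      from anti[OF k j(1) this g j(3)] show "?w j = - v T" .
    qed
    also have "\<dots> = - of_nat (a - 1) * v T"
    proof -
      have "card ?J1 = card (G ` ?J1)"
        using bij_betw_imp_inj_on[OF G] by (intro card_image[symmetric]) (auto simp: inj_on_def)
      also have "G ` ?J1 = (\<lambda>a'. (a', b, d)) ` {1..<a}"
      proof (intro subset_antisym subsetI)
        fix p assume "p \<in> G ` ?J1"
        then obtain j a' where j: "j < n" "a' < a" "G j = (a', b, d)" "p = G j" by blast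
        then have "(a', b, d) \<in> D" using inD[of j] by simp
        then show "p \<in> (\<lambda>a'. (a', b, d)) ` {1..<a}" using j is_diagD(1)[OF dD(1)] by auto
      next
        fix p assume "p \<in> (\<lambda>a'. (a', b, d)) ` {1..<a}"
        then obtain a' where a': "p = (a', b, d)" "1 \<le> a'" "a' < a" by auto
        then have "p \<in> D" using ab(5)[of a' b] ab(2) by simp
        then obtain j where "j < n" "G j = p" using bij_betw_imp_surj_on[OF G] by (metis imageE lessThan_iff)
        then show "p \<in> G ` ?J1" using a' by blast
      qed
      also have "card \<dots> = a - 1" by (subst card_image) (auto simp: inj_on_def)
      finally show ?thesis by simp
    qed
    also have "(\<Sum>j\<in>?J2. ?w j) = (\<Sum>b'\<in>{1..<b}. \<Sum>j | j < n \<and> (\<exists>a'. G j = (a', b', d)). ?w j)"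
      by (rule sum.UNION_disjoint) auto
    also have "\<dots> = (\<Sum>b'\<in>{1..<b}. v T)"
    proof (rule sum.cong[OF refl])
      fix b' assume "b' \<in> {1..<b}"
      then have "1 \<le> b'" "b' < b" by auto
      show "(\<Sum>j | j < n \<and> (\<exists>a'. G j = (a', b', d)). ?w j) = v T"
        by (rule garnir[OF dD(1) G _ _ k g \<open>1 \<le> b'\<close> \<open>b' < b\<close>]) (rule anti, assumption+, rule supp, assumption+)
    qed
    also have "- of_nat (a - 1) * v T + (\<Sum>b'\<in>{1..<b}. v T) = of_int (content (G k)) * v T"
      using ab(1,2) g by (simp add: of_nat_diff algebra_simps)
    finally show ?thesis .
  qed
  then show ?thesis using bcS unfolding wt_of_def is_wt_def fscale_def by blast
qed

section \<open>Tensor products of Specht modules as functions on tabloids\<close>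

text \<open>The blocks of entries of the components of \<open>\<lambda>\<close> are consecutive; \<open>tens\<close> is the function that
  vanishes unless each entry lies in the component of its block.\<close>

fun tens :: "nat \<Rightarrow> nat list list \<Rightarrow> (tabloid \<Rightarrow> complex) list \<Rightarrow> tvec" where
  "tens e [] bs T = (if \<forall>x. T x = (0, 0) then 1 else 0)"
| "tens e (\<mu> # mus) bs T =
    (if \<forall>x<sum_list \<mu>. snd (T x) = Suc e then hd bs (\<lambda>x. if x < sum_list \<mu> then fst (T x) else 0) else 0) *
    tens (Suc e) mus (tl bs) (\<lambda>x. T (x + sum_list \<mu>))"

fun glue :: "nat \<Rightarrow> nat list list \<Rightarrow> (nat \<Rightarrow> nat \<times> nat) list \<Rightarrow> nat \<Rightarrow> box" where
  "glue e [] ts x = (0, 0, 0)"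
| "glue e (\<mu> # mus) ts x = (if x < sum_list \<mu> then (fst (hd ts x), snd (hd ts x), Suc e)
     else glue (Suc e) mus (tl ts) (x - sum_list \<mu>))"

fun blk :: "nat \<Rightarrow> nat list list \<Rightarrow> nat \<Rightarrow> nat" where
  "blk e [] x = 0"
| "blk e (\<mu> # mus) x = (if x < sum_list \<mu> then Suc e else blk (Suc e) mus (x - sum_list \<mu>))"

fun polys :: "nat list list \<Rightarrow> (nat \<Rightarrow> nat \<times> nat) list \<Rightarrow> (tabloid \<Rightarrow> complex) list" where
  "polys [] ts = []"
| "polys (\<mu> # mus) ts = polytabloid (sum_list \<mu>) (hd ts) # polys mus (tl ts)"

abbreviation tableaux :: "nat list list \<Rightarrow> (nat \<Rightarrow> nat \<times> nat) list \<Rightarrow> bool" where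
  "tableaux mus ts \<equiv> list_all2 (\<lambda>\<mu> t. bij_betw t {..<sum_list \<mu>} (ydiag \<mu>)) mus ts"

lemma lpart_size_simps [simp]: "lpart_size [] = 0" "lpart_size (\<mu> # mus) = sum_list \<mu> + lpart_size mus"
  by (simp_all add: lpart_size_def)

lemma glue_bij: "tableaux mus ts \<Longrightarrow> bij_betw (glue e mus ts) {..<lpart_size mus} (ldiag_from e mus)"
proof (induction mus ts arbitrary: e rule: list_all2_induct)
  case Nil
  then show ?case by (simp add: bij_betw_def)
next
  case (Cons \<mu> mus t ts)
  let ?m = "sum_list \<mu>"
  have "bij_betw (glue e (\<mu> # mus) (t # ts)) {..<?m} ((\<lambda>(a, b). (a, b, Suc e)) ` ydiag \<mu>)"
  proof -
    have "bij_betw (\<lambda>(a, b). (a, b, Suc e)) (ydiag \<mu>) ((\<lambda>(a, b). (a, b, Suc e)) ` ydiag \<mu>)"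
      by (rule inj_on_imp_bij_betw) (auto simp: inj_on_def)
    from bij_betw_trans[OF Cons(1) this] show ?thesis
      by (subst bij_betw_cong[of _ _ "(\<lambda>(a, b). (a, b, Suc e)) \<circ> t"]) (auto simp: case_prod_unfold)
  qed
  moreover have "bij_betw (glue e (\<mu> # mus) (t # ts)) {?m..<?m + lpart_size mus} (ldiag_from (Suc e) mus)"
  proof -
    have "bij_betw (\<lambda>x. x - ?m) {?m..<?m + lpart_size mus} {..<lpart_size mus}"
      by (rule bij_betw_byWitness[of _ "\<lambda>x. x + ?m"]) auto
    from bij_betw_trans[OF this Cons(3)[of "Suc e"]] show ?thesis
      by (subst bij_betw_cong[of _ _ "glue (Suc e) mus ts \<circ> (\<lambda>x. x - ?m)"]) auto
  qed
  moreover have "(\<lambda>(a, b). (a, b, Suc e)) ` ydiag \<mu> \<inter> ldiag_from (Suc e) mus = {}"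
    using ldiag_from_comp by fastforce
  ultimately have "bij_betw (glue e (\<mu> # mus) (t # ts)) ({..<?m} \<union> {?m..<?m + lpart_size mus}) (ldiag_from e (\<mu> # mus))"
    unfolding ldiag_from_Cons by (rule bij_betw_combine)
  moreover have "{..<?m} \<union> {?m..<?m + lpart_size mus} = {..<lpart_size (\<mu> # mus)}" by auto
  ultimately show ?case by (simp only:)
qed

lemma glue_off: "x \<ge> lpart_size mus \<Longrightarrow> glue e mus ts x = (0, 0, 0)"
  by (induction mus arbitrary: e ts x) auto

lemma glue_blk: "x < lpart_size mus \<Longrightarrow> snd (snd (glue e mus ts x)) = blk e mus x"
  by (induction mus arbitrary: e ts x) auto

lemma blk_gt: "x < lpart_size mus \<Longrightarrow> e < blk e mus x"
proof (induction mus arbitrary: e x)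
  case (Cons \<mu> mus)
  show ?case
  proof (cases "x < sum_list \<mu>")
    case False
    then have "x - sum_list \<mu> < lpart_size mus" using Cons.prems by simp
    from Cons.IH[OF this, of "Suc e"] show ?thesis using False by simp
  qed simp
qed simp

lemma glue_increasing:
  assumes "tableaux mus ts"
    and "list_all2 (\<lambda>\<mu> t. \<forall>x y. x < y \<longrightarrow> y < sum_list \<mu> \<longrightarrow>
      snd (t x) < snd (t y) \<or> snd (t x) = snd (t y) \<and> fst (t x) < fst (t y)) mus ts"
    and "x < y" "y < lpart_size mus" "glue e mus ts x = (a, b, d)" "glue e mus ts y = (a', b', d')"
  shows "d < d' \<or> d = d' \<and> (b < b' \<or> b = b' \<and> a < a')"
  using assms
proof (induction mus ts arbitrary: e x y rule: list_all2_induct)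
  case (Cons \<mu> mus t ts)
  let ?m = "sum_list \<mu>"
  consider "y < ?m" | "x < ?m" "y \<ge> ?m" | "x \<ge> ?m" by linarith
  then show ?case
  proof cases
    case 1
    then show ?thesis using Cons.prems by auto
  next
    case 2
    have "d = Suc e" using Cons.prems 2 by simp
    moreover have "d' = blk (Suc e) mus (y - ?m)"
      using glue_blk[of "y - ?m" mus "Suc e" ts] Cons.prems 2 by simp
    moreover have "Suc e < blk (Suc e) mus (y - ?m)" using 2 Cons.prems by (intro blk_gt) auto
    ultimately show ?thesis by simp
  next
    case 3
    then show ?thesis using Cons.IH[of "x - ?m" "y - ?m" "Suc e"] Cons.prems by auto
  qed
qed simp

lemma tens_support_comp:
  assumes "tens e mus bs T \<noteq> 0"
  shows "if x < lpart_size mus then snd (T x) = blk e mus x else T x = (0, 0)"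
  using assms
proof (induction mus arbitrary: e bs T x)
  case Nil
  then show ?case by (auto split: if_splits)
next
  case (Cons \<mu> mus)
  let ?m = "sum_list \<mu>"
  have nz: "tens (Suc e) mus (tl bs) (\<lambda>x. T (x + ?m)) \<noteq> 0" and hd: "\<forall>x<?m. snd (T x) = Suc e"
    using Cons.prems by (auto split: if_splits)
  show ?case
  proof (cases "x < ?m")
    case False
    then have "x - ?m + ?m = x" "x - ?m < lpart_size mus \<longleftrightarrow> x < lpart_size (\<mu> # mus)" by auto
    note e = this
    have "if x < lpart_size (\<mu> # mus) then snd (T x) = blk (Suc e) mus (x - ?m) else T x = (0, 0)"
      using Cons.IH[OF nz, of "x - ?m"] unfolding e .
    then show ?thesis using False by simp
  qed (use hd in simp)
qed

lemma tens_polys_support: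
  assumes "tableaux mus ts" "tens e mus (polys mus ts) T \<noteq> 0" "x < lpart_size mus" "glue e mus ts x = (a, b, d)"
  shows "snd (T x) = d \<and> (fst (T x), b, d) \<in> ldiag_from e mus"
  using assms
proof (induction mus ts arbitrary: e T x rule: list_all2_induct)
  case (Cons \<mu> mus t ts)
  let ?m = "sum_list \<mu>"
  have nz: "tens (Suc e) mus (polys mus ts) (\<lambda>x. T (x + ?m)) \<noteq> 0"
    "polytabloid ?m t (\<lambda>x. if x < ?m then fst (T x) else 0) \<noteq> 0" "\<forall>x<?m. snd (T x) = Suc e"
    using Cons.prems(1) by (auto split: if_splits)
  show ?case
  proof (cases "x < ?m")
    case True
    then have "(fst (T x), snd (t x)) \<in> ydiag \<mu>"
      using polytabloid_support(2)[OF Cons(1) nz(2) True] by simp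
    then show ?thesis using Cons.prems True nz(3) unfolding ldiag_from_Cons by force
  next
    case False
    have "snd (T (x - ?m + ?m)) = d \<and> (fst (T (x - ?m + ?m)), b, d) \<in> ldiag_from (Suc e) mus"
      by (rule Cons.IH[OF nz(1)]) (use Cons.prems False in auto)
    then show ?thesis using False unfolding ldiag_from_Cons by simp
  qed
qed simp

lemma tens_polys_antisym:
  assumes "tableaux mus ts" "x < lpart_size mus" "y < lpart_size mus" "x \<noteq> y"
    "glue e mus ts x = (a, b, d)" "glue e mus ts y = (a', b, d)"
  shows "tens e mus (polys mus ts) (T \<circ> swp x y) = - tens e mus (polys mus ts) T"
  using assms
proof (induction mus ts arbitrary: e T x y rule: list_all2_induct)
  case (Cons \<mu> mus t ts)
  let ?m = "sum_list \<mu>" and ?s = "swp x y"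
  have bd: "blk e (\<mu> # mus) x = d" "blk e (\<mu> # mus) y = d"
    using glue_blk[of x "\<mu> # mus" e "t # ts"] glue_blk[of y "\<mu> # mus" e "t # ts"] Cons.prems by simp_all
  \<comment> \<open>Block labels increase from block to block, so entries of equal component lie in
    the same block.\<close>
  have same: "x < ?m \<longleftrightarrow> y < ?m"
  proof -
    have *: "d \<noteq> Suc e" if "z < lpart_size (\<mu> # mus)" "\<not> z < ?m" "blk e (\<mu> # mus) z = d" for z
    proof -
      have "Suc e < blk (Suc e) mus (z - ?m)" using that by (intro blk_gt) auto
      then show ?thesis using that by simp
    qed
    show ?thesis
    proof
      assume "x < ?m" then show "y < ?m" using *[OF Cons.prems(2) _ bd(2)] bd(1) by (cases "y < ?m") simp_all
    next
      assume "y < ?m" then show "x < ?m" using *[OF Cons.prems(1) _ bd(1)] bd(2) by (cases "x < ?m") simp_all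
    qed
  qed
  show ?case
  proof (cases "x < ?m")
    case True
    then have y: "y < ?m" using same by simp
    have tail: "(\<lambda>z. (T \<circ> ?s) (z + ?m)) = (\<lambda>z. T (z + ?m))"
      using True y by (auto simp: Transposition.transpose_def fun_eq_iff)
    have head: "(\<lambda>z. if z < ?m then fst ((T \<circ> ?s) z) else 0) = (\<lambda>z. if z < ?m then fst (T z) else 0) \<circ> ?s"
      using True y by (auto simp: Transposition.transpose_def fun_eq_iff)
    have cond: "(\<forall>z<?m. snd ((T \<circ> ?s) z) = Suc e) \<longleftrightarrow> (\<forall>z<?m. snd (T z) = Suc e)"
      using True y by (metis comp_apply transpose_involutory transpose_apply_first transpose_apply_second transpose_apply_other)
    have "snd (t x) = snd (t y)" using Cons.prems True y by simp
    from polytabloid_antisym[OF True y \<open>x \<noteq> y\<close> this] show ?thesis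
      unfolding tens.simps tail head cond polys.simps list.sel
      by (simp; blast)
  next
    case False
    then have y: "\<not> y < ?m" using same by simp
    have tail: "(\<lambda>z. (T \<circ> ?s) (z + ?m)) = (\<lambda>z. T (z + ?m)) \<circ> swp (x - ?m) (y - ?m)"
      using False y by (auto simp: Transposition.transpose_def fun_eq_iff)
    have head: "(\<lambda>z. if z < ?m then fst ((T \<circ> ?s) z) else 0) = (\<lambda>z. if z < ?m then fst (T z) else 0)"
      using False y by (auto simp: Transposition.transpose_def fun_eq_iff)
    have cond: "(\<forall>z<?m. snd ((T \<circ> ?s) z) = Suc e) \<longleftrightarrow> (\<forall>z<?m. snd (T z) = Suc e)"
      using False y by (auto simp: Transposition.transpose_def)
    have "tens (Suc e) mus (polys mus ts) ((\<lambda>z. T (z + ?m)) \<circ> swp (x - ?m) (y - ?m)) =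
      - tens (Suc e) mus (polys mus ts) (\<lambda>z. T (z + ?m))"
      by (rule Cons.IH) (use Cons.prems False y in auto)
    then show ?thesis unfolding tens.simps polys.simps list.sel tail head cond by simp
  qed
qed simp

text \<open>At the tabloid of the glued tableau every factor is the diagonal value 1 of a
  polytabloid; in particular the tensor is nonzero.\<close>

lemma tens_polys_nonzero:
  assumes "tableaux mus ts"
  shows "tens e mus (polys mus ts) (\<lambda>x. (fst (glue e mus ts x), snd (snd (glue e mus ts x)))) = 1"
  using assms
proof (induction mus ts arbitrary: e rule: list_all2_induct)
  case (Cons \<mu> mus t ts)
  let ?m = "sum_list \<mu>"
  have "(\<lambda>x. if x < ?m then fst (fst (glue e (\<mu> # mus) (t # ts) x), snd (snd (glue e (\<mu> # mus) (t # ts) x))) else 0) = tabloid_of ?m t"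
    by (auto simp: tabloid_of_def)
  moreover have "polytabloid ?m t (tabloid_of ?m t) = 1"
    by (rule polytabloid_diagonal[OF bij_betw_imp_inj_on[OF Cons(1)]])
  ultimately show ?case using Cons.IH[of "Suc e"] unfolding tens.simps by simp
qed simp

lemma ex_column_reading:
  "\<exists>t. bij_betw t {..<sum_list \<mu>} (ydiag \<mu>) \<and> (\<forall>x y. x < y \<longrightarrow> y < sum_list \<mu> \<longrightarrow>
      snd (t x) < snd (t y) \<or> snd (t x) = snd (t y) \<and> fst (t x) < fst (t y))"
proof -
  \<comment> \<open>A bound exceeding all coordinates, so that \<open>key\<close> compares boxes
    lexicographically.\<close>
  define N where "N = Suc (Max (insert 0 (fst ` ydiag \<mu> \<union> snd ` ydiag \<mu>)))"
  have N: "a < N \<and> b < N" if "(a, b) \<in> ydiag \<mu>" for a b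
  proof -
    have "finite (insert 0 (fst ` ydiag \<mu> \<union> snd ` ydiag \<mu>))" by simp
    moreover have "a \<in> insert 0 (fst ` ydiag \<mu> \<union> snd ` ydiag \<mu>)" "b \<in> insert 0 (fst ` ydiag \<mu> \<union> snd ` ydiag \<mu>)"
      using that by force+
    ultimately show ?thesis unfolding N_def using Max_ge by (meson le_imp_less_Suc)
  qed
  define f where "f = (\<lambda>(a, b). key N (a, b, 0))"
  have f_less: "f p < f q \<longleftrightarrow> snd p < snd q \<or> snd p = snd q \<and> fst p < fst q" if "p \<in> ydiag \<mu>" "q \<in> ydiag \<mu>" for p q
    using key_less[of "fst p" N "snd p" "fst q" "snd q" 0 0] N[of "fst p" "snd p"] N[of "fst q" "snd q"] that
    by (simp add: f_def case_prod_unfold)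
  have "inj_on f (ydiag \<mu>)"
  proof (rule inj_onI)
    fix p q assume "p \<in> ydiag \<mu>" "q \<in> ydiag \<mu>" "f p = f q"
    then show "p = q" using f_less[of p q] f_less[of q p] by (simp add: prod_eq_iff) (metis linorder_neqE_nat)
  qed
  then have bf: "bij_betw f (ydiag \<mu>) (f ` ydiag \<mu>)" by (rule inj_on_imp_bij_betw)
  obtain h where h: "bij_betw h {..<card (f ` ydiag \<mu>)} (f ` ydiag \<mu>)" "strict_mono_on {..<card (f ` ydiag \<mu>)} h"
    using ex_bij_betw_strict_mono_card[of "f ` ydiag \<mu>"] by auto
  have c: "card (f ` ydiag \<mu>) = sum_list \<mu>" using bij_betw_same_card[OF bf] by (simp add: card_ydiag)
  define t where "t = inv_into (ydiag \<mu>) f \<circ> h"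
  have tb: "bij_betw t {..<sum_list \<mu>} (ydiag \<mu>)"
    unfolding t_def using bij_betw_trans[OF h(1) bij_betw_inv_into[OF bf]] by (simp add: c)
  have ft: "f (t x) = h x" "t x \<in> ydiag \<mu>" if "x < sum_list \<mu>" for x
  proof -
    have "h x \<in> f ` ydiag \<mu>" using h(1) that c by (auto simp: bij_betw_def)
    then show "f (t x) = h x" by (simp add: t_def f_inv_into_f)
    show "t x \<in> ydiag \<mu>" using tb that by (auto simp: bij_betw_def)
  qed
  have "snd (t x) < snd (t y) \<or> snd (t x) = snd (t y) \<and> fst (t x) < fst (t y)" if "x < y" "y < sum_list \<mu>" for x y
  proof -
    have "h x < h y" using h(2) that c by (auto simp: strict_mono_on_def)
    then show ?thesis using f_less[of "t x" "t y"] ft[of x] ft[of y] that by simp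
  qed
  then show ?thesis using tb by blast
qed

text \<open>Keeps two descriptions of one vector together: as a tensor of polytabloids, for the
  comparison with the induced module, and as a weight vector of the column reading tableau G, as the
  start of the intertwiner construction.\<close>

definition is_base_vec :: "nat \<Rightarrow> nat \<Rightarrow> nat list list \<Rightarrow> tvec \<Rightarrow> bool" where
  "is_base_vec l n lam v \<longleftrightarrow> (\<exists>ts G. tableaux lam ts \<and> v = tens 0 lam (polys lam ts) \<and>
    wt_of n G v \<and> v \<noteq> 0 \<and> v \<in> coord_space (omega l n) \<and> G ` {..<n} = ldiag lam \<and>
    (\<forall>x y. x < y \<longrightarrow> y < n \<longrightarrow> key (Suc n) (G x) < key (Suc n) (G y)) \<and> (\<forall>x\<ge>n. G x = (0, 0, 0)))"

lemma ex_base_vector: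
  assumes l: "1 \<le> l" and lam: "lam \<in> lparts l n"
  shows "\<exists>v. is_base_vec l n lam v"
proof -
  have sz: "lpart_size lam = n" and lp: "length lam = l" using lam by (auto simp: lparts_def is_lpart_def)
  define t where "t = (\<lambda>\<mu>. SOME t. bij_betw t {..<sum_list \<mu>} (ydiag \<mu>) \<and> (\<forall>x y. x < y \<longrightarrow> y < sum_list \<mu> \<longrightarrow>
      snd (t x) < snd (t y) \<or> snd (t x) = snd (t y) \<and> fst (t x) < fst (t y)))"
  have t: "bij_betw (t \<mu>) {..<sum_list \<mu>} (ydiag \<mu>) \<and> (\<forall>x y. x < y \<longrightarrow> y < sum_list \<mu> \<longrightarrow>
      snd (t \<mu> x) < snd (t \<mu> y) \<or> snd (t \<mu> x) = snd (t \<mu> y) \<and> fst (t \<mu> x) < fst (t \<mu> y))" for \<mu>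
    unfolding t_def by (rule someI_ex[OF ex_column_reading])
  let ?ts = "map t lam"
  have ts: "tableaux lam ?ts" using t by (simp add: list_all2_map2 list.rel_refl)
  have ts2: "list_all2 (\<lambda>\<mu> t. \<forall>x y. x < y \<longrightarrow> y < sum_list \<mu> \<longrightarrow>
      snd (t x) < snd (t y) \<or> snd (t x) = snd (t y) \<and> fst (t x) < fst (t y)) lam ?ts"
    using t by (simp add: list_all2_map2 list.rel_refl)
  let ?G = "glue 0 lam ?ts" and ?v = "tens 0 lam (polys lam ?ts)"
  have D: "ldiag lam \<in> diags l n" by (rule ldiag_in_diags[OF lam])
  have G: "bij_betw ?G {..<n} (ldiag lam)" using glue_bij[OF ts, of 0] by (simp add: sz ldiag_eq_from)
  have inD: "?G x \<in> ldiag lam" if "x < n" for x using G that by (auto simp: bij_betw_def)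
  have inc: "key (Suc n) (?G x) < key (Suc n) (?G y)" if xy: "x < y" "y < n" for x y
  proof -
    obtain a b d where gx: "?G x = (a, b, d)" by (cases "?G x")
    obtain a' b' d' where gy: "?G y = (a', b', d')" by (cases "?G y")
    have "(a, b, d) \<in> ldiag lam" "(a', b', d') \<in> ldiag lam" using inD[of x] inD[of y] xy gx gy by auto
    then have "a \<le> n" "b \<le> n" "a' \<le> n" "b' \<le> n"
      using diag_box_le[of l "ldiag lam"] D unfolding diags_def by auto
    then show ?thesis
      unfolding gx gy using key_less[of a "Suc n" b a' b' d d'] glue_increasing[OF ts ts2 xy(1) _ gx gy] xy(2) sz by simp
  qed
  have supp: "snd (T x) = d \<and> (fst (T x), b, d) \<in> ldiag lam" if "?v T \<noteq> 0" "x < n" "?G x = (a, b, d)" for T x a b d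
    using tens_polys_support[OF ts that(1) _ that(3)] that(2) by (simp add: sz ldiag_eq_from)
  have "wt_of n ?G ?v"
  proof (rule column_reading_weight[OF D G])
    fix x y assume "x < y" "y < n"
    then show "key (Suc n) (?G x) < key (Suc n) (?G y)" by (rule inc)
  next
    fix x y T a a' b d assume "x < n" "y < n" "x \<noteq> y" "?G x = (a, b, d)" "?G y = (a', b, d)"
    then show "?v (T \<circ> swp x y) = - ?v T"
      using tens_polys_antisym[OF ts, of x y 0 a b d a' T] by (simp add: sz)
  next
    fix T x a b d assume "?v T \<noteq> 0" "x < n" "?G x = (a, b, d)"
    then show "snd (T x) = d \<and> (fst (T x), b, d) \<in> ldiag lam" by (rule supp)
  qed
  moreover have "?v \<noteq> 0"
  proof
    assume "?v = 0"
    then show False using tens_polys_nonzero[OF ts, of 0] by simp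
  qed
  moreover have "?v \<in> coord_space (omega l n)"
  proof -
    have "T \<in> omega l n" if nz: "?v T \<noteq> 0" for T
    proof -
      have "T x \<in> {1..n} \<times> {1..l}" if x: "x < n" for x
      proof -
        obtain a b d where gx: "?G x = (a, b, d)" by (cases "?G x")
        have "snd (T x) = d" "(fst (T x), b, d) \<in> ldiag lam" using supp[OF nz x gx] by auto
        then have "(fst (T x), b, snd (T x)) \<in> {1..n} \<times> {1..n} \<times> {1..l}"
          using diag_subset_grid[of l "ldiag lam" n] D unfolding diags_def by auto
        then show ?thesis by (simp add: mem_Times_iff)
      qed
      moreover have "T x = (0, 0)" if "x \<ge> n" for x using tens_support_comp[OF nz, of x] that sz by simp
      ultimately show ?thesis by (simp add: omega_def)
    qed
    then show ?thesis unfolding coord_space_def by blast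
  qed
  moreover have "?G ` {..<n} = ldiag lam" by (rule bij_betw_imp_surj_on[OF G])
  moreover have "\<forall>x\<ge>n. ?G x = (0, 0, 0)" using glue_off[of lam _ 0 ?ts] sz by simp
  ultimately have "is_base_vec l n lam ?v"
    unfolding is_base_vec_def using ts inc by (intro exI[of _ ?ts] exI[of _ ?G]) blast
  then show ?thesis by (rule exI[where P = "is_base_vec l n lam"])
qed

section \<open>Bases of Specht modules\<close>

lemma coord_space_span:
  assumes "finite X"
  shows "coord_space X \<subseteq> fn.span ((\<lambda>x y. if y = x then 1 else 0) ` X)"
proof
  fix f assume f: "f \<in> coord_space X"
  have "f = (\<Sum>x\<in>X. fscale (f x) (\<lambda>y. if y = x then 1 else 0))"
  proof
    fix y
    have "(\<Sum>x\<in>X. fscale (f x) (\<lambda>y. if y = x then 1 else 0)) y = (\<Sum>x\<in>X. fscale (f x) (\<lambda>y. if y = x then 1 else 0) y)"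
      by (induction X rule: infinite_finite_induct) auto
    also have "\<dots> = (\<Sum>x\<in>X. if x = y then f y else 0)" by (rule sum.cong) (auto simp: fscale_def)
    also have "\<dots> = f y" using assms f by (simp add: coord_space_def)
    finally show "f y = (\<Sum>x\<in>X. fscale (f x) (\<lambda>y. if y = x then 1 else 0)) y" by simp
  qed
  also have "\<dots> \<in> fn.span ((\<lambda>x y. if y = x then 1 else 0) ` X)"
    by (intro fn.span_sum fn.span_scale fn.span_base imageI)
  finally show "f \<in> fn.span ((\<lambda>x y. if y = x then 1 else 0) ` X)" .
qed

lemma independent_coord_finite:
  assumes "finite X" "fn.independent B" "B \<subseteq> coord_space X"
  shows "finite B \<and> card B \<le> card X"
proof -
  let ?E = "(\<lambda>x y. if y = x then 1 else 0 :: complex) ` X"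
  have "finite B \<and> card B \<le> card ?E"
    by (rule fn.independent_span_bound[OF finite_imageI[OF assms(1)] assms(2)
        order.trans[OF assms(3) coord_space_span[OF assms(1)]]])
  then show ?thesis using card_image_le[OF assms(1), of "\<lambda>x y. if y = x then 1 else 0 :: complex"] by linarith
qed

lemma specht_finite_support: "\<exists>X. finite X \<and> specht_module \<mu> \<subseteq> coord_space X \<and> (\<forall>R\<in>X. \<forall>x\<ge>sum_list \<mu>. R x = 0)"
proof -
  let ?X = "{R. (\<forall>x<sum_list \<mu>. R x \<in> fst ` ydiag \<mu>) \<and> (\<forall>x\<ge>sum_list \<mu>. R x = (0::nat))}"
  have "finite ?X"
  proof (rule finite_subset)
    show "?X \<subseteq> {R. \<forall>x. (x \<in> {..<sum_list \<mu>} \<longrightarrow> R x \<in> fst ` ydiag \<mu>) \<and> (x \<notin> {..<sum_list \<mu>} \<longrightarrow> R x = 0)}" by auto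
    show "finite \<dots>" by (rule finite_set_of_finite_funs) auto
  qed
  moreover have "specht_module \<mu> \<subseteq> coord_space ?X"
    unfolding specht_module_def
  proof (rule fn.span_minimal)
    show "{polytabloid (sum_list \<mu>) t |t. bij_betw t {..<sum_list \<mu>} (ydiag \<mu>)} \<subseteq> coord_space ?X"
    proof
      fix f assume "f \<in> {polytabloid (sum_list \<mu>) t |t. bij_betw t {..<sum_list \<mu>} (ydiag \<mu>)}"
      then obtain t where f: "f = polytabloid (sum_list \<mu>) t" and t: "bij_betw t {..<sum_list \<mu>} (ydiag \<mu>)" by blast
      have "R x \<in> fst ` ydiag \<mu>" if "f R \<noteq> 0" "x < sum_list \<mu>" for R x
        using polytabloid_support(2)[OF t, of R x] that f by force
      moreover have "R x = 0" if "f R \<noteq> 0" "x \<ge> sum_list \<mu>" for R x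
        using polytabloid_support(1)[OF t, of R x] that f by simp
      ultimately show "f \<in> coord_space ?X" unfolding coord_space_def by blast
    qed
  qed (rule subspace_coord_space)
  ultimately show ?thesis by (intro exI[of _ ?X]) simp
qed

lemma specht_basis:
  "fn.independent (specht_basis \<mu>)" "fn.span (specht_basis \<mu>) = specht_module \<mu>" "finite (specht_basis \<mu>)"
proof -
  obtain B where B: "B \<subseteq> specht_module \<mu>" "fn.independent B" "specht_module \<mu> \<subseteq> fn.span B"
    by (rule fn.basis_exists)
  have "fn.span B = specht_module \<mu>"
  proof
    show "fn.span B \<subseteq> specht_module \<mu>"
      by (rule fn.span_minimal[OF B(1)]) (simp add: specht_module_def fn.subspace_span)
  qed (rule B(3))
  with B(2) have ex: "\<exists>B. fn.independent B \<and> fn.span B = specht_module \<mu>" by (intro exI[of _ B] conjI)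
  show 1: "fn.independent (specht_basis \<mu>)" and 2: "fn.span (specht_basis \<mu>) = specht_module \<mu>"
    using someI_ex[OF ex] unfolding specht_basis_def by simp_all
  obtain X where X: "finite X" "specht_module \<mu> \<subseteq> coord_space X"
    using specht_finite_support[of \<mu>] by (elim exE conjE)
  have "specht_basis \<mu> \<subseteq> coord_space X"
    by (rule order.trans[OF fn.span_superset]) (use 2 X(2) in simp)
  then show "finite (specht_basis \<mu>)" using independent_coord_finite[OF X(1) 1] by blast
qed

text \<open>Tabloids are encoded as functions on all naturals; vectors of the Specht module live on
  those that are 0 beyond the entries.\<close>

lemma specht_basis_off:
  assumes "b \<in> specht_basis \<mu>" "R x \<noteq> 0" "x \<ge> sum_list \<mu>"
  shows "b R = 0"
proof -
  obtain X where X: "specht_module \<mu> \<subseteq> coord_space X" "\<forall>R\<in>X. \<forall>x\<ge>sum_list \<mu>. R x = 0"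
    using specht_finite_support[of \<mu>] by (elim exE conjE)
  have "b \<in> specht_module \<mu>" using fn.span_base[OF assms(1)] specht_basis(2) by simp
  then have "b \<in> coord_space X" by (rule subsetD[OF X(1)])
  moreover have "R \<notin> X"
  proof
    assume "R \<in> X"
    from X(2)[THEN bspec[OF _ this]] assms(3) have "R x = 0" by simp
    then show False using assms(2) by simp
  qed
  ultimately show ?thesis by (simp add: coord_space_def)
qed

lemma specht_module_translate:
  assumes w: "w permutes {..<sum_list \<mu>}" and f: "f \<in> specht_module \<mu>"
  shows "(\<lambda>R. f (R \<circ> w)) \<in> specht_module \<mu>"
  using f unfolding specht_module_def
proof (induction rule: fn.span_induct_alt)
  case base
  show ?case using fn.span_zero by (simp add: zero_fun_def)
next
  case (step c x y)
  let ?S = "{polytabloid (sum_list \<mu>) t |t. bij_betw t {..<sum_list \<mu>} (ydiag \<mu>)}"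
  from step(1) obtain t where x: "x = polytabloid (sum_list \<mu>) t" and t: "bij_betw t {..<sum_list \<mu>} (ydiag \<mu>)" by blast
  have wi: "pinv w permutes {..<sum_list \<mu>}" by (rule permutes_inv[OF w])
  have "(\<lambda>R. x (R \<circ> w)) = polytabloid (sum_list \<mu>) (t \<circ> pinv w)"
    unfolding x by (rule ext, subst polytabloid_translate[OF wi]) (simp only: permutes_inv_inv[OF w])
  moreover have "bij_betw (t \<circ> pinv w) {..<sum_list \<mu>} (ydiag \<mu>)"
    by (rule bij_betw_trans[OF permutes_imp_bij[OF wi] t])
  ultimately have "(\<lambda>R. x (R \<circ> w)) \<in> fn.span ?S" by (intro fn.span_base CollectI exI conjI)
  moreover have "(\<lambda>R. (fscale c x + y) (R \<circ> w)) = fscale c (\<lambda>R. x (R \<circ> w)) + (\<lambda>R. y (R \<circ> w))"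
    by (simp add: fscale_def fun_eq_iff)
  ultimately show ?case using step(2) by (simp only:) (intro fn.span_add fn.span_scale)
qed

lemma fn_sum_apply: "(\<Sum>i\<in>I. F i) x = (\<Sum>i\<in>I. F i x)" for F :: "'i \<Rightarrow> 'x \<Rightarrow> complex"
  by (induction I rule: infinite_finite_induct) auto

text \<open>The Specht module is stable under translation, so the translated vector has coordinates
  in the basis; outside the span \<open>fn.representation\<close> would return 0.\<close>

lemma specht_matrix_expand:
  assumes w: "w permutes {..<sum_list \<mu>}" and b': "b' \<in> specht_basis \<mu>"
  shows "b' (R \<circ> w) = (\<Sum>b\<in>specht_basis \<mu>. specht_matrix \<mu> w b b' * b R)"
proof -
  let ?B = "specht_basis \<mu>" and ?f = "\<lambda>R. b' (R \<circ> w)"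
  have "b' \<in> specht_module \<mu>" using fn.span_base[OF b'] specht_basis(2) by simp
  then have f: "?f \<in> fn.span ?B" unfolding specht_basis(2) by (rule specht_module_translate[OF w])
  have "?f = (\<Sum>b\<in>?B. fscale (fn.representation ?B ?f b) b)"
    using fn.sum_representation_eq[OF specht_basis(1) f specht_basis(3) order_refl] by simp
  then have "?f R = (\<Sum>b\<in>?B. fscale (fn.representation ?B ?f b) b) R" by (rule fun_cong)
  then show ?thesis by (simp only: fn_sum_apply fscale_def specht_matrix_def)
qed

section \<open>Characters of the induced modules\<close>

fun mons :: "nat list list \<Rightarrow> (nat \<Rightarrow> nat) list \<Rightarrow> (nat \<Rightarrow> complex) list \<Rightarrow> complex mat list" where
  "mons [] ws ys = []"
| "mons (\<mu> # mus) ws ys = mon (sum_list \<mu>) (hd ws) (hd ys) # mons mus (tl ws) (tl ys)"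

fun bperm :: "nat list list \<Rightarrow> (nat \<Rightarrow> nat) list \<Rightarrow> nat \<Rightarrow> nat" where
  "bperm [] ws x = x"
| "bperm (\<mu> # mus) ws x = (if x < sum_list \<mu> then hd ws x else bperm mus (tl ws) (x - sum_list \<mu>) + sum_list \<mu>)"

fun bphase :: "nat list list \<Rightarrow> (nat \<Rightarrow> complex) list \<Rightarrow> nat \<Rightarrow> complex" where
  "bphase [] ys x = 1"
| "bphase (\<mu> # mus) ys x = (if x < sum_list \<mu> then hd ys x else bphase mus (tl ys) (x - sum_list \<mu>))"

abbreviation block_perms :: "nat list list \<Rightarrow> (nat \<Rightarrow> nat) list \<Rightarrow> bool" where
  "block_perms mus ws \<equiv> list_all2 (\<lambda>\<mu> w. w permutes {..<sum_list \<mu>}) mus ws"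

abbreviation block_phases :: "nat \<Rightarrow> nat list list \<Rightarrow> (nat \<Rightarrow> complex) list \<Rightarrow> bool" where
  "block_phases l mus ys \<equiv> list_all2 (\<lambda>\<mu> y. \<forall>i<sum_list \<mu>. y i ^ l = 1) mus ys"

lemma bperm_permutes: "block_perms mus ws \<Longrightarrow> bperm mus ws permutes {..<lpart_size mus}"
proof (induction mus ws rule: list_all2_induct)
  case Nil
  have "bperm [] [] = id" by (simp add: fun_eq_iff)
  then show ?case by (simp only: permutes_id)
next
  case (Cons \<mu> mus w ws)
  let ?m = "sum_list \<mu>" and ?k = "lpart_size mus"
  show ?case
  proof (rule bij_imp_permutes)
    have "bij_betw (bperm (\<mu> # mus) (w # ws)) {..<?m} {..<?m}"
      using permutes_imp_bij[OF Cons(1)] by (subst bij_betw_cong[of _ _ w]) auto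
    moreover have "bij_betw (bperm (\<mu> # mus) (w # ws)) {?m..<?m + ?k} {?m..<?m + ?k}"
    proof -
      have 1: "bij_betw (\<lambda>x. x - ?m) {?m..<?m + ?k} {..<?k}"
        by (rule bij_betw_byWitness[of _ "\<lambda>x. x + ?m"]) auto
      have 2: "bij_betw (\<lambda>x. x + ?m) {..<?k} {?m..<?m + ?k}"
        by (rule bij_betw_byWitness[of _ "\<lambda>x. x - ?m"]) auto
      from bij_betw_trans[OF bij_betw_trans[OF 1 permutes_imp_bij[OF Cons(3)]] 2]
      show ?thesis by (subst bij_betw_cong[of _ _ "(\<lambda>x. x + ?m) \<circ> (bperm mus ws \<circ> (\<lambda>x. x - ?m))"]) auto
    qed
    ultimately have "bij_betw (bperm (\<mu> # mus) (w # ws)) ({..<?m} \<union> {?m..<?m + ?k}) ({..<?m} \<union> {?m..<?m + ?k})"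
      by (rule bij_betw_combine) auto
    moreover have "{..<?m} \<union> {?m..<?m + ?k} = {..<lpart_size (\<mu> # mus)}" by auto
    ultimately show "bij_betw (bperm (\<mu> # mus) (w # ws)) {..<lpart_size (\<mu> # mus)} {..<lpart_size (\<mu> # mus)}"
      by (simp only:)
    fix x assume x: "x \<notin> {..<lpart_size (\<mu> # mus)}"
    then have "bperm mus ws (x - ?m) = x - ?m" using permutes_not_in[OF Cons(3), of "x - ?m"] by simp
    then show "bperm (\<mu> # mus) (w # ws) x = x" using x by simp
  qed
qed

text \<open>Brings an element of the block subgroup into the normal form \<open>mon\<close>, where
  \<open>act_mon\<close> applies.\<close>

lemma diag_block_mons:
  assumes "block_perms mus ws" "length ys = length mus"
  shows "diag_block_mat (mons mus ws ys) = mon (lpart_size mus) (bperm mus ws) (bphase mus ys)"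
  using assms
proof (induction mus ws arbitrary: ys rule: list_all2_induct)
  case Nil
  show ?case by (rule eq_matI) auto
next
  case (Cons \<mu> mus w ws)
  obtain y ys' where ys: "ys = y # ys'" "length ys' = length mus" using Cons.prems by (cases ys) auto
  let ?m = "sum_list \<mu>" and ?k = "lpart_size mus"
  have IH: "diag_block_mat (mons mus ws ys') = mon ?k (bperm mus ws) (bphase mus ys')" by (rule Cons.IH[OF ys(2)])
  show ?case
  proof (rule eq_matI)
    fix i j assume "i < dim_row (mon (lpart_size (\<mu> # mus)) (bperm (\<mu> # mus) (w # ws)) (bphase (\<mu> # mus) ys))"
      "j < dim_col (mon (lpart_size (\<mu> # mus)) (bperm (\<mu> # mus) (w # ws)) (bphase (\<mu> # mus) ys))"
    then have ij: "i < ?m + ?k" "j < ?m + ?k" by simp_all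
    have w: "w j < ?m" if "j < ?m" using permutes_lt[OF Cons(1) that] .
    show "diag_block_mat (mons (\<mu> # mus) (w # ws) ys) $$ (i, j) =
      mon (lpart_size (\<mu> # mus)) (bperm (\<mu> # mus) (w # ws)) (bphase (\<mu> # mus) ys) $$ (i, j)"
      using ij w by (auto simp: ys IH Let_def)
  qed (simp_all add: ys IH Let_def)
qed

lemma block_tuples_Cons: "block_tuples l (\<mu> # mus) = {g # gs | g gs. g \<in> carrier (Gl1 l (sum_list \<mu>)) \<and> gs \<in> block_tuples l mus}"
  by (simp add: block_tuples_def set_Cons_def)

lemma block_tuplesE:
  assumes l: "1 \<le> l" and gs: "gs \<in> block_tuples l mus"
  shows "\<exists>ws ys. gs = mons mus ws ys \<and> block_perms mus ws \<and> block_phases l mus ys"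
  using gs
proof (induction mus arbitrary: gs)
  case Nil
  then show ?case by (simp add: block_tuples_def)
next
  case (Cons \<mu> mus)
  then obtain g gs' where g: "gs = g # gs'" "g \<in> carrier (Gl1 l (sum_list \<mu>))" "gs' \<in> block_tuples l mus"
    unfolding block_tuples_Cons by blast
  obtain w y where 1: "g = mon (sum_list \<mu>) w y" "w permutes {..<sum_list \<mu>}" "\<And>i. i < sum_list \<mu> \<Longrightarrow> y i ^ l = 1"
    by (rule Gl1_cases[OF l g(2)]) blast
  obtain ws ys where "gs' = mons mus ws ys" "block_perms mus ws" "block_phases l mus ys"
    using Cons.IH[OF g(3)] by blast
  then have "gs = mons (\<mu> # mus) (w # ws) (y # ys) \<and> block_perms (\<mu> # mus) (w # ws) \<and> block_phases l (\<mu> # mus) (y # ys)"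
    using g 1 by simp
  then show ?case by blast
qed

lemma mons_in_block_tuples:
  assumes l: "1 \<le> l" and "block_perms mus ws" "block_phases l mus ys"
  shows "mons mus ws ys \<in> block_tuples l mus"
  using assms(2,3)
proof (induction mus ws arbitrary: ys rule: list_all2_induct)
  case Nil
  then show ?case by (simp add: block_tuples_def)
next
  case (Cons \<mu> mus w ws)
  then obtain y ys' where "ys = y # ys'" "\<forall>i<sum_list \<mu>. y i ^ l = 1" "block_phases l mus ys'"
    by (auto simp: list_all2_Cons1)
  then show ?case using Cons.IH[of ys'] Cons(1) by (simp add: block_tuples_Cons mon_in_Gl1[OF l])
qed

lemma blk_bperm: "block_perms mus ws \<Longrightarrow> blk e mus (bperm mus ws x) = blk e mus x"
proof (induction mus ws arbitrary: e x rule: list_all2_induct)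
  case (Cons \<mu> mus w ws)
  show ?case using Cons.IH[of "Suc e" "x - sum_list \<mu>"] permutes_lt[OF Cons(1), of x] by simp
qed simp

lemma bphase_root: "block_phases l mus ys \<Longrightarrow> bphase mus ys x ^ l = 1"
  by (induction mus ys arbitrary: x rule: list_all2_induct) auto

text \<open>The block labels identify the first block, which w therefore preserves; w splits into
  its restriction there and a shifted permutation of the remaining blocks.\<close>

lemma block_perm_split:
  assumes w: "w permutes {..<lpart_size mus}" and b: "\<And>x. x < lpart_size mus \<Longrightarrow> blk e mus (w x) = blk e mus x"
  shows "\<exists>ws. block_perms mus ws \<and> w = bperm mus ws"
  using assms
proof (induction mus arbitrary: e w)
  case Nil
  then have "w = bperm [] []" by (simp add: fun_eq_iff)
  then show ?case by (intro exI[of _ "[]"]) simp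
next
  case (Cons \<mu> mus)
  let ?m = "sum_list \<mu>" and ?k = "lpart_size mus"
  note wlt = permutes_lt[OF Cons.prems(1)]
  have iff: "w x < ?m \<longleftrightarrow> x < ?m" if x: "x < ?m + ?k" for x
  proof -
    have *: "blk e (\<mu> # mus) z = Suc e \<longleftrightarrow> z < ?m" if "z < ?m + ?k" for z
    proof (cases "z < ?m")
      case False
      then have "Suc e < blk (Suc e) mus (z - ?m)" using that by (intro blk_gt) auto
      then show ?thesis using False by simp
    qed simp
    show ?thesis using *[of x] *[of "w x"] wlt[of x] Cons.prems(2)[of x] x by simp
  qed
  define w1 where "w1 = (\<lambda>x. if x < ?m then w x else x)"
  define w2 where "w2 = (\<lambda>x. if x < ?k then w (x + ?m) - ?m else x)"
  have inj: "w x = w y \<longleftrightarrow> x = y" for x y using permutes_inj[OF Cons.prems(1)] by (auto simp: inj_def)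
  have w1: "w1 permutes {..<?m}"
  proof (rule bij_imp_permutes)
    have "inj_on w1 {..<?m}" using inj by (auto simp: w1_def inj_on_def)
    moreover have "w1 ` {..<?m} \<subseteq> {..<?m}" using iff by (auto simp: w1_def)
    ultimately show "bij_betw w1 {..<?m} {..<?m}" by (simp add: bij_betw_def endo_inj_surj)
  qed (simp add: w1_def)
  have ge: "?m \<le> w (x + ?m)" if "x < ?k" for x using iff[of "x + ?m"] that by simp
  have w2: "w2 permutes {..<?k}"
  proof (rule bij_imp_permutes)
    have "inj_on w2 {..<?k}"
    proof (rule inj_onI)
      fix x y assume xy: "x \<in> {..<?k}" "y \<in> {..<?k}" "w2 x = w2 y"
      then have "w (x + ?m) = w (y + ?m)" using ge[of x] ge[of y] by (simp add: w2_def)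
      then show "x = y" using inj by simp
    qed
    moreover have "w2 ` {..<?k} \<subseteq> {..<?k}"
    proof (intro image_subsetI)
      fix x assume "x \<in> {..<?k}"
      then show "w2 x \<in> {..<?k}" using ge[of x] wlt[of "x + ?m"] by (simp add: w2_def)
    qed
    ultimately show "bij_betw w2 {..<?k} {..<?k}" by (simp add: bij_betw_def endo_inj_surj)
  qed (simp add: w2_def)
  have "blk (Suc e) mus (w2 x) = blk (Suc e) mus x" if x: "x < ?k" for x
    using Cons.prems(2)[of "x + ?m"] ge[OF x] x by (simp add: w2_def)
  from Cons.IH[OF w2 this] obtain ws where ws: "block_perms mus ws" "w2 = bperm mus ws" by blast
  have "w = bperm (\<mu> # mus) (w1 # ws)"
  proof
    fix x
    show "w x = bperm (\<mu> # mus) (w1 # ws) x"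
    proof (cases "x < ?m")
      case False
      show ?thesis
      proof (cases "x < ?m + ?k")
        case True
        then have "x - ?m < ?k" using False by simp
        then show ?thesis using False ge[of "x - ?m"] by (simp add: ws(2)[symmetric] w2_def)
      next
        case False2: False
        then have "w x = x" using permutes_not_in[OF Cons.prems(1), of x] by simp
        then show ?thesis using False False2 by (simp add: ws(2)[symmetric] w2_def)
      qed
    qed (simp add: w1_def)
  qed
  then show ?case using ws w1 by (intro exI[of _ "w1 # ws"]) simp
qed

fun bsplit :: "nat list list \<Rightarrow> (nat \<Rightarrow> complex) \<Rightarrow> (nat \<Rightarrow> complex) list" where
  "bsplit [] y = []"
| "bsplit (\<mu> # mus) y = y # bsplit mus (\<lambda>x. y (x + sum_list \<mu>))"

lemma bphase_bsplit: "x < lpart_size mus \<Longrightarrow> bphase mus (bsplit mus y) x = y x"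
  by (induction mus arbitrary: x y) auto

lemma block_phases_bsplit: "\<forall>i<lpart_size mus. y i ^ l = 1 \<Longrightarrow> block_phases l mus (bsplit mus y)"
  by (induction mus arbitrary: y) auto

text \<open>Diagonal matrices belong to the block subgroup, so membership is a condition on the
  permutation alone: it must preserve the blocks.\<close>

lemma block_subgroup_iff:
  assumes l: "1 \<le> l" and w: "w permutes {..<lpart_size lam}" and y: "\<And>i. i < lpart_size lam \<Longrightarrow> y i ^ l = 1"
  shows "mon (lpart_size lam) w y \<in> block_subgroup l lam \<longleftrightarrow>
    (\<forall>x<lpart_size lam. blk 0 lam (w x) = blk 0 lam x)"
proof
  assume "mon (lpart_size lam) w y \<in> block_subgroup l lam"
  then obtain gs where gs: "gs \<in> block_tuples l lam" "mon (lpart_size lam) w y = diag_block_mat gs"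
    unfolding block_subgroup_def by blast
  obtain ws ys where ws: "gs = mons lam ws ys" "block_perms lam ws" "block_phases l lam ys"
    using block_tuplesE[OF l gs(1)] by blast
  have "mon (lpart_size lam) w y = mon (lpart_size lam) (bperm lam ws) (bphase lam ys)"
    using gs(2) diag_block_mons[OF ws(2)] list_all2_lengthD[OF ws(3)] ws(1) by simp
  then have "mon_perm (mon (lpart_size lam) w y) = mon_perm (mon (lpart_size lam) (bperm lam ws) (bphase lam ys))" by simp
  moreover have "mon_perm (mon (lpart_size lam) w y) = w"
    by (rule mon_perm_mon[OF w]) (rule root_nonzero[OF l y])
  moreover have "mon_perm (mon (lpart_size lam) (bperm lam ws) (bphase lam ys)) = bperm lam ws"
    by (rule mon_perm_mon[OF bperm_permutes[OF ws(2)]]) (rule root_nonzero[OF l bphase_root[OF ws(3)]])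
  ultimately show "\<forall>x<lpart_size lam. blk 0 lam (w x) = blk 0 lam x" using blk_bperm[OF ws(2)] by simp
next
  assume "\<forall>x<lpart_size lam. blk 0 lam (w x) = blk 0 lam x"
  then obtain ws where ws: "block_perms lam ws" "w = bperm lam ws" using block_perm_split[OF w, of 0] by blast
  have ys: "block_phases l lam (bsplit lam y)" using y by (intro block_phases_bsplit) simp
  have "mon (lpart_size lam) w y = mon (lpart_size lam) (bperm lam ws) (bphase lam (bsplit lam y))"
    unfolding ws(2) by (rule mon_cong) (simp add: bphase_bsplit)
  also have "\<dots> = diag_block_mat (mons lam ws (bsplit lam y))"
    using diag_block_mons[OF ws(1), of "bsplit lam y"] list_all2_lengthD[OF ys] by simp
  finally show "mon (lpart_size lam) w y \<in> block_subgroup l lam"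
    unfolding block_subgroup_def using mons_in_block_tuples[OF l ws(1) ys] by blast
qed

lemma sum_listset_Cons:
  assumes "finite A" "\<And>B. B \<in> set As \<Longrightarrow> finite B"
  shows "(\<Sum>xs\<in>listset (A # As). F xs) = (\<Sum>x\<in>A. \<Sum>xs\<in>listset As. F (x # xs))"
proof -
  have "listset (A # As) = (\<lambda>(x, xs). x # xs) ` (A \<times> listset As)"
    by (auto simp: set_Cons_def)
  moreover have "inj_on (\<lambda>(x, xs). x # xs) (A \<times> listset As)" by (auto simp: inj_on_def)
  ultimately have "(\<Sum>xs\<in>listset (A # As). F xs) = (\<Sum>p\<in>A \<times> listset As. F (case p of (x, xs) \<Rightarrow> x # xs))"
    by (simp add: sum.reindex comp_def)
  also have "\<dots> = (\<Sum>x\<in>A. \<Sum>xs\<in>listset As. F (x # xs))"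
    by (simp add: sum.cartesian_product case_prod_unfold)
  finally show ?thesis .
qed

lemma finite_listset: "\<forall>B\<in>set As. finite B \<Longrightarrow> finite (listset As)"
proof (induction As)
  case (Cons A As)
  have "listset (A # As) = (\<lambda>(x, xs). x # xs) ` (A \<times> listset As)"
    by (auto simp: set_Cons_def)
  then show ?case using Cons by simp
qed simp

lemma finite_tensor_index [simp]: "finite (tensor_index mus)"
  unfolding tensor_index_def using specht_basis(3) by (intro finite_listset) auto

lemma sum_tensor_index_Cons:
  "(\<Sum>bs\<in>tensor_index (\<mu> # mus). F bs) = (\<Sum>b\<in>specht_basis \<mu>. \<Sum>bs\<in>tensor_index mus. F (b # bs))"
  unfolding tensor_index_def list.map
  by (rule sum_listset_Cons) (use specht_basis(3) in auto)

lemma tensor_index_ConsE: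
  assumes "bs \<in> tensor_index (\<mu> # mus)"
  obtains b bs' where "bs = b # bs'" "b \<in> specht_basis \<mu>" "bs' \<in> tensor_index mus"
  using assms unfolding tensor_index_def by (auto simp: set_Cons_def)

text \<open>\<open>tensor_matrix\<close> with the powers of \<open>delta_char\<close> shifted by e,
  in a form suited to recursion on the components.\<close>

definition tens_coeff :: "nat \<Rightarrow> nat list list \<Rightarrow> complex mat list \<Rightarrow> (tabloid \<Rightarrow> complex) list \<Rightarrow> (tabloid \<Rightarrow> complex) list \<Rightarrow> complex" where
  "tens_coeff e mus gs bs bs' = (\<Prod>k<length mus. twisted_specht (mus ! k) (e + k) (gs ! k) (bs ! k) (bs' ! k))"

lemma tens_coeff_Cons:
  "tens_coeff e (\<mu> # mus) (g # gs) (b # bs) (b' # bs') = twisted_specht \<mu> e g b b' * tens_coeff (Suc e) mus gs bs bs'"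
  unfolding tens_coeff_def length_Cons prod.lessThan_Suc_shift by simp

text \<open>Where the tensor is nonzero, entries of the first block lie in component
  \<open>Suc e\<close>, so each phase there occurs to the power e and their product is
  \<open>delta_char ^ e\<close>; the permutation part acts by the Specht matrix.\<close>

lemma act_block:
  assumes l: "1 \<le> l" and "block_perms mus ws" "block_phases l mus ys" "bs' \<in> tensor_index mus"
  shows "act (lpart_size mus) (mon (lpart_size mus) (bperm mus ws) (bphase mus ys)) (tens e mus bs') T =
    (\<Sum>bs\<in>tensor_index mus. tens_coeff e mus (mons mus ws ys) bs bs' * tens e mus bs T)"
  using assms(2-)
proof (induction mus ws arbitrary: e ys bs' T rule: list_all2_induct)
  case Nil
  have i: "bperm [] [] = id" by (simp add: fun_eq_iff)
  have b: "bs' = []" using Nil.prems(2) by (simp add: tensor_index_def)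
  have r: "(\<Sum>bs\<in>tensor_index []. tens_coeff e [] (mons [] [] ys) bs [] * tens e [] bs T) = tens e [] [] T"
    by (simp add: tensor_index_def tens_coeff_def del: tens.simps)
  have "act 0 (mon 0 id (bphase [] ys)) (tens e [] []) T = tens e [] [] T"
    by (subst act_mon) (auto intro: permutes_id simp del: tens.simps)
  then show ?case unfolding r lpart_size_simps i b .
next
  case (Cons \<mu> mus w ws)
  let ?m = "sum_list \<mu>" and ?k = "lpart_size mus"
  from Cons.prems(1) obtain y ys' where ys: "ys = y # ys'" "\<forall>i<?m. y i ^ l = 1" "block_phases l mus ys'"
    by (auto simp: list_all2_Cons1)
  from Cons.prems(2) obtain b' bs'' where bs': "bs' = b' # bs''" "b' \<in> specht_basis \<mu>" "bs'' \<in> tensor_index mus"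
    by (rule tensor_index_ConsE)
  let ?W = "bperm (\<mu> # mus) (w # ws)" and ?Y = "bphase (\<mu> # mus) ys"
  let ?W' = "bperm mus ws" and ?Y' = "bphase mus ys'"
  let ?T2 = "\<lambda>x. T (x + ?m)" and ?R = "\<lambda>x. if x < ?m then fst (T x) else 0"
  have W: "?W permutes {..<lpart_size (\<mu> # mus)}" by (rule bperm_permutes) (use Cons in simp)
  have W': "?W' permutes {..<?k}" by (rule bperm_permutes[OF Cons(2)])
  have Y: "?Y i \<noteq> 0" for i by (rule root_nonzero[OF l bphase_root[OF Cons.prems(1)]])
  have Y': "?Y' i \<noteq> 0" for i by (rule root_nonzero[OF l bphase_root[OF ys(3)]])
  have yn: "y i \<noteq> 0" if "i < ?m" for i using root_nonzero[OF l] ys(2) that by blast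
  have "act (lpart_size (\<mu> # mus)) (mon (lpart_size (\<mu> # mus)) ?W ?Y) (tens e (\<mu> # mus) bs') T =
    (\<Prod>i<?m + ?k. ?Y i ^ (snd (T i) - 1)) * tens e (\<mu> # mus) bs' (T \<circ> ?W)"
    by (subst act_mon[OF W Y]) (simp only: lpart_size_simps)
  also have "(\<Prod>i<?m + ?k. ?Y i ^ (snd (T i) - 1)) =
    (\<Prod>i<?m. y i ^ (snd (T i) - 1)) * (\<Prod>i<?k. ?Y' i ^ (snd (?T2 i) - 1))"
  proof -
    have S: "{..<?m + ?k} = {..<?m} \<union> {?m..<?m + ?k}" by auto
    have "(\<Prod>i<?m + ?k. ?Y i ^ (snd (T i) - 1)) =
      (\<Prod>i<?m. ?Y i ^ (snd (T i) - 1)) * (\<Prod>i\<in>{?m..<?m + ?k}. ?Y i ^ (snd (T i) - 1))"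
      unfolding S by (rule prod.union_disjoint) (simp_all add: ivl_disj_int)
    also have "(\<Prod>i\<in>{?m..<?m + ?k}. ?Y i ^ (snd (T i) - 1)) = (\<Prod>i<?k. ?Y' i ^ (snd (?T2 i) - 1))"
      by (rule prod.reindex_bij_witness[of _ "\<lambda>i. i + ?m" "\<lambda>i. i - ?m"]) (auto simp: ys(1))
    finally show ?thesis by (simp add: ys(1))
  qed
  also have "tens e (\<mu> # mus) bs' (T \<circ> ?W) =
    (if \<forall>x<?m. snd (T x) = Suc e then b' (?R \<circ> w) else 0) * tens (Suc e) mus bs'' (?T2 \<circ> ?W')"
  proof -
    have "(\<lambda>x. if x < ?m then fst ((T \<circ> ?W) x) else 0) = ?R \<circ> w"
    proof
      fix x show "(if x < ?m then fst ((T \<circ> ?W) x) else 0) = (?R \<circ> w) x"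
        using permutes_lt[OF Cons(1), of x] permutes_not_in[OF Cons(1), of x] by (cases "x < ?m") simp_all
    qed
    moreover have "(\<forall>x<?m. snd ((T \<circ> ?W) x) = Suc e) \<longleftrightarrow> (\<forall>x<?m. snd (T x) = Suc e)"
    proof
      assume "\<forall>x<?m. snd (T x) = Suc e"
      then show "\<forall>x<?m. snd ((T \<circ> ?W) x) = Suc e" using permutes_lt[OF Cons(1)] by simp
    next
      assume a: "\<forall>x<?m. snd ((T \<circ> ?W) x) = Suc e"
      show "\<forall>x<?m. snd (T x) = Suc e"
      proof (intro allI impI)
        fix x assume "x < ?m"
        then have p: "pinv w x < ?m" by (rule permutes_lt[OF permutes_inv[OF Cons(1)]])
        have "snd ((T \<circ> ?W) (pinv w x)) = Suc e" using a p by blast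
        moreover have "?W (pinv w x) = x" using p permutes_inverses(1)[OF Cons(1), of x] by simp
        ultimately show "snd (T x) = Suc e" by (simp only: comp_apply)
      qed
    qed
    moreover have "(\<lambda>x. (T \<circ> ?W) (x + ?m)) = ?T2 \<circ> ?W'" by (simp add: fun_eq_iff)
    ultimately show ?thesis unfolding tens.simps(2) bs'(1) list.sel by (simp only:)
  qed
  also have "(\<Prod>i<?m. y i ^ (snd (T i) - 1)) * (\<Prod>i<?k. ?Y' i ^ (snd (?T2 i) - 1)) *
      ((if \<forall>x<?m. snd (T x) = Suc e then b' (?R \<circ> w) else 0) * tens (Suc e) mus bs'' (?T2 \<circ> ?W')) =
    ((\<Prod>i<?m. y i ^ (snd (T i) - 1)) * (if \<forall>x<?m. snd (T x) = Suc e then b' (?R \<circ> w) else 0)) *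
    ((\<Prod>i<?k. ?Y' i ^ (snd (?T2 i) - 1)) * tens (Suc e) mus bs'' (?T2 \<circ> ?W'))"
    by (simp only: mult_ac)
  also have "(\<Prod>i<?k. ?Y' i ^ (snd (?T2 i) - 1)) * tens (Suc e) mus bs'' (?T2 \<circ> ?W') =
    act ?k (mon ?k ?W' ?Y') (tens (Suc e) mus bs'') ?T2"
    by (subst act_mon[OF W' Y']) (rule refl)
  also have "\<dots> = (\<Sum>bs\<in>tensor_index mus. tens_coeff (Suc e) mus (mons mus ws ys') bs bs'' * tens (Suc e) mus bs ?T2)"
    by (rule Cons.IH[OF ys(3) bs'(3)])
  also have "(\<Prod>i<?m. y i ^ (snd (T i) - 1)) * (if \<forall>x<?m. snd (T x) = Suc e then b' (?R \<circ> w) else 0) =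
    (\<Sum>b\<in>specht_basis \<mu>. twisted_specht \<mu> e (mon ?m w y) b b' * (if \<forall>x<?m. snd (T x) = Suc e then b ?R else 0))"
  proof (cases "\<forall>x<?m. snd (T x) = Suc e")
    case True
    have "(\<Prod>i<?m. y i ^ (snd (T i) - 1)) = delta_char (mon ?m w y) ^ e"
      unfolding delta_char_mon[of w ?m y, OF Cons(1) yn, simplified] using True by (simp add: prod_power_distrib)
    moreover have "mon_perm (mon ?m w y) = w" by (rule mon_perm_mon[OF Cons(1) yn])
    ultimately show ?thesis
      unfolding if_P[OF True] specht_matrix_expand[OF Cons(1) bs'(2)] twisted_specht_def sum_distrib_left
      by (simp only: mult.assoc)
  next
    case False
    show ?thesis unfolding if_not_P[OF False] by simp
  qed
  finally have F: "act (lpart_size (\<mu> # mus)) (mon (lpart_size (\<mu> # mus)) ?W ?Y) (tens e (\<mu> # mus) bs') T =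
    (\<Sum>b\<in>specht_basis \<mu>. twisted_specht \<mu> e (mon ?m w y) b b' * (if \<forall>x<?m. snd (T x) = Suc e then b ?R else 0)) *
    (\<Sum>bs\<in>tensor_index mus. tens_coeff (Suc e) mus (mons mus ws ys') bs bs'' * tens (Suc e) mus bs ?T2)" .
  have mm: "p * u * (q * v) = p * q * (u * v)" for p q u v :: complex by (simp only: mult_ac)
  have G1: "tens_coeff e (\<mu> # mus) (mons (\<mu> # mus) (w # ws) ys) (b # bs) bs' * tens e (\<mu> # mus) (b # bs) T =
      twisted_specht \<mu> e (mon ?m w y) b b' * tens_coeff (Suc e) mus (mons mus ws ys') bs bs'' *
      ((if \<forall>x<?m. snd (T x) = Suc e then b ?R else 0) * tens (Suc e) mus bs ?T2)" for b bs
  proof -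
    have "tens_coeff e (\<mu> # mus) (mons (\<mu> # mus) (w # ws) ys) (b # bs) bs' =
      twisted_specht \<mu> e (mon ?m w y) b b' * tens_coeff (Suc e) mus (mons mus ws ys') bs bs''"
      unfolding bs'(1) ys(1) mons.simps list.sel by (rule tens_coeff_Cons)
    moreover have "tens e (\<mu> # mus) (b # bs) T = (if \<forall>x<?m. snd (T x) = Suc e then b ?R else 0) * tens (Suc e) mus bs ?T2"
      by (simp only: tens.simps(2) list.sel)
    ultimately show ?thesis by (rule arg_cong2[where f = "(*)"])
  qed
  show ?case
    by (rule trans[OF F], subst sum_product, subst sum_tensor_index_Cons, rule sum.cong[OF refl], rule sum.cong[OF refl],
      subst G1, rule mm)
qed

lemma subspace_preimage_add:
  assumes "fn.subspace V" "\<And>x. x \<in> B \<Longrightarrow> F x \<in> V" "\<And>x y. F (x + y) = F x + F y" "\<And>c x. F (fscale c x) = fscale c (F x)"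
    "x \<in> fn.span B"
  shows "F x \<in> V"
  using assms(5)
proof (induction rule: fn.span_induct_alt)
  case base
  have "F 0 = F (fscale 0 0)" by (simp only: fn.scale_zero_right)
  also have "\<dots> = 0" unfolding assms(4) by (rule fn.scale_zero_left)
  finally show ?case using fn.subspace_0[OF assms(1)] by (simp only:)
next
  case (step c x y)
  show ?case unfolding assms(3,4)
    by (rule fn.subspace_add[OF assms(1) fn.subspace_scale[OF assms(1) assms(2)[OF step(1)]] step(2)])
qed

text \<open>Multilinearity of \<open>tens\<close>. It is applied in both directions, between the
  polytabloids and the chosen bases of the Specht modules.\<close>

lemma tens_span:
  assumes "list_all2 (\<lambda>b P. b \<in> fn.span P) bs Ps" "length Ps = length mus"
  shows "tens e mus bs \<in> fn.span (tens e mus ` listset Ps)"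
  using assms
proof (induction bs Ps arbitrary: e mus rule: list_all2_induct)
  case Nil
  then show ?case by (auto intro!: fn.span_base)
next
  case (Cons b bs P Ps)
  obtain \<mu> mus' where mus: "mus = \<mu> # mus'" "length Ps = length mus'" using Cons.prems by (cases mus) auto
  let ?V = "fn.span (tens e mus ` listset (P # Ps))" and ?m = "sum_list \<mu>"
  define Q where "Q = (\<lambda>(b :: tabloid \<Rightarrow> complex) (h :: (nat \<Rightarrow> nat \<times> nat) \<Rightarrow> complex) (T :: nat \<Rightarrow> nat \<times> nat).
    (if \<forall>x<?m. snd (T x) = Suc e then b (\<lambda>x. if x < ?m then fst (T x) else 0) else 0) * h (\<lambda>x. T (x + ?m)))"
  have tQ: "tens e mus (b # bs) = Q b (tens (Suc e) mus' bs)" for b bs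
    by (rule ext) (simp only: mus(1) Q_def tens.simps(2) list.sel)
  have Q1: "Q (b + b') h = Q b h + Q b' h" "Q (fscale c b) h = fscale c (Q b h)" for b b' h c
    by (auto simp: Q_def fun_eq_iff fscale_def algebra_simps)
  have Q2: "Q b (h + h') = Q b h + Q b h'" "Q b (fscale c h) = fscale c (Q b h)" for b h h' c
    by (auto simp: Q_def fun_eq_iff fscale_def algebra_simps)
  have 1: "Q p h \<in> ?V" if p: "p \<in> P" and h: "h \<in> fn.span (tens (Suc e) mus' ` listset Ps)" for p h
  proof (rule subspace_preimage_add[OF fn.subspace_span _ Q2 h])
    fix x assume "x \<in> tens (Suc e) mus' ` listset Ps"
    then obtain ps where ps: "ps \<in> listset Ps" "x = tens (Suc e) mus' ps" by blast
    show "Q p x \<in> ?V" unfolding ps(2) tQ[symmetric]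
      by (intro fn.span_base imageI) (use p ps(1) in \<open>auto simp: set_Cons_def\<close>)
  qed
  have "Q b (tens (Suc e) mus' bs) \<in> ?V"
    by (rule subspace_preimage_add[where F = "\<lambda>b. Q b (tens (Suc e) mus' bs)", OF fn.subspace_span 1 Q1 Cons(1)])
      (auto intro: Cons.IH[OF mus(2)])
  then show ?case unfolding tQ .
qed

text \<open>With the values on the later blocks fixed, the relation becomes one among the basis
  vectors of the first Specht module, so each of its coefficients vanishes; these are relations for
  the remaining blocks.\<close>

lemma tens_independent:
  assumes "\<And>T. (\<Sum>bs\<in>tensor_index mus. a bs * tens e mus bs T) = 0" "bs \<in> tensor_index mus"
  shows "a bs = (0::complex)"
  using assms
proof (induction mus arbitrary: e a bs)
  case Nil
  have "(\<Sum>bs\<in>tensor_index []. a bs * tens e [] bs (\<lambda>_. (0, 0))) = a []" by (simp add: tensor_index_def)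
  then show ?case using Nil.prems(1)[of "\<lambda>_. (0, 0)"] Nil.prems(2) by (simp add: tensor_index_def)
next
  case (Cons \<mu> mus)
  let ?m = "sum_list \<mu>"
  obtain b' bs' where bs: "bs = b' # bs'" "b' \<in> specht_basis \<mu>" "bs' \<in> tensor_index mus"
    using Cons.prems(2) by (rule tensor_index_ConsE)
  have "(\<Sum>bs\<in>tensor_index mus. a (b' # bs) * tens (Suc e) mus bs T2) = 0" for T2
  proof -
    define c where "c = (\<lambda>b. \<Sum>bs\<in>tensor_index mus. a (b # bs) * tens (Suc e) mus bs T2)"
    have "(\<Sum>b\<in>specht_basis \<mu>. fscale (c b) b) = 0"
    proof
      fix R
      show "(\<Sum>b\<in>specht_basis \<mu>. fscale (c b) b) R = 0 R"
      proof (cases "\<forall>x\<ge>?m. R x = 0")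
        case True
        define T where "T = (\<lambda>x. if x < ?m then (R x, Suc e) else T2 (x - ?m))"
        have R: "(\<lambda>x. if x < ?m then fst (T x) else 0) = R" using True by (auto simp: T_def fun_eq_iff)
        have T2: "(\<lambda>x. T (x + ?m)) = T2" by (simp add: T_def)
        have c: "\<forall>x<?m. snd (T x) = Suc e" by (simp add: T_def)
        have "tens e (\<mu> # mus) (b # bs) T = b R * tens (Suc e) mus bs T2" for b bs
          unfolding tens.simps(2) list.sel if_P[OF c] R T2 by (rule refl)
        then have "0 = (\<Sum>b\<in>specht_basis \<mu>. \<Sum>bs\<in>tensor_index mus. a (b # bs) * (b R * tens (Suc e) mus bs T2))"
          using Cons.prems(1)[of T] unfolding sum_tensor_index_Cons by (simp only:)
        also have "\<dots> = (\<Sum>b\<in>specht_basis \<mu>. c b * b R)"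
          unfolding c_def sum_distrib_right by (intro sum.cong refl) (simp only: mult_ac)
        finally show ?thesis by (simp only: fn_sum_apply fscale_def zero_fun_apply)
      next
        case False
        then obtain x where "x \<ge> ?m" "R x \<noteq> 0" by blast
        then have "b R = 0" if "b \<in> specht_basis \<mu>" for b using specht_basis_off[OF that] by blast
        then show ?thesis unfolding fn_sum_apply fscale_def zero_fun_apply by (intro sum.neutral ballI) simp
      qed
    qed
    then have "c b' = 0"
      by (rule fn.independentD[OF specht_basis(1) specht_basis(3) order_refl _ bs(2)])
    then show ?thesis by (simp only: c_def)
  qed
  from Cons.IH[OF this bs(3)] show ?case by (simp only: bs(1))
qed

text \<open>Passes from independence of an indexed family to independence of the set of its members;
  the first claim excludes repetitions.\<close>

lemma family_independent:
  assumes fin: "finite S" and ind: "\<And>b. (\<And>x. (\<Sum>s\<in>S. b s * u s x) = 0) \<Longrightarrow> \<forall>s\<in>S. b s = (0::complex)"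
  shows "inj_on u S" "fn.independent (u ` S)"
proof -
  show inj: "inj_on u S"
  proof (rule inj_onI, rule ccontr)
    fix p q assume pq: "p \<in> S" "q \<in> S" "u p = u q" "p \<noteq> q"
    let ?b = "\<lambda>r. (if r = p then 1 else 0) - (if r = q then 1 else (0::complex))"
    have "(\<Sum>r\<in>S. ?b r * u r x) = 0" for x
    proof -
      have "(\<Sum>r\<in>S. ?b r * u r x) = (\<Sum>r\<in>S. if r = p then u r x else 0) - (\<Sum>r\<in>S. if r = q then u r x else 0)"
        unfolding sum_subtractf[symmetric] by (intro sum.cong refl) auto
      also have "\<dots> = u p x - u q x" using fin pq by simp
      finally show ?thesis using pq(3) by simp
    qed
    from ind[of ?b, OF this] pq show False by auto
  qed
  show "fn.independent (u ` S)"
  proof (rule ccontr)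
    assume "\<not> fn.independent (u ` S)"
    then obtain c w where c: "w \<in> u ` S" "c w \<noteq> 0" "(\<Sum>v\<in>u ` S. fscale (c v) v) = 0"
      using fn.dependent_finite[of "u ` S"] fin by blast
    have "(\<Sum>s\<in>S. fscale (c (u s)) (u s)) = 0" using c(3) unfolding sum.reindex[OF inj] o_def .
    then have "(\<Sum>s\<in>S. fscale (c (u s)) (u s)) x = 0" for x by (simp only: zero_fun_apply)
    then have "(\<Sum>s\<in>S. c (u s) * u s x) = 0" for x unfolding fn_sum_apply fscale_def .
    from ind[OF this] c(1,2) show False by blast
  qed
qed

text \<open>Both traces belong to one operator g written in two bases of one space:
  \<open>R = Q D P\<close> with \<open>P Q = 1\<close>, and the trace is cyclic.\<close>

lemma trace_change_of_basis:
  fixes \<Phi> :: "'i \<Rightarrow> 'x \<Rightarrow> complex" and v :: "'j \<Rightarrow> 'x \<Rightarrow> complex"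
  assumes fin: "finite X" "finite Y"
    and ind\<Phi>: "\<And>a. (\<And>z. (\<Sum>x\<in>X. a x * \<Phi> x z) = 0) \<Longrightarrow> \<forall>x\<in>X. a x = 0"
    and indv: "\<And>a. (\<And>z. (\<Sum>y\<in>Y. a y * v y z) = 0) \<Longrightarrow> \<forall>y\<in>Y. a y = 0"
    and P: "\<And>x z. x \<in> X \<Longrightarrow> \<Phi> x z = (\<Sum>y\<in>Y. P y x * v y z)"
    and Q: "\<And>y z. y \<in> Y \<Longrightarrow> v y z = (\<Sum>x\<in>X. Q x y * \<Phi> x z)"
    and gP: "\<And>x z. x \<in> X \<Longrightarrow> g (\<Phi> x) z = (\<Sum>y\<in>Y. P y x * g (v y) z)"
    and R: "\<And>x' z. x' \<in> X \<Longrightarrow> g (\<Phi> x') z = (\<Sum>x\<in>X. R x x' * \<Phi> x z)"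
    and D: "\<And>y' z. y' \<in> Y \<Longrightarrow> g (v y') z = (\<Sum>y\<in>Y. D y y' * v y z)"
  shows "(\<Sum>x\<in>X. R x x) = (\<Sum>y\<in>Y. D y y)"
proof -
  have R': "R x x' = (\<Sum>y\<in>Y. \<Sum>y'\<in>Y. Q x y' * D y' y * P y x')" if x: "x \<in> X" "x' \<in> X" for x x'
  proof -
    have "(\<Sum>x\<in>X. (R x x' - (\<Sum>y\<in>Y. \<Sum>y'\<in>Y. Q x y' * D y' y * P y x')) * \<Phi> x z) = 0" for z
    proof -
      have "g (\<Phi> x') z = (\<Sum>y\<in>Y. P y x' * (\<Sum>y'\<in>Y. D y' y * (\<Sum>x\<in>X. Q x y' * \<Phi> x z)))"
        unfolding gP[OF x(2)] by (intro sum.cong refl arg_cong2[where f = "(*)"]) (simp only: D, intro sum.cong refl, simp only: Q)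
      also have "\<dots> = (\<Sum>y\<in>Y. \<Sum>y'\<in>Y. \<Sum>x\<in>X. Q x y' * D y' y * P y x' * \<Phi> x z)"
        unfolding sum_distrib_left by (intro sum.cong refl) (simp only: mult_ac)
      also have "\<dots> = (\<Sum>y\<in>Y. \<Sum>x\<in>X. \<Sum>y'\<in>Y. Q x y' * D y' y * P y x' * \<Phi> x z)"
        by (intro sum.cong refl, rule sum.swap)
      also have "\<dots> = (\<Sum>x\<in>X. \<Sum>y\<in>Y. \<Sum>y'\<in>Y. Q x y' * D y' y * P y x' * \<Phi> x z)"
        by (rule sum.swap)
      also have "\<dots> = (\<Sum>x\<in>X. (\<Sum>y\<in>Y. \<Sum>y'\<in>Y. Q x y' * D y' y * P y x') * \<Phi> x z)"
        by (simp only: sum_distrib_right)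
      finally show ?thesis unfolding R[OF x(2)] left_diff_distrib sum_subtractf by simp
    qed
    from ind\<Phi>[OF this] x(1) show ?thesis by simp
  qed
  have PQ: "(\<Sum>x\<in>X. P y x * Q x y') = (if y = y' then 1 else 0)" if y: "y \<in> Y" "y' \<in> Y" for y y'
  proof -
    have "(\<Sum>y\<in>Y. ((\<Sum>x\<in>X. P y x * Q x y') - (if y = y' then 1 else 0)) * v y z) = 0" for z
    proof -
      have "v y' z = (\<Sum>x\<in>X. Q x y' * (\<Sum>y\<in>Y. P y x * v y z))"
        unfolding Q[OF y(2)] by (intro sum.cong refl) (simp only: P)
      also have "\<dots> = (\<Sum>x\<in>X. \<Sum>y\<in>Y. P y x * Q x y' * v y z)"
        unfolding sum_distrib_left by (intro sum.cong refl) (simp only: mult_ac)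
      also have "\<dots> = (\<Sum>y\<in>Y. \<Sum>x\<in>X. P y x * Q x y' * v y z)" by (rule sum.swap)
      also have "\<dots> = (\<Sum>y\<in>Y. (\<Sum>x\<in>X. P y x * Q x y') * v y z)" by (simp only: sum_distrib_right)
      finally have "(\<Sum>y\<in>Y. (\<Sum>x\<in>X. P y x * Q x y') * v y z) = v y' z" by (rule sym)
      moreover have "(\<Sum>y\<in>Y. (if y = y' then 1 else 0) * v y z) = v y' z"
        using fin(2) y(2) by (simp add: if_distrib[of "\<lambda>c. c * _"] cong: if_cong)
      ultimately show ?thesis by (simp only: left_diff_distrib sum_subtractf diff_self)
    qed
    from indv[OF this] y(1) show ?thesis by (simp only: right_minus_eq)
  qed
  have "(\<Sum>x\<in>X. R x x) = (\<Sum>x\<in>X. \<Sum>y\<in>Y. \<Sum>y'\<in>Y. Q x y' * D y' y * P y x)"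
    by (intro sum.cong refl R')
  also have "\<dots> = (\<Sum>y\<in>Y. \<Sum>x\<in>X. \<Sum>y'\<in>Y. Q x y' * D y' y * P y x)" by (rule sum.swap)
  also have "\<dots> = (\<Sum>y\<in>Y. \<Sum>y'\<in>Y. \<Sum>x\<in>X. Q x y' * D y' y * P y x)"
    by (intro sum.cong refl, rule sum.swap)
  also have "\<dots> = (\<Sum>y\<in>Y. \<Sum>y'\<in>Y. D y' y * (\<Sum>x\<in>X. P y x * Q x y'))"
    unfolding sum_distrib_left by (intro sum.cong refl) (simp only: mult_ac)
  also have "\<dots> = (\<Sum>y\<in>Y. \<Sum>y'\<in>Y. D y' y * (if y = y' then 1 else 0))"
    by (intro sum.cong refl arg_cong2[where f = "(*)"] PQ)
  also have "\<dots> = (\<Sum>y\<in>Y. D y y)"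
    using fin(2) by (intro sum.cong refl) (simp add: if_distrib[of "\<lambda>c. _ * c"] cong: if_cong)
  finally show ?thesis .
qed

section \<open>Groups with a basis of matrix coefficients\<close>

lemma fn_span_image:
  assumes "finite X" "v \<in> fn.span (\<Phi> ` X)"
  shows "\<exists>u. v = (\<Sum>x\<in>X. fscale (u x) (\<Phi> x))"
  using assms(2)
proof (induction rule: fn.span_induct_alt)
  case base
  show ?case by (intro exI[of _ "\<lambda>_. 0"]) (simp only: fn.scale_zero_left sum.neutral_const)
next
  case (step c b v)
  then obtain x u where x: "x \<in> X" "b = \<Phi> x" "v = (\<Sum>x\<in>X. fscale (u x) (\<Phi> x))" by blast
  have "fscale c b = (\<Sum>y\<in>X. fscale (if y = x then c else 0) (\<Phi> y))"
    using assms(1) x(1) unfolding x(2) by (simp add: if_distrib[of "\<lambda>z. fscale z _"] cong: if_cong)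
  then have "fscale c b + v = (\<Sum>y\<in>X. fscale ((if y = x then c else 0) + u y) (\<Phi> y))"
    by (simp only: x(3) fn.scale_left_distrib sum.distrib)
  then show ?case by (intro exI[of _ "\<lambda>y. (if y = x then c else 0) + u y"])
qed

lemma mat_act_add: "mat_act X M (v + w) = mat_act X M v + mat_act X M w"
  by (auto simp: mat_act_def fun_eq_iff distrib_left sum.distrib)

lemma mat_act_zero: "mat_act X M 0 = 0"
  by (rule ext) (simp add: mat_act_def)

lemma mat_act_scale: "mat_act X M (fscale z v) = fscale z (mat_act X M v)"
  by (auto simp: mat_act_def fun_eq_iff fscale_def sum_distrib_left mult.left_commute intro!: sum.cong)

lemma mat_act_diff: "mat_act X M (v - w) = mat_act X M v - mat_act X M w"
  by (auto simp: mat_act_def fun_eq_iff right_diff_distrib sum_subtractf)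

lemma mat_act_sum: "mat_act X M (\<lambda>x. \<Sum>s\<in>S. b s * u s x) x = (\<Sum>s\<in>S. b s * mat_act X M (u s) x)"
proof (cases "x \<in> X")
  case True
  have "(\<Sum>y\<in>X. M x y * (\<Sum>s\<in>S. b s * u s y)) = (\<Sum>y\<in>X. \<Sum>s\<in>S. b s * (M x y * u s y))"
    unfolding sum_distrib_left by (intro sum.cong refl) (simp only: mult_ac)
  also have "\<dots> = (\<Sum>s\<in>S. \<Sum>y\<in>X. b s * (M x y * u s y))" by (rule sum.swap)
  also have "\<dots> = (\<Sum>s\<in>S. b s * (\<Sum>y\<in>X. M x y * u s y))" by (simp only: sum_distrib_left)
  finally show ?thesis using True by (simp add: mat_act_def)
qed (simp add: mat_act_def)

text \<open>A block diagonal matrix representation \<open>D\<close>, with blocks indexed by the fibres of \<open>sh\<close>, whose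
  coefficients inside the blocks form a basis of the space of functions on the group.\<close>

locale coeff_basis =
  fixes G :: "'g monoid" and \<Theta> :: "'t set" and sh :: "'t \<Rightarrow> 's" and D :: "'t \<Rightarrow> 't \<Rightarrow> 'g \<Rightarrow> complex"
  assumes grp: "group G" and finG: "finite (carrier G)" and fin: "finite \<Theta>"
    and D_off: "\<And>s t g. sh s \<noteq> sh t \<Longrightarrow> D s t g = 0"
    and D_mult: "\<And>s t g h. s \<in> \<Theta> \<Longrightarrow> t \<in> \<Theta> \<Longrightarrow> g \<in> carrier G \<Longrightarrow> h \<in> carrier G \<Longrightarrow>
      D s t (g \<otimes>\<^bsub>G\<^esub> h) = (\<Sum>r\<in>\<Theta>. D s r g * D r t h)"
    and D_one: "\<And>s t. s \<in> \<Theta> \<Longrightarrow> t \<in> \<Theta> \<Longrightarrow> D s t \<one>\<^bsub>G\<^esub> = (if s = t then 1 else 0)"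
    and ind: "\<And>a s t. (\<And>g. g \<in> carrier G \<Longrightarrow> (\<Sum>s\<in>\<Theta>. \<Sum>t\<in>\<Theta>. a s t * D s t g) = 0) \<Longrightarrow>
      s \<in> \<Theta> \<Longrightarrow> t \<in> \<Theta> \<Longrightarrow> sh s = sh t \<Longrightarrow> a s t = 0"
    and spn: "\<And>\<phi>. \<exists>a. \<forall>g\<in>carrier G. \<phi> g = (\<Sum>s\<in>\<Theta>. \<Sum>t\<in>\<Theta>. a s t * D s t g)"
begin

definition fib :: "'s \<Rightarrow> 't set" where
  "fib \<alpha> = {t \<in> \<Theta>. sh t = \<alpha>}"

definition blk_char :: "'s \<Rightarrow> 'g \<Rightarrow> complex" where
  "blk_char \<alpha> = (\<lambda>g. if g \<in> carrier G then (\<Sum>s\<in>fib \<alpha>. D s s g) else 0)"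

lemma finite_fib [simp]: "finite (fib \<alpha>)"
  using fin by (simp add: fib_def)

lemma ind_eq:
  assumes "\<And>g. g \<in> carrier G \<Longrightarrow> (\<Sum>s\<in>\<Theta>. \<Sum>t\<in>\<Theta>. a s t * D s t g) = (\<Sum>s\<in>\<Theta>. \<Sum>t\<in>\<Theta>. b s t * D s t g)"
    "s \<in> \<Theta>" "t \<in> \<Theta>" "sh s = sh t"
  shows "a s t = b s t"
proof -
  have "(\<Sum>s\<in>\<Theta>. \<Sum>t\<in>\<Theta>. (a s t - b s t) * D s t g) = 0" if "g \<in> carrier G" for g
    using assms(1)[OF that] by (simp only: left_diff_distrib sum_subtractf diff_self)
  from ind[OF this assms(2-4)] show ?thesis by simp
qed

text \<open>Comparing the coefficients of \<open>D s t g * D u v h\<close> in the multiplicativity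
  of \<open>\<rho>\<close> shows that the coefficient matrices \<open>A s t\<close> inside the
  blocks multiply like matrix units; the value at the unit shows that the diagonal ones add up to
  the identity.\<close>

lemma rep_expand:
  assumes rep: "is_rep G X \<rho>"
  obtains A where "\<And>x y g. x \<in> X \<Longrightarrow> y \<in> X \<Longrightarrow> g \<in> carrier G \<Longrightarrow> \<rho> g x y = (\<Sum>s\<in>\<Theta>. \<Sum>t\<in>\<Theta>. A s t x y * D s t g)"
    and "\<And>s t u v x y. s \<in> \<Theta> \<Longrightarrow> t \<in> \<Theta> \<Longrightarrow> u \<in> \<Theta> \<Longrightarrow> v \<in> \<Theta> \<Longrightarrow> sh s = sh t \<Longrightarrow> sh u = sh v \<Longrightarrow> x \<in> X \<Longrightarrow> y \<in> X \<Longrightarrow>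
      (\<Sum>z\<in>X. A s t x z * A u v z y) = (if t = u then A s v x y else 0)"
    and "\<And>x y. x \<in> X \<Longrightarrow> y \<in> X \<Longrightarrow> (\<Sum>t\<in>\<Theta>. A t t x y) = (if x = y then 1 else 0)"
proof -
  have "\<forall>p. \<exists>a. \<forall>g\<in>carrier G. \<rho> g (fst p) (snd p) = (\<Sum>s\<in>\<Theta>. \<Sum>t\<in>\<Theta>. a s t * D s t g)"
    by (intro allI spn)
  from choice[OF this] obtain A' where
    A': "\<forall>p. \<forall>g\<in>carrier G. \<rho> g (fst p) (snd p) = (\<Sum>s\<in>\<Theta>. \<Sum>t\<in>\<Theta>. A' p s t * D s t g)" ..
  define A where "A = (\<lambda>s t x y. A' (x, y) s t)"
  have A: "\<rho> g x y = (\<Sum>s\<in>\<Theta>. \<Sum>t\<in>\<Theta>. A s t x y * D s t g)" if "g \<in> carrier G" for x y g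
    using A'[rule_format, OF that, of "(x, y)"] by (simp add: A_def)
  have mult: "(\<Sum>z\<in>X. A s t x z * A u v z y) = (if t = u then A s v x y else 0)"
    if st: "s \<in> \<Theta>" "t \<in> \<Theta>" "u \<in> \<Theta>" "v \<in> \<Theta>" "sh s = sh t" "sh u = sh v" and xy: "x \<in> X" "y \<in> X" for s t u v x y
  proof -
    \<comment> \<open>The coefficients in g are compared first, for fixed h; those in h are compared
      afterwards.\<close>
    have 1: "(\<Sum>u\<in>\<Theta>. \<Sum>v\<in>\<Theta>. (\<Sum>z\<in>X. A s t x z * A u v z y) * D u v h) = (\<Sum>v\<in>\<Theta>. A s v x y * D t v h)"
      if st: "s \<in> \<Theta>" "t \<in> \<Theta>" "sh s = sh t" and h: "h \<in> carrier G" for s t h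
    proof (rule ind_eq[OF _ st])
      fix g assume g: "g \<in> carrier G"
      have gh: "g \<otimes>\<^bsub>G\<^esub> h \<in> carrier G" using monoid.m_closed[OF group.is_monoid[OF grp] g h] .
      have "\<rho> (g \<otimes>\<^bsub>G\<^esub> h) x y = (\<Sum>z\<in>X. \<rho> g x z * \<rho> h z y)"
        using rep g h xy unfolding is_rep_def by blast
      also have "\<dots> = (\<Sum>z\<in>X. (\<Sum>s\<in>\<Theta>. \<Sum>t\<in>\<Theta>. A s t x z * D s t g) * \<rho> h z y)"
        by (simp only: A[OF g])
      also have "\<dots> = (\<Sum>z\<in>X. \<Sum>s\<in>\<Theta>. \<Sum>t\<in>\<Theta>. A s t x z * \<rho> h z y * D s t g)"
        unfolding sum_distrib_right by (intro sum.cong refl) (simp only: mult_ac)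
      also have "\<dots> = (\<Sum>s\<in>\<Theta>. \<Sum>t\<in>\<Theta>. \<Sum>z\<in>X. A s t x z * \<rho> h z y * D s t g)" by (rule sum_rotate)
      also have "\<dots> = (\<Sum>s\<in>\<Theta>. \<Sum>t\<in>\<Theta>. (\<Sum>u\<in>\<Theta>. \<Sum>v\<in>\<Theta>. (\<Sum>z\<in>X. A s t x z * A u v z y) * D u v h) * D s t g)"
      proof (intro sum.cong refl)
        fix s t assume "s \<in> \<Theta>" "t \<in> \<Theta>"
        have "(\<Sum>z\<in>X. A s t x z * \<rho> h z y * D s t g) = (\<Sum>z\<in>X. A s t x z * (\<Sum>u\<in>\<Theta>. \<Sum>v\<in>\<Theta>. A u v z y * D u v h)) * D s t g"
          by (simp only: A[OF h] sum_distrib_right)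
        also have "(\<Sum>z\<in>X. A s t x z * (\<Sum>u\<in>\<Theta>. \<Sum>v\<in>\<Theta>. A u v z y * D u v h)) =
          (\<Sum>z\<in>X. \<Sum>u\<in>\<Theta>. \<Sum>v\<in>\<Theta>. A s t x z * A u v z y * D u v h)"
          unfolding sum_distrib_left by (simp only: mult.assoc)
        also have "\<dots> = (\<Sum>u\<in>\<Theta>. \<Sum>v\<in>\<Theta>. \<Sum>z\<in>X. A s t x z * A u v z y * D u v h)" by (rule sum_rotate)
        also have "\<dots> = (\<Sum>u\<in>\<Theta>. \<Sum>v\<in>\<Theta>. (\<Sum>z\<in>X. A s t x z * A u v z y) * D u v h)"
          by (simp only: sum_distrib_right)
        finally show "(\<Sum>z\<in>X. A s t x z * \<rho> h z y * D s t g) =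
          (\<Sum>u\<in>\<Theta>. \<Sum>v\<in>\<Theta>. (\<Sum>z\<in>X. A s t x z * A u v z y) * D u v h) * D s t g" .
      qed
      finally have L: "\<rho> (g \<otimes>\<^bsub>G\<^esub> h) x y = (\<Sum>s\<in>\<Theta>. \<Sum>t\<in>\<Theta>. (\<Sum>u\<in>\<Theta>. \<Sum>v\<in>\<Theta>. (\<Sum>z\<in>X. A s t x z * A u v z y) * D u v h) * D s t g)" .
      have "\<rho> (g \<otimes>\<^bsub>G\<^esub> h) x y = (\<Sum>s\<in>\<Theta>. \<Sum>v\<in>\<Theta>. A s v x y * (\<Sum>r\<in>\<Theta>. D s r g * D r v h))"
        unfolding A[OF gh] by (intro sum.cong refl arg_cong2[where f = "(*)"] D_mult g h)
      also have "\<dots> = (\<Sum>s\<in>\<Theta>. \<Sum>v\<in>\<Theta>. \<Sum>t\<in>\<Theta>. A s v x y * D t v h * D s t g)"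
        unfolding sum_distrib_left by (intro sum.cong refl) (simp only: mult_ac)
      also have "\<dots> = (\<Sum>s\<in>\<Theta>. \<Sum>t\<in>\<Theta>. \<Sum>v\<in>\<Theta>. A s v x y * D t v h * D s t g)"
        by (rule sum.cong[OF refl], rule sum.swap)
      also have "\<dots> = (\<Sum>s\<in>\<Theta>. \<Sum>t\<in>\<Theta>. (\<Sum>v\<in>\<Theta>. A s v x y * D t v h) * D s t g)"
        by (simp only: sum_distrib_right)
      finally show "(\<Sum>s\<in>\<Theta>. \<Sum>t\<in>\<Theta>. (\<Sum>u\<in>\<Theta>. \<Sum>v\<in>\<Theta>. (\<Sum>z\<in>X. A s t x z * A u v z y) * D u v h) * D s t g) =
        (\<Sum>s\<in>\<Theta>. \<Sum>t\<in>\<Theta>. (\<Sum>v\<in>\<Theta>. A s v x y * D t v h) * D s t g)" unfolding L[symmetric] .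
    qed
    show ?thesis
    proof (rule ind_eq[where a = "\<lambda>u v. \<Sum>z\<in>X. A s t x z * A u v z y" and b = "\<lambda>u v. if t = u then A s v x y else 0", OF _ st(3,4,6)])
      fix h assume h: "h \<in> carrier G"
      have "(\<Sum>u\<in>\<Theta>. \<Sum>v\<in>\<Theta>. (if t = u then A s v x y else 0) * D u v h) =
        (\<Sum>u\<in>\<Theta>. if t = u then (\<Sum>v\<in>\<Theta>. A s v x y * D u v h) else 0)"
        by (intro sum.cong refl) auto
      also have "\<dots> = (\<Sum>v\<in>\<Theta>. A s v x y * D t v h)" using fin st(2) by simp
      finally show "(\<Sum>u\<in>\<Theta>. \<Sum>v\<in>\<Theta>. (\<Sum>z\<in>X. A s t x z * A u v z y) * D u v h) =
        (\<Sum>u\<in>\<Theta>. \<Sum>v\<in>\<Theta>. (if t = u then A s v x y else 0) * D u v h)"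
        using 1[OF st(1,2,5) h] by (simp only:)
    qed
  qed
  have unit: "(\<Sum>t\<in>\<Theta>. A t t x y) = (if x = y then 1 else 0)" if xy: "x \<in> X" "y \<in> X" for x y
  proof -
    have o: "\<one>\<^bsub>G\<^esub> \<in> carrier G" using monoid.one_closed[OF group.is_monoid[OF grp]] .
    have "\<rho> \<one>\<^bsub>G\<^esub> x y = (\<Sum>s\<in>\<Theta>. \<Sum>t\<in>\<Theta>. A s t x y * (if s = t then 1 else 0))"
      unfolding A[OF o] by (intro sum.cong refl arg_cong2[where f = "(*)"] D_one)
    also have "\<dots> = (\<Sum>s\<in>\<Theta>. A s s x y)"
    proof (rule sum.cong[OF refl])
      fix s assume "s \<in> \<Theta>"
      have "(\<Sum>t\<in>\<Theta>. A s t x y * (if s = t then 1 else 0)) = (\<Sum>t\<in>\<Theta>. if s = t then A s t x y else 0)"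
        by (rule sum.cong) auto
      then show "(\<Sum>t\<in>\<Theta>. A s t x y * (if s = t then 1 else 0)) = A s s x y" using fin \<open>s \<in> \<Theta>\<close> by simp
    qed
    finally show ?thesis using rep xy unfolding is_rep_def by simp
  qed
  show thesis by (rule that[of A]) (use A mult unit in blast)+
qed

text \<open>The vectors u form a basis on which the group acts by the block \<open>\<alpha>\<close>
  of D; in other words, u is an isomorphism from the block module.\<close>

definition adapted :: "'x set \<Rightarrow> ('g \<Rightarrow> 'x \<Rightarrow> 'x \<Rightarrow> complex) \<Rightarrow> 's \<Rightarrow> ('t \<Rightarrow> 'x \<Rightarrow> complex) \<Rightarrow> bool" where
  "adapted X \<rho> \<alpha> u \<longleftrightarrow> (\<forall>s\<in>fib \<alpha>. u s \<in> coord_space X) \<and>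
     (\<forall>g\<in>carrier G. \<forall>s\<in>fib \<alpha>. \<forall>x. mat_act X (\<rho> g) (u s) x = (\<Sum>r\<in>fib \<alpha>. D r s g * u r x)) \<and>
     (\<forall>b. (\<forall>x. (\<Sum>s\<in>fib \<alpha>. b s * u s x) = 0) \<longrightarrow> (\<forall>s\<in>fib \<alpha>. b s = 0)) \<and>
     (\<forall>f\<in>coord_space X. \<exists>b. \<forall>x. f x = (\<Sum>s\<in>fib \<alpha>. b s * u s x))"

text \<open>Some \<open>A t t\<close> has a nonzero diagonal entry, because these matrices add up to
  the identity. The columns of the \<open>A s t\<close> at this position span a nonzero submodule
  that carries the block of t, and irreducibility makes it everything.\<close>

lemma irreducible_adapted:
  assumes rep: "is_rep G X \<rho>" and irr: "irreducible_on (carrier G) X \<rho>"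
  shows "\<exists>\<alpha>\<in>sh ` \<Theta>. \<exists>u. adapted X \<rho> \<alpha> u"
proof -
  obtain A where A: "\<And>x y g. x \<in> X \<Longrightarrow> y \<in> X \<Longrightarrow> g \<in> carrier G \<Longrightarrow> \<rho> g x y = (\<Sum>s\<in>\<Theta>. \<Sum>t\<in>\<Theta>. A s t x y * D s t g)"
    and mult: "\<And>s t u v x y. s \<in> \<Theta> \<Longrightarrow> t \<in> \<Theta> \<Longrightarrow> u \<in> \<Theta> \<Longrightarrow> v \<in> \<Theta> \<Longrightarrow> sh s = sh t \<Longrightarrow> sh u = sh v \<Longrightarrow> x \<in> X \<Longrightarrow> y \<in> X \<Longrightarrow>
      (\<Sum>z\<in>X. A s t x z * A u v z y) = (if t = u then A s v x y else 0)"
    and unit: "\<And>x y. x \<in> X \<Longrightarrow> y \<in> X \<Longrightarrow> (\<Sum>t\<in>\<Theta>. A t t x y) = (if x = y then 1 else 0)"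
    by (rule rep_expand[OF rep]) blast
  have finX: "finite X" using rep by (simp add: is_rep_def)
  obtain x0 where x0: "x0 \<in> X" using irr by (auto simp: irreducible_on_def)
  have "(\<Sum>t\<in>\<Theta>. A t t x0 x0) \<noteq> 0" using unit[OF x0 x0] by simp
  then obtain t where t: "t \<in> \<Theta>" "A t t x0 x0 \<noteq> 0" using sum.not_neutral_contains_not_neutral by blast
  let ?\<alpha> = "sh t"
  define u where "u = (\<lambda>s z. if z \<in> X then A s t z x0 else 0)"
  have uc: "u s \<in> coord_space X" for s by (simp add: u_def coord_space_def)
  have act: "mat_act X (\<rho> g) (u s) x = (\<Sum>r\<in>fib ?\<alpha>. D r s g * u r x)" if g: "g \<in> carrier G" and s: "s \<in> fib ?\<alpha>" for g s x
  proof (cases "x \<in> X")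
    case True
    have s': "s \<in> \<Theta>" "sh s = sh t" using s by (simp_all add: fib_def)
    have "mat_act X (\<rho> g) (u s) x = (\<Sum>z\<in>X. (\<Sum>p\<in>\<Theta>. \<Sum>q\<in>\<Theta>. A p q x z * D p q g) * A s t z x0)"
      using True by (simp add: mat_act_def u_def A[OF _ _ g])
    also have "\<dots> = (\<Sum>z\<in>X. \<Sum>p\<in>\<Theta>. \<Sum>q\<in>\<Theta>. D p q g * (A p q x z * A s t z x0))"
      unfolding sum_distrib_right by (intro sum.cong refl) (simp only: mult_ac)
    also have "\<dots> = (\<Sum>p\<in>\<Theta>. \<Sum>q\<in>\<Theta>. \<Sum>z\<in>X. D p q g * (A p q x z * A s t z x0))" by (rule sum_rotate)
    also have "\<dots> = (\<Sum>p\<in>\<Theta>. \<Sum>q\<in>\<Theta>. if q = s then D p s g * A p t x x0 else 0)"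
    proof (intro sum.cong refl)
      fix p q assume pq: "p \<in> \<Theta>" "q \<in> \<Theta>"
      show "(\<Sum>z\<in>X. D p q g * (A p q x z * A s t z x0)) = (if q = s then D p s g * A p t x x0 else 0)"
      proof (cases "sh p = sh q")
        case True2: True
        show ?thesis
          unfolding sum_distrib_left[symmetric] mult[OF pq s'(1) t(1) True2 s'(2) True x0] by simp
      next
        case False
        have "D p q g = 0" by (rule D_off[OF False])
        then show ?thesis by auto
      qed
    qed
    also have "\<dots> = (\<Sum>p\<in>\<Theta>. D p s g * A p t x x0)" using fin s'(1) by simp
    also have "\<dots> = (\<Sum>p\<in>fib ?\<alpha>. D p s g * A p t x x0)"
      using fin s'(2) D_off[of _ s g] by (intro sum.mono_neutral_right) (auto simp: fib_def)
    finally show ?thesis using True by (simp add: u_def)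
  next
    case False
    then show ?thesis by (simp add: mat_act_def u_def)
  qed
  have ind_u: "b s = 0" if b: "\<And>x. (\<Sum>s\<in>fib ?\<alpha>. b s * u s x) = 0" and s: "s \<in> fib ?\<alpha>" for b s
  proof -
    have s': "s \<in> \<Theta>" "sh s = sh t" using s by (simp_all add: fib_def)
    \<comment> \<open>Applying the matrix unit \<open>A t s\<close> to the relation isolates its
      s-th coefficient.\<close>
    have "0 = (\<Sum>z\<in>X. A t s x0 z * (\<Sum>r\<in>fib ?\<alpha>. b r * u r z))" unfolding b by simp
    also have "\<dots> = (\<Sum>z\<in>X. \<Sum>r\<in>fib ?\<alpha>. b r * (A t s x0 z * A r t z x0))"
      unfolding sum_distrib_left by (intro sum.cong refl) (simp add: u_def)
    also have "\<dots> = (\<Sum>r\<in>fib ?\<alpha>. \<Sum>z\<in>X. b r * (A t s x0 z * A r t z x0))" by (rule sum.swap)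
    also have "\<dots> = (\<Sum>r\<in>fib ?\<alpha>. if s = r then b r * A t t x0 x0 else 0)"
    proof (rule sum.cong[OF refl])
      fix r assume "r \<in> fib ?\<alpha>"
      then have r: "r \<in> \<Theta>" "sh r = sh t" by (simp_all add: fib_def)
      show "(\<Sum>z\<in>X. b r * (A t s x0 z * A r t z x0)) = (if s = r then b r * A t t x0 x0 else 0)"
        unfolding sum_distrib_left[symmetric] mult[OF t(1) s'(1) r(1) t(1) s'(2)[symmetric] r(2) x0 x0] by simp
    qed
    also have "\<dots> = b s * A t t x0 x0" using s by simp
    finally show "b s = 0" using t(2) by simp
  qed
  define W where "W = fn.span (u ` fib ?\<alpha>)"
  have sub: "submod (carrier G) X \<rho> W"
    unfolding submod_def
  proof (intro conjI ballI)
    show "fn.subspace W" unfolding W_def by (rule fn.subspace_span)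
    show "W \<subseteq> coord_space X" unfolding W_def by (rule fn.span_minimal[OF _ subspace_coord_space]) (use uc in blast)
    fix g f assume g: "g \<in> carrier G" and f: "f \<in> W"
    show "mat_act X (\<rho> g) f \<in> W"
      unfolding W_def
    proof (rule subspace_preimage_add[OF fn.subspace_span _ mat_act_add mat_act_scale f[unfolded W_def]])
      fix h assume "h \<in> u ` fib ?\<alpha>"
      then obtain s where s: "s \<in> fib ?\<alpha>" "h = u s" by blast
      have "mat_act X (\<rho> g) h = (\<Sum>r\<in>fib ?\<alpha>. fscale (D r s g) (u r))"
        by (rule ext) (simp only: fn_sum_apply fscale_def act[OF g s(1)] s(2))
      then show "mat_act X (\<rho> g) h \<in> fn.span (u ` fib ?\<alpha>)"
        by (simp only:) (intro fn.span_sum fn.span_scale fn.span_base imageI)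
    qed
  qed
  have "u t \<in> W" unfolding W_def using t(1) by (intro fn.span_base imageI) (simp add: fib_def)
  moreover have "u t x0 \<noteq> 0" using t(2) x0 by (simp add: u_def)
  ultimately have "W \<noteq> {0}" by auto
  then have W: "fn.span (u ` fib ?\<alpha>) = coord_space X"
    using conjunct2[OF irr[unfolded irreducible_on_def], rule_format, OF sub] unfolding W_def by simp
  have "\<exists>b. \<forall>x. f x = (\<Sum>s\<in>fib ?\<alpha>. b s * u s x)" if f: "f \<in> coord_space X" for f
  proof -
    have "\<exists>b. f = (\<Sum>s\<in>fib ?\<alpha>. fscale (b s) (u s))"
      by (rule fn_span_image[OF finite_fib]) (simp only: W f)
    then obtain b where "f = (\<Sum>s\<in>fib ?\<alpha>. fscale (b s) (u s))" ..
    then show ?thesis by (intro exI[of _ b]) (simp only: fn_sum_apply fscale_def simp_thms)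
  qed
  then have "adapted X \<rho> ?\<alpha> u" unfolding adapted_def using uc act ind_u by blast
  then show ?thesis using t(1) by blast
qed

lemma adapted_char:
  assumes rep: "is_rep G X \<rho>" and u: "adapted X \<rho> \<alpha> u"
  shows "rep_char G X \<rho> = blk_char \<alpha>"
proof
  fix g
  show "rep_char G X \<rho> g = blk_char \<alpha> g"
  proof (cases "g \<in> carrier G")
    case True
    have finX: "finite X" using rep by (simp add: is_rep_def)
    let ?\<Phi> = "\<lambda>x z. if z = x then 1 else (0::complex)"
    have sp: "\<exists>b. \<forall>x. f x = (\<Sum>s\<in>fib \<alpha>. b s * u s x)" if "f \<in> coord_space X" for f
      using u that unfolding adapted_def by blast
    have "\<forall>x. \<exists>b. x \<in> X \<longrightarrow> (\<forall>z. ?\<Phi> x z = (\<Sum>s\<in>fib \<alpha>. b s * u s z))"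
    proof
      fix x
      show "\<exists>b. x \<in> X \<longrightarrow> (\<forall>z. ?\<Phi> x z = (\<Sum>s\<in>fib \<alpha>. b s * u s z))"
      proof (cases "x \<in> X")
        case True
        then have "?\<Phi> x \<in> coord_space X" by (auto simp: coord_space_def)
        from sp[OF this] show ?thesis by simp
      qed simp
    qed
    from choice[OF this] obtain p where p: "\<forall>x. x \<in> X \<longrightarrow> (\<forall>z. ?\<Phi> x z = (\<Sum>s\<in>fib \<alpha>. p x s * u s z))" ..
    have "(\<Sum>x\<in>X. \<rho> g x x) = (\<Sum>s\<in>fib \<alpha>. D s s g)"
    proof (rule trace_change_of_basis[where \<Phi> = ?\<Phi> and v = u and P = "\<lambda>s x. p x s" and Q = "\<lambda>x s. u s x" and R = "\<rho> g" and D = "\<lambda>r s. D r s g" and g = "mat_act X (\<rho> g)"])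
      show "finite X" "finite (fib \<alpha>)" using finX by simp_all
    next
      fix a assume "\<And>z. (\<Sum>x\<in>X. a x * ?\<Phi> x z) = 0"
      moreover have "(\<Sum>x\<in>X. a x * ?\<Phi> x z) = a z" if "z \<in> X" for z
      proof -
        have "(\<Sum>x\<in>X. a x * ?\<Phi> x z) = (\<Sum>x\<in>X. if z = x then a x else 0)" by (rule sum.cong) auto
        then show ?thesis using finX that by simp
      qed
      ultimately show "\<forall>x\<in>X. a x = 0" by simp
    next
      fix a assume "\<And>z. (\<Sum>s\<in>fib \<alpha>. a s * u s z) = 0"
      then show "\<forall>s\<in>fib \<alpha>. a s = 0" using u unfolding adapted_def by blast
    next
      fix x z assume "x \<in> X"
      then show "?\<Phi> x z = (\<Sum>s\<in>fib \<alpha>. p x s * u s z)" using p by blast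
    next
      fix s z assume "s \<in> fib \<alpha>"
      then have c: "u s \<in> coord_space X" using u unfolding adapted_def by blast
      have "(\<Sum>x\<in>X. u s x * ?\<Phi> x z) = (\<Sum>x\<in>X. if z = x then u s x else 0)" by (rule sum.cong) auto
      also have "\<dots> = u s z" using finX c by (simp add: coord_space_def)
      finally show "u s z = (\<Sum>x\<in>X. u s x * ?\<Phi> x z)" by (rule sym)
    next
      fix x z assume x: "x \<in> X"
      have "?\<Phi> x = (\<lambda>z. \<Sum>s\<in>fib \<alpha>. p x s * u s z)" using p x by (intro ext) blast
      then show "mat_act X (\<rho> g) (?\<Phi> x) z = (\<Sum>s\<in>fib \<alpha>. p x s * mat_act X (\<rho> g) (u s) z)"
        by (simp only: mat_act_sum)
    next
      fix x' z assume x': "x' \<in> X"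
      have "(\<Sum>x\<in>X. \<rho> g x x' * ?\<Phi> x z) = (\<Sum>x\<in>X. if z = x then \<rho> g x x' else 0)" by (rule sum.cong) auto
      also have "\<dots> = (if z \<in> X then \<rho> g z x' else 0)" using finX by simp
      also have "\<dots> = mat_act X (\<rho> g) (?\<Phi> x') z"
      proof -
        have "(\<Sum>y\<in>X. \<rho> g z y * ?\<Phi> x' y) = (\<Sum>y\<in>X. if y = x' then \<rho> g z y else 0)" by (rule sum.cong) auto
        then show ?thesis using finX x' by (simp add: mat_act_def)
      qed
      finally show "mat_act X (\<rho> g) (?\<Phi> x') z = (\<Sum>x\<in>X. \<rho> g x x' * ?\<Phi> x z)" by (rule sym)
    next
      fix s z assume "s \<in> fib \<alpha>"
      then show "mat_act X (\<rho> g) (u s) z = (\<Sum>r\<in>fib \<alpha>. D r s g * u r z)" using u True unfolding adapted_def by blast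
    qed
    then show ?thesis using True by (simp add: rep_char_def blk_char_def)
  qed (simp add: rep_char_def blk_char_def)
qed

text \<open>\<open>E s t g\<close> is the coefficient at \<open>D s t\<close> of the indicator
  function of g. Writing \<open>D u v\<close> as the sum of its values times indicators gives the
  duality.\<close>

lemma ex_dual:
  obtains E where "\<And>s t u v. s \<in> \<Theta> \<Longrightarrow> t \<in> \<Theta> \<Longrightarrow> sh s = sh t \<Longrightarrow> u \<in> \<Theta> \<Longrightarrow> v \<in> \<Theta> \<Longrightarrow>
    (\<Sum>g\<in>carrier G. E s t g * D u v g) = (if s = u \<and> t = v then 1 else 0)"
proof -
  have "\<forall>g. \<exists>a. \<forall>h\<in>carrier G. (if h = g then 1 else 0) = (\<Sum>s\<in>\<Theta>. \<Sum>t\<in>\<Theta>. a s t * D s t h)"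
    by (rule allI) (rule spn)
  from choice[OF this] obtain B where
    B: "\<forall>g. \<forall>h\<in>carrier G. (if h = g then 1 else 0) = (\<Sum>s\<in>\<Theta>. \<Sum>t\<in>\<Theta>. B g s t * D s t h)" ..
  show thesis
  proof (rule that[of "\<lambda>s t g. B g s t"])
    fix s t u v assume st: "s \<in> \<Theta>" "t \<in> \<Theta>" "sh s = sh t" and uv: "u \<in> \<Theta>" "v \<in> \<Theta>"
    show "(\<Sum>g\<in>carrier G. B g s t * D u v g) = (if s = u \<and> t = v then 1 else 0)"
    proof (rule ind_eq[where a = "\<lambda>s t. \<Sum>g\<in>carrier G. B g s t * D u v g" and b = "\<lambda>s t. if s = u \<and> t = v then 1 else 0", OF _ st])
      fix h assume h: "h \<in> carrier G"
      have "(\<Sum>s\<in>\<Theta>. \<Sum>t\<in>\<Theta>. (\<Sum>g\<in>carrier G. B g s t * D u v g) * D s t h) =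
        (\<Sum>s\<in>\<Theta>. \<Sum>t\<in>\<Theta>. \<Sum>g\<in>carrier G. D u v g * (B g s t * D s t h))"
        unfolding sum_distrib_right by (intro sum.cong refl) (simp only: mult_ac)
      also have "\<dots> = (\<Sum>s\<in>\<Theta>. \<Sum>g\<in>carrier G. \<Sum>t\<in>\<Theta>. D u v g * (B g s t * D s t h))"
        by (rule sum.cong[OF refl], rule sum.swap)
      also have "\<dots> = (\<Sum>g\<in>carrier G. \<Sum>s\<in>\<Theta>. \<Sum>t\<in>\<Theta>. D u v g * (B g s t * D s t h))" by (rule sum.swap)
      also have "\<dots> = (\<Sum>g\<in>carrier G. D u v g * (if h = g then 1 else 0))"
        unfolding B[rule_format, OF h] by (simp only: sum_distrib_left)
      also have "\<dots> = (\<Sum>g\<in>carrier G. if h = g then D u v g else 0)" by (rule sum.cong) auto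
      also have "\<dots> = D u v h" using finG h by simp
      also have "\<dots> = (\<Sum>s\<in>\<Theta>. if s = u then (\<Sum>t\<in>\<Theta>. if t = v then D s t h else 0) else 0)"
        using fin uv by simp
      also have "\<dots> = (\<Sum>s\<in>\<Theta>. \<Sum>t\<in>\<Theta>. (if s = u \<and> t = v then 1 else 0) * D s t h)"
        by (intro sum.cong refl) (auto intro!: sum.cong)
      finally show "(\<Sum>s\<in>\<Theta>. \<Sum>t\<in>\<Theta>. (\<Sum>g\<in>carrier G. B g s t * D u v g) * D s t h) =
        (\<Sum>s\<in>\<Theta>. \<Sum>t\<in>\<Theta>. (if s = u \<and> t = v then 1 else 0) * D s t h)" .
    qed
  qed
qed

lemma blk_char_in_Irr:
  assumes \<alpha>: "\<alpha> \<in> sh ` \<Theta>"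
  shows "blk_char \<alpha> \<in> Irr G"
proof -
  define d where "d = card (fib \<alpha>)"
  \<comment> \<open>\<open>Irr\<close> asks for a representation on an initial segment of the
    naturals, so the block is renumbered.\<close>
  obtain \<iota> where \<iota>: "bij_betw \<iota> {..<d} (fib \<alpha>)"
    using ex_bij_betw_nat_finite[OF finite_fib[of \<alpha>]] by (auto simp: d_def atLeast0LessThan)
  have \<iota>T: "\<iota> x \<in> fib \<alpha>" "\<iota> x \<in> \<Theta>" "sh (\<iota> x) = \<alpha>" if "x < d" for x
    using \<iota> that by (auto simp: bij_betw_def fib_def)
  have \<iota>i: "\<iota> x = \<iota> y \<longleftrightarrow> x = y" if "x < d" "y < d" for x y
    using \<iota> that by (auto simp: bij_betw_def inj_on_def)
  define \<rho> where "\<rho> = (\<lambda>g x y. D (\<iota> x) (\<iota> y) g)"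
  have rep: "is_rep G {..<d} \<rho>"
    unfolding is_rep_def
  proof (intro conjI ballI)
    fix x y assume xy: "x \<in> {..<d}" "y \<in> {..<d}"
    then show "\<rho> \<one>\<^bsub>G\<^esub> x y = (if x = y then 1 else 0)"
      unfolding \<rho>_def using D_one[OF \<iota>T(2)[of x] \<iota>T(2)[of y]] \<iota>i[of x y] by simp
  next
    fix g h x y assume gh: "g \<in> carrier G" "h \<in> carrier G" and xy: "x \<in> {..<d}" "y \<in> {..<d}"
    have "\<rho> (g \<otimes>\<^bsub>G\<^esub> h) x y = (\<Sum>r\<in>\<Theta>. D (\<iota> x) r g * D r (\<iota> y) h)"
      unfolding \<rho>_def using xy by (intro D_mult gh \<iota>T) auto
    also have "\<dots> = (\<Sum>r\<in>fib \<alpha>. D (\<iota> x) r g * D r (\<iota> y) h)"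
    proof (rule sum.mono_neutral_right[OF fin])
      show "\<forall>r\<in>\<Theta> - fib \<alpha>. D (\<iota> x) r g * D r (\<iota> y) h = 0"
      proof
        fix r assume "r \<in> \<Theta> - fib \<alpha>"
        then have "sh (\<iota> x) \<noteq> sh r" using \<iota>T(3)[of x] xy by (auto simp: fib_def)
        from D_off[OF this] show "D (\<iota> x) r g * D r (\<iota> y) h = 0" by simp
      qed
    qed (auto simp: fib_def)
    also have "\<dots> = (\<Sum>z<d. \<rho> g x z * \<rho> h z y)"
      unfolding \<rho>_def by (rule sum.reindex_bij_betw[OF \<iota>, symmetric])
    finally show "\<rho> (g \<otimes>\<^bsub>G\<^esub> h) x y = (\<Sum>z\<in>{..<d}. \<rho> g x z * \<rho> h z y)" .
  qed simp
  obtain E where E: "\<And>s t u v. s \<in> \<Theta> \<Longrightarrow> t \<in> \<Theta> \<Longrightarrow> sh s = sh t \<Longrightarrow> u \<in> \<Theta> \<Longrightarrow> v \<in> \<Theta> \<Longrightarrow>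
    (\<Sum>g\<in>carrier G. E s t g * D u v g) = (if s = u \<and> t = v then 1 else 0)" by (rule ex_dual) blast
  have irr: "irreducible_on (carrier G) {..<d} \<rho>"
    unfolding irreducible_on_def
  proof (intro conjI allI impI)
    have "fib \<alpha> \<noteq> {}" using \<alpha> by (auto simp: fib_def)
    then have "0 < d" by (simp add: d_def card_gt_0_iff)
    then show "{..<d} \<noteq> {}" by (simp add: lessThan_empty_iff)
    fix W assume W: "submod (carrier G) {..<d} \<rho> W"
    have sub: "fn.subspace W" and cs: "W \<subseteq> coord_space {..<d}"
      and st: "\<And>g w. g \<in> carrier G \<Longrightarrow> w \<in> W \<Longrightarrow> mat_act {..<d} (\<rho> g) w \<in> W" using W by (auto simp: submod_def)
    show "W = {0} \<or> W = coord_space {..<d}"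
    proof (cases "W \<subseteq> {0}")
      case True
      then show ?thesis using fn.subspace_0[OF sub] by blast
    next
      case False
      then obtain w where w: "w \<in> W" "w \<noteq> 0" by blast
      then obtain y where "w y \<noteq> 0" by (auto simp: fun_eq_iff)
      then have y: "y < d" "w y \<noteq> 0" using w(1) cs by (auto simp: coord_space_def)
      have unit: "(\<lambda>z. if z = x then 1 else 0) \<in> W" if x: "x < d" for x
      proof -
        \<comment> \<open>The combination of group elements dual to the position (x, y) acts as a
          matrix unit: it sends w to \<open>w y\<close> times the x-th unit vector.\<close>
        let ?f = "\<Sum>g\<in>carrier G. fscale (E (\<iota> x) (\<iota> y) g / w y) (mat_act {..<d} (\<rho> g) w)"
        have "?f \<in> W" by (intro fn.subspace_sum[OF sub] fn.subspace_scale[OF sub] st w(1))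
        moreover have "?f = (\<lambda>z. if z = x then 1 else 0)"
        proof
          fix z
          show "?f z = (if z = x then 1 else 0)"
          proof (cases "z < d")
            case True
            have "?f z = (\<Sum>g\<in>carrier G. E (\<iota> x) (\<iota> y) g / w y * (\<Sum>v<d. D (\<iota> z) (\<iota> v) g * w v))"
              using True by (simp add: fn_sum_apply fscale_def mat_act_def \<rho>_def)
            also have "\<dots> = (\<Sum>g\<in>carrier G. \<Sum>v<d. E (\<iota> x) (\<iota> y) g * D (\<iota> z) (\<iota> v) g * (w v / w y))"
              unfolding sum_distrib_left by (intro sum.cong refl) (simp add: field_simps)
            also have "\<dots> = (\<Sum>v<d. \<Sum>g\<in>carrier G. E (\<iota> x) (\<iota> y) g * D (\<iota> z) (\<iota> v) g * (w v / w y))" by (rule sum.swap)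
            also have "\<dots> = (\<Sum>v<d. if v = y then (if z = x then w v / w y else 0) else 0)"
            proof (rule sum.cong[OF refl])
              fix v assume "v \<in> {..<d}"
              then have v: "v < d" by simp
              show "(\<Sum>g\<in>carrier G. E (\<iota> x) (\<iota> y) g * D (\<iota> z) (\<iota> v) g * (w v / w y)) = (if v = y then (if z = x then w v / w y else 0) else 0)"
                unfolding sum_distrib_right[symmetric]
                using E[OF \<iota>T(2)[OF x] \<iota>T(2)[OF y(1)] _ \<iota>T(2)[OF True] \<iota>T(2)[OF v]] \<iota>T(3)[OF x] \<iota>T(3)[OF y(1)] \<iota>i[OF x True] \<iota>i[OF y(1) v] by auto
            qed
            also have "\<dots> = (if z = x then 1 else 0)" using y by simp
            finally show ?thesis .
          next
            case False
            then show ?thesis using x by (auto simp: fn_sum_apply fscale_def mat_act_def)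
          qed
        qed
        ultimately show ?thesis by simp
      qed
      have "coord_space {..<d} \<subseteq> fn.span ((\<lambda>x y. if y = x then 1 else 0) ` {..<d})" by (rule coord_space_span) simp
      also have "\<dots> \<subseteq> W" by (rule fn.span_minimal[OF _ sub]) (use unit in auto)
      finally show ?thesis using cs by blast
    qed
  qed
  have "blk_char \<alpha> = rep_char G {..<d} \<rho>"
  proof -
    have "(\<Sum>s\<in>fib \<alpha>. D s s g) = (\<Sum>x<d. D (\<iota> x) (\<iota> x) g)" for g
      by (rule sum.reindex_bij_betw[OF \<iota>, symmetric])
    then show ?thesis by (simp only: blk_char_def rep_char_def \<rho>_def)
  qed
  then show ?thesis using rep irr unfolding Irr_def affords_def by blast
qed

lemma Irr_eq: "Irr G = blk_char ` sh ` \<Theta>"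
proof (intro subset_antisym subsetI)
  fix \<chi> assume "\<chi> \<in> Irr G"
  then have "\<exists>d \<rho>. affords G d \<rho> \<chi>" by (simp add: Irr_def)
  then obtain d \<rho> where "affords G d \<rho> \<chi>" by blast
  then have r: "is_rep G {..<d} \<rho>" "irreducible_on (carrier G) {..<d} \<rho>" "\<chi> = rep_char G {..<d} \<rho>"
    by (simp_all add: affords_def)
  obtain \<alpha> u where "\<alpha> \<in> sh ` \<Theta>" "adapted {..<d} \<rho> \<alpha> u" using irreducible_adapted[OF r(1,2)] by blast
  then show "\<chi> \<in> blk_char ` sh ` \<Theta>" using adapted_char[OF r(1)] r(3) by blast
next
  fix \<chi> assume "\<chi> \<in> blk_char ` sh ` \<Theta>"
  then show "\<chi> \<in> Irr G" using blk_char_in_Irr by blast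
qed

text \<open>A block character is a sum of diagonal coefficients of that block only, so independence
  of the coefficients distinguishes the blocks.\<close>

lemma blk_char_inj: "inj_on blk_char (sh ` \<Theta>)"
proof (rule inj_onI)
  fix \<alpha> \<mu> assume \<alpha>: "\<alpha> \<in> sh ` \<Theta>" and "\<mu> \<in> sh ` \<Theta>" and eq: "blk_char \<alpha> = blk_char \<mu>"
  have e: "blk_char \<alpha> g = (\<Sum>s\<in>\<Theta>. \<Sum>t\<in>\<Theta>. (if s = t \<and> sh s = \<alpha> then 1 else 0) * D s t g)" if g: "g \<in> carrier G" for \<alpha> g
  proof -
    have "(\<Sum>s\<in>\<Theta>. \<Sum>t\<in>\<Theta>. (if s = t \<and> sh s = \<alpha> then 1 else 0) * D s t g) =
      (\<Sum>s\<in>\<Theta>. \<Sum>t\<in>\<Theta>. if s = t then (if sh s = \<alpha> then D s t g else 0) else 0)"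
      by (intro sum.cong refl) auto
    also have "\<dots> = (\<Sum>s\<in>\<Theta>. if sh s = \<alpha> then D s s g else 0)" using fin by simp
    also have "\<dots> = (\<Sum>s\<in>fib \<alpha>. D s s g)" unfolding fib_def by (rule sum.inter_filter[symmetric, OF fin])
    finally show ?thesis using g by (simp add: blk_char_def)
  qed
  obtain s where s: "s \<in> \<Theta>" "sh s = \<alpha>" using \<alpha> by blast
  have "(if s = s \<and> sh s = \<alpha> then 1 else 0) = (if s = s \<and> sh s = \<mu> then 1 else (0::complex))"
    by (rule ind_eq[where a = "\<lambda>s t. if s = t \<and> sh s = \<alpha> then 1 else 0" and b = "\<lambda>s t. if s = t \<and> sh s = \<mu> then 1 else 0", OF _ s(1) s(1) refl])
      (simp only: e[symmetric] eq)
  then show "\<alpha> = \<mu>" using s(2) by (simp split: if_splits)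
qed

end

section \<open>The seminormal matrix coefficients\<close>

definition base_vec :: "nat \<Rightarrow> nat \<Rightarrow> box set \<Rightarrow> tvec" where
  "base_vec l n D = (SOME v. \<exists>lam\<in>lparts l n. ldiag lam = D \<and> is_base_vec l n lam v)"

text \<open>Mutual generation with the base vector is part of the choice: all standard vectors of
  one shape then generate the same submodule.\<close>

definition std_vec :: "nat \<Rightarrow> nat \<Rightarrow> (nat \<Rightarrow> box) \<Rightarrow> tvec" where
  "std_vec l n t = (SOME v. wt_of n t v \<and> v \<noteq> 0 \<and> v \<in> gspan l n (base_vec l n (shape n t)) \<and>
    base_vec l n (shape n t) \<in> gspan l n v)"

text \<open>Coordinates with respect to an orthogonal but unnormalized basis. For different shapes
  the quotient vanishes as well, by \<open>act_std_vec\<close> and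
  \<open>std_vec_orthogonal\<close>; writing 0 makes the block form available before this is
  known.\<close>

definition std_coeff :: "nat \<Rightarrow> nat \<Rightarrow> (nat \<Rightarrow> box) \<Rightarrow> (nat \<Rightarrow> box) \<Rightarrow> complex mat \<Rightarrow> complex" where
  "std_coeff l n s t g = (if shape n s = shape n t
     then ip l n (act n g (std_vec l n t)) (std_vec l n s) / ip l n (std_vec l n s) (std_vec l n s) else 0)"

lemma base_vec:
  assumes l: "1 \<le> l" and lam: "lam \<in> lparts l n"
  shows "is_base_vec l n lam (base_vec l n (ldiag lam))"
proof -
  obtain v where "is_base_vec l n lam v" using ex_base_vector[OF l lam] by blast
  then have "\<exists>v. \<exists>mu\<in>lparts l n. ldiag mu = ldiag lam \<and> is_base_vec l n mu v" using lam by blast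
  from someI_ex[OF this] obtain mu where
    mu: "mu \<in> lparts l n" "ldiag mu = ldiag lam" "is_base_vec l n mu (base_vec l n (ldiag lam))"
    unfolding base_vec_def by blast
  have "mu = lam" using mu(1,2) lam by (intro ldiag_inj[of l]) (simp_all add: lparts_def)
  then show ?thesis using mu(3) by simp
qed

lemma std_vec:
  assumes l: "1 \<le> l" and t: "t \<in> Std l n"
  shows "wt_of n t (std_vec l n t)" "std_vec l n t \<noteq> 0"
    "gspan l n (std_vec l n t) = gspan l n (base_vec l n (shape n t))" "std_vec l n t \<in> coord_space (omega l n)"
proof -
  have "shape n t \<in> ldiag ` lparts l n"
    using shape_in_diags[OF t] unfolding bij_betw_imp_surj_on[OF bij_ldiag] .
  then obtain lam where lam: "shape n t = ldiag lam" "lam \<in> lparts l n" by (rule imageE)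
  from base_vec[OF l lam(2)] have "is_base_vec l n lam (base_vec l n (shape n t))" unfolding lam(1) .
  then obtain ts G where b: "wt_of n G (base_vec l n (shape n t))" "base_vec l n (shape n t) \<noteq> 0"
    "base_vec l n (shape n t) \<in> coord_space (omega l n)" "G ` {..<n} = shape n t"
    "\<forall>x y. x < y \<longrightarrow> y < n \<longrightarrow> key (Suc n) (G x) < key (Suc n) (G y)" "\<forall>x\<ge>n. G x = (0, 0, 0)"
    unfolding is_base_vec_def lam(1)[symmetric] by (elim exE conjE) rule
  have "\<exists>v. wt_of n t v \<and> v \<noteq> 0 \<and> v \<in> gspan l n (base_vec l n (shape n t)) \<and> base_vec l n (shape n t) \<in> gspan l n v"
    by (rule ex_weight_vector[OF l b(1,2) _ _ t b(4)[symmetric]]) (use b(5,6) in blast)+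
  from someI_ex[OF this] have v: "wt_of n t (std_vec l n t) \<and> std_vec l n t \<noteq> 0 \<and>
    std_vec l n t \<in> gspan l n (base_vec l n (shape n t)) \<and> base_vec l n (shape n t) \<in> gspan l n (std_vec l n t)"
    unfolding std_vec_def .
  show "wt_of n t (std_vec l n t)" "std_vec l n t \<noteq> 0" using v by blast+
  show "gspan l n (std_vec l n t) = gspan l n (base_vec l n (shape n t))"
    using gspan_trans[OF l, of "std_vec l n t" n] gspan_trans[OF l, of "base_vec l n (shape n t)" n] v by blast
  show "std_vec l n t \<in> coord_space (omega l n)" using gspan_coord[OF l b(3)] v by blast
qed

lemma std_vec_in_gspan: "1 \<le> l \<Longrightarrow> t \<in> Std l n \<Longrightarrow> std_vec l n t \<in> gspan l n (base_vec l n (shape n t))"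
  using self_in_gspan std_vec(3) by blast

lemma std_vec_jm:
  assumes "1 \<le> l" "t \<in> Std l n" "i < n"
  shows "jm_op i (std_vec l n t) = fscale (of_int (content (t i))) (std_vec l n t)"
    "std_vec l n t T \<noteq> 0 \<Longrightarrow> snd (T i) = bcomp (t i)"
  using std_vec(1)[OF assms(1,2)] assms(3) unfolding wt_of_def is_wt_def by blast+

lemma ip_std_vec_self: "1 \<le> l \<Longrightarrow> t \<in> Std l n \<Longrightarrow> ip l n (std_vec l n t) (std_vec l n t) \<noteq> 0"
  using ip_self std_vec(2,4) by blast

text \<open>Contents are integers, so the conjugation in the second argument leaves the eigenvalue
  unchanged.\<close>

lemma ip_jm_right:
  assumes "1 \<le> l" "s \<in> Std l n" "i < n"
  shows "ip l n (jm_op i f) (std_vec l n s) = of_int (content (s i)) * ip l n f (std_vec l n s)"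
proof -
  have "ip l n (jm_op i f) (std_vec l n s) = ip l n f (fscale (of_int (content (s i))) (std_vec l n s))"
    unfolding jm_op_self_adjoint[OF assms(3)] std_vec_jm(1)[OF assms] ..
  also have "\<dots> = cnj (of_int (content (s i)) * ip l n (std_vec l n s) f)"
    by (subst ip_cnj) (simp only: ip_scale)
  also have "\<dots> = of_int (content (s i)) * ip l n f (std_vec l n s)"
    by (subst (2) ip_cnj) simp
  finally show ?thesis .
qed

text \<open>By \<open>Std_eqI\<close> the tableaux differ in a component, and then the supports are
  disjoint, or in a content, and then the vectors belong to different eigenvalues of a self-adjoint
  operator.\<close>

lemma std_vec_orthogonal:
  assumes l: "1 \<le> l" and t: "t \<in> Std l n" and s: "s \<in> Std l n" and "t \<noteq> s"
  shows "ip l n (std_vec l n t) (std_vec l n s) = 0"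
proof -
  obtain i where i: "i < n" "bcomp (t i) \<noteq> bcomp (s i) \<or> content (t i) \<noteq> content (s i)"
    using Std_eqI[OF t s] \<open>t \<noteq> s\<close> by blast
  from i(2) show ?thesis
  proof
    assume b: "bcomp (t i) \<noteq> bcomp (s i)"
    have "std_vec l n t T * cnj (std_vec l n s T) = 0" for T
      by (cases "std_vec l n t T = 0"; cases "std_vec l n s T = 0")
        (use std_vec_jm(2)[OF l t i(1), of T] std_vec_jm(2)[OF l s i(1), of T] b in simp_all)
    then show ?thesis unfolding ip_def by (intro sum.neutral ballI)
  next
    assume c: "content (t i) \<noteq> content (s i)"
    have "of_int (content (t i)) * ip l n (std_vec l n t) (std_vec l n s) =
      of_int (content (s i)) * ip l n (std_vec l n t) (std_vec l n s)"
      unfolding ip_jm_right[OF l s i(1), symmetric] std_vec_jm(1)[OF l t i(1)] ip_scale ..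
    then show ?thesis using c by simp
  qed
qed

lemma ip_sum_std_vec:
  assumes l: "1 \<le> l" and S: "S \<subseteq> Std l n" "s \<in> S"
  shows "ip l n (\<Sum>t\<in>S. fscale (b t) (std_vec l n t)) (std_vec l n s) = b s * ip l n (std_vec l n s) (std_vec l n s)"
proof -
  have fin: "finite S" using S(1) finite_Std by (rule finite_subset)
  have "ip l n (\<Sum>t\<in>S. fscale (b t) (std_vec l n t)) (std_vec l n s) =
    (\<Sum>t\<in>S. b t * ip l n (std_vec l n t) (std_vec l n s))" by (simp only: ip_sum ip_scale)
  also have "\<dots> = (\<Sum>t\<in>S. if t = s then b s * ip l n (std_vec l n s) (std_vec l n s) else 0)"
    using S std_vec_orthogonal[OF l, of _ n s] by (intro sum.cong refl) auto
  also have "\<dots> = b s * ip l n (std_vec l n s) (std_vec l n s)" using fin S(2) by simp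
  finally show ?thesis .
qed

text \<open>If all translates of w are orthogonal to \<open>std_vec l n s\<close>, then w is
  orthogonal to the submodule generated by that vector. This submodule is the one of the base vector
  and so contains w, whose norm is therefore 0.\<close>

lemma gspan_nondegenerate:
  assumes l: "1 \<le> l" and s: "s \<in> Std l n" and w: "w \<in> gspan l n (base_vec l n (shape n s))"
    and 0: "\<And>g. g \<in> GL l n \<Longrightarrow> ip l n (act n g w) (std_vec l n s) = 0"
  shows "w = 0"
proof -
  interpret group "Gl1 l n" by (rule group_Gl1[OF l])
  have wv: "w \<in> gspan l n (std_vec l n s)" using w std_vec(3)[OF l s] by simp
  have "ip l n h w = 0" if "h \<in> gspan l n (std_vec l n s)" for h
    using that unfolding gspan_def
  proof (induction rule: fn.span_induct_alt)
    case base
    show ?case by (simp only: ip_zero)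
  next
    case (step c x y)
    then obtain g where g: "g \<in> GL l n" "x = act n g (std_vec l n s)" by blast
    have "ip l n x w = cnj (ip l n (act n (inv\<^bsub>Gl1 l n\<^esub> g) w) (std_vec l n s))"
      unfolding g(2) by (subst ip_act_swap[OF l g(1)], subst ip_cnj) (rule refl)
    also have "\<dots> = 0" using 0[OF inv_closed[OF g(1)]] by simp
    finally show ?case unfolding ip_add ip_scale using step(2) by simp
  qed
  from this[OF wv] have "ip l n w w = 0" .
  moreover have "w \<in> coord_space (omega l n)"
    using gspan_coord[OF l std_vec(4)[OF l s]] wv by blast
  ultimately show ?thesis by (intro ip_self)
qed

text \<open>Left translation by the reflections and diagonal matrices separates the vectors on the right
  of the inner product.\<close>

lemma left_separation:
  fixes v :: "'k \<Rightarrow> tvec" and s :: "'k \<Rightarrow> nat \<Rightarrow> box"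
  assumes l: "1 \<le> l" and K: "finite K" "\<And>k. k \<in> K \<Longrightarrow> s k \<in> Std l n" and s0: "s0 \<in> Std l n"
    and 0: "\<And>g. g \<in> GL l n \<Longrightarrow> (\<Sum>k\<in>K. ip l n (act n g (v k)) (std_vec l n (s k))) = 0"
    and g: "g \<in> GL l n"
  shows "(\<Sum>k | k \<in> K \<and> s k = s0. ip l n (act n g (v k)) (std_vec l n (s k))) = 0"
proof -
  interpret group "Gl1 l n" by (rule group_Gl1[OF l])
  \<comment> \<open>Z says that the relation survives, for all group elements, after weighting its
    summands by a; R consists of the functions of the tableau by which all such weights may be
    multiplied.\<close>
  define Z where "Z = (\<lambda>a :: 'k \<Rightarrow> complex. \<forall>g\<in>GL l n. (\<Sum>k\<in>K. a k * ip l n (act n g (v k)) (std_vec l n (s k))) = 0)"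
  define R where "R = {r :: (nat \<Rightarrow> box) \<Rightarrow> complex. \<forall>a. Z a \<longrightarrow> Z (\<lambda>k. r (s k) * a k)}"
  have one: "(\<lambda>_. 1) \<in> R" by (simp add: R_def)
  have scale: "(\<lambda>i. z * r i) \<in> R" if "r \<in> R" for r z
  proof -
    have "Z (\<lambda>k. z * r (s k) * a k)" if "Z (\<lambda>k. r (s k) * a k)" for a
      using that by (simp add: Z_def mult.assoc sum_distrib_left[symmetric])
    then show ?thesis using that by (simp add: R_def)
  qed
  have add: "(\<lambda>i. r i + r' i) \<in> R" if "r \<in> R" "r' \<in> R" for r r'
  proof -
    have "Z (\<lambda>k. (r (s k) + r' (s k)) * a k)" if "Z (\<lambda>k. r (s k) * a k)" "Z (\<lambda>k. r' (s k) * a k)" for a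
      using that by (simp add: Z_def distrib_right sum.distrib)
    then show ?thesis using that by (simp add: R_def)
  qed
  have mult: "(\<lambda>i. r i * r' i) \<in> R" if r: "r \<in> R" "r' \<in> R" for r r'
    unfolding R_def
  proof (intro CollectI allI impI)
    fix a assume "Z a"
    then have "Z (\<lambda>k. r' (s k) * a k)" using r(2) unfolding R_def by blast
    then have "Z (\<lambda>k. r (s k) * (r' (s k) * a k))" using r(1) unfolding R_def by blast
    then show "Z (\<lambda>k. r (s k) * r' (s k) * a k)" by (simp only: mult.assoc)
  qed
  have cont: "(\<lambda>t. of_int (content (t i))) \<in> R" if i: "i < n" for i
    unfolding R_def
  proof (intro CollectI allI impI)
    fix a assume Za: "Z a"
    show "Z (\<lambda>k. of_int (content (s k i)) * a k)"
      unfolding Z_def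
    proof
      fix g assume g: "g \<in> GL l n"
      \<comment> \<open>Left translation by all reflections \<open>swap_refl l n i j u\<close> with
        j < i puts l times \<open>jm_op\<close> in front, which by self-adjointness multiplies each
        summand by a content.\<close>
      have swap: "ip l n (\<lambda>T. \<Sum>j<i. \<Sum>u<l. act n (swap_refl l n i j u * g) f T) h = of_nat l * ip l n (jm_op i (act n g f)) h" for f h
      proof -
        have "(\<Sum>j<i. \<Sum>u<l. act n (swap_refl l n i j u * g) f T) = of_nat l * jm_op i (act n g f) T" if "T \<in> omega l n" for T
        proof -
          have "act n (swap_refl l n i j u * g) f = act n (swap_refl l n i j u) (act n g f)" if "j < i" for j u
            using that i by (intro act_mult[OF l] swap_refl_carrier[OF l] g) auto
          then have "(\<Sum>j<i. \<Sum>u<l. act n (swap_refl l n i j u * g) f T) = (\<Sum>j<i. \<Sum>u<l. act n (swap_refl l n i j u) (act n g f) T)" by simp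
          then show ?thesis using sum_act_swap_refl[OF l i that] by (simp only:)
        qed
        then show ?thesis by (simp add: ip_def sum_distrib_left mult.assoc)
      qed
      have lin: "ip l n (\<lambda>T. \<Sum>j<i. \<Sum>u<l. F j u T) h = (\<Sum>j<i. \<Sum>u<l. ip l n (F j u) h)" for F h
      proof -
        have "(\<lambda>T. \<Sum>j<i. \<Sum>u<l. F j u T) = (\<Sum>j<i. \<Sum>u<l. F j u)" by (rule ext) (simp only: fn_sum_apply)
        then show ?thesis by (simp only: ip_sum)
      qed
      have "of_nat l * (\<Sum>k\<in>K. of_int (content (s k i)) * a k * ip l n (act n g (v k)) (std_vec l n (s k))) =
        (\<Sum>k\<in>K. a k * (of_nat l * ip l n (jm_op i (act n g (v k))) (std_vec l n (s k))))"
        unfolding sum_distrib_left by (intro sum.cong refl) (simp add: ip_jm_right[OF l K(2) i])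
      also have "\<dots> = (\<Sum>k\<in>K. \<Sum>j<i. \<Sum>u<l. a k * ip l n (act n (swap_refl l n i j u * g) (v k)) (std_vec l n (s k)))"
        unfolding swap[symmetric] lin by (simp only: sum_distrib_left)
      also have "\<dots> = (\<Sum>j<i. \<Sum>u<l. \<Sum>k\<in>K. a k * ip l n (act n (swap_refl l n i j u * g) (v k)) (std_vec l n (s k)))" by (rule sum_rotate)
      also have "\<dots> = (\<Sum>j<i. \<Sum>u<l. 0)"
      proof (rule sum.cong[OF refl], rule sum.cong[OF refl])
        fix j u assume "j \<in> {..<i}"
        then have "swap_refl l n i j u * g \<in> GL l n"
          using m_closed[OF swap_refl_carrier[OF l i, of j u] g] i by simp
        then show "(\<Sum>k\<in>K. a k * ip l n (act n (swap_refl l n i j u * g) (v k)) (std_vec l n (s k))) = 0"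
          using Za unfolding Z_def by blast
      qed
      finally show "(\<Sum>k\<in>K. of_int (content (s k i)) * a k * ip l n (act n g (v k)) (std_vec l n (s k))) = 0"
        using l by simp
    qed
  qed
  \<comment> \<open>Left translation by a diagonal generator multiplies each summand by a power of
    \<open>zeta l\<close> that determines the component of entry i.\<close>
  have comp: "(\<lambda>t. zeta l ^ (bcomp (t i) - 1)) \<in> R" if i: "i < n" for i
    unfolding R_def
  proof (intro CollectI allI impI)
    fix a assume Za: "Z a"
    show "Z (\<lambda>k. zeta l ^ (bcomp (s k i) - 1) * a k)"
      unfolding Z_def
    proof
      fix g assume g: "g \<in> GL l n"
      have c: "sigma_pow l n i 1 * g \<in> GL l n" using m_closed[OF sigma_pow_carrier[OF l] g] by simp
      have "ip l n (act n (sigma_pow l n i 1 * g) f) (std_vec l n u) = zeta l ^ (bcomp (u i) - 1) * ip l n (act n g f) (std_vec l n u)"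
        if u: "u \<in> Std l n" for f u
      proof -
        have "act n (sigma_pow l n i 1 * g) f T * cnj (std_vec l n u T) =
          zeta l ^ (bcomp (u i) - 1) * (act n g f T * cnj (std_vec l n u T))" for T
        proof (cases "std_vec l n u T = 0")
          case False
          have "act n (sigma_pow l n i 1 * g) f T = zeta l ^ (snd (T i) - 1) * act n g f T"
            unfolding act_mult[OF l sigma_pow_carrier[OF l] g] act_sigma_pow[OF i] by simp
          then show ?thesis using std_vec_jm(2)[OF l u i False] by simp
        qed simp
        then show ?thesis unfolding ip_def sum_distrib_left by (intro sum.cong refl)
      qed
      then have "(\<Sum>k\<in>K. zeta l ^ (bcomp (s k i) - 1) * a k * ip l n (act n g (v k)) (std_vec l n (s k))) =
        (\<Sum>k\<in>K. a k * ip l n (act n (sigma_pow l n i 1 * g) (v k)) (std_vec l n (s k)))"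
        by (intro sum.cong refl) (simp add: K(2))
      also have "\<dots> = 0" using Za c unfolding Z_def by blast
      finally show "(\<Sum>k\<in>K. zeta l ^ (bcomp (s k i) - 1) * a k * ip l n (act n g (v k)) (std_vec l n (s k))) = 0" .
    qed
  qed
  \<comment> \<open>Contents and component phases lie in R and separate standard tableaux, so this
    idempotent is the indicator of \<open>s0\<close>.\<close>
  obtain r where r: "r \<in> R" "\<forall>t\<in>Std l n. r t = (if \<forall>q\<in>R. q t = q s0 then 1 else 0)"
    using separating_idempotent[OF finite_Std s0 one scale add mult] by blast
  have r': "r t = (if t = s0 then 1 else 0)" if t: "t \<in> Std l n" for t
  proof -
    have "t = s0" if eq: "\<forall>q\<in>R. q t = q s0"
    proof (rule Std_eqI[OF t s0])
      fix i assume i: "i < n"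
      have "complex_of_int (content (t i)) = of_int (content (s0 i))" using bspec[OF eq cont[OF i]] .
      moreover have "bcomp (t i) = bcomp (s0 i)"
      proof -
        have b: "1 \<le> bcomp (u i) \<and> bcomp (u i) \<le> l" if "u \<in> Std l n" for u
          using Std_box(5,6)[OF that i, of "fst (u i)" "fst (snd (u i))" "snd (snd (u i))"] by (cases "u i") simp
        have "zeta l ^ (bcomp (t i) - 1) = zeta l ^ (bcomp (s0 i) - 1)" using bspec[OF eq comp[OF i]] .
        then have "bcomp (t i) - 1 = bcomp (s0 i) - 1"
          using b[OF t] b[OF s0] by (intro zeta_pow_inj[OF l]) auto
        then show ?thesis using b[OF t] b[OF s0] by linarith
      qed
      ultimately show "bcomp (t i) = bcomp (s0 i) \<and> content (t i) = content (s0 i)" by simp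
    qed
    then show ?thesis using r(2) t by auto
  qed
  have "Z (\<lambda>_. 1)" using 0 by (simp add: Z_def)
  then have "Z (\<lambda>k. r (s k) * 1)" using r(1) unfolding R_def by blast
  then have "0 = (\<Sum>k\<in>K. r (s k) * 1 * ip l n (act n g (v k)) (std_vec l n (s k)))" using g unfolding Z_def by simp
  also have "\<dots> = (\<Sum>k\<in>K. if s k = s0 then ip l n (act n g (v k)) (std_vec l n (s k)) else 0)"
    by (rule sum.cong[OF refl]) (simp only: r'[OF K(2)] mult_1_left mult_1_right if_distribR mult_zero_left if_distrib[of "\<lambda>z. z * _"] cong: if_cong)
  also have "\<dots> = (\<Sum>k | k \<in> K \<and> s k = s0. ip l n (act n g (v k)) (std_vec l n (s k)))"
    by (rule sum.inter_filter[OF K(1), symmetric])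
  finally show ?thesis by simp
qed

text \<open>At least as many independent functions on X as X has points must span: one more
  independent function would exceed the dimension.\<close>

lemma basis_by_count:
  fixes f :: "'i \<Rightarrow> 'x \<Rightarrow> complex"
  assumes fin: "finite X" "finite I" and le: "card X \<le> card I"
    and ind: "\<And>a. (\<And>x. x \<in> X \<Longrightarrow> (\<Sum>p\<in>I. a p * f p x) = 0) \<Longrightarrow> \<forall>p\<in>I. a p = 0"
  shows "\<exists>a. \<forall>x\<in>X. \<phi> x = (\<Sum>p\<in>I. a p * f p x)"
proof -
  define F where "F = (\<lambda>p x. if x \<in> X then f p x else 0)"
  have "\<forall>p\<in>I. a p = 0" if 0: "\<And>x. (\<Sum>p\<in>I. a p * F p x) = 0" for a
  proof (rule ind)
    fix x assume "x \<in> X"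
    then show "(\<Sum>p\<in>I. a p * f p x) = 0" using 0[of x] by (simp add: F_def)
  qed
  note inj = family_independent(1)[OF fin(2) this] and indep = family_independent(2)[OF fin(2) this]
  have Fc: "F ` I \<subseteq> coord_space X" by (auto simp: F_def coord_space_def)
  define h where "h = (\<lambda>x. if x \<in> X then \<phi> x else 0)"
  have hc: "h \<in> coord_space X" by (simp add: h_def coord_space_def)
  have "h \<in> fn.span (F ` I)"
  proof (rule ccontr)
    assume n: "h \<notin> fn.span (F ` I)"
    then have "h \<notin> F ` I" using fn.span_base by blast
    have "fn.independent (insert h (F ` I))" by (rule fn.independent_insertI[OF n indep])
    then have "card (insert h (F ` I)) \<le> card X" using independent_coord_finite[OF fin(1)] Fc hc by blast
    moreover have "card (insert h (F ` I)) = Suc (card I)"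
      using \<open>h \<notin> F ` I\<close> fin(2) by (simp add: card_image[OF inj])
    ultimately show False using le by simp
  qed
  then obtain u where u: "h = (\<Sum>v\<in>F ` I. fscale (u v) v)"
    using fn.span_finite[of "F ` I"] fin(2) by auto
  have "\<phi> x = (\<Sum>p\<in>I. u (F p) * f p x)" if x: "x \<in> X" for x
  proof -
    have "h = (\<Sum>p\<in>I. fscale (u (F p)) (F p))" using u by (simp add: sum.reindex[OF inj])
    then have "h x = (\<Sum>p\<in>I. fscale (u (F p)) (F p)) x" by simp
    then show ?thesis using x by (simp add: h_def fn_sum_apply fscale_def F_def)
  qed
  then show ?thesis by (intro exI[of _ "\<lambda>p. u (F p)"]) blast
qed

section \<open>The matrix coefficients of the standard vectors form a basis\<close>

definition std_pairs :: "nat \<Rightarrow> nat \<Rightarrow> ((nat \<Rightarrow> box) \<times> (nat \<Rightarrow> box)) set" where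
  "std_pairs l n = {(t, s). t \<in> Std l n \<and> s \<in> Std l n \<and> shape n t = shape n s}"

lemma finite_std_pairs [simp]: "finite (std_pairs l n)"
  by (rule finite_subset[of _ "Std l n \<times> Std l n"]) (auto simp: std_pairs_def)

lemma card_std_pairs: "card (std_pairs l n) = l ^ n * fact n"
proof -
  have "std_pairs l n = (\<Union>D\<in>diags l n. {t \<in> Std l n. shape n t = D} \<times> {t \<in> Std l n. shape n t = D})"
    using shape_in_diags by (auto simp: std_pairs_def)
  then have "card (std_pairs l n) = (\<Sum>D\<in>diags l n. card ({t \<in> Std l n. shape n t = D} \<times> {t \<in> Std l n. shape n t = D}))"
    by (simp only:) (rule card_UN_disjoint, auto)
  also have "\<dots> = (\<Sum>D\<in>diags l n. nstd l D * nstd l D)"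
    by (rule sum.cong) (auto simp: card_cartesian_product nstd_def diags_def)
  finally show ?thesis by (simp add: sum_nstd_squares)
qed

text \<open>\<open>left_separation\<close> fixes the vector of \<open>s0\<close> on the right. What
  remains is a single vector w all of whose translates are orthogonal to
  \<open>std_vec l n s0\<close>; it vanishes by \<open>gspan_nondegenerate\<close>, and
  orthogonality returns the coefficients.\<close>

lemma std_pairs_independent:
  assumes l: "1 \<le> l" and 0: "\<And>g. g \<in> GL l n \<Longrightarrow>
    (\<Sum>p\<in>std_pairs l n. a p * ip l n (act n g (std_vec l n (fst p))) (std_vec l n (snd p))) = 0"
  shows "\<forall>p\<in>std_pairs l n. a p = 0"
proof
  fix p assume "p \<in> std_pairs l n"
  then obtain t0 s0 where p: "p = (t0, s0)" "t0 \<in> Std l n" "s0 \<in> Std l n" "shape n t0 = shape n s0"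
    by (auto simp: std_pairs_def)
  let ?v = "\<lambda>p. fscale (a p) (std_vec l n (fst p))"
  let ?S = "{t \<in> Std l n. shape n t = shape n s0}"
  define w where "w = (\<Sum>t\<in>?S. fscale (a (t, s0)) (std_vec l n t))"
  have "ip l n (act n g w) (std_vec l n s0) = 0" if g: "g \<in> GL l n" for g
  proof -
    have "(\<Sum>k | k \<in> std_pairs l n \<and> snd k = s0. ip l n (act n g (?v k)) (std_vec l n (snd k))) = 0"
    proof (rule left_separation[OF l finite_std_pairs _ p(3) _ g])
      fix k assume "k \<in> std_pairs l n"
      then show "snd k \<in> Std l n" by (auto simp: std_pairs_def)
    next
      fix g assume "g \<in> GL l n"
      from 0[OF this] show "(\<Sum>k\<in>std_pairs l n. ip l n (act n g (?v k)) (std_vec l n (snd k))) = 0"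
        by (simp only: act_scale ip_scale)
    qed
    also have "{k. k \<in> std_pairs l n \<and> snd k = s0} = (\<lambda>t. (t, s0)) ` ?S" using p(3) by (auto simp: std_pairs_def)
    also have "(\<Sum>k\<in>(\<lambda>t. (t, s0)) ` ?S. ip l n (act n g (?v k)) (std_vec l n (snd k))) =
      (\<Sum>t\<in>?S. ip l n (act n g (fscale (a (t, s0)) (std_vec l n t))) (std_vec l n s0))"
      by (subst sum.reindex) (auto simp: inj_on_def)
    finally show ?thesis unfolding w_def act_sum ip_sum .
  qed
  moreover have "w \<in> gspan l n (base_vec l n (shape n s0))"
    unfolding w_def
  proof (intro fn.subspace_sum[OF subspace_gspan] fn.subspace_scale[OF subspace_gspan])
    fix t assume "t \<in> ?S"
    then show "std_vec l n t \<in> gspan l n (base_vec l n (shape n s0))"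
      using std_vec_in_gspan[OF l, of t n] by auto
  qed
  ultimately have "w = 0" using gspan_nondegenerate[OF l p(3)] by blast
  have "a (t0, s0) * ip l n (std_vec l n t0) (std_vec l n t0) = ip l n w (std_vec l n t0)"
    unfolding w_def by (rule ip_sum_std_vec[OF l, symmetric, of ?S n t0 "\<lambda>t. a (t, s0)"]) (use p in auto)
  then show "a p = 0" using ip_std_vec_self[OF l p(2)] \<open>w = 0\<close> p(1) by simp
qed

lemma std_pairs_span:
  assumes l: "1 \<le> l"
  shows "\<exists>a. \<forall>g\<in>GL l n. \<phi> g =
    (\<Sum>p\<in>std_pairs l n. a p * ip l n (act n g (std_vec l n (fst p))) (std_vec l n (snd p)))"
  using Gl1_finite_card[OF l, of n] std_pairs_independent[OF l] card_std_pairs[of l n]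
  by (intro basis_by_count) auto

text \<open>The function of g given by u and one standard vector is expanded in the coefficients of
  pairs. After \<open>left_separation\<close> only left vectors of the shape of \<open>s0\<close>
  remain, and nondegeneracy turns the equality of functions into an equality of vectors.\<close>

lemma gspan_expand:
  assumes l: "1 \<le> l" and D: "D \<in> diags l n" and u: "u \<in> gspan l n (base_vec l n D)"
  shows "\<exists>b. u = (\<Sum>t | t \<in> Std l n \<and> shape n t = D. fscale (b t) (std_vec l n t))"
proof -
  have "0 < nstd l D" using D nstd_pos by (simp add: diags_def)
  then obtain s0 where s0: "s0 \<in> Std l n" "shape n s0 = D"
    using D by (auto simp: nstd_def diags_def card_gt_0_iff)
  obtain a where a: "\<And>g. g \<in> GL l n \<Longrightarrow> ip l n (act n g u) (std_vec l n s0) =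
    (\<Sum>p\<in>std_pairs l n. a p * ip l n (act n g (std_vec l n (fst p))) (std_vec l n (snd p)))"
    using std_pairs_span[OF l, of n "\<lambda>g. ip l n (act n g u) (std_vec l n s0)"] by blast
  let ?S = "{t \<in> Std l n. shape n t = D}"
  define m :: complex where "m = - 1"
  \<comment> \<open>The extra index \<open>None\<close> carries -u with the tableau
    \<open>s0\<close>, so that both sides of the expansion form one family for
    \<open>left_separation\<close>.\<close>
  let ?v = "case_option (fscale m u) (\<lambda>p. fscale (a p) (std_vec l n (fst p)))"
  let ?s = "case_option s0 snd"
  let ?K = "insert None (Some ` std_pairs l n)"
  define w where "w = (\<Sum>t\<in>?S. fscale (a (t, s0)) (std_vec l n t)) - u"
  have "ip l n (act n g w) (std_vec l n s0) = 0" if g: "g \<in> GL l n" for g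
  proof -
    have "(\<Sum>k | k \<in> ?K \<and> ?s k = s0. ip l n (act n g (?v k)) (std_vec l n (?s k))) = 0"
    proof (rule left_separation[OF l _ _ s0(1) _ g])
      fix k assume "k \<in> ?K"
      then show "?s k \<in> Std l n" using s0 by (auto simp: std_pairs_def)
    next
      fix g assume g: "g \<in> GL l n"
      have "(\<Sum>k\<in>?K. ip l n (act n g (?v k)) (std_vec l n (?s k))) =
        m * ip l n (act n g u) (std_vec l n s0) + (\<Sum>p\<in>std_pairs l n. a p * ip l n (act n g (std_vec l n (fst p))) (std_vec l n (snd p)))"
        by (subst sum.insert) (auto simp: sum.reindex act_scale ip_scale)
      then show "(\<Sum>k\<in>?K. ip l n (act n g (?v k)) (std_vec l n (?s k))) = 0" using a[OF g] by (simp add: m_def)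
    qed simp
    also have "{k. k \<in> ?K \<and> ?s k = s0} = insert None ((\<lambda>t. Some (t, s0)) ` ?S)"
      using s0 by (auto simp: std_pairs_def image_iff)
    also have "(\<Sum>k\<in>insert None ((\<lambda>t. Some (t, s0)) ` ?S). ip l n (act n g (?v k)) (std_vec l n (?s k))) =
      ip l n (act n g (fscale m u)) (std_vec l n s0) +
      (\<Sum>t\<in>?S. ip l n (act n g (fscale (a (t, s0)) (std_vec l n t))) (std_vec l n s0))"
      by (subst sum.insert) (auto simp: sum.reindex inj_on_def)
    finally show ?thesis unfolding w_def act_diff act_sum ip_diff ip_sum act_scale ip_scale by (simp add: m_def)
  qed
  moreover have "w \<in> gspan l n (base_vec l n (shape n s0))"
    unfolding w_def
  proof (intro fn.subspace_diff[OF subspace_gspan] fn.subspace_sum[OF subspace_gspan] fn.subspace_scale[OF subspace_gspan])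
    fix t assume "t \<in> ?S"
    then show "std_vec l n t \<in> gspan l n (base_vec l n (shape n s0))"
      using std_vec_in_gspan[OF l, of t n] s0 by auto
  qed (use u s0 in simp)
  ultimately have "w = 0" using gspan_nondegenerate[OF l s0(1)] by blast
  then have "u = (\<Sum>t\<in>?S. fscale (a (t, s0)) (std_vec l n t))" by (simp add: w_def)
  then show ?thesis by (intro exI[of _ "\<lambda>t. a (t, s0)"])
qed

lemma act_std_vec:
  assumes l: "1 \<le> l" and t: "t \<in> Std l n" and g: "g \<in> GL l n"
  shows "act n g (std_vec l n t) = (\<Sum>s | s \<in> Std l n \<and> shape n s = shape n t. fscale (std_coeff l n s t g) (std_vec l n s))"
proof -
  let ?S = "{s \<in> Std l n. shape n s = shape n t}"
  from gspan_expand[OF l shape_in_diags[OF t] act_gspan[OF l std_vec_in_gspan[OF l t] g]]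
  obtain b where b: "act n g (std_vec l n t) = (\<Sum>s\<in>?S. fscale (b s) (std_vec l n s))" by blast
  have "b s = std_coeff l n s t g" if s: "s \<in> ?S" for s
  proof -
    have "ip l n (act n g (std_vec l n t)) (std_vec l n s) = b s * ip l n (std_vec l n s) (std_vec l n s)"
      unfolding b by (rule ip_sum_std_vec[OF l _ s]) auto
    then show ?thesis using s ip_std_vec_self[OF l, of s n] by (simp add: std_coeff_def)
  qed
  then show ?thesis unfolding b by (intro sum.cong refl) simp
qed

lemma std_coeff_one:
  assumes l: "1 \<le> l" and s: "s \<in> Std l n" and t: "t \<in> Std l n"
  shows "std_coeff l n s t \<one>\<^bsub>Gl1 l n\<^esub> = (if s = t then 1 else 0)"
  using std_vec_orthogonal[OF l t s] ip_std_vec_self[OF l s] by (auto simp: std_coeff_def Gl1_one act_one)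

lemma std_coeff_mult:
  assumes l: "1 \<le> l" and s: "s \<in> Std l n" and t: "t \<in> Std l n"
    and g: "g \<in> GL l n" and h: "h \<in> GL l n"
  shows "std_coeff l n s t (g \<otimes>\<^bsub>Gl1 l n\<^esub> h) = (\<Sum>r\<in>Std l n. std_coeff l n s r g * std_coeff l n r t h)"
proof -
  have sum_off: "(\<Sum>r\<in>Std l n. std_coeff l n s r g * std_coeff l n r t h) =
    (\<Sum>r | r \<in> Std l n \<and> shape n r = shape n t. std_coeff l n s r g * std_coeff l n r t h)"
    by (rule sum.mono_neutral_right) (auto simp: std_coeff_def)
  show ?thesis
  proof (cases "shape n s = shape n t")
    case True
    let ?S = "{r. r \<in> Std l n \<and> shape n r = shape n t}"
    have "ip l n (act n (g * h) (std_vec l n t)) (std_vec l n s) =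
      (\<Sum>r\<in>?S. std_coeff l n r t h * ip l n (act n g (std_vec l n r)) (std_vec l n s))"
      by (simp only: act_mult[OF l g h] act_std_vec[OF l t h] act_sum ip_sum act_scale ip_scale)
    then have "ip l n (act n (g * h) (std_vec l n t)) (std_vec l n s) / ip l n (std_vec l n s) (std_vec l n s) =
      (\<Sum>r\<in>?S. std_coeff l n r t h * ip l n (act n g (std_vec l n r)) (std_vec l n s)) / ip l n (std_vec l n s) (std_vec l n s)" by (simp only:)
    also have "\<dots> = (\<Sum>r\<in>?S. std_coeff l n s r g * std_coeff l n r t h)"
      unfolding sum_divide_distrib using True by (intro sum.cong refl) (simp add: std_coeff_def mult.commute)
    finally show ?thesis unfolding sum_off using True by (simp add: std_coeff_def)
  next
    case False
    then show ?thesis unfolding sum_off by (simp add: std_coeff_def)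
  qed
qed

text \<open>In a pair the first tableau belongs to the vector that is moved and the second to the
  one it is paired with, so the indices of \<open>std_coeff\<close> appear in reverse order.\<close>

lemma sum_std_coeff:
  "(\<Sum>s\<in>Std l n. \<Sum>t\<in>Std l n. a s t * std_coeff l n s t g) =
    (\<Sum>p\<in>std_pairs l n. a (snd p) (fst p) / ip l n (std_vec l n (snd p)) (std_vec l n (snd p)) *
      ip l n (act n g (std_vec l n (fst p))) (std_vec l n (snd p)))"
proof -
  have "(\<Sum>s\<in>Std l n. \<Sum>t\<in>Std l n. a s t * std_coeff l n s t g) = (\<Sum>t\<in>Std l n. \<Sum>s\<in>Std l n. a s t * std_coeff l n s t g)"
    by (rule sum.swap)
  also have "\<dots> = (\<Sum>p\<in>Std l n \<times> Std l n. a (snd p) (fst p) * std_coeff l n (snd p) (fst p) g)"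
    by (simp add: sum.cartesian_product case_prod_unfold)
  also have "\<dots> = (\<Sum>p\<in>std_pairs l n. a (snd p) (fst p) * std_coeff l n (snd p) (fst p) g)"
    by (rule sum.mono_neutral_right) (auto simp: std_pairs_def std_coeff_def)
  also have "\<dots> = (\<Sum>p\<in>std_pairs l n. a (snd p) (fst p) / ip l n (std_vec l n (snd p)) (std_vec l n (snd p)) *
    ip l n (act n g (std_vec l n (fst p))) (std_vec l n (snd p)))"
    by (rule sum.cong) (auto simp: std_pairs_def std_coeff_def)
  finally show ?thesis .
qed

lemma std_coeff_independent:
  assumes l: "1 \<le> l" and 0: "\<And>g. g \<in> GL l n \<Longrightarrow> (\<Sum>s\<in>Std l n. \<Sum>t\<in>Std l n. a s t * std_coeff l n s t g) = 0"
    and st: "s \<in> Std l n" "t \<in> Std l n" "shape n s = shape n t"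
  shows "a s t = 0"
proof -
  have "\<forall>p\<in>std_pairs l n. a (snd p) (fst p) / ip l n (std_vec l n (snd p)) (std_vec l n (snd p)) = 0"
    by (rule std_pairs_independent[OF l]) (simp only: sum_std_coeff[symmetric] 0)
  moreover have "(t, s) \<in> std_pairs l n" using st by (simp add: std_pairs_def)
  ultimately have "a s t / ip l n (std_vec l n s) (std_vec l n s) = 0" by fastforce
  then show ?thesis using ip_std_vec_self[OF l st(1)] by simp
qed

lemma std_coeff_span:
  assumes l: "1 \<le> l"
  shows "\<exists>a. \<forall>g\<in>GL l n. \<phi> g = (\<Sum>s\<in>Std l n. \<Sum>t\<in>Std l n. a s t * std_coeff l n s t g)"
proof -
  obtain a where a: "\<And>g. g \<in> GL l n \<Longrightarrow> \<phi> g =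
    (\<Sum>p\<in>std_pairs l n. a p * ip l n (act n g (std_vec l n (fst p))) (std_vec l n (snd p)))"
    using std_pairs_span[OF l, of n \<phi>] by blast
  have "\<phi> g = (\<Sum>s\<in>Std l n. \<Sum>t\<in>Std l n. (a (t, s) * ip l n (std_vec l n s) (std_vec l n s)) * std_coeff l n s t g)"
    if "g \<in> GL l n" for g
  proof -
    have "(\<Sum>p\<in>std_pairs l n. a p * ip l n (act n g (std_vec l n (fst p))) (std_vec l n (snd p))) =
      (\<Sum>p\<in>std_pairs l n. (a (fst p, snd p) * ip l n (std_vec l n (snd p)) (std_vec l n (snd p))) /
        ip l n (std_vec l n (snd p)) (std_vec l n (snd p)) * ip l n (act n g (std_vec l n (fst p))) (std_vec l n (snd p)))"
      using ip_std_vec_self[OF l, of _ n] by (intro sum.cong refl) (auto simp: std_pairs_def)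
    then show ?thesis unfolding a[OF that] sum_std_coeff .
  qed
  then show ?thesis by (intro exI[of _ "\<lambda>s t. a (t, s) * ip l n (std_vec l n s) (std_vec l n s)"] ballI)
qed

lemma std_coeff_basis:
  assumes l: "1 \<le> l"
  shows "coeff_basis (Gl1 l n) (Std l n) (shape n) (std_coeff l n)"
proof (rule coeff_basis.intro[OF group_Gl1[OF l] Gl1_finite_card(1)[OF l] finite_Std])
  fix s t :: "nat \<Rightarrow> box" and g
  show "shape n s \<noteq> shape n t \<Longrightarrow> std_coeff l n s t g = 0" by (simp add: std_coeff_def)
qed (fact std_coeff_mult[OF l] std_coeff_one[OF l] std_coeff_independent[OF l] std_coeff_span[OF l])+

section \<open>The characters of the multipartitions\<close>

text \<open>An invariant of left cosets of the block subgroup: each entry is labelled with the block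
  from which g brings it. The value 0 beyond the entries makes equality of functions the right
  comparison.\<close>

definition coset_pattern :: "nat list list \<Rightarrow> complex mat \<Rightarrow> nat \<Rightarrow> nat" where
  "coset_pattern lam g = (\<lambda>x. if x < lpart_size lam then blk 0 lam (pinv (mon_perm g) x) else 0)"

lemma lparts_size: "lam \<in> lparts l n \<Longrightarrow> lpart_size lam = n"
  by (simp add: lparts_def)

lemma coset_pattern_iff:
  assumes l: "1 \<le> l" and lam: "lam \<in> lparts l n" and t: "t \<in> GL l n" and g: "g \<in> GL l n"
  shows "inv\<^bsub>Gl1 l n\<^esub> t \<otimes>\<^bsub>Gl1 l n\<^esub> g \<in> block_subgroup l lam \<longleftrightarrow> coset_pattern lam t = coset_pattern lam g"
proof -
  note n = lparts_size[OF lam]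
  obtain w y where t': "t = mon n w y" "w permutes {..<n}" "\<And>i. i < n \<Longrightarrow> y i ^ l = 1" by (rule Gl1_cases[OF l t]) blast
  obtain w' y' where g': "g = mon n w' y'" "w' permutes {..<n}" "\<And>i. i < n \<Longrightarrow> y' i ^ l = 1" by (rule Gl1_cases[OF l g]) blast
  define z where "z = (\<lambda>i. inverse (y (w i)) * y' (w i))"
  have iw: "pinv w permutes {..<n}" by (rule permutes_inv[OF t'(2)])
  have "inv\<^bsub>Gl1 l n\<^esub> t \<otimes>\<^bsub>Gl1 l n\<^esub> g = mon n (pinv w \<circ> w') z"
  proof -
    have "inv\<^bsub>Gl1 l n\<^esub> t = mon n (pinv w) (\<lambda>i. inverse (y (w i)))"
      unfolding t'(1) by (rule inv_mon[OF l t'(2)]) (rule t'(3))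
    then show ?thesis
      unfolding g'(1) Gl1_mult z_def by (simp only: mon_mult[OF iw g'(2)] permutes_inv_inv[OF t'(2)])
  qed
  moreover have "z i ^ l = 1" if "i < n" for i
    using t'(3)[OF permutes_lt[OF t'(2) that]] g'(3)[OF permutes_lt[OF t'(2) that]]
    by (simp add: z_def power_mult_distrib power_inverse)
  ultimately have 1: "inv\<^bsub>Gl1 l n\<^esub> t \<otimes>\<^bsub>Gl1 l n\<^esub> g \<in> block_subgroup l lam \<longleftrightarrow>
    (\<forall>x<n. blk 0 lam (pinv w (w' x)) = blk 0 lam x)"
    using block_subgroup_iff[OF l, of "pinv w \<circ> w'" lam z] permutes_compose[OF g'(2) iw] n by simp
  have 2: "mon_perm t = w" "mon_perm g = w'"
    unfolding t'(1) g'(1) by (intro mon_perm_mon t'(2) g'(2) root_nonzero[OF l] t'(3) g'(3); assumption)+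
  have "(\<forall>x<n. blk 0 lam (pinv w (w' x)) = blk 0 lam x) \<longleftrightarrow> (\<forall>x<n. blk 0 lam (pinv w x) = blk 0 lam (pinv w' x))"
  proof safe
    fix x assume a: "\<forall>x<n. blk 0 lam (pinv w (w' x)) = blk 0 lam x" and x: "x < n"
    have "pinv w' x < n" using permutes_lt[OF permutes_inv[OF g'(2)] x] .
    from a[rule_format, OF this] show "blk 0 lam (pinv w x) = blk 0 lam (pinv w' x)"
      by (simp only: permutes_inverses(1)[OF g'(2)])
  next
    fix x assume a: "\<forall>x<n. blk 0 lam (pinv w x) = blk 0 lam (pinv w' x)" and x: "x < n"
    from a[rule_format, OF permutes_lt[OF g'(2) x]] show "blk 0 lam (pinv w (w' x)) = blk 0 lam x"
      by (simp only: permutes_inverses(2)[OF g'(2)])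
  qed
  also have "\<dots> \<longleftrightarrow> coset_pattern lam t = coset_pattern lam g"
    unfolding coset_pattern_def 2 n fun_eq_iff by auto
  finally show ?thesis unfolding 1 .
qed

text \<open>The choice operator yields a transversal once one exists; one is built by picking an
  element for each pattern that occurs.\<close>

lemma transversal_pattern:
  assumes l: "1 \<le> l" and lam: "lam \<in> lparts l n"
  defines "T \<equiv> transversal (Gl1 l n) (block_subgroup l lam)"
  shows "T \<subseteq> GL l n" "g \<in> GL l n \<Longrightarrow> \<exists>!t. t \<in> T \<and> coset_pattern lam t = coset_pattern lam g"
proof -
  let ?C = "GL l n" and ?H = "block_subgroup l lam" and ?p = "coset_pattern lam"
  define sel where "sel = (\<lambda>p. SOME h. h \<in> ?C \<and> ?p h = p)"
  have sel: "sel (?p g) \<in> ?C \<and> ?p (sel (?p g)) = ?p g" if "g \<in> ?C" for g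
    unfolding sel_def by (rule someI[of _ g]) (use that in simp)
  have ex: "\<exists>T. T \<subseteq> ?C \<and> (\<forall>g\<in>?C. \<exists>!t. t \<in> T \<and> inv\<^bsub>Gl1 l n\<^esub> t \<otimes>\<^bsub>Gl1 l n\<^esub> g \<in> ?H)"
  proof (intro exI[of _ "(\<lambda>g. sel (?p g)) ` ?C"] conjI ballI)
    show "(\<lambda>g. sel (?p g)) ` ?C \<subseteq> ?C" using sel by blast
    fix g assume g: "g \<in> ?C"
    show "\<exists>!t. t \<in> (\<lambda>g. sel (?p g)) ` ?C \<and> inv\<^bsub>Gl1 l n\<^esub> t \<otimes>\<^bsub>Gl1 l n\<^esub> g \<in> ?H"
    proof (rule ex1I[of _ "sel (?p g)"], intro conjI)
      show "sel (?p g) \<in> (\<lambda>g. sel (?p g)) ` ?C" using g by (rule imageI)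
      show "inv\<^bsub>Gl1 l n\<^esub> (sel (?p g)) \<otimes>\<^bsub>Gl1 l n\<^esub> g \<in> ?H"
        using coset_pattern_iff[OF l lam conjunct1[OF sel[OF g]] g] sel[OF g] by blast
    next
      fix t assume t: "t \<in> (\<lambda>g. sel (?p g)) ` ?C \<and> inv\<^bsub>Gl1 l n\<^esub> t \<otimes>\<^bsub>Gl1 l n\<^esub> g \<in> ?H"
      then obtain g1 where g1: "g1 \<in> ?C" "t = sel (?p g1)" by blast
      then have "t \<in> ?C" "?p t = ?p g1" using sel by simp_all
      moreover have "?p t = ?p g" using coset_pattern_iff[OF l lam \<open>t \<in> ?C\<close> g] t by blast
      ultimately show "t = sel (?p g)" unfolding g1(2) by (simp only:)
    qed
  qed
  have T: "T \<subseteq> ?C \<and> (\<forall>g\<in>?C. \<exists>!t. t \<in> T \<and> inv\<^bsub>Gl1 l n\<^esub> t \<otimes>\<^bsub>Gl1 l n\<^esub> g \<in> ?H)"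
    unfolding T_def transversal_def by (rule someI_ex[OF ex])
  then show T1: "T \<subseteq> ?C" ..
  assume g: "g \<in> ?C"
  have iff: "t \<in> T \<and> inv\<^bsub>Gl1 l n\<^esub> t \<otimes>\<^bsub>Gl1 l n\<^esub> g \<in> ?H \<longleftrightarrow> t \<in> T \<and> ?p t = ?p g" for t
    using coset_pattern_iff[OF l lam _ g, of t] T1 by blast
  show "\<exists>!t. t \<in> T \<and> ?p t = ?p g"
    using conjunct2[OF T, rule_format, OF g] unfolding iff .
qed

text \<open>The coset of g prescribes the components of all entries on the support of a translate by
  g, so translates for different cosets have disjoint supports.\<close>

lemma tensor_coset_support:
  assumes l: "1 \<le> l" and lam: "lam \<in> lparts l n" and g: "g \<in> GL l n"
    and nz: "act n g (tens 0 lam bs) z \<noteq> 0" and x: "x < n"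
  shows "snd (z x) = coset_pattern lam g x"
proof -
  note n = lparts_size[OF lam]
  obtain w y where g': "g = mon n w y" "w permutes {..<n}" "\<And>i. i < n \<Longrightarrow> y i ^ l = 1" by (rule Gl1_cases[OF l g]) blast
  have w: "mon_perm g = w"
    unfolding g'(1) by (intro mon_perm_mon g'(2) root_nonzero[OF l] g'(3); assumption)
  have "tens 0 lam bs (z \<circ> w) \<noteq> 0" using nz unfolding act_def w by auto
  from tens_support_comp[OF this, of "pinv w x"] have "snd (z (w (pinv w x))) = blk 0 lam (pinv w x)"
    using permutes_lt[OF permutes_inv[OF g'(2)] x] n by simp
  then show ?thesis using x n by (simp add: coset_pattern_def w permutes_inverses(1)[OF g'(2)])
qed

text \<open>The vectors \<open>act n t (tens 0 lam bs)\<close> for coset representatives \<open>t\<close> realise the induced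
  module inside the tensor space: the components of an index distinguish the cosets.\<close>

lemma induced_vectors_independent:
  assumes l: "1 \<le> l" and lam: "lam \<in> lparts l n"
  defines "X \<equiv> transversal (Gl1 l n) (block_subgroup l lam) \<times> tensor_index lam"
  assumes 0: "\<And>z. (\<Sum>x\<in>X. a x * act n (fst x) (tens 0 lam (snd x)) z) = 0"
  shows "\<forall>x\<in>X. a x = 0"
proof
  note n = lparts_size[OF lam]
  let ?T = "transversal (Gl1 l n) (block_subgroup l lam)"
  note T = transversal_pattern[OF l lam]
  have finT: "finite ?T" using T(1) Gl1_finite_card(1)[OF l] by (rule finite_subset)
  fix x assume "x \<in> X"
  then obtain t bs where x: "x = (t, bs)" "t \<in> ?T" "bs \<in> tensor_index lam" by (auto simp: X_def)
  have tc: "t \<in> GL l n" using T(1) x(2) by blast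
  obtain w y where t': "t = mon n w y" "w permutes {..<n}" "\<And>i. i < n \<Longrightarrow> y i ^ l = 1" by (rule Gl1_cases[OF l tc]) blast
  have y0: "y i \<noteq> 0" if "i < n" for i by (rule root_nonzero[OF l t'(3)[OF that]])
  have w: "mon_perm t = w" unfolding t'(1) by (rule mon_perm_mon[OF t'(2) y0])
  have "(\<Sum>bs\<in>tensor_index lam. a (t, bs) * tens 0 lam bs R) = 0" for R
  proof (cases "\<forall>x<n. snd (R x) = blk 0 lam x")
    case True
    \<comment> \<open>R is distributed over the components like the blocks, so at z only translates
      by t can be nonzero and the relation reduces to one among tensors.\<close>
    define z where "z = R \<circ> pinv w"
    have zw: "z \<circ> w = R" by (simp add: z_def comp_assoc permutes_inv_o(2)[OF t'(2)])
    have pat: "snd (z x) = coset_pattern lam t x" if "x < n" for x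
      using True permutes_lt[OF permutes_inv[OF t'(2)] that] that by (simp add: z_def coset_pattern_def w n)
    define p where "p = (\<Prod>i<n. y i ^ (snd (z i) - 1))"
    have p0: "p \<noteq> 0" using y0 by (simp add: p_def)
    have off: "act n u (tens 0 lam bs) z = 0" if u: "u \<in> ?T" "u \<noteq> t" for u bs
    proof (rule ccontr)
      assume nz: "act n u (tens 0 lam bs) z \<noteq> 0"
      have uc: "u \<in> GL l n" using T(1) u(1) by blast
      have "coset_pattern lam u x = coset_pattern lam t x" for x
      proof (cases "x < n")
        case True
        then show ?thesis using tensor_coset_support[OF l lam uc nz True] pat[OF True] by (simp only:)
      qed (simp add: coset_pattern_def n)
      then have "coset_pattern lam u = coset_pattern lam t" by (rule ext)
      then show False using T(2)[OF tc] u x(2) by blast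
    qed
    have "0 = (\<Sum>u\<in>?T. \<Sum>bs\<in>tensor_index lam. a (u, bs) * act n u (tens 0 lam bs) z)"
      using 0[of z] unfolding X_def by (simp add: sum.cartesian_product case_prod_unfold)
    also have "\<dots> = (\<Sum>u\<in>{t}. \<Sum>bs\<in>tensor_index lam. a (u, bs) * act n u (tens 0 lam bs) z)"
      by (rule sum.mono_neutral_right[OF finT]) (use x(2) off in \<open>auto intro!: sum.neutral\<close>)
    also have "\<dots> = (\<Sum>bs\<in>tensor_index lam. a (t, bs) * (p * tens 0 lam bs R))"
      unfolding p_def by (simp add: t'(1) act_mon[OF t'(2) y0] zw)
    also have "\<dots> = p * (\<Sum>bs\<in>tensor_index lam. a (t, bs) * tens 0 lam bs R)"
      unfolding sum_distrib_left by (rule sum.cong) (simp_all only: mult_ac)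
    finally show ?thesis using p0 by simp
  next
    case False
    then have "tens 0 lam bs R = 0" for bs using tens_support_comp[of 0 lam bs R] n by meson
    then show ?thesis by simp
  qed
  from tens_independent[OF this x(3)] show "a x = 0" unfolding x(1) .
qed

text \<open>For given t' exactly one representative t has \<open>t^(-1) g t'\<close> in the block
  subgroup. Calling this element h gives \<open>g t' = t h\<close>, and \<open>act_block\<close> for
  h produces the entries of the induced matrix.\<close>

lemma induced_action:
  assumes l: "1 \<le> l" and lam: "lam \<in> lparts l n" and g: "g \<in> GL l n"
  defines "T \<equiv> transversal (Gl1 l n) (block_subgroup l lam)"
  assumes x: "x' \<in> T \<times> tensor_index lam"
  shows "act n g (act n (fst x') (tens 0 lam (snd x'))) z =
    (\<Sum>x\<in>T \<times> tensor_index lam. induced_matrix (Gl1 l n) (block_subgroup l lam) (block_matrix l lam) g x x' *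
      act n (fst x) (tens 0 lam (snd x)) z)"
proof -
  note n = lparts_size[OF lam]
  interpret group "Gl1 l n" by (rule group_Gl1[OF l])
  note T = transversal_pattern[OF l lam, folded T_def]
  have finT: "finite T" using T(1) Gl1_finite_card(1)[OF l] by (rule finite_subset)
  obtain t' bs' where x': "x' = (t', bs')" "t' \<in> T" "bs' \<in> tensor_index lam" using x by (auto simp: T_def)
  have t'c: "t' \<in> GL l n" using T(1) x'(2) by blast
  have gt: "g \<otimes>\<^bsub>Gl1 l n\<^esub> t' \<in> GL l n" by (rule m_closed[OF g t'c])
  obtain t where t: "t \<in> T" "coset_pattern lam t = coset_pattern lam (g \<otimes>\<^bsub>Gl1 l n\<^esub> t')"
    "\<And>u. u \<in> T \<Longrightarrow> coset_pattern lam u = coset_pattern lam (g \<otimes>\<^bsub>Gl1 l n\<^esub> t') \<Longrightarrow> u = t"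
    using T(2)[OF gt] by blast
  have tc: "t \<in> GL l n" using T(1) t(1) by blast
  have hH: "inv\<^bsub>Gl1 l n\<^esub> u \<otimes>\<^bsub>Gl1 l n\<^esub> g \<otimes>\<^bsub>Gl1 l n\<^esub> t' \<in> block_subgroup l lam \<longleftrightarrow> u = t" if u: "u \<in> T" for u
  proof -
    have uc: "u \<in> GL l n" using T(1) u by blast
    have "inv\<^bsub>Gl1 l n\<^esub> u \<otimes>\<^bsub>Gl1 l n\<^esub> g \<otimes>\<^bsub>Gl1 l n\<^esub> t' = inv\<^bsub>Gl1 l n\<^esub> u \<otimes>\<^bsub>Gl1 l n\<^esub> (g \<otimes>\<^bsub>Gl1 l n\<^esub> t')"
      by (rule m_assoc[OF inv_closed[OF uc] g t'c])
    then show ?thesis using coset_pattern_iff[OF l lam uc gt] t u by metis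
  qed
  define h where "h = inv\<^bsub>Gl1 l n\<^esub> t \<otimes>\<^bsub>Gl1 l n\<^esub> g \<otimes>\<^bsub>Gl1 l n\<^esub> t'"
  define gs where "gs = inv_into (block_tuples l lam) diag_block_mat h"
  have h: "h \<in> block_subgroup l lam" using hH[OF t(1)] by (simp add: h_def)
  have hc: "h \<in> GL l n" unfolding h_def by (intro m_closed inv_closed tc g t'c)
  have th: "g * t' = t * h"
  proof -
    have "t \<otimes>\<^bsub>Gl1 l n\<^esub> h = t \<otimes>\<^bsub>Gl1 l n\<^esub> inv\<^bsub>Gl1 l n\<^esub> t \<otimes>\<^bsub>Gl1 l n\<^esub> (g \<otimes>\<^bsub>Gl1 l n\<^esub> t')"
      unfolding h_def m_assoc[OF inv_closed[OF tc] g t'c] by (rule m_assoc[symmetric, OF tc inv_closed[OF tc] gt])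
    also have "\<dots> = g \<otimes>\<^bsub>Gl1 l n\<^esub> t'" by (simp only: r_inv[OF tc] l_one[OF gt])
    finally show ?thesis by (simp only: Gl1_mult)
  qed
  have hI: "h \<in> diag_block_mat ` block_tuples l lam" using h unfolding block_subgroup_def .
  have gs: "gs \<in> block_tuples l lam" "diag_block_mat gs = h"
    unfolding gs_def by (rule inv_into_into[OF hI], rule f_inv_into_f[OF hI])
  obtain ws ys where m: "gs = mons lam ws ys" "block_perms lam ws" "block_phases l lam ys"
    using block_tuplesE[OF l gs(1)] by blast
  have hm: "h = mon n (bperm lam ws) (bphase lam ys)"
    using diag_block_mons[OF m(2), of ys] list_all2_lengthD[OF m(3)] gs(2) n unfolding m(1) by simp
  have ah: "act n h (tens 0 lam bs') = (\<Sum>bs\<in>tensor_index lam. fscale (block_matrix l lam h bs bs') (tens 0 lam bs))"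
  proof
    fix R
    have "act n h (tens 0 lam bs') R = (\<Sum>bs\<in>tensor_index lam. tens_coeff 0 lam gs bs bs' * tens 0 lam bs R)"
      using act_block[OF l m(2,3) x'(3), of 0 R] unfolding hm m(1) n .
    also have "\<dots> = (\<Sum>bs\<in>tensor_index lam. fscale (block_matrix l lam h bs bs') (tens 0 lam bs)) R"
      by (simp only: fn_sum_apply fscale_def block_matrix_def gs_def[symmetric] tens_coeff_def tensor_matrix_def add_0)
    finally show "act n h (tens 0 lam bs') R = (\<Sum>bs\<in>tensor_index lam. fscale (block_matrix l lam h bs bs') (tens 0 lam bs)) R" .
  qed
  let ?M = "induced_matrix (Gl1 l n) (block_subgroup l lam) (block_matrix l lam) g"
  have "act n g (act n t' (tens 0 lam bs')) = act n t (act n h (tens 0 lam bs'))"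
    unfolding act_mult[OF l g t'c, symmetric] act_mult[OF l tc hc, symmetric] th ..
  then have L: "act n g (act n t' (tens 0 lam bs')) z = (\<Sum>bs\<in>tensor_index lam. block_matrix l lam h bs bs' * act n t (tens 0 lam bs) z)"
    unfolding ah act_sum act_scale by (simp only: fn_sum_apply fscale_def)
  have "(\<Sum>x\<in>T \<times> tensor_index lam. ?M x x' * act n (fst x) (tens 0 lam (snd x)) z) =
    (\<Sum>u\<in>T. \<Sum>bs\<in>tensor_index lam. ?M (u, bs) x' * act n u (tens 0 lam bs) z)"
    by (simp add: sum.cartesian_product case_prod_unfold)
  also have "\<dots> = (\<Sum>u\<in>{t}. \<Sum>bs\<in>tensor_index lam. ?M (u, bs) x' * act n u (tens 0 lam bs) z)"
    by (rule sum.mono_neutral_right[OF finT])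
      (use t(1) hH in \<open>auto simp: induced_matrix_def x'(1) Let_def intro!: sum.neutral\<close>)
  also have "\<dots> = (\<Sum>bs\<in>tensor_index lam. block_matrix l lam h bs bs' * act n t (tens 0 lam bs) z)"
    using h by (simp add: induced_matrix_def x'(1) Let_def h_def)
  finally show ?thesis unfolding x'(1) fst_conv snd_conv L by (rule sym)
qed

lemma polytabloid_cong:
  assumes "\<And>x. x < m \<Longrightarrow> t x = u x"
  shows "polytabloid m t = polytabloid m u"
proof -
  have "column_stabilizer m t = column_stabilizer m u"
  proof -
    have "(\<forall>x<m. snd (t (p x)) = snd (t x)) \<longleftrightarrow> (\<forall>x<m. snd (u (p x)) = snd (u x))" if "p permutes {..<m}" for p
      using assms permutes_lt[OF that] by simp
    then show ?thesis unfolding column_stabilizer_def by blast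
  qed
  moreover have "tabloid_of m (t \<circ> pinv p) = tabloid_of m (u \<circ> pinv p)" if "p \<in> column_stabilizer m u" for p
    using assms permutes_lt[OF permutes_inv[OF column_stabilizerD(1)[OF that]]] by (auto simp: tabloid_of_def)
  ultimately show ?thesis unfolding polytabloid_def by (intro ext sum.cong) simp_all
qed

lemma tableau_translate:
  assumes t: "bij_betw t {..<m} Y" and u: "bij_betw u {..<m} Y"
  shows "\<exists>w. w permutes {..<m} \<and> (\<forall>R. polytabloid m u R = polytabloid m t (R \<circ> w))"
proof -
  define v where "v = (\<lambda>x. if x < m then inv_into {..<m} t (u x) else x)"
  have "bij_betw (inv_into {..<m} t \<circ> u) {..<m} {..<m}"
    using u bij_betw_inv_into[OF t] by (rule bij_betw_trans)
  then have "bij_betw v {..<m} {..<m}" by (rule bij_betw_cong[THEN iffD1, rotated]) (simp add: v_def)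
  then have v: "v permutes {..<m}" by (rule bij_imp_permutes) (simp add: v_def)
  have "polytabloid m u = polytabloid m (t \<circ> v)"
  proof (rule polytabloid_cong)
    fix x assume x: "x < m"
    have "u x \<in> t ` {..<m}" using u x bij_betw_imp_surj_on[OF t] bij_betw_apply[OF u] by simp
    then show "u x = (t \<circ> v) x" using x by (simp add: v_def f_inv_into_f)
  qed
  then have "polytabloid m u R = polytabloid m t (R \<circ> pinv v)" for R using polytabloid_translate[OF v] by simp
  then show ?thesis using permutes_inv[OF v] by blast
qed

text \<open>Two choices of tableaux for the components differ by a permutation of each block. Hence
  one tensor of polytabloids generates all of them.\<close>

lemma tens_polys_translate:
  assumes "tableaux mus ts" "tableaux mus us"
  shows "\<exists>ws. block_perms mus ws \<and> (\<forall>T. tens e mus (polys mus us) T = tens e mus (polys mus ts) (T \<circ> bperm mus ws))"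
  using assms
proof (induction mus arbitrary: e ts us)
  case Nil
  then show ?case by (intro exI[of _ "[]"]) simp
next
  case (Cons \<mu> mus)
  let ?m = "sum_list \<mu>"
  obtain t ts' where ts: "ts = t # ts'" "bij_betw t {..<?m} (ydiag \<mu>)" "tableaux mus ts'"
    using Cons.prems(1) by (auto simp: list_all2_Cons1)
  obtain u us' where us: "us = u # us'" "bij_betw u {..<?m} (ydiag \<mu>)" "tableaux mus us'"
    using Cons.prems(2) by (auto simp: list_all2_Cons1)
  obtain w where w: "w permutes {..<?m}" "\<And>R. polytabloid ?m u R = polytabloid ?m t (R \<circ> w)"
    using tableau_translate[OF ts(2) us(2)] by blast
  obtain ws where ws: "block_perms mus ws"
    "\<And>T. tens (Suc e) mus (polys mus us') T = tens (Suc e) mus (polys mus ts') (T \<circ> bperm mus ws)"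
    using Cons.IH[OF ts(3) us(3), of "Suc e"] by blast
  have "tens e (\<mu> # mus) (polys (\<mu> # mus) us) T = tens e (\<mu> # mus) (polys (\<mu> # mus) ts) (T \<circ> bperm (\<mu> # mus) (w # ws))" for T
  proof -
    have 1: "(\<forall>x<?m. snd (T (w x)) = Suc e) \<longleftrightarrow> (\<forall>x<?m. snd (T x) = Suc e)"
    proof safe
      fix x assume a: "\<forall>x<?m. snd (T (w x)) = Suc e" and x: "x < ?m"
      from a[rule_format, OF permutes_lt[OF permutes_inv[OF w(1)] x]] show "snd (T x) = Suc e"
        by (simp only: permutes_inverses(1)[OF w(1)])
    next
      fix x assume a: "\<forall>x<?m. snd (T x) = Suc e" and x: "x < ?m"
      from a[rule_format, OF permutes_lt[OF w(1) x]] show "snd (T (w x)) = Suc e" .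
    qed
    have 2: "(\<lambda>x. if x < ?m then fst (T (w x)) else 0) = (\<lambda>x. if x < ?m then fst (T x) else 0) \<circ> w"
    proof
      fix x
      have "w x < ?m \<longleftrightarrow> x < ?m" using permutes_in_image[OF w(1), of x] by simp
      then show "(if x < ?m then fst (T (w x)) else 0) = ((\<lambda>x. if x < ?m then fst (T x) else 0) \<circ> w) x" by simp
    qed
    have 3: "(\<lambda>x. (T \<circ> bperm (\<mu> # mus) (w # ws)) (x + ?m)) = (\<lambda>x. T (x + ?m)) \<circ> bperm mus ws"
      by (simp add: fun_eq_iff)
    have 4: "(\<forall>x<?m. snd ((T \<circ> bperm (\<mu> # mus) (w # ws)) x) = Suc e) \<longleftrightarrow> (\<forall>x<?m. snd (T x) = Suc e)"
      unfolding 1[symmetric] by simp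
    have 5: "(\<lambda>x. if x < ?m then fst ((T \<circ> bperm (\<mu> # mus) (w # ws)) x) else 0) = (\<lambda>x. if x < ?m then fst (T x) else 0) \<circ> w"
      unfolding 2[symmetric] by (simp add: fun_eq_iff)
    show ?thesis unfolding tens.simps polys.simps ts(1) us(1) list.sel 3 4 5 w(2) ws(2) ..
  qed
  then show ?case using w(1) ws(1)
    by (intro exI[of _ "w # ws"] conjI allI) (simp_all only: list_all2_Cons)
qed

lemma listset_polytabloids:
  assumes "bs \<in> listset (map (\<lambda>\<mu>. {polytabloid (sum_list \<mu>) t | t. bij_betw t {..<sum_list \<mu>} (ydiag \<mu>)}) mus)"
  shows "\<exists>us. tableaux mus us \<and> bs = polys mus us"
  using assms
proof (induction mus arbitrary: bs)
  case Nil
  then show ?case by (intro exI[of _ "[]"]) simp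
next
  case (Cons \<mu> mus)
  then obtain t bs' where b: "bs = polytabloid (sum_list \<mu>) t # bs'" "bij_betw t {..<sum_list \<mu>} (ydiag \<mu>)"
    "bs' \<in> listset (map (\<lambda>\<mu>. {polytabloid (sum_list \<mu>) t | t. bij_betw t {..<sum_list \<mu>} (ydiag \<mu>)}) mus)"
    by (auto simp: set_Cons_def)
  from Cons.IH[OF b(3)] obtain us where us: "tableaux mus us" "bs' = polys mus us" by blast
  then show ?case using b by (intro exI[of _ "t # us"]) simp
qed

lemma polys_in_specht:
  "tableaux mus ts \<Longrightarrow> list_all2 (\<lambda>b P. b \<in> fn.span P) (polys mus ts) (map specht_basis mus)"
proof (induction mus arbitrary: ts)
  case (Cons \<mu> mus)
  then obtain t ts' where ts: "ts = t # ts'" "bij_betw t {..<sum_list \<mu>} (ydiag \<mu>)" "tableaux mus ts'"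
    by (auto simp: list_all2_Cons1)
  have "polytabloid (sum_list \<mu>) t \<in> specht_module \<mu>"
    unfolding specht_module_def using ts(2) by (intro fn.span_base) blast
  then show ?case using Cons.IH[OF ts(3)] unfolding ts(1) by (simp add: specht_basis(2))
qed simp

lemma tensor_index_in_polytabloids:
  "bs \<in> tensor_index mus \<Longrightarrow> list_all2 (\<lambda>b P. b \<in> fn.span P) bs
    (map (\<lambda>\<mu>. {polytabloid (sum_list \<mu>) t | t. bij_betw t {..<sum_list \<mu>} (ydiag \<mu>)}) mus)"
proof (induction mus arbitrary: bs)
  case Nil
  then show ?case by (simp add: tensor_index_def)
next
  case (Cons \<mu> mus)
  from Cons.prems obtain b bs' where b: "bs = b # bs'" "b \<in> specht_basis \<mu>" "bs' \<in> tensor_index mus"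
    by (rule tensor_index_ConsE)
  have "b \<in> specht_module \<mu>" using fn.span_base[OF b(2)] unfolding specht_basis(2) .
  then show ?case using Cons.IH[OF b(3)] unfolding b(1) specht_module_def by simp
qed

lemma base_vec_ldiag:
  assumes l: "1 \<le> l" and lam: "lam \<in> lparts l n"
  obtains ts where "tableaux lam ts" "base_vec l n (ldiag lam) = tens 0 lam (polys lam ts)"
  using base_vec[OF l lam] unfolding is_base_vec_def by (elim exE conjE) rule

lemma tens_in_gspan:
  assumes l: "1 \<le> l" and lam: "lam \<in> lparts l n" and bs: "bs \<in> tensor_index lam"
  shows "tens 0 lam bs \<in> gspan l n (base_vec l n (ldiag lam))"
proof -
  note n = lparts_size[OF lam]
  obtain ts where ts: "tableaux lam ts" "base_vec l n (ldiag lam) = tens 0 lam (polys lam ts)"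
    by (rule base_vec_ldiag[OF l lam])
  let ?Ps = "map (\<lambda>\<mu>. {polytabloid (sum_list \<mu>) t | t. bij_betw t {..<sum_list \<mu>} (ydiag \<mu>)}) lam"
  have "tens 0 lam bs \<in> fn.span (tens 0 lam ` listset ?Ps)"
    by (rule tens_span[OF tensor_index_in_polytabloids[OF bs]]) simp
  also have "fn.span (tens 0 lam ` listset ?Ps) \<subseteq> gspan l n (base_vec l n (ldiag lam))"
  proof (rule fn.span_minimal[OF _ subspace_gspan], rule image_subsetI)
    fix ps assume "ps \<in> listset ?Ps"
    from listset_polytabloids[OF this] obtain us where us: "tableaux lam us" "ps = polys lam us" by blast
    from tens_polys_translate[OF ts(1) us(1), of 0] obtain ws where ws: "block_perms lam ws"
      "\<And>T. tens 0 lam (polys lam us) T = tens 0 lam (polys lam ts) (T \<circ> bperm lam ws)" by blast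
    have w: "bperm lam ws permutes {..<n}" using bperm_permutes[OF ws(1)] unfolding n .
    have "tens 0 lam ps = act n (mon n (bperm lam ws) (\<lambda>_. 1)) (base_vec l n (ldiag lam))"
      unfolding us(2) ts(2) by (rule ext) (simp add: act_mon[OF w] ws(2))
    moreover have "mon n (bperm lam ws) (\<lambda>_. 1) \<in> GL l n" by (rule mon_in_Gl1[OF l w]) simp
    ultimately show "tens 0 lam ps \<in> gspan l n (base_vec l n (ldiag lam))" using act_in_gspan by simp
  qed
  finally show ?thesis .
qed

text \<open>With \<open>tens_in_gspan\<close> this identifies the induced module inside the tabloid
  functions with the submodule generated by the base vector. The span U is stable by
  \<open>induced_action\<close> and contains every tensor of Specht vectors.\<close>

lemma gspan_in_induced:
  assumes l: "1 \<le> l" and lam: "lam \<in> lparts l n"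
  defines "X \<equiv> transversal (Gl1 l n) (block_subgroup l lam) \<times> tensor_index lam"
  defines "U \<equiv> fn.span ((\<lambda>x. act n (fst x) (tens 0 lam (snd x))) ` X)"
  shows "gspan l n (base_vec l n (ldiag lam)) \<subseteq> U"
proof (rule gspan_minimal)
  interpret group "Gl1 l n" by (rule group_Gl1[OF l])
  note T = transversal_pattern[OF l lam]
  show sU: "fn.subspace U" unfolding U_def by (rule fn.subspace_span)
  have st: "act n g (act n (fst x') (tens 0 lam (snd x'))) \<in> U" if g: "g \<in> GL l n" and x': "x' \<in> X" for g x'
  proof -
    let ?M = "induced_matrix (Gl1 l n) (block_subgroup l lam) (block_matrix l lam) g"
    have "act n g (act n (fst x') (tens 0 lam (snd x'))) = (\<Sum>x\<in>X. fscale (?M x x') (act n (fst x) (tens 0 lam (snd x))))"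
      by (rule ext) (simp only: fn_sum_apply fscale_def induced_action[OF l lam g x'[unfolded X_def]] X_def)
    then show ?thesis unfolding U_def
      by (simp only:) (intro fn.span_sum fn.span_scale fn.span_base imageI)
  qed
  show "act n g h \<in> U" if g: "g \<in> GL l n" and h: "h \<in> U" for g h
  proof (rule act_stable_span[OF _ sU h[unfolded U_def]])
    fix b assume "b \<in> (\<lambda>x. act n (fst x) (tens 0 lam (snd x))) ` X"
    then show "act n g b \<in> U" using st[OF g] by (auto elim!: imageE)
  qed
  obtain ts where ts: "tableaux lam ts" "base_vec l n (ldiag lam) = tens 0 lam (polys lam ts)"
    by (rule base_vec_ldiag[OF l lam])
  have "tens 0 lam (polys lam ts) \<in> fn.span (tens 0 lam ` listset (map specht_basis lam))"
    by (rule tens_span[OF polys_in_specht[OF ts(1)]]) simp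
  also have "fn.span (tens 0 lam ` listset (map specht_basis lam)) \<subseteq> U"
  proof (rule fn.span_minimal[OF _ sU], rule image_subsetI)
    fix bs assume "bs \<in> listset (map specht_basis lam)"
    then have bs: "bs \<in> tensor_index lam" by (simp add: tensor_index_def)
    \<comment> \<open>Any representative t will do: its inverse brings the translated tensor back,
      and U is stable.\<close>
    obtain t where t: "t \<in> transversal (Gl1 l n) (block_subgroup l lam)" using T(2)[OF one_closed] by blast
    have tc: "t \<in> GL l n" using T(1) t by blast
    have "act n (inv\<^bsub>Gl1 l n\<^esub> t) (act n t (tens 0 lam bs)) = tens 0 lam bs"
      using l_inv[OF tc] unfolding act_mult[OF l inv_closed[OF tc] tc, symmetric] by (simp add: Gl1_one act_one)
    then show "tens 0 lam bs \<in> U" using st[OF inv_closed[OF tc], of "(t, bs)"] t bs by (simp add: X_def)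
  qed
  finally show "base_vec l n (ldiag lam) \<in> U" unfolding ts(2) .
qed

lemma std_vec_independent:
  assumes l: "1 \<le> l" and S: "S \<subseteq> Std l n" and 0: "\<And>z. (\<Sum>t\<in>S. a t * std_vec l n t z) = 0"
  shows "\<forall>t\<in>S. a t = 0"
proof
  fix t assume t: "t \<in> S"
  have "(\<Sum>t\<in>S. fscale (a t) (std_vec l n t)) = 0"
    by (rule ext) (simp only: fn_sum_apply fscale_def 0 zero_fun_apply)
  then have "a t * ip l n (std_vec l n t) (std_vec l n t) = 0"
    using ip_sum_std_vec[OF l S t, of a] by (simp only: ip_zero)
  then show "a t = 0" using ip_std_vec_self[OF l] S t by auto
qed

text \<open>The induced vectors and the standard vectors of shape \<open>ldiag lam\<close> are two
  bases of the same submodule, so both matrices of g have the same trace.\<close>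

lemma chi_std_coeff:
  assumes l: "1 \<le> l" and lam: "lam \<in> lparts l n" and g: "g \<in> GL l n"
  shows "chi l lam g = (\<Sum>t | t \<in> Std l n \<and> shape n t = ldiag lam. std_coeff l n t t g)"
proof -
  note n = lparts_size[OF lam]
  let ?H = "block_subgroup l lam"
  let ?X = "transversal (Gl1 l n) ?H \<times> tensor_index lam"
  let ?S = "{t. t \<in> Std l n \<and> shape n t = ldiag lam}"
  let ?M = "induced_matrix (Gl1 l n) ?H (block_matrix l lam) g"
  define \<Phi> where "\<Phi> = (\<lambda>x. act n (fst x) (tens 0 lam (snd x)))"
  note T = transversal_pattern[OF l lam]
  have finX: "finite ?X" using finite_subset[OF T(1) Gl1_finite_card(1)[OF l]] by simp
  have finS: "finite ?S" by simp
  have "\<forall>x\<in>?X. \<exists>b. \<Phi> x = (\<Sum>t\<in>?S. fscale (b t) (std_vec l n t))"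
  proof
    fix x assume "x \<in> ?X"
    then have "fst x \<in> GL l n" "snd x \<in> tensor_index lam" using T(1) by auto
    then have "\<Phi> x \<in> gspan l n (base_vec l n (ldiag lam))"
      unfolding \<Phi>_def by (intro act_gspan[OF l] tens_in_gspan[OF l lam])
    from gspan_expand[OF l ldiag_in_diags[OF lam] this]
    show "\<exists>b. \<Phi> x = (\<Sum>t\<in>?S. fscale (b t) (std_vec l n t))" .
  qed
  from bchoice[OF this] obtain P where P: "\<forall>x\<in>?X. \<Phi> x = (\<Sum>t\<in>?S. fscale (P x t) (std_vec l n t))" ..
  have "\<forall>t\<in>?S. \<exists>u. std_vec l n t = (\<Sum>x\<in>?X. fscale (u x) (\<Phi> x))"
  proof
    fix t assume t: "t \<in> ?S"
    have "std_vec l n t \<in> gspan l n (base_vec l n (ldiag lam))"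
      using std_vec_in_gspan[OF l, of t n] t by auto
    then have "std_vec l n t \<in> fn.span (\<Phi> ` ?X)" using gspan_in_induced[OF l lam] unfolding \<Phi>_def by blast
    then show "\<exists>u. std_vec l n t = (\<Sum>x\<in>?X. fscale (u x) (\<Phi> x))"
      by (rule fn_span_image[OF finX])
  qed
  from bchoice[OF this] obtain Q where Q: "\<forall>t\<in>?S. std_vec l n t = (\<Sum>x\<in>?X. fscale (Q t x) (\<Phi> x))" ..
  have "(\<Sum>x\<in>?X. ?M x x) = (\<Sum>t\<in>?S. std_coeff l n t t g)"
  proof (rule trace_change_of_basis[where \<Phi> = \<Phi> and v = "std_vec l n" and g = "act n g" and R = ?M and D = "\<lambda>s t. std_coeff l n s t g" and P = "\<lambda>t x. P x t" and Q = "\<lambda>x t. Q t x", OF finX finS])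
    show "\<forall>x\<in>?X. a x = 0" if "\<And>z. (\<Sum>x\<in>?X. a x * \<Phi> x z) = 0" for a
      by (rule induced_vectors_independent[OF l lam]) (use that in \<open>simp only: \<Phi>_def\<close>)
    show "\<forall>t\<in>?S. a t = 0" if "\<And>z. (\<Sum>t\<in>?S. a t * std_vec l n t z) = 0" for a
      by (rule std_vec_independent[OF l _ that]) blast
    show "\<Phi> x z = (\<Sum>t\<in>?S. P x t * std_vec l n t z)" if "x \<in> ?X" for x z
      using P[rule_format, OF that] by (simp only: fn_sum_apply fscale_def)
    show "std_vec l n t z = (\<Sum>x\<in>?X. Q t x * \<Phi> x z)" if "t \<in> ?S" for t z
      by (subst Q[rule_format, OF that]) (simp only: fn_sum_apply fscale_def)
    show "act n g (\<Phi> x) z = (\<Sum>t\<in>?S. P x t * act n g (std_vec l n t) z)" if "x \<in> ?X" for x z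
    proof -
      have "act n g (\<Phi> x) = (\<Sum>t\<in>?S. fscale (P x t) (act n g (std_vec l n t)))"
        using P[rule_format, OF that] by (simp only: act_sum act_scale)
      then show ?thesis by (simp only: fn_sum_apply fscale_def)
    qed
    show "act n g (\<Phi> x') z = (\<Sum>x\<in>?X. ?M x x' * \<Phi> x z)" if "x' \<in> ?X" for x' z
      unfolding \<Phi>_def by (rule induced_action[OF l lam g that])
    show "act n g (std_vec l n t) z = (\<Sum>s\<in>?S. std_coeff l n s t g * std_vec l n s z)" if "t \<in> ?S" for t z
    proof -
      have t: "t \<in> Std l n" "shape n t = ldiag lam" using that by simp_all
      show ?thesis unfolding act_std_vec[OF l t(1) g] t(2) by (simp only: fn_sum_apply fscale_def)
    qed
  qed
  then show ?thesis using g by (simp add: chi_def Let_def n rep_char_def)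
qed

section \<open>Multiplicities in diagonalizable modules\<close>

locale diagonal_module =
  fixes A :: "'a set" and X :: "'x set" and \<sigma> :: "'a \<Rightarrow> 'x \<Rightarrow> 'x \<Rightarrow> complex"
    and S :: "'s set" and u :: "'s \<Rightarrow> 'x \<Rightarrow> complex" and w :: "'a \<Rightarrow> 's \<Rightarrow> complex"
  assumes finX: "finite X" and finS: "finite S"
    and uX: "\<And>s. s \<in> S \<Longrightarrow> u s \<in> coord_space X"
    and u_ind: "\<And>b. (\<And>x. (\<Sum>s\<in>S. b s * u s x) = 0) \<Longrightarrow> \<forall>s\<in>S. b s = 0"
    and u_span: "coord_space X \<subseteq> fn.span (u ` S)"
    and u_act: "\<And>a s. a \<in> A \<Longrightarrow> s \<in> S \<Longrightarrow> mat_act X (\<sigma> a) (u s) = fscale (w a s) (u s)"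
begin

lemma u_inj: "inj_on u S"
  by (rule family_independent(1)[OF finS]) (fact u_ind)

lemma u_indep: "fn.independent (u ` S)"
  by (rule family_independent(2)[OF finS]) (fact u_ind)

lemma span_coord: "S' \<subseteq> S \<Longrightarrow> fn.span (u ` S') \<subseteq> coord_space X"
  by (intro fn.span_minimal subspace_coord_space) (use uX in blast)

lemma submod_span:
  assumes "S' \<subseteq> S"
  shows "submod A X \<sigma> (fn.span (u ` S'))"
  unfolding submod_def
proof (intro conjI ballI)
  show "fn.subspace (fn.span (u ` S'))" by (rule fn.subspace_span)
  show "fn.span (u ` S') \<subseteq> coord_space X" by (rule span_coord[OF assms])
  fix a v assume a: "a \<in> A" and v: "v \<in> fn.span (u ` S')"
  show "mat_act X (\<sigma> a) v \<in> fn.span (u ` S')"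
  proof (rule subspace_preimage_add[OF fn.subspace_span _ mat_act_add mat_act_scale v])
    fix b assume "b \<in> u ` S'"
    then obtain s where s: "s \<in> S'" "b = u s" by blast
    then have "mat_act X (\<sigma> a) b = fscale (w a s) (u s)" using u_act[OF a, of s] assms by blast
    then show "mat_act X (\<sigma> a) b \<in> fn.span (u ` S')"
      using fn.span_scale[OF fn.span_base[of "u s" "u ` S'"]] s(1) by simp
  qed
qed

text \<open>\<open>comp_mult\<close> is a definite description, so a composition series has to
  exist. Adding the eigenvectors one at a time gives factors of dimension one.\<close>

lemma ex_composition_series: "\<exists>Ws. composition_series A X \<sigma> Ws"
proof -
  obtain ss where ss: "set ss = S" "distinct ss" using finite_distinct_list[OF finS] by blast
  define W where "W = (\<lambda>i. fn.span (u ` set (take i ss)))"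
  define Ws where "Ws = map W [0..<Suc (length ss)]"
  have sub: "set (take i ss) \<subseteq> S" for i using set_take_subset[of i ss] ss(1) by blast
  have len: "length Ws = Suc (length ss)" by (simp add: Ws_def)
  have nth: "Ws ! i = W i" if "i \<le> length ss" for i using that unfolding Ws_def by (subst nth_map) (auto simp del: upt_Suc)
  have W0: "W 0 = {0}" by (simp add: W_def)
  have WS: "W (length ss) = coord_space X" using u_span span_coord[OF order_refl] ss(1) by (simp add: W_def)
  have "composition_series A X \<sigma> Ws"
    unfolding composition_series_def
  proof (intro conjI ballI allI impI)
    show ne: "Ws \<noteq> []" unfolding Ws_def by (simp del: upt_Suc)
    show "hd Ws = {0}" unfolding hd_conv_nth[OF ne] nth[OF le0] by (rule W0)
    show "last Ws = coord_space X" unfolding last_conv_nth[OF ne] len diff_Suc_1 nth[OF order_refl] by (rule WS)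
    show "submod A X \<sigma> V" if "V \<in> set Ws" for V
    proof -
      have "V \<in> W ` {0..<Suc (length ss)}" using that unfolding Ws_def set_map set_upt .
      then obtain i where "V = W i" by (rule imageE)
      then show ?thesis unfolding W_def by (simp only: submod_span[OF sub])
    qed
    fix i assume "Suc i < length Ws"
    then have i: "i < length ss" using len by simp
    have n: "Ws ! i = W i" "Ws ! Suc i = W (Suc i)" using nth i by simp_all
    let ?s = "ss ! i"
    have tk: "set (take (Suc i) ss) = insert ?s (set (take i ss))" using i by (simp add: take_Suc_conv_app_nth)
    have sS: "?s \<in> S" using i ss(1) by auto
    have new: "?s \<notin> set (take i ss)" using ss(2) i by (metis distinct_take id_take_nth_drop not_distinct_conv_prefix take_Suc_conv_app_nth)
    have notin: "u ?s \<notin> W i"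
    proof
      assume "u ?s \<in> W i"
      moreover have "u ` set (take i ss) \<subseteq> u ` S - {u ?s}" using sub[of i] new sS u_inj by (auto simp: inj_on_def)
      ultimately have "u ?s \<in> fn.span (u ` S - {u ?s})" using fn.span_mono unfolding W_def by blast
      then show False using u_indep sS unfolding fn.dependent_def by blast
    qed
    have W: "W (Suc i) = fn.span (insert (u ?s) (u ` set (take i ss)))" unfolding W_def tk by simp
    have "u ?s \<in> W (Suc i)" unfolding W by (rule fn.span_base) simp
    moreover have mono: "W i \<subseteq> W (Suc i)" unfolding W unfolding W_def by (rule fn.span_mono) blast
    ultimately show "Ws ! i \<subset> Ws ! Suc i" using notin unfolding n by blast
    fix U assume U: "submod A X \<sigma> U \<and> Ws ! i \<subseteq> U \<and> U \<subseteq> Ws ! Suc i"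
    have sU: "fn.subspace U" using U by (simp add: submod_def)
    show "U = Ws ! i \<or> U = Ws ! Suc i"
    proof (cases "U \<subseteq> W i")
      case False
      \<comment> \<open>A submodule of \<open>W (Suc i)\<close> containing \<open>W i\<close> and
        more has a vector with nonzero coefficient at the new eigenvector, hence contains that
        eigenvector.\<close>
      then obtain x where x: "x \<in> U" "x \<notin> W i" by blast
      have "x \<in> W (Suc i)" using U x(1) unfolding n by blast
      then have "\<exists>z. x - fscale z (u ?s) \<in> W i" unfolding W fn.span_breakdown_eq unfolding W_def .
      then obtain z where z: "x - fscale z (u ?s) \<in> W i" ..
      have "z \<noteq> 0" using x(2) z by auto
      have "x - fscale z (u ?s) \<in> U" using z U unfolding n by blast
      from fn.subspace_diff[OF sU x(1) this] have "fscale z (u ?s) \<in> U" by simp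
      from fn.subspace_scale[OF sU this, of "inverse z"] have "u ?s \<in> U" using \<open>z \<noteq> 0\<close> by simp
      moreover have "u ` set (take i ss) \<subseteq> U" using U fn.span_superset[of "u ` set (take i ss)"] unfolding n W_def by blast
      ultimately have "W (Suc i) \<subseteq> U" unfolding W by (intro fn.span_minimal[OF _ sU]) blast
      then show ?thesis using U unfolding n by blast
    next
      case True
      then show ?thesis using U unfolding n by blast
    qed
  qed
  then show ?thesis by blast
qed

text \<open>The idempotent \<open>p\<close> projects onto the isotypic component of the character \<open>\<tau>\<close>; along a
  composition series the dimension of this component grows by one exactly at the factors
  isomorphic to \<open>\<tau>\<close>.\<close>

lemma comp_mult_eq:
  fixes \<tau> :: "'a \<Rightarrow> nat \<Rightarrow> nat \<Rightarrow> complex"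
  assumes p: "p \<in> A" "\<tau> p 0 0 = 1" "\<And>s. s \<in> S \<Longrightarrow> w p s = (if \<forall>a\<in>A. w a s = \<tau> a 0 0 then 1 else 0)"
  shows "comp_mult A X \<sigma> {..<1} \<tau> = card {s \<in> S. \<forall>a\<in>A. w a s = \<tau> a 0 0}"
proof -
  define S0 where "S0 = {s \<in> S. \<forall>a\<in>A. w a s = \<tau> a 0 0}"
  \<comment> \<open>The part of the module on which the algebra acts by \<open>\<tau>\<close>;
    \<open>pK\<close> shows that p maps into it.\<close>
  define K where "K = fn.span (u ` S0)"
  have S0: "S0 \<subseteq> S" "finite S0" using finS by (auto simp: S0_def)
  have sK: "fn.subspace K" unfolding K_def by (rule fn.subspace_span)
  have aK: "mat_act X (\<sigma> a) v = fscale (\<tau> a 0 0) v" if a: "a \<in> A" and v: "v \<in> K" for a v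
    using v unfolding K_def
  proof (induction rule: fn.span_induct_alt)
    case base
    show ?case by (simp only: mat_act_zero fn.scale_zero_right)
  next
    case (step c x y)
    then obtain s where s: "s \<in> S0" "x = u s" by blast
    have "mat_act X (\<sigma> a) x = fscale (\<tau> a 0 0) x" using u_act[OF a, of s] s a unfolding S0_def by simp
    then show ?case using step(2)
      by (simp only: mat_act_add mat_act_scale fn.scale_right_distrib fn.scale_scale mult.commute)
  qed
  have pK: "mat_act X (\<sigma> p) v \<in> K" if v: "v \<in> coord_space X" for v
  proof (rule subspace_preimage_add[OF sK _ mat_act_add mat_act_scale])
    show "v \<in> fn.span (u ` S)" using u_span v by blast
    fix b assume "b \<in> u ` S"
    then obtain s where s: "s \<in> S" "b = u s" by blast
    show "mat_act X (\<sigma> p) b \<in> K"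
    proof (cases "s \<in> S0")
      case True
      then have "u s \<in> K" unfolding K_def by (intro fn.span_base) blast
      then show ?thesis unfolding s(2) u_act[OF p(1) s(1)] by (rule fn.subspace_scale[OF sK])
    next
      case False
      then have "w p s = 0" using p(3)[OF s(1)] s(1) by (auto simp: S0_def)
      then show ?thesis unfolding s(2) u_act[OF p(1) s(1)] using fn.subspace_0[OF sK] by simp
    qed
  qed
  define e :: "nat \<Rightarrow> complex" where "e = (\<lambda>x. if x = 0 then 1 else 0)"
  have ec: "e \<in> coord_space {..<1}" by (simp add: e_def coord_space_def)
  have ce: "f = fscale (f 0) e" if "f \<in> coord_space {..<1}" for f :: "nat \<Rightarrow> complex"
    using that by (auto simp: coord_space_def e_def fscale_def fun_eq_iff)
  have te: "mat_act {..<1} (\<tau> a) (fscale z e) = fscale (\<tau> a 0 0 * z) e" for a z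
    by (auto simp: mat_act_def e_def fscale_def fun_eq_iff)
  \<comment> \<open>A preimage of the generator of the quotient is moved by p into K; since p acts
    as 1 on the quotient, it still maps to the generator.\<close>
  have grow: "\<exists>x. x \<in> W' \<inter> K \<and> x \<notin> W \<and> (\<forall>v\<in>W' \<inter> K. \<exists>z. v - fscale z x \<in> W \<inter> K)"
    if W': "submod A X \<sigma> W'" and W: "submod A X \<sigma> W" and q: "quotient_iso A X \<sigma> W W' {..<1} \<tau>" for W W'
  proof -
    obtain \<phi> where add: "\<forall>u\<in>W'. \<forall>v\<in>W'. \<phi> (u + v) = \<phi> u + \<phi> v" and sc: "\<forall>u\<in>W'. \<forall>z. \<phi> (fscale z u) = fscale z (\<phi> u)"
      and im: "\<phi> ` W' = coord_space {..<1}" and ker: "{x \<in> W'. \<phi> x = 0} = W"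
      and eq: "\<forall>a\<in>A. \<forall>x\<in>W'. \<phi> (mat_act X (\<sigma> a) x) = mat_act {..<1} (\<tau> a) (\<phi> x)"
      using q unfolding quotient_iso_def by (elim exE conjE) rule
    obtain y where y: "y \<in> W'" "\<phi> y = e" using ec im by (metis imageE)
    define x where "x = mat_act X (\<sigma> p) y"
    have yX: "y \<in> coord_space X" using W' y(1) by (auto simp: submod_def)
    have sW': "fn.subspace W'" using W' by (simp add: submod_def)
    have x1: "x \<in> W'" using W' p(1) y(1) by (simp add: submod_def x_def)
    have x2: "x \<in> K" unfolding x_def by (rule pK[OF yX])
    have x3: "\<phi> x = e" unfolding x_def using eq p(1,2) y te[of p 1] by simp
    have e0: "e \<noteq> 0" by (auto simp: e_def fun_eq_iff)
    have x4: "x \<notin> W" using x3 e0 ker by blast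
    have "v - fscale (\<phi> v 0) x \<in> W \<inter> K" if v: "v \<in> W'" "v \<in> K" for v
    proof -
      have d: "v - fscale (\<phi> v 0) x = v + fscale (- \<phi> v 0) x"
        by (simp only: fn.scale_minus_left diff_conv_add_uminus)
      have "\<phi> (v + fscale (- \<phi> v 0) x) = \<phi> v + fscale (- \<phi> v 0) e"
        using add[rule_format, OF v(1) fn.subspace_scale[OF sW' x1]] sc[rule_format, OF x1] x3 by (simp only:)
      also have "\<dots> = fscale (\<phi> v 0) e + fscale (- \<phi> v 0) e"
        by (rule arg_cong2[where f = "(+)"], rule ce) (use im v(1) in blast, rule refl)
      also have "\<dots> = 0" by (simp only: fn.scale_minus_left add.right_inverse)
      finally have "\<phi> (v + fscale (- \<phi> v 0) x) = 0" .
      moreover have "v - fscale (\<phi> v 0) x \<in> W'" by (intro fn.subspace_diff[OF sW'] fn.subspace_scale[OF sW'] v(1) x1)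
      ultimately have "v - fscale (\<phi> v 0) x \<in> W" using ker unfolding d by blast
      then show ?thesis by (intro IntI fn.subspace_diff[OF sK] fn.subspace_scale[OF sK] v(2) x2)
    qed
    then show ?thesis using x1 x2 x4 by blast
  qed
  \<comment> \<open>By contradiction: a vector x of K in W' outside W spans, together with W, a
    submodule that must be W' by maximality, and the algebra acts on x by \<open>\<tau>\<close>, so
    the factor would be isomorphic to \<open>\<tau>\<close>.\<close>
  have stay: "W' \<inter> K \<subseteq> W"
    if W': "submod A X \<sigma> W'" and W: "submod A X \<sigma> W" and ss: "W \<subseteq> W'" and nq: "\<not> quotient_iso A X \<sigma> W W' {..<1} \<tau>"
      and mx: "\<And>U. submod A X \<sigma> U \<Longrightarrow> W \<subseteq> U \<Longrightarrow> U \<subseteq> W' \<Longrightarrow> U = W \<or> U = W'" for W W'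
  proof (rule ccontr)
    assume "\<not> W' \<inter> K \<subseteq> W"
    then obtain x where x: "x \<in> W'" "x \<in> K" "x \<notin> W" by blast
    have sW: "fn.subspace W" and sW': "fn.subspace W'" using W W' by (simp_all add: submod_def)
    define U where "U = {v. \<exists>z. v - fscale z x \<in> W}"
    have Uspan: "U = fn.span (insert x W)"
      by (simp only: U_def fn.span_insert fn.span_eq_iff[THEN iffD2, OF sW])
    have UW': "U \<subseteq> W'" unfolding Uspan using x(1) ss by (intro fn.span_minimal[OF _ sW']) blast
    have "submod A X \<sigma> U"
      unfolding submod_def
    proof (intro conjI ballI)
      show "fn.subspace U" unfolding Uspan by (rule fn.subspace_span)
      show "U \<subseteq> coord_space X" using UW' W' unfolding submod_def by blast
      fix a v assume a: "a \<in> A" and "v \<in> U"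
      then obtain z where z: "v - fscale z x \<in> W" unfolding U_def by blast
      then have "mat_act X (\<sigma> a) (v - fscale z x) \<in> W" using W a unfolding submod_def by blast
      then have "mat_act X (\<sigma> a) v - fscale (z * \<tau> a 0 0) x \<in> W"
        unfolding mat_act_diff mat_act_scale aK[OF a x(2)] fn.scale_scale .
      then show "mat_act X (\<sigma> a) v \<in> U" unfolding U_def by blast
    qed
    moreover have "W \<subseteq> U" unfolding Uspan using fn.span_superset[of "insert x W"] by blast
    moreover have "x \<in> U" unfolding Uspan by (rule fn.span_base) simp
    ultimately have UeqW': "U = W'" using mx[of U] UW' x(3) by blast
    \<comment> \<open>The coordinate along x modulo W; it induces the isomorphism from the quotient
      to the one-dimensional module.\<close>
    define f where "f = (\<lambda>v. SOME z. v - fscale z x \<in> W)"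
    have f: "v - fscale z x \<in> W \<longleftrightarrow> z = f v" if "v \<in> W'" for v z
    proof -
      have "\<exists>z. v - fscale z x \<in> W" using that unfolding UeqW'[symmetric] U_def by blast
      then have fv: "v - fscale (f v) x \<in> W" unfolding f_def by (rule someI_ex)
      have "z = f v" if z: "v - fscale z x \<in> W"
      proof (rule ccontr)
        assume "z \<noteq> f v"
        have "fscale (z - f v) x = (v - fscale (f v) x) - (v - fscale z x)"
          by (simp only: fn.scale_left_diff_distrib diff_diff_eq2 diff_add_cancel add_diff_cancel_left' diff_add_eq_diff_diff_swap) (simp only: algebra_simps)
        then have "fscale (z - f v) x \<in> W" using fn.subspace_diff[OF sW fv z] by simp
        from fn.subspace_scale[OF sW this, of "inverse (z - f v)"] have "x \<in> W" using \<open>z \<noteq> f v\<close> by simp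
        then show False using x(3) by blast
      qed
      then show ?thesis using fv by blast
    qed
    have fx: "v - fscale (f v) x \<in> W" if "v \<in> W'" for v using f[OF that] by blast
    have "quotient_iso A X \<sigma> W W' {..<1} \<tau>"
      unfolding quotient_iso_def
    proof (intro exI[of _ "\<lambda>v. fscale (f v) e"] conjI ballI allI)
      fix v v' assume v: "v \<in> W'" and v': "v' \<in> W'"
      have "v + v' - fscale (f v + f v') x = (v - fscale (f v) x) + (v' - fscale (f v') x)"
        unfolding fn.scale_left_distrib by (rule add_diff_add)
      then have "v + v' - fscale (f v + f v') x \<in> W" using fn.subspace_add[OF sW fx[OF v] fx[OF v']] by (simp only:)
      then have "f (v + v') = f v + f v'" by (rule f[OF fn.subspace_add[OF sW' v v'], THEN iffD1, symmetric])
      then show "fscale (f (v + v')) e = fscale (f v) e + fscale (f v') e" by (simp only: fn.scale_left_distrib)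
    next
      fix v z assume v: "v \<in> W'"
      have "fscale z v - fscale (z * f v) x = fscale z (v - fscale (f v) x)"
        by (simp only: fn.scale_right_diff_distrib fn.scale_scale)
      then have "fscale z v - fscale (z * f v) x \<in> W" using fn.subspace_scale[OF sW fx[OF v]] by (simp only:)
      then have "f (fscale z v) = z * f v" by (rule f[OF fn.subspace_scale[OF sW' v], THEN iffD1, symmetric])
      then show "fscale (f (fscale z v)) e = fscale z (fscale (f v) e)" by simp
    next
      show "(\<lambda>v. fscale (f v) e) ` W' = coord_space {..<1}"
      proof (intro subset_antisym subsetI)
        fix h assume "h \<in> (\<lambda>v. fscale (f v) e) ` W'"
        then show "h \<in> coord_space {..<1}" using fn.subspace_scale[OF subspace_coord_space ec] by blast
      next
        fix h :: "nat \<Rightarrow> complex" assume h: "h \<in> coord_space {..<1}"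
        have m: "fscale (h 0) x \<in> W'" by (rule fn.subspace_scale[OF sW' x(1)])
        have "fscale (h 0) x - fscale (h 0) x \<in> W" unfolding diff_self by (rule fn.subspace_0[OF sW])
        then have "h 0 = f (fscale (h 0) x)" by (rule f[OF m, THEN iffD1])
        then have "h = fscale (f (fscale (h 0) x)) e" using ce[OF h] by (simp only:)
        then show "h \<in> (\<lambda>v. fscale (f v) e) ` W'" using m by (rule image_eqI)
      qed
    next
      have e0: "e \<noteq> 0" by (auto simp: e_def fun_eq_iff)
      have "fscale (f v) e = 0 \<longleftrightarrow> v \<in> W" if v: "v \<in> W'" for v
      proof -
        have "v \<in> W \<longleftrightarrow> 0 = f v" using f[OF v, of 0] unfolding fn.scale_zero_left diff_0_right .
        also have "0 = f v \<longleftrightarrow> f v = 0" by (rule eq_commute)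
        finally show ?thesis unfolding fn.scale_eq_0_iff using e0 by blast
      qed
      then show "{v \<in> W'. fscale (f v) e = 0} = W" using ss by blast
    next
      fix a v assume a: "a \<in> A" and v: "v \<in> W'"
      have m: "mat_act X (\<sigma> a) v \<in> W'" using W' a v unfolding submod_def by blast
      have "mat_act X (\<sigma> a) (v - fscale (f v) x) \<in> W" using W a fx[OF v] unfolding submod_def by blast
      then have "mat_act X (\<sigma> a) v - fscale (f v * \<tau> a 0 0) x \<in> W"
        unfolding mat_act_diff mat_act_scale aK[OF a x(2)] fn.scale_scale .
      then have "f (mat_act X (\<sigma> a) v) = \<tau> a 0 0 * f v" using f[OF m] by (simp add: mult.commute)
      then show "fscale (f (mat_act X (\<sigma> a) v)) e = mat_act {..<1} (\<tau> a) (fscale (f v) e)" by (simp only: te)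
    qed
    then show False using nq by blast
  qed
  have count: "card {i. Suc i < length Ws \<and> quotient_iso A X \<sigma> (Ws ! i) (Ws ! Suc i) {..<1} \<tau>} = card S0"
    if Ws: "composition_series A X \<sigma> Ws" for Ws
  proof -
    let ?q = "\<lambda>i. quotient_iso A X \<sigma> (Ws ! i) (Ws ! Suc i) {..<1} \<tau>"
    have ne: "Ws \<noteq> []" and hd: "Ws ! 0 = {0}" and lst: "Ws ! (length Ws - 1) = coord_space X"
      using Ws hd_conv_nth[of Ws] last_conv_nth[of Ws] by (simp_all add: composition_series_def)
    have sm: "submod A X \<sigma> (Ws ! i)" if "i < length Ws" for i
      using Ws nth_mem[OF that] unfolding composition_series_def by blast
    have "\<exists>B. finite B \<and> fn.independent B \<and> fn.span B = Ws ! i \<inter> K \<and> card B = card {j. j < i \<and> ?q j}" if "i < length Ws" for i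
      using that
    proof (induction i)
      case 0
      have "fn.span {} = {0} \<inter> K" using fn.subspace_0[OF sK] by simp
      then show ?case unfolding hd by (intro exI[of _ "{}"] conjI fn.independent_empty) simp_all
    next
      case (Suc i)
      then obtain B where B: "finite B" "fn.independent B" "fn.span B = Ws ! i \<inter> K" "card B = card {j. j < i \<and> ?q j}" by auto
      have step: "Ws ! i \<subset> Ws ! Suc i" "\<And>U. submod A X \<sigma> U \<Longrightarrow> Ws ! i \<subseteq> U \<Longrightarrow> U \<subseteq> Ws ! Suc i \<Longrightarrow> U = Ws ! i \<or> U = Ws ! Suc i"
        using Ws Suc.prems unfolding composition_series_def by blast+
      have smi: "submod A X \<sigma> (Ws ! i)" "submod A X \<sigma> (Ws ! Suc i)" using sm Suc.prems by simp_all
      have sSK: "fn.subspace (Ws ! Suc i \<inter> K)" using smi(2) sK by (simp add: submod_def fn.subspace_inter)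
      show ?case
      proof (cases "?q i")
        case True
        obtain x where x: "x \<in> Ws ! Suc i \<inter> K" "x \<notin> Ws ! i" "\<forall>v\<in>Ws ! Suc i \<inter> K. \<exists>z. v - fscale z x \<in> Ws ! i \<inter> K"
          using grow[OF smi(2,1) True] by blast
        have xB: "x \<notin> fn.span B" using x(2) unfolding B(3) by blast
        have "fn.span (insert x B) = Ws ! Suc i \<inter> K"
        proof (intro subset_antisym)
          show "fn.span (insert x B) \<subseteq> Ws ! Suc i \<inter> K"
            using x(1) fn.span_superset[of B] step(1) unfolding B(3) by (intro fn.span_minimal[OF _ sSK]) blast
          show "Ws ! Suc i \<inter> K \<subseteq> fn.span (insert x B)"
            using x(3) unfolding fn.span_insert B(3) by blast
        qed
        moreover have "fn.independent (insert x B)" by (rule fn.independent_insertI[OF xB B(2)])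
        moreover have "x \<notin> B" using xB fn.span_base by blast
        then have "card (insert x B) = Suc (card {j. j < i \<and> ?q j})" using B(1,4) by simp
        moreover have "{j. j < Suc i \<and> ?q j} = insert i {j. j < i \<and> ?q j}" using True less_Suc_eq by auto
        ultimately show ?thesis using B(1) by (intro exI[of _ "insert x B"]) simp
      next
        case False
        have "Ws ! Suc i \<inter> K \<subseteq> Ws ! i" by (rule stay[OF smi(2,1) _ False step(2)]) (use step(1) in auto)
        then have "Ws ! Suc i \<inter> K = Ws ! i \<inter> K" using step(1) by blast
        moreover have "{j. j < Suc i \<and> ?q j} = {j. j < i \<and> ?q j}" using False less_Suc_eq by auto
        ultimately show ?thesis using B by (intro exI[of _ B]) simp
      qed
    qed
    from this[of "length Ws - 1"] ne obtain B where B: "fn.independent B" "fn.span B = coord_space X \<inter> K"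
      "card B = card {j. j < length Ws - 1 \<and> ?q j}" unfolding lst by auto
    have "coord_space X \<inter> K = K" using span_coord[OF S0(1)] unfolding K_def by blast
    then have "fn.span B = fn.span (u ` S0)" using B(2) unfolding K_def by simp
    from fn.dim_eq_card[OF this B(1)] have "card B = fn.dim (u ` S0)" by simp
    also have "\<dots> = card (u ` S0)"
      by (rule fn.dim_eq_card_independent[OF fn.independent_mono[OF u_indep]]) (use S0(1) in blast)
    also have "\<dots> = card S0" by (rule card_image[OF inj_on_subset[OF u_inj S0(1)]])
    finally have "card {j. j < length Ws - 1 \<and> ?q j} = card S0" using B(3) by simp
    moreover have "{j. j < length Ws - 1 \<and> ?q j} = {i. Suc i < length Ws \<and> ?q i}" by auto
    ultimately show ?thesis by simp
  qed
  show ?thesis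
    unfolding comp_mult_def S0_def[symmetric]
  proof (rule the_equality)
    obtain Ws where Ws: "composition_series A X \<sigma> Ws" using ex_composition_series by blast
    show "\<exists>Ws. composition_series A X \<sigma> Ws \<and>
      card S0 = card {i. Suc i < length Ws \<and> quotient_iso A X \<sigma> (Ws ! i) (Ws ! Suc i) {..<1} \<tau>}"
      using Ws count[OF Ws] by (intro exI[of _ Ws] conjI) simp_all
    fix m assume "\<exists>Ws. composition_series A X \<sigma> Ws \<and>
      m = card {i. Suc i < length Ws \<and> quotient_iso A X \<sigma> (Ws ! i) (Ws ! Suc i) {..<1} \<tau>}"
    then show "m = card S0" using count by (elim exE conjE) (simp only:)
  qed
qed

end

section \<open>Subalgebras acting diagonally\<close>

context coeff_basis begin

definition alg_coeff :: "('g \<Rightarrow> complex) \<Rightarrow> 't \<Rightarrow> 't \<Rightarrow> complex" where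
  "alg_coeff a s t = (\<Sum>g\<in>carrier G. a g * D s t g)"

lemma alg_coeff_one:
  assumes "s \<in> \<Theta>" "t \<in> \<Theta>"
  shows "alg_coeff (galg_one G) s t = (if s = t then 1 else 0)"
proof -
  have o: "\<one>\<^bsub>G\<^esub> \<in> carrier G" using monoid.one_closed[OF group.is_monoid[OF grp]] .
  have "alg_coeff (galg_one G) s t = (\<Sum>g\<in>carrier G. if g = \<one>\<^bsub>G\<^esub> then D s t g else 0)"
    unfolding alg_coeff_def galg_one_def by (rule sum.cong) auto
  also have "\<dots> = D s t \<one>\<^bsub>G\<^esub>" using finG o by simp
  finally show ?thesis using D_one[OF assms] by simp
qed

lemma alg_coeff_scale: "alg_coeff (fscale z a) s t = z * alg_coeff a s t"
  by (simp add: alg_coeff_def fscale_def sum_distrib_left mult.assoc)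

lemma alg_coeff_zero: "alg_coeff 0 s t = 0"
  by (simp add: alg_coeff_def)

lemma alg_coeff_add: "alg_coeff (a + b) s t = alg_coeff a s t + alg_coeff b s t"
  by (simp add: alg_coeff_def distrib_right sum.distrib)

lemma alg_coeff_mult:
  assumes st: "s \<in> \<Theta>" "t \<in> \<Theta>"
  shows "alg_coeff (galg_mult G a b) s t = (\<Sum>r\<in>\<Theta>. alg_coeff a s r * alg_coeff b r t)"
proof -
  interpret group G by (rule grp)
  have "alg_coeff (galg_mult G a b) s t = (\<Sum>g\<in>carrier G. \<Sum>h\<in>carrier G. a h * b (inv\<^bsub>G\<^esub> h \<otimes>\<^bsub>G\<^esub> g) * D s t g)"
    by (simp add: alg_coeff_def galg_mult_def sum_distrib_right)
  also have "\<dots> = (\<Sum>h\<in>carrier G. \<Sum>g\<in>carrier G. a h * b (inv\<^bsub>G\<^esub> h \<otimes>\<^bsub>G\<^esub> g) * D s t g)" by (rule sum.swap)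
  also have "\<dots> = (\<Sum>h\<in>carrier G. \<Sum>k\<in>carrier G. a h * b k * D s t (h \<otimes>\<^bsub>G\<^esub> k))"
  proof (rule sum.cong[OF refl])
    fix h assume h: "h \<in> carrier G"
    show "(\<Sum>g\<in>carrier G. a h * b (inv\<^bsub>G\<^esub> h \<otimes>\<^bsub>G\<^esub> g) * D s t g) = (\<Sum>k\<in>carrier G. a h * b k * D s t (h \<otimes>\<^bsub>G\<^esub> k))"
      by (rule sum.reindex_bij_witness[of _ "\<lambda>k. h \<otimes>\<^bsub>G\<^esub> k" "\<lambda>g. inv\<^bsub>G\<^esub> h \<otimes>\<^bsub>G\<^esub> g"])
        (use h in \<open>simp_all add: m_assoc[symmetric]\<close>)
  qed
  also have "\<dots> = (\<Sum>h\<in>carrier G. \<Sum>k\<in>carrier G. \<Sum>r\<in>\<Theta>. (a h * D s r h) * (b k * D r t k))"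
    by (intro sum.cong refl) (simp add: D_mult[OF st] sum_distrib_left mult_ac)
  also have "\<dots> = (\<Sum>h\<in>carrier G. \<Sum>r\<in>\<Theta>. \<Sum>k\<in>carrier G. (a h * D s r h) * (b k * D r t k))"
    by (rule sum.cong[OF refl], rule sum.swap)
  also have "\<dots> = (\<Sum>r\<in>\<Theta>. \<Sum>h\<in>carrier G. \<Sum>k\<in>carrier G. (a h * D s r h) * (b k * D r t k))" by (rule sum.swap)
  also have "\<dots> = (\<Sum>r\<in>\<Theta>. alg_coeff a s r * alg_coeff b r t)"
    by (simp only: alg_coeff_def sum_product)
  finally show ?thesis .
qed

text \<open>The value of an element at h is a fixed combination of its matrix entries, because the
  indicator of h is a combination of the functions \<open>D s t\<close>.\<close>

lemma alg_coeff_inj: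
  assumes a: "\<And>g. g \<notin> carrier G \<Longrightarrow> a g = 0" and b: "\<And>g. g \<notin> carrier G \<Longrightarrow> b g = 0"
    and eq: "\<And>s t. s \<in> \<Theta> \<Longrightarrow> t \<in> \<Theta> \<Longrightarrow> alg_coeff a s t = alg_coeff b s t"
  shows "a = b"
proof
  fix h
  show "a h = b h"
  proof (cases "h \<in> carrier G")
    case True
    obtain c where c: "\<forall>g\<in>carrier G. (if g = h then 1 else 0) = (\<Sum>s\<in>\<Theta>. \<Sum>t\<in>\<Theta>. c s t * D s t g)"
      using spn[of "\<lambda>g. if g = h then 1 else 0"] ..
    have e: "f h = (\<Sum>s\<in>\<Theta>. \<Sum>t\<in>\<Theta>. c s t * alg_coeff f s t)" for f
    proof -
      have "f h = (\<Sum>g\<in>carrier G. f g * (if g = h then 1 else 0))"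
        using finG True by (simp add: if_distrib cong: if_cong)
      also have "\<dots> = (\<Sum>g\<in>carrier G. \<Sum>s\<in>\<Theta>. \<Sum>t\<in>\<Theta>. c s t * (f g * D s t g))"
        using c by (intro sum.cong refl) (simp only: sum_distrib_left mult.left_commute)
      also have "\<dots> = (\<Sum>s\<in>\<Theta>. \<Sum>t\<in>\<Theta>. \<Sum>g\<in>carrier G. c s t * (f g * D s t g))" by (rule sum_rotate)
      finally show ?thesis by (simp only: alg_coeff_def sum_distrib_left)
    qed
    show ?thesis unfolding e by (intro sum.cong refl) (simp only: eq)
  qed (simp add: a b)
qed

end

locale diagonal_algebra = coeff_basis G \<Theta> sh D
  for G :: "'g monoid" and \<Theta> :: "'t set" and sh :: "'t \<Rightarrow> 's" and D :: "'t \<Rightarrow> 't \<Rightarrow> 'g \<Rightarrow> complex" +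
  fixes S :: "('g \<Rightarrow> complex) set"
  assumes S_diag: "\<And>a s t. a \<in> S \<Longrightarrow> s \<in> \<Theta> \<Longrightarrow> t \<in> \<Theta> \<Longrightarrow> s \<noteq> t \<Longrightarrow> alg_coeff a s t = 0"
    and S_off: "\<And>a g. a \<in> S \<Longrightarrow> g \<notin> carrier G \<Longrightarrow> a g = 0"
begin

abbreviation A :: "('g \<Rightarrow> complex) set" where
  "A \<equiv> generated_subalgebra G S"

definition same_weight :: "'t \<Rightarrow> 't \<Rightarrow> bool" where
  "same_weight s t \<longleftrightarrow> (\<forall>a\<in>A. alg_coeff a s s = alg_coeff a t t)"

lemma sum_diag:
  assumes "a \<in> A" "s \<in> \<Theta>" "\<And>r. r \<in> \<Theta> \<Longrightarrow> s \<noteq> r \<Longrightarrow> alg_coeff a s r = 0"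
  shows "(\<Sum>r\<in>\<Theta>. alg_coeff a s r * f r) = alg_coeff a s s * f s"
proof -
  have "(\<Sum>r\<in>\<Theta>. alg_coeff a s r * f r) = (\<Sum>r\<in>{s}. alg_coeff a s r * f r)"
    by (rule sum.mono_neutral_right[OF fin]) (use assms in auto)
  then show ?thesis by simp
qed

lemma A_diag: "a \<in> A \<Longrightarrow> s \<in> \<Theta> \<Longrightarrow> t \<in> \<Theta> \<Longrightarrow> s \<noteq> t \<Longrightarrow> alg_coeff a s t = 0"
proof (induction arbitrary: s t rule: generated_subalgebra.induct)
  case (mult a b)
  then show ?case using sum_diag[OF mult.hyps(1) mult.prems(1), of "\<lambda>r. alg_coeff b r t"] by (simp add: alg_coeff_mult)
qed (simp_all add: alg_coeff_one alg_coeff_scale alg_coeff_add S_diag)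

lemma weight_mult:
  assumes "a \<in> A" "b \<in> A" "t \<in> \<Theta>"
  shows "alg_coeff (galg_mult G a b) t t = alg_coeff a t t * alg_coeff b t t"
  unfolding alg_coeff_mult[OF assms(3,3)] by (rule sum_diag[OF assms(1,3)]) (rule A_diag[OF assms(1,3)])

lemma A_off: "a \<in> A \<Longrightarrow> g \<notin> carrier G \<Longrightarrow> a g = 0"
proof (induction rule: generated_subalgebra.induct)
  case one
  have "\<one>\<^bsub>G\<^esub> \<in> carrier G" using monoid.one_closed[OF group.is_monoid[OF grp]] .
  then show ?case using one by (auto simp: galg_one_def)
qed (simp_all add: S_off fscale_def galg_mult_def)

text \<open>Elements of the generated algebra are diagonal, so their diagonal entries determine
  them; identities in A reduce to identities of weights.\<close>

lemma A_eqI: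
  assumes "a \<in> A" "b \<in> A" "\<And>t. t \<in> \<Theta> \<Longrightarrow> alg_coeff a t t = alg_coeff b t t"
  shows "a = b"
proof (rule alg_coeff_inj)
  fix s t assume "s \<in> \<Theta>" "t \<in> \<Theta>"
  then show "alg_coeff a s t = alg_coeff b s t"
    using assms(3) A_diag[OF assms(1)] A_diag[OF assms(2)] by (cases "s = t") simp_all
qed (rule A_off[OF assms(1)], assumption, rule A_off[OF assms(2)], assumption)

lemma same_weight_iff:
  assumes st: "s \<in> \<Theta>" "t \<in> \<Theta>"
  shows "same_weight s t \<longleftrightarrow> (\<forall>a\<in>S. alg_coeff a s s = alg_coeff a t t)"
proof
  assume "same_weight s t"
  then show "\<forall>a\<in>S. alg_coeff a s s = alg_coeff a t t" unfolding same_weight_def using generated_subalgebra.gen by blast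
next
  assume g: "\<forall>a\<in>S. alg_coeff a s s = alg_coeff a t t"
  show "same_weight s t"
    unfolding same_weight_def
  proof
    fix a assume "a \<in> A"
    then show "alg_coeff a s s = alg_coeff a t t"
    proof (induction rule: generated_subalgebra.induct)
      case (mult a b)
      then show ?case using weight_mult[OF mult.hyps st(1)] weight_mult[OF mult.hyps st(2)] by simp
    next
      case one
      show ?case by (simp add: alg_coeff_one st)
    next
      case (gen a)
      then show ?case using g by blast
    next
      case (scale a z)
      then show ?case by (simp only: alg_coeff_scale)
    next
      case (add a b)
      then show ?case by (simp only: alg_coeff_add)
    qed
  qed
qed

text \<open>The weights of A form a unital algebra of functions on the index set, so
  \<open>separating_idempotent\<close> yields an element of A that projects onto a joint
  eigenspace.\<close>

lemma ex_projection:
  assumes t0: "t0 \<in> \<Theta>"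
  shows "\<exists>p\<in>A. \<forall>t\<in>\<Theta>. alg_coeff p t t = (if same_weight t t0 then 1 else 0)"
proof -
  define R where "R = {r. \<exists>a\<in>A. \<forall>t\<in>\<Theta>. r t = alg_coeff a t t}"
  have R: "r \<in> R" if "a \<in> A" "\<And>t. t \<in> \<Theta> \<Longrightarrow> r t = alg_coeff a t t" for r a
    using that unfolding R_def by blast
  have "\<exists>r\<in>R. \<forall>i\<in>\<Theta>. r i = (if \<forall>s\<in>R. s i = s t0 then 1 else 0)"
  proof (rule separating_idempotent[OF fin t0])
    show "(\<lambda>_. 1) \<in> R" by (rule R[OF generated_subalgebra.one]) (simp add: alg_coeff_one)
    show "(\<lambda>i. z * r i) \<in> R" if r: "r \<in> R" for r z
    proof -
      obtain a where a: "a \<in> A" "\<forall>t\<in>\<Theta>. r t = alg_coeff a t t" using r unfolding R_def by blast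
      show ?thesis by (rule R[OF generated_subalgebra.scale[OF a(1), of z]]) (simp add: alg_coeff_scale a(2))
    qed
    fix r r' assume "r \<in> R" "r' \<in> R"
    then obtain a b where a: "a \<in> A" "\<forall>t\<in>\<Theta>. r t = alg_coeff a t t" and b: "b \<in> A" "\<forall>t\<in>\<Theta>. r' t = alg_coeff b t t"
      unfolding R_def by blast
    show "(\<lambda>i. r i + r' i) \<in> R" by (rule R[OF generated_subalgebra.add[OF a(1) b(1)]]) (simp add: alg_coeff_add a(2) b(2))
    show "(\<lambda>i. r i * r' i) \<in> R" by (rule R[OF generated_subalgebra.mult[OF a(1) b(1)]]) (simp add: weight_mult[OF a(1) b(1)] a(2) b(2))
  qed
  then obtain r where r: "r \<in> R" "\<forall>i\<in>\<Theta>. r i = (if \<forall>s\<in>R. s i = s t0 then 1 else 0)" by blast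
  have iff: "(\<forall>s\<in>R. s i = s t0) \<longleftrightarrow> same_weight i t0" if i: "i \<in> \<Theta>" for i
  proof
    assume h: "\<forall>s\<in>R. s i = s t0"
    show "same_weight i t0" unfolding same_weight_def
    proof
      fix a assume "a \<in> A"
      then have "(\<lambda>t. alg_coeff a t t) \<in> R" by (rule R) (rule refl)
      from bspec[OF h this] show "alg_coeff a i i = alg_coeff a t0 t0" .
    qed
  next
    assume h: "same_weight i t0"
    show "\<forall>s\<in>R. s i = s t0" using h i t0 unfolding same_weight_def R_def by auto
  qed
  obtain p where p: "p \<in> A" "\<forall>t\<in>\<Theta>. r t = alg_coeff p t t" using r(1) unfolding R_def by blast
  show ?thesis
  proof (rule bexI[OF _ p(1)], rule ballI)
    fix t assume t: "t \<in> \<Theta>"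
    then have "alg_coeff p t t = (if \<forall>s\<in>R. s t = s t0 then 1 else 0)" using p(2) r(2) by simp
    then show "alg_coeff p t t = (if same_weight t t0 then 1 else 0)" by (simp only: iff[OF t])
  qed
qed

lemma zero_in_A: "0 \<in> A"
  using generated_subalgebra.scale[OF generated_subalgebra.one[of G S], of 0] unfolding fn.scale_zero_left .

lemma sum_in_A:
  assumes "finite I" "\<And>i. i \<in> I \<Longrightarrow> f i \<in> A"
  shows "(\<Sum>i\<in>I. f i) \<in> A"
  using assms
proof (induction I rule: finite_induct)
  case empty
  show ?case unfolding sum.empty by (rule zero_in_A)
next
  case (insert i I)
  show ?case unfolding sum.insert[OF insert.hyps]
    by (rule generated_subalgebra.add) (use insert in blast)+
qed

lemma alg_rep_sum:
  assumes rep: "is_alg_rep G A X \<tau>" and xy: "x \<in> X" "y \<in> X" and "finite I" "\<And>i. i \<in> I \<Longrightarrow> f i \<in> A"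
  shows "\<tau> (\<Sum>i\<in>I. f i) x y = (\<Sum>i\<in>I. \<tau> (f i) x y)"
  using assms(4,5)
proof (induction I rule: finite_induct)
  case empty
  have "\<tau> (fscale 0 (galg_one G)) x y = 0 * \<tau> (galg_one G) x y"
    using rep xy generated_subalgebra.one[of G S] unfolding is_alg_rep_def by blast
  then show ?case unfolding sum.empty fn.scale_zero_left mult_zero_left .
next
  case (insert i I)
  have fi: "f i \<in> A" by (rule insert.prems) simp
  have F: "(\<Sum>i\<in>I. f i) \<in> A" by (rule sum_in_A[OF insert.hyps(1)]) (rule insert.prems, simp)
  have "\<tau> (f i + (\<Sum>i\<in>I. f i)) x y = \<tau> (f i) x y + \<tau> (\<Sum>i\<in>I. f i) x y"
    using rep xy fi F unfolding is_alg_rep_def by blast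
  also have "\<tau> (\<Sum>i\<in>I. f i) x y = (\<Sum>i\<in>I. \<tau> (f i) x y)" by (rule insert.IH) (rule insert.prems, simp)
  finally show ?case unfolding sum.insert[OF insert.hyps] .
qed

text \<open>The joint eigenspace projections, suitably weighted, add up to the unit, so one of them
  acts nontrivially. As a times \<open>p t\<close> is the weight of a at t times \<open>p t\<close>,
  the columns of its matrix are eigenvectors.\<close>

lemma alg_rep_eigenvector:
  assumes rep: "is_alg_rep G A X \<tau>" and x0: "x0 \<in> X"
  shows "\<exists>t\<in>\<Theta>. \<exists>v\<in>coord_space X. v \<noteq> 0 \<and> (\<forall>a\<in>A. mat_act X (\<tau> a) v = fscale (alg_coeff a t t) v)"
proof -
  have "\<forall>t\<in>\<Theta>. \<exists>p. p \<in> A \<and> (\<forall>s\<in>\<Theta>. alg_coeff p s s = (if same_weight s t then 1 else 0))"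
    using ex_projection by blast
  from bchoice[OF this] obtain p where p: "\<forall>t\<in>\<Theta>. p t \<in> A \<and> (\<forall>s\<in>\<Theta>. alg_coeff (p t) s s = (if same_weight s t then 1 else 0))" ..
  have sw: "same_weight s t \<longleftrightarrow> same_weight t s" "same_weight s s" "same_weight s t \<Longrightarrow> same_weight t r \<Longrightarrow> same_weight s r" for s t r
    by (auto simp: same_weight_def)
  \<comment> \<open>A projection occurs once for every index of its weight class; dividing by the
    size of the class makes the sum equal to the unit.\<close>
  define N where "N = (\<lambda>t. card {s \<in> \<Theta>. same_weight s t})"
  have N0: "N t > 0" if "t \<in> \<Theta>" for t using fin that sw(2) by (auto simp: N_def card_gt_0_iff)
  define b where "b = (\<Sum>t\<in>\<Theta>. fscale (1 / of_nat (N t)) (p t))"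
  have pA: "fscale (1 / of_nat (N t)) (p t) \<in> A" if "t \<in> \<Theta>" for t
    using generated_subalgebra.scale p that by blast
  have bA: "b \<in> A" unfolding b_def by (rule sum_in_A[OF fin pA])
  have coeff_sum: "alg_coeff (\<Sum>t\<in>I. f t) s s = (\<Sum>t\<in>I. alg_coeff (f t) s s)" if "finite I" for f s and I :: "'t set"
    using that by (induction I rule: finite_induct) (simp_all only: sum.empty sum.insert alg_coeff_add alg_coeff_zero simp_thms)
  have "b = galg_one G"
  proof (rule A_eqI)
    show "b \<in> A" by (rule bA)
    show "galg_one G \<in> A" by (rule generated_subalgebra.one)
    fix s assume s: "s \<in> \<Theta>"
    have "alg_coeff b s s = (\<Sum>t\<in>\<Theta>. if same_weight t s then 1 / of_nat (N s) else 0)"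
      unfolding b_def coeff_sum[OF fin]
    proof (rule sum.cong[OF refl])
      fix t assume t: "t \<in> \<Theta>"
      have "N t = N s" if "same_weight t s"
      proof -
        have "{r \<in> \<Theta>. same_weight r t} = {r \<in> \<Theta>. same_weight r s}" using that sw by blast
        then show ?thesis by (simp add: N_def)
      qed
      then show "alg_coeff (fscale (1 / of_nat (N t)) (p t)) s s = (if same_weight t s then 1 / of_nat (N s) else 0)"
        using p t s sw(1)[of s t] by (auto simp: alg_coeff_scale)
    qed
    also have "\<dots> = (\<Sum>t\<in>{t \<in> \<Theta>. same_weight t s}. 1 / of_nat (N s))"
      by (rule sum.inter_filter[OF fin, symmetric])
    also have "\<dots> = 1" using N0[OF s] by (simp add: N_def)
    finally show "alg_coeff b s s = alg_coeff (galg_one G) s s" by (simp add: alg_coeff_one[OF s s])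
  qed
  have "\<tau> b x0 x0 = (\<Sum>t\<in>\<Theta>. \<tau> (fscale (1 / of_nat (N t)) (p t)) x0 x0)"
    unfolding b_def by (rule alg_rep_sum[OF rep x0 x0 fin pA])
  moreover have "\<tau> b x0 x0 = 1" using rep x0 unfolding \<open>b = galg_one G\<close> is_alg_rep_def by simp
  ultimately have "(\<Sum>t\<in>\<Theta>. \<tau> (fscale (1 / of_nat (N t)) (p t)) x0 x0) \<noteq> 0" by simp
  then obtain t where t: "t \<in> \<Theta>" "\<tau> (fscale (1 / of_nat (N t)) (p t)) x0 x0 \<noteq> 0"
    using sum.not_neutral_contains_not_neutral by blast
  have ptA: "p t \<in> A" using p t(1) by blast
  have "\<tau> (fscale (1 / of_nat (N t)) (p t)) x0 x0 = 1 / of_nat (N t) * \<tau> (p t) x0 x0"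
    using rep x0 ptA unfolding is_alg_rep_def by blast
  then have nz: "\<tau> (p t) x0 x0 \<noteq> 0" using t(2) by auto
  define v where "v = (\<lambda>x. if x \<in> X then \<tau> (p t) x x0 else 0)"
  have "mat_act X (\<tau> a) v = fscale (alg_coeff a t t) v" if a: "a \<in> A" for a
  proof
    fix x
    have eq: "galg_mult G a (p t) = fscale (alg_coeff a t t) (p t)"
    proof (rule A_eqI[OF generated_subalgebra.mult[OF a ptA] generated_subalgebra.scale[OF ptA]])
      fix s assume s: "s \<in> \<Theta>"
      have ps: "alg_coeff (p t) s s = (if same_weight s t then 1 else 0)" using p t(1) s by blast
      have "alg_coeff a s s = alg_coeff a t t" if "same_weight s t" using that a unfolding same_weight_def by blast
      then show "alg_coeff (galg_mult G a (p t)) s s = alg_coeff (fscale (alg_coeff a t t) (p t)) s s"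
        unfolding weight_mult[OF a ptA s] alg_coeff_scale ps by simp
    qed
    show "mat_act X (\<tau> a) v x = fscale (alg_coeff a t t) v x"
    proof (cases "x \<in> X")
      case True
      have "mat_act X (\<tau> a) v x = (\<Sum>z\<in>X. \<tau> a x z * \<tau> (p t) z x0)" using True by (simp add: mat_act_def v_def)
      also have "\<dots> = \<tau> (galg_mult G a (p t)) x x0" using rep True x0 a ptA unfolding is_alg_rep_def by simp
      also have "\<dots> = alg_coeff a t t * \<tau> (p t) x x0" unfolding eq using rep True x0 ptA unfolding is_alg_rep_def by blast
      finally show ?thesis using True by (simp add: v_def fscale_def)
    qed (simp add: mat_act_def v_def fscale_def)
  qed
  moreover have "v \<in> coord_space X" by (simp add: v_def coord_space_def)
  moreover have "v \<noteq> 0" using nz x0 by (auto simp: v_def fun_eq_iff)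
  ultimately show ?thesis using t(1) by blast
qed

text \<open>A joint eigenvector spans a submodule, so an irreducible representation has dimension
  one and is given by a weight.\<close>

lemma irreducible_alg_rep:
  fixes e :: nat
  assumes rep: "is_alg_rep G A {..<e} \<tau>" and irr: "irreducible_on A {..<e} \<tau>"
  shows "e = 1 \<and> (\<exists>t\<in>\<Theta>. \<forall>a\<in>A. \<tau> a 0 0 = alg_coeff a t t)"
proof -
  have "{..<e} \<noteq> {}" using irr by (simp add: irreducible_on_def)
  then have e: "0 \<in> {..<e}" by auto
  obtain t v where t: "t \<in> \<Theta>" and v: "v \<in> coord_space {..<e}" "v \<noteq> 0"
    "\<forall>a\<in>A. mat_act {..<e} (\<tau> a) v = fscale (alg_coeff a t t) v"
    using alg_rep_eigenvector[OF rep e] by blast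
  have "submod A {..<e} \<tau> (fn.span {v})"
    unfolding submod_def
  proof (intro conjI ballI)
    show "fn.span {v} \<subseteq> coord_space {..<e}" by (rule fn.span_minimal[OF _ subspace_coord_space]) (use v(1) in simp)
    fix a h assume a: "a \<in> A" and "h \<in> fn.span {v}"
    then obtain z where "h = fscale z v" unfolding fn.span_singleton by blast
    then have "mat_act {..<e} (\<tau> a) h = fscale (z * alg_coeff a t t) v" using v(3) a by (simp add: mat_act_scale)
    then show "mat_act {..<e} (\<tau> a) h \<in> fn.span {v}" unfolding fn.span_singleton by blast
  qed (rule fn.subspace_span)
  then have "fn.span {v} = {0} \<or> fn.span {v} = coord_space {..<e}" using irr unfolding irreducible_on_def by blast
  moreover have "v \<in> fn.span {v}" by (rule fn.span_base) simp
  ultimately have sp: "coord_space {..<e} = fn.span {v}" using v(2) by blast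
  have unit: "\<exists>z. (\<lambda>x. if x = i then 1 else 0) = fscale z v" if "i < e" for i
  proof -
    have "(\<lambda>x. if x = i then 1 else 0) \<in> coord_space {..<e}" using that by (simp add: coord_space_def)
    then show ?thesis unfolding sp fn.span_singleton by blast
  qed
  obtain z0 where z0: "(\<lambda>x. if x = 0 then 1 else 0) = fscale z0 v" using unit[of 0] e by blast
  have v0: "z0 * v 0 = 1" using fun_cong[OF z0, of 0] by (simp add: fscale_def)
  have "e = 1"
  proof (rule ccontr)
    assume "e \<noteq> 1"
    then have "1 < e" using e by simp
    then obtain z1 where z1: "(\<lambda>x. if x = 1 then 1 else 0) = fscale z1 v" using unit by blast
    have "z1 * v 0 = 0" "z1 * v 1 = 1" using fun_cong[OF z1, of 0] fun_cong[OF z1, of 1] by (simp_all add: fscale_def)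
    then show False using v0 by auto
  qed
  moreover have "\<tau> a 0 0 = alg_coeff a t t" if a: "a \<in> A" for a
  proof -
    have "mat_act {..<1} (\<tau> a) v 0 = alg_coeff a t t * v 0" using v(3) a \<open>e = 1\<close> by (simp add: fscale_def)
    then show ?thesis using v0 by (auto simp: mat_act_def)
  qed
  ultimately show ?thesis using t by blast
qed

lemma weight_rep:
  assumes t: "t \<in> \<Theta>"
  shows "is_alg_rep G A {..<1::nat} (\<lambda>a x y. alg_coeff a t t)" "irreducible_on A {..<1::nat} (\<lambda>a x y. alg_coeff a t t)"
proof -
  show "is_alg_rep G A {..<1::nat} (\<lambda>a x y. alg_coeff a t t)"
    unfolding is_alg_rep_def using t by (simp add: alg_coeff_one alg_coeff_scale alg_coeff_add weight_mult)
  show "irreducible_on A {..<1::nat} (\<lambda>a x y. alg_coeff a t t)"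
    unfolding irreducible_on_def
  proof (intro conjI allI impI)
    have "0 \<in> {..<1::nat}" by simp
    then show "{..<1::nat} \<noteq> {}" by blast
    fix W :: "(nat \<Rightarrow> complex) set" assume W: "submod A {..<1} (\<lambda>a x y. alg_coeff a t t) W"
    then have sW: "fn.subspace W" and WX: "W \<subseteq> coord_space {..<1}" by (simp_all add: submod_def)
    show "W = {0} \<or> W = coord_space {..<1}"
    proof (cases "\<exists>v\<in>W. v \<noteq> 0")
      case True
      then obtain v where v: "v \<in> W" "v \<noteq> 0" by blast
      have c: "f x = 0" if "f \<in> coord_space {..<1}" "x \<noteq> 0" for f :: "nat \<Rightarrow> complex" and x
        using that by (simp add: coord_space_def)
      have vc: "v \<in> coord_space {..<1}" using v(1) WX by blast
      have v0: "v 0 \<noteq> 0"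
      proof
        assume "v 0 = 0"
        then have "v x = 0" for x using c[OF vc, of x] by (cases "x = 0") simp_all
        then have "v = 0" by (intro ext) (simp only: zero_fun_apply)
        then show False using v(2) by blast
      qed
      have "h \<in> W" if h: "h \<in> coord_space {..<1}" for h
      proof -
        have "h x = fscale (h 0 / v 0) v x" for x
          using c[OF h, of x] c[OF vc, of x] v0 by (cases "x = 0") (simp_all add: fscale_def)
        then have "h = fscale (h 0 / v 0) v" by (rule ext)
        moreover have "fscale (h 0 / v 0) v \<in> W" by (rule fn.subspace_scale[OF sW v(1)])
        ultimately show ?thesis by (simp only:)
      qed
      then show ?thesis using WX by blast
    next
      case False
      then show ?thesis using fn.subspace_0[OF sW] by blast
    qed
  qed
qed

lemma comp_mult_adapted:
  fixes \<tau> :: "('g \<Rightarrow> complex) \<Rightarrow> nat \<Rightarrow> nat \<Rightarrow> complex"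
  assumes rep: "is_rep G X \<rho>" and u: "adapted X \<rho> \<alpha> u" and t0: "t0 \<in> \<Theta>"
    and \<tau>: "\<And>a. a \<in> A \<Longrightarrow> \<tau> a 0 0 = alg_coeff a t0 t0"
  shows "comp_mult A X (alg_ext G \<rho>) {..<1} \<tau> = card {s \<in> fib \<alpha>. same_weight s t0}"
proof -
  have finX: "finite X" using rep by (simp add: is_rep_def)
  have fb: "s \<in> \<Theta>" if "s \<in> fib \<alpha>" for s using that by (simp add: fib_def)
  interpret diagonal_module A X "alg_ext G \<rho>" "fib \<alpha>" u "\<lambda>a s. alg_coeff a s s"
  proof (rule diagonal_module.intro[OF finX finite_fib])
    show "u s \<in> coord_space X" if "s \<in> fib \<alpha>" for s using u that unfolding adapted_def by blast
    show "\<forall>s\<in>fib \<alpha>. b s = 0" if "\<And>x. (\<Sum>s\<in>fib \<alpha>. b s * u s x) = 0" for b using u that unfolding adapted_def by blast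
    show "coord_space X \<subseteq> fn.span (u ` fib \<alpha>)"
    proof
      fix f assume "f \<in> coord_space X"
      then obtain b where b: "\<forall>x. f x = (\<Sum>s\<in>fib \<alpha>. b s * u s x)" using u unfolding adapted_def by blast
      have "f = (\<Sum>s\<in>fib \<alpha>. fscale (b s) (u s))" by (rule ext) (simp only: fn_sum_apply fscale_def b)
      then show "f \<in> fn.span (u ` fib \<alpha>)" by (simp only:) (intro fn.span_sum fn.span_scale fn.span_base imageI)
    qed
    fix a s assume a: "a \<in> A" and s: "s \<in> fib \<alpha>"
    show "mat_act X (alg_ext G \<rho> a) (u s) = fscale (alg_coeff a s s) (u s)"
    proof
      fix x
      show "mat_act X (alg_ext G \<rho> a) (u s) x = fscale (alg_coeff a s s) (u s) x"
      proof (cases "x \<in> X")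
        case True
        have "mat_act X (alg_ext G \<rho> a) (u s) x = (\<Sum>y\<in>X. \<Sum>g\<in>carrier G. a g * (\<rho> g x y * u s y))"
          using True by (simp add: mat_act_def alg_ext_def sum_distrib_right mult.assoc)
        also have "\<dots> = (\<Sum>g\<in>carrier G. \<Sum>y\<in>X. a g * (\<rho> g x y * u s y))" by (rule sum.swap)
        also have "\<dots> = (\<Sum>g\<in>carrier G. a g * mat_act X (\<rho> g) (u s) x)"
          using True by (simp add: mat_act_def sum_distrib_left)
        also have "\<dots> = (\<Sum>g\<in>carrier G. \<Sum>r\<in>fib \<alpha>. (a g * D r s g) * u r x)"
          using u s unfolding adapted_def by (intro sum.cong refl) (simp add: sum_distrib_left mult.assoc)
        also have "\<dots> = (\<Sum>r\<in>fib \<alpha>. \<Sum>g\<in>carrier G. (a g * D r s g) * u r x)" by (rule sum.swap)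
        also have "\<dots> = (\<Sum>r\<in>fib \<alpha>. alg_coeff a r s * u r x)" by (simp only: alg_coeff_def sum_distrib_right)
        also have "\<dots> = (\<Sum>r\<in>{s}. alg_coeff a r s * u r x)"
          by (rule sum.mono_neutral_right) (use s A_diag[OF a fb fb[OF s]] in auto)
        finally show ?thesis by (simp add: fscale_def)
      next
        case False
        then show ?thesis using u s unfolding adapted_def by (simp add: mat_act_def fscale_def coord_space_def)
      qed
    qed
  qed
  obtain p where p: "p \<in> A" "\<forall>t\<in>\<Theta>. alg_coeff p t t = (if same_weight t t0 then 1 else 0)"
    using ex_projection[OF t0] by blast
  have iff: "(\<forall>a\<in>A. alg_coeff a s s = \<tau> a 0 0) \<longleftrightarrow> same_weight s t0" for s
    using \<tau> by (simp add: same_weight_def)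
  have "same_weight t0 t0" by (simp add: same_weight_def)
  then have "\<tau> p 0 0 = 1" using \<tau>[OF p(1)] p(2) t0 by simp
  from comp_mult_eq[where \<tau> = \<tau>, OF p(1) this] show ?thesis unfolding iff using p(2) fb by simp
qed

text \<open>\<open>irr_rep\<close> picks an arbitrary representation with the given character.
  \<open>irreducible_adapted\<close> identifies it with some block, and \<open>blk_char_inj\<close>
  forces this block to be \<open>\<alpha>\<close>.\<close>

lemma comp_mult_irr_rep:
  fixes \<tau> :: "('g \<Rightarrow> complex) \<Rightarrow> nat \<Rightarrow> nat \<Rightarrow> complex"
  assumes \<alpha>: "\<alpha> \<in> sh ` \<Theta>" and t0: "t0 \<in> \<Theta>" and \<tau>: "\<And>a. a \<in> A \<Longrightarrow> \<tau> a 0 0 = alg_coeff a t0 t0"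
  shows "(case irr_rep G (blk_char \<alpha>) of (d, \<rho>) \<Rightarrow> comp_mult A {..<d} (alg_ext G \<rho>) {..<1} \<tau>) =
    card {s \<in> fib \<alpha>. same_weight s t0}"
proof -
  obtain d \<rho> where dr: "irr_rep G (blk_char \<alpha>) = (d, \<rho>)" by (cases "irr_rep G (blk_char \<alpha>)")
  have "\<exists>p. case p of (d, \<rho>) \<Rightarrow> affords G d \<rho> (blk_char \<alpha>)"
    using blk_char_in_Irr[OF \<alpha>] unfolding Irr_def by auto
  from someI_ex[OF this] have "affords G d \<rho> (blk_char \<alpha>)" using dr unfolding irr_rep_def by simp
  then have r: "is_rep G {..<d} \<rho>" "irreducible_on (carrier G) {..<d} \<rho>" "blk_char \<alpha> = rep_char G {..<d} \<rho>"
    by (simp_all add: affords_def)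
  obtain \<beta> u where b: "\<beta> \<in> sh ` \<Theta>" "adapted {..<d} \<rho> \<beta> u" using irreducible_adapted[OF r(1,2)] by blast
  have "blk_char \<alpha> = blk_char \<beta>" using adapted_char[OF r(1) b(2)] r(3) by (simp only:)
  then have "\<beta> = \<alpha>" using inj_onD[OF blk_char_inj _ \<alpha> b(1)] by simp
  then show ?thesis using comp_mult_adapted[where \<tau> = \<tau>, OF r(1) b(2) t0 \<tau>] unfolding dr by simp
qed

lemma sum_Irr:
  fixes \<tau> :: "('g \<Rightarrow> complex) \<Rightarrow> nat \<Rightarrow> nat \<Rightarrow> complex"
  assumes t0: "t0 \<in> \<Theta>" and \<tau>: "\<And>a. a \<in> A \<Longrightarrow> \<tau> a 0 0 = alg_coeff a t0 t0"
  shows "(\<Sum>\<chi>\<in>Irr G. (case irr_rep G \<chi> of (d, \<rho>) \<Rightarrow> of_nat (comp_mult A {..<d} (alg_ext G \<rho>) {..<1} \<tau>)) * \<chi> g) =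
    (\<Sum>\<alpha>\<in>sh ` \<Theta>. of_nat (card {s \<in> fib \<alpha>. same_weight s t0}) * blk_char \<alpha> g)"
  unfolding Irr_eq sum.reindex[OF blk_char_inj] o_def
proof (rule sum.cong[OF refl])
  fix \<alpha> assume "\<alpha> \<in> sh ` \<Theta>"
  from comp_mult_irr_rep[where \<tau> = \<tau>, OF this t0 \<tau>]
  show "(case irr_rep G (blk_char \<alpha>) of (d, \<rho>) \<Rightarrow> of_nat (comp_mult A {..<d} (alg_ext G \<rho>) {..<1} \<tau>)) * blk_char \<alpha> g =
    of_nat (card {s \<in> fib \<alpha>. same_weight s t0}) * blk_char \<alpha> g"
    by (simp add: case_prod_unfold)
qed

end

section \<open>The Jucys--Murphy algebra\<close>

lemma jm_element_off:
  assumes l: "1 \<le> l" and i: "i < n" and g: "g \<notin> GL l n"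
  shows "jm_element l n c (Suc i) g = 0"
proof -
  have "new_refls l n i \<subseteq> GL l n"
    unfolding new_refls_def using i by (auto intro!: sigma_pow_carrier[OF l] swap_refl_carrier[OF l])
  then show ?thesis using g reflections_diff[OF l i] by (auto simp: jm_element_def)
qed

text \<open>The inner product only sums over \<open>omega l n\<close>, where
  \<open>jm_element_acts\<close> is available; the vector of t is an eigenvector there, and distinct
  standard vectors are orthogonal.\<close>

lemma jm_element_std_coeff:
  assumes l: "1 \<le> l" and i: "i < n" and c0: "c 0 = - 1 / of_nat l" and s: "s \<in> Std l n" and t: "t \<in> Std l n"
  shows "(\<Sum>g\<in>GL l n. jm_element l n c (Suc i) g * std_coeff l n s t g) =
    (if s = t then jm_weight l c (bcomp (t i)) + of_int (content (t i)) else 0)"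
proof (cases "shape n s = shape n t")
  case False
  then show ?thesis by (auto simp: std_coeff_def)
next
  case True
  let ?w = "jm_weight l c (bcomp (t i)) + of_int (content (t i))"
  let ?v = "std_vec l n t" and ?u = "std_vec l n s"
  let ?J = "jm_element l n c (Suc i)"
  have pt: "(\<Sum>g\<in>GL l n. ?J g * act n g ?v T) = ?w * ?v T" if T: "T \<in> omega l n" for T
  proof -
    have j: "jm_op i ?v T = of_int (content (t i)) * ?v T" using std_vec_jm(1)[OF l t i] by (simp add: fscale_def)
    have "jm_weight l c (snd (T i)) * ?v T = jm_weight l c (bcomp (t i)) * ?v T"
      using std_vec_jm(2)[OF l t i, of T] by (cases "?v T = 0") simp_all
    then show ?thesis unfolding jm_element_acts[where c = c, OF l i T c0] j by (simp add: distrib_right)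
  qed
  have "(\<Sum>g\<in>GL l n. ?J g * ip l n (act n g ?v) ?u) =
    (\<Sum>g\<in>GL l n. \<Sum>T\<in>omega l n. ?J g * act n g ?v T * cnj (?u T))"
    by (simp add: ip_def sum_distrib_left mult.assoc)
  also have "\<dots> = (\<Sum>T\<in>omega l n. \<Sum>g\<in>GL l n. ?J g * act n g ?v T * cnj (?u T))" by (rule sum.swap)
  also have "\<dots> = (\<Sum>T\<in>omega l n. ?w * ?v T * cnj (?u T))"
    unfolding sum_distrib_right[symmetric] by (intro sum.cong refl) (simp only: pt)
  also have "\<dots> = ?w * ip l n ?v ?u" by (simp only: ip_def sum_distrib_left mult.assoc)
  finally have "(\<Sum>g\<in>GL l n. ?J g * std_coeff l n s t g) = ?w * ip l n ?v ?u / ip l n ?u ?u"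
    using True by (simp add: std_coeff_def sum_divide_distrib[symmetric])
  then show ?thesis using std_vec_orthogonal[OF l t s] ip_std_vec_self[OF l s] by auto
qed

lemma jm_generators: "jm_element l n c ` {1..n} = {jm_element l n c (Suc i) | i. i < n}"
proof -
  have "{1..n} = Suc ` {..<n}" by (simp add: lessThan_Suc_atMost image_Suc_lessThan)
  then show ?thesis by auto
qed

lemma JM_diagonal:
  assumes l: "1 \<le> l" and c0: "c 0 = - 1 / of_nat l"
  shows "diagonal_algebra (Gl1 l n) (Std l n) (shape n) (std_coeff l n) (jm_element l n c ` {1..n})"
proof (rule diagonal_algebra.intro[OF std_coeff_basis[OF l]], rule diagonal_algebra_axioms.intro)
  interpret coeff_basis "Gl1 l n" "Std l n" "shape n" "std_coeff l n" by (rule std_coeff_basis[OF l])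
  show "alg_coeff a s t = 0" if "a \<in> jm_element l n c ` {1..n}" "s \<in> Std l n" "t \<in> Std l n" "s \<noteq> t" for a s t
    using that jm_element_std_coeff[where c = c, OF l _ c0 that(2,3)] unfolding jm_generators alg_coeff_def by auto
  show "a g = 0" if "a \<in> jm_element l n c ` {1..n}" "g \<notin> GL l n" for a g
    using that jm_element_off[OF l] unfolding jm_generators by auto
qed

lemma shape_Std: "shape n ` Std l n = diags l n"
proof (intro subset_antisym subsetI)
  fix D assume "D \<in> diags l n"
  then have "0 < nstd l D" "card D = n" using nstd_pos by (simp_all add: diags_def)
  then have "{t \<in> Std l n. shape n t = D} \<noteq> {}" by (auto simp: nstd_def card_gt_0_iff)
  then show "D \<in> shape n ` Std l n" by blast
qed (use shape_in_diags in blast)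

text \<open>The meeting point of both sides: cellular characters and evaluated quasimonomial vectors
  are each shown to be of this form, with t running over the standard tableaux.\<close>

definition residue_char :: "nat \<Rightarrow> nat \<Rightarrow> (nat \<Rightarrow> int) \<Rightarrow> (nat \<Rightarrow> box) \<Rightarrow> complex mat \<Rightarrow> complex" where
  "residue_char l n s t = (\<lambda>g. \<Sum>lam\<in>lparts l n. of_nat (card {u \<in> Std l n. shape n u = ldiag lam \<and>
    (\<forall>x<n. charged_content s (u x) = charged_content s (t x))}) * chi l lam g)"

text \<open>The eigenvalue of the \<open>i\<close>-th Jucys--Murphy element on the vector of \<open>t\<close> is
  \<open>k\<close> plus the charged content of the box containing \<open>i\<close>.\<close>

lemma jm_cellular_characters_eq:
  assumes l: "1 \<le> l" and c0: "c 0 = - 1 / of_nat l"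
    and k': "\<forall>d\<in>{1..l}. of_int (k' d) = of_nat l * k_param l c (1 - int d) - k"
  shows "jm_cellular_characters l n c = residue_char l n k' ` Std l n"
proof -
  interpret diagonal_algebra "Gl1 l n" "Std l n" "shape n" "std_coeff l n" "jm_element l n c ` {1..n}"
    by (rule JM_diagonal[where c = c, OF l c0])
  have JM: "JM l n c = A" by (simp add: JM_def)
  have ev: "alg_coeff (jm_element l n c (Suc i)) t t = of_int (charged_content k' (t i)) + k"
    if t: "t \<in> Std l n" and i: "i < n" for t i
  proof -
    obtain a b d where b: "t i = (a, b, d)" by (cases "t i")
    have "d \<in> {1..l}" using Std_box(5,6)[OF t i b] by simp
    then have "jm_weight l c d = of_int (k' d) + k" using bspec[OF k', of d] jm_weight_k_param[OF l, of c d] by simp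
    then show ?thesis using jm_element_std_coeff[where c = c, OF l i c0 t t] by (simp add: alg_coeff_def b)
  qed
  \<comment> \<open>Equality of weights may be tested on the generators, and there the shift k
    cancels.\<close>
  have same: "same_weight s t \<longleftrightarrow> (\<forall>x<n. charged_content k' (s x) = charged_content k' (t x))"
    if s: "s \<in> Std l n" and t: "t \<in> Std l n" for s t
    unfolding same_weight_iff[OF s t] unfolding jm_generators using ev[OF s] ev[OF t] by auto
  have bij: "bij_betw ldiag (lparts l n) (shape n ` Std l n)" unfolding shape_Std by (rule bij_ldiag)
  have char: "jm_char l n c 1 \<tau> = residue_char l n k' t"
    if t: "t \<in> Std l n" and \<tau>: "\<And>a. a \<in> A \<Longrightarrow> \<tau> a 0 0 = alg_coeff a t t" for t and \<tau> :: "(complex mat \<Rightarrow> complex) \<Rightarrow> nat \<Rightarrow> nat \<Rightarrow> complex"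
  proof
    fix g
    have "jm_char l n c 1 \<tau> g = (\<Sum>\<alpha>\<in>shape n ` Std l n. of_nat (card {s \<in> fib \<alpha>. same_weight s t}) * blk_char \<alpha> g)"
      unfolding jm_char_def JM by (rule sum_Irr[where \<tau> = \<tau>, OF t \<tau>])
    also have "\<dots> = (\<Sum>lam\<in>lparts l n. of_nat (card {s \<in> fib (ldiag lam). same_weight s t}) * blk_char (ldiag lam) g)"
      by (rule sum.reindex_bij_betw[OF bij, symmetric])
    also have "\<dots> = (\<Sum>lam\<in>lparts l n. of_nat (card {s \<in> Std l n. shape n s = ldiag lam \<and>
      (\<forall>x<n. charged_content k' (s x) = charged_content k' (t x))}) * chi l lam g)"
    proof (rule sum.cong[OF refl])
      fix lam assume lam: "lam \<in> lparts l n"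
      have "{s \<in> fib (ldiag lam). same_weight s t} = {s \<in> Std l n. shape n s = ldiag lam \<and>
        (\<forall>x<n. charged_content k' (s x) = charged_content k' (t x))}"
        using same[OF _ t] by (auto simp: fib_def)
      moreover have "blk_char (ldiag lam) g = chi l lam g"
      proof (cases "g \<in> GL l n")
        case True
        then show ?thesis using chi_std_coeff[OF l lam True] by (simp add: blk_char_def fib_def)
      next
        case False
        then show ?thesis by (simp add: blk_char_def chi_def Let_def rep_char_def lparts_size[OF lam])
      qed
      ultimately show "of_nat (card {s \<in> fib (ldiag lam). same_weight s t}) * blk_char (ldiag lam) g =
        of_nat (card {s \<in> Std l n. shape n s = ldiag lam \<and>
        (\<forall>x<n. charged_content k' (s x) = charged_content k' (t x))}) * chi l lam g" by simp
    qed
    also have "\<dots> = residue_char l n k' t g" by (simp only: residue_char_def)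
    finally show "jm_char l n c 1 \<tau> g = residue_char l n k' t g" .
  qed
  show ?thesis
  proof (intro subset_antisym subsetI)
    fix \<chi> assume "\<chi> \<in> jm_cellular_characters l n c"
    then obtain e \<tau> where e: "\<chi> = jm_char l n c e \<tau>" "is_alg_rep (Gl1 l n) A {..<e} \<tau>" "irreducible_on A {..<e} \<tau>"
      unfolding jm_cellular_characters_def JM by blast
    obtain t where t: "e = 1" "t \<in> Std l n" "\<forall>a\<in>A. \<tau> a 0 0 = alg_coeff a t t"
      using irreducible_alg_rep[OF e(2,3)] by blast
    have "jm_char l n c 1 \<tau> = residue_char l n k' t" by (rule char[OF t(2)]) (use t(3) in blast)
    then have "\<chi> = residue_char l n k' t" using e(1) t(1) by (simp only:)
    then show "\<chi> \<in> residue_char l n k' ` Std l n" using t(2) by (rule image_eqI)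
  next
    fix \<chi> assume "\<chi> \<in> residue_char l n k' ` Std l n"
    then obtain t where t: "\<chi> = residue_char l n k' t" "t \<in> Std l n" by (rule imageE)
    have "\<chi> = jm_char l n c 1 (\<lambda>a x y. alg_coeff a t t)" unfolding t(1) by (rule char[OF t(2) refl, symmetric])
    then show "\<chi> \<in> jm_cellular_characters l n c"
      unfolding jm_cellular_characters_def JM using weight_rep[OF t(2)] by blast
  qed
qed

section \<open>The Fock space at q = 1\<close>

text \<open>The relation behind the definite description \<open>at_one\<close>. It carries existence
  and value together and so passes through sums and products.\<close>

definition has_value :: "ratfun \<Rightarrow> rat \<Rightarrow> bool" where
  "has_value a r \<longleftrightarrow> (\<exists>f g. poly g 1 \<noteq> 0 \<and> a = Fract f g \<and> r = poly f 1 / poly g 1)"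

lemma has_valueI: "poly g 1 \<noteq> 0 \<Longrightarrow> has_value (Fract f g) (poly f 1 / poly g 1)"
  unfolding has_value_def by blast

lemma has_valueE:
  assumes "has_value a r"
  obtains f g where "poly g 1 \<noteq> 0" "a = Fract f g" "r = poly f 1 / poly g 1"
  using assms unfolding has_value_def by blast

lemma has_value_unique:
  assumes "has_value a r" "has_value a r'"
  shows "r = r'"
proof -
  obtain f g where a: "poly g 1 \<noteq> 0" "a = Fract f g" "r = poly f 1 / poly g 1" by (rule has_valueE[OF assms(1)])
  obtain f' g' where b: "poly g' 1 \<noteq> 0" "a = Fract f' g'" "r' = poly f' 1 / poly g' 1" using assms(2) unfolding has_value_def by blast
  have "g \<noteq> 0" "g' \<noteq> 0" using a(1) b(1) by auto
  then have "f * g' = f' * g" using a(2) b(2) by (simp add: eq_fract)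
  then have "poly f 1 * poly g' 1 = poly f' 1 * poly g 1" by (metis poly_mult)
  then show ?thesis unfolding a(3) b(3) using a(1) b(1) by (simp add: frac_eq_eq)
qed

lemma at_one_eq: "has_value a r \<Longrightarrow> at_one a = r"
  unfolding at_one_def has_value_def[symmetric] by (rule the_equality) (auto intro: has_value_unique)

lemma has_value_0: "has_value 0 0"
  using has_valueI[of 1 0] by (simp add: Zero_fract_def)

lemma has_value_1: "has_value 1 1"
  using has_valueI[of 1 1] by (simp add: One_fract_def)

lemma has_value_add:
  assumes "has_value a r" "has_value b s"
  shows "has_value (a + b) (r + s)"
proof -
  obtain f g where a: "poly g 1 \<noteq> 0" "a = Fract f g" "r = poly f 1 / poly g 1" by (rule has_valueE[OF assms(1)])
  obtain f' g' where b: "poly g' 1 \<noteq> 0" "b = Fract f' g'" "s = poly f' 1 / poly g' 1" by (rule has_valueE[OF assms(2)])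
  have "g \<noteq> 0" "g' \<noteq> 0" using a(1) b(1) by auto
  then have "a + b = Fract (f * g' + f' * g) (g * g')" unfolding a(2) b(2) by (rule add_fract)
  moreover have "r + s = poly (f * g' + f' * g) 1 / poly (g * g') 1"
    unfolding a(3) b(3) add_frac_eq[OF a(1) b(1)] by simp
  ultimately show ?thesis using a(1) b(1) by (simp only:) (rule has_valueI, simp)
qed

lemma has_value_mult:
  assumes "has_value a r" "has_value b s"
  shows "has_value (a * b) (r * s)"
proof -
  obtain f g where a: "poly g 1 \<noteq> 0" "a = Fract f g" "r = poly f 1 / poly g 1" by (rule has_valueE[OF assms(1)])
  obtain f' g' where b: "poly g' 1 \<noteq> 0" "b = Fract f' g'" "s = poly f' 1 / poly g' 1" by (rule has_valueE[OF assms(2)])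
  show ?thesis unfolding has_value_def using a b
    by (intro exI[of _ "f * f'"] exI[of _ "g * g'"]) simp
qed

lemma has_value_inverse:
  assumes "has_value a r" "r \<noteq> 0"
  shows "has_value (inverse a) (inverse r)"
proof -
  obtain f g where a: "poly g 1 \<noteq> 0" "a = Fract f g" "r = poly f 1 / poly g 1" by (rule has_valueE[OF assms(1)])
  have "inverse a = Fract g f" "inverse r = poly g 1 / poly f 1" "poly f 1 \<noteq> 0" using a assms(2) by auto
  then show ?thesis by (simp only:) (rule has_valueI)
qed

lemma has_value_sum:
  "(\<And>x. x \<in> I \<Longrightarrow> has_value (f x) (r x)) \<Longrightarrow> has_value (\<Sum>x\<in>I. f x) (\<Sum>x\<in>I. r x)"
  by (induction I rule: infinite_finite_induct) (simp_all add: has_value_0 has_value_add)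

text \<open>Every exponent, positive or negative, gives the value 1, so the integers
  \<open>N_succ\<close> disappear at q = 1.\<close>

lemma has_value_q_powi: "has_value (q_ind powi N) 1"
proof -
  have q: "has_value q_ind 1" using has_valueI[of 1 "[:0, 1:]"] by (simp add: q_ind_def to_fract_def)
  have pow: "has_value (a ^ m) 1" if "has_value a 1" for a m
    using that by (induction m) (use has_value_1 has_value_mult[of a 1 _ 1] in simp_all)
  show ?thesis
    unfolding power_int_def using pow[OF q] pow[OF has_value_inverse[OF q, simplified]] by simp
qed

lemma finite_lparts [simp]: "finite (lparts l n)"
  using bij_betw_finite[OF bij_ldiag[of l n]] finite_diags by blast

definition residue_count :: "nat \<Rightarrow> (nat \<Rightarrow> int) \<Rightarrow> int list \<Rightarrow> box set \<Rightarrow> nat" where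
  "residue_count l s is D = card {t \<in> Std l (length is). shape (length is) t = D \<and>
     (\<forall>x<length is. charged_content s (t x) = is ! x)}"

lemma residue_count_nonzero:
  "residue_count l s is D \<noteq> 0 \<longleftrightarrow> (\<exists>t\<in>Std l (length is). shape (length is) t = D \<and>
    (\<forall>x<length is. charged_content s (t x) = is ! x))"
  by (auto simp: residue_count_def card_eq_0_iff)

lemma lparts_0: "lparts l 0 = {replicate l []}"
proof (intro subset_antisym subsetI)
  fix lam assume "lam \<in> lparts l 0"
  then have len: "length lam = l" and p: "\<forall>\<mu>\<in>set lam. is_partition \<mu>" and z: "\<forall>\<mu>\<in>set lam. sum_list \<mu> = 0"
    by (auto simp: lparts_def is_lpart_def lpart_size_def)
  have "\<mu> = []" if "\<mu> \<in> set lam" for \<mu>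
    using p z that by (cases \<mu>) (auto simp: is_partition_def)
  then show "lam \<in> {replicate l []}" using len by (simp add: replicate_eqI)
next
  fix lam :: "nat list list" assume "lam \<in> {replicate l []}"
  then show "lam \<in> lparts l 0" by (auto simp: lparts_def is_lpart_def lpart_size_def is_partition_def)
qed

lemma F_condition_iff:
  assumes lam: "lam \<in> lparts l m" and mu: "mu \<in> lparts l (Suc m)"
  shows "(\<exists>\<gamma>. addable l lam \<gamma> \<and> charged_content s \<gamma> = i \<and> ldiag mu = ldiag lam \<union> {\<gamma>}) \<longleftrightarrow>
    ldiag lam \<in> down_diags l (ldiag mu) \<and> charged_content s (the_elem (ldiag mu - ldiag lam)) = i"
proof
  assume "\<exists>\<gamma>. addable l lam \<gamma> \<and> charged_content s \<gamma> = i \<and> ldiag mu = ldiag lam \<union> {\<gamma>}"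
  then obtain \<gamma> where g: "\<gamma> \<notin> ldiag lam" "charged_content s \<gamma> = i" "ldiag mu = ldiag lam \<union> {\<gamma>}"
    by (auto simp: addable_def)
  have "is_diag l (ldiag lam)" using lam by (intro is_diag_ldiag) (simp add: lparts_def)
  moreover have "ldiag lam = ldiag mu - {\<gamma>}" "\<gamma> \<in> ldiag mu" "ldiag mu - ldiag lam = {\<gamma>}" using g(1,3) by auto
  ultimately show "ldiag lam \<in> down_diags l (ldiag mu) \<and> charged_content s (the_elem (ldiag mu - ldiag lam)) = i"
    using g(2) unfolding down_diags_def by (simp only:) (intro conjI CollectI exI[of _ \<gamma>], simp_all)
next
  assume a: "ldiag lam \<in> down_diags l (ldiag mu) \<and> charged_content s (the_elem (ldiag mu - ldiag lam)) = i"
  then obtain \<gamma> where g: "\<gamma> \<in> ldiag mu" "ldiag lam = ldiag mu - {\<gamma>}" by (auto simp: down_diags_def)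
  have d: "ldiag mu - ldiag lam = {\<gamma>}" "ldiag mu = ldiag lam \<union> {\<gamma>}" using g by auto
  have "addable l lam \<gamma>" unfolding addable_def
    using g(2) d(2) mu by (auto simp: lparts_def intro!: exI[of _ mu])
  then show "\<exists>\<gamma>. addable l lam \<gamma> \<and> charged_content s \<gamma> = i \<and> ldiag mu = ldiag lam \<union> {\<gamma>}"
    using a d by (intro exI[of _ \<gamma>]) simp
qed

text \<open>The recursion \<open>card_Std_Suc\<close> with P prescribing the charged contents; the
  sum runs over multipartitions to match the form of \<open>fock_F\<close>.\<close>

lemma residue_count_snoc:
  assumes mu: "mu \<in> lparts l (Suc (length is))"
  shows "residue_count l s (is @ [i]) (ldiag mu) = (\<Sum>lam\<in>lparts l (length is).
    if ldiag lam \<in> down_diags l (ldiag mu) \<and> charged_content s (the_elem (ldiag mu - ldiag lam)) = i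
    then residue_count l s is (ldiag lam) else 0)"
proof -
  let ?n = "length is"
  have E: "ldiag mu \<in> diags l (Suc ?n)" by (rule ldiag_in_diags[OF mu])
  let ?P = "\<lambda>t. \<forall>x<Suc ?n. charged_content s (t x) = (is @ [i]) ! x"
  let ?F = "\<lambda>D. if D \<in> down_diags l (ldiag mu) \<and> charged_content s (the_elem (ldiag mu - D)) = i
    then residue_count l s is D else 0"
  have P: "?P (t(?n := b)) \<longleftrightarrow> (\<forall>x<?n. charged_content s (t x) = is ! x) \<and> charged_content s b = i" for t b
    by (auto simp: less_Suc_eq nth_append)
  have "residue_count l s (is @ [i]) (ldiag mu) =
    (\<Sum>D\<in>down_diags l (ldiag mu). card {t \<in> Std l ?n. shape ?n t = D \<and> ?P (t(?n := the_elem (ldiag mu - D)))})"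
    unfolding residue_count_def using card_Std_Suc[OF E, of ?P] by simp
  also have "\<dots> = (\<Sum>D\<in>down_diags l (ldiag mu). ?F D)"
    unfolding P by (rule sum.cong) (auto simp: residue_count_def)
  also have "\<dots> = (\<Sum>D\<in>diags l ?n. ?F D)"
    by (rule sum.mono_neutral_left[OF finite_diags down_diags_subset[OF E]]) auto
  also have "\<dots> = (\<Sum>lam\<in>lparts l ?n. ?F (ldiag lam))"
    by (rule sum.reindex_bij_betw[OF bij_ldiag, symmetric])
  finally show ?thesis .
qed

text \<open>Support and value are proved together: the value at q = 1 alone would not show that a
  coefficient with count 0 is zero as a function of q.\<close>

lemma quasimonomial_coeffs:
  fixes l :: nat and s :: "nat \<Rightarrow> int" and "is" :: "int list"
  defines "v \<equiv> fold (fock_F l s) is (ket (replicate l []))"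
  shows "(v lam \<noteq> 0 \<longrightarrow> lam \<in> lparts l (length is) \<and> residue_count l s is (ldiag lam) \<noteq> 0) \<and>
    (lam \<in> lparts l (length is) \<longrightarrow> has_value (v lam) (of_nat (residue_count l s is (ldiag lam))))"
  unfolding v_def
\<comment> \<open>The head of the list acts first, so the last index belongs to the outermost
  operator.\<close>
proof (induction "is" arbitrary: lam rule: rev_induct)
  case Nil
  have "ldiag (replicate l []) = {}" using ldiag_in_diags[of "replicate l []" l 0] by (simp add: lparts_0 diags_0)
  then have "residue_count l s [] (ldiag (replicate l [])) = 1"
    by (simp add: residue_count_def Std_0 shape_def)
  then show ?case by (auto simp: lparts_0 ket_def has_value_1)
next
  case (snoc i "is")
  let ?v = "fold (fock_F l s) is (ket (replicate l []))"
  let ?n = "length is"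
  have v': "fold (fock_F l s) (is @ [i]) (ket (replicate l [])) = fock_F l s i ?v" by simp
  have supp: "{nu. ?v nu \<noteq> 0} \<subseteq> lparts l ?n" using snoc.IH by blast
  have fock: "fock_F l s i ?v lam = (\<Sum>nu\<in>lparts l ?n. ?v nu * F_ket l s i nu lam)"
    unfolding fock_F_def[of l s i ?v] by (rule sum.mono_neutral_left[OF finite_lparts supp]) auto
  have size: "lam \<in> lparts l (Suc ?n)"
    if nu: "nu \<in> lparts l ?n" and F: "F_ket l s i nu lam \<noteq> 0" for nu
  proof -
    obtain \<gamma> where g: "is_lpart l lam" "addable l nu \<gamma>" "ldiag lam = ldiag nu \<union> {\<gamma>}"
      using F by (auto simp: F_ket_def split: if_splits)
    have "lpart_size lam = card (ldiag lam)" "lpart_size nu = card (ldiag nu)" "finite (ldiag nu)"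
      by (simp_all add: ldiag_eq_from card_ldiag_from finite_ldiag_from)
    moreover have "lpart_size nu = ?n" by (rule lparts_size[OF nu])
    moreover have "\<gamma> \<notin> ldiag nu" using g(2) by (simp add: addable_def)
    ultimately have "lpart_size lam = Suc ?n" using g(3) by simp
    then show ?thesis using g(1) by (simp add: lparts_def)
  qed
  let ?c = "\<lambda>nu. ldiag nu \<in> down_diags l (ldiag lam) \<and> charged_content s (the_elem (ldiag lam - ldiag nu)) = i"
  have Fv: "F_ket l s i nu lam = (if ?c nu then q_ind powi N_succ l s i nu (the_elem (ldiag lam - ldiag nu)) else 0)"
    if "nu \<in> lparts l ?n" "lam \<in> lparts l (Suc ?n)" for nu
    unfolding F_ket_def F_condition_iff[OF that] using that(2) by (simp add: lparts_def)
  show ?case unfolding v' length_append_singleton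
  proof (intro conjI impI)
    assume nz: "fock_F l s i ?v lam \<noteq> 0"
    then obtain nu where nu: "nu \<in> lparts l ?n" "?v nu * F_ket l s i nu lam \<noteq> 0"
      unfolding fock using sum.not_neutral_contains_not_neutral by blast
    then have vF: "?v nu \<noteq> 0" "F_ket l s i nu lam \<noteq> 0" by auto
    show lam: "lam \<in> lparts l (Suc ?n)" by (rule size[OF nu(1) vF(2)])
    have "?c nu" using vF(2) Fv[OF nu(1) lam] by (auto split: if_splits)
    moreover have "residue_count l s is (ldiag nu) \<noteq> 0" using snoc.IH vF(1) by blast
    ultimately show "residue_count l s (is @ [i]) (ldiag lam) \<noteq> 0"
      unfolding residue_count_snoc[OF lam] using nu(1) by auto
  next
    assume lam: "lam \<in> lparts l (Suc ?n)"
    have "has_value (F_ket l s i nu lam) (if ?c nu then 1 else 0)" if "nu \<in> lparts l ?n" for nu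
      unfolding Fv[OF that lam] by (simp add: has_value_q_powi has_value_0)
    then have "has_value (\<Sum>nu\<in>lparts l ?n. ?v nu * F_ket l s i nu lam)
      (\<Sum>nu\<in>lparts l ?n. of_nat (residue_count l s is (ldiag nu)) * (if ?c nu then 1 else 0))"
      using snoc.IH by (intro has_value_sum has_value_mult) blast+
    moreover have "(\<Sum>nu\<in>lparts l ?n. of_nat (residue_count l s is (ldiag nu)) * (if ?c nu then 1 else 0)) =
      (of_nat (residue_count l s (is @ [i]) (ldiag lam)) :: rat)"
      unfolding residue_count_snoc[OF lam] of_nat_sum by (intro sum.cong refl) simp
    ultimately show "has_value (fock_F l s i ?v lam) (of_nat (residue_count l s (is @ [i]) (ldiag lam)))"
      unfolding fock by (simp only:)
  qed
qed

theorem theorem3p8: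
  fixes l n :: nat and c :: "nat \<Rightarrow> complex" and k :: complex and k' :: "nat \<Rightarrow> int"
  assumes "l \<ge> 1"
    and "c 0 = - 1 / of_nat l"
    and "\<forall>i::int. \<exists>m::int. of_nat l * k_param l c i = of_int m + k"
    and "\<forall>d\<in>{1..l}. of_int (k' d) = of_nat l * k_param l c (1 - int d) - k"
  shows "jm_cellular_characters l n c = {gamma_char l n v | v. quasimonomial l k' n v}"
proof -
  have gamma: "gamma_char l n (fold (fock_F l k') is (ket (replicate l []))) = residue_char l n k' t"
    if len: "length is = n" and cc: "\<And>x. x < n \<Longrightarrow> is ! x = charged_content k' (t x)" for "is" t
  proof
    fix g
    show "gamma_char l n (fold (fock_F l k') is (ket (replicate l []))) g = residue_char l n k' t g"
      unfolding gamma_char_def residue_char_def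
    proof (rule sum.cong[OF refl])
      fix lam assume "lam \<in> lparts l n"
      then have "at_one (fold (fock_F l k') is (ket (replicate l [])) lam) = of_nat (residue_count l k' is (ldiag lam))"
        using quasimonomial_coeffs[of l k' "is" lam] len by (intro at_one_eq) blast
      moreover have "residue_count l k' is (ldiag lam) = card {s \<in> Std l n. shape n s = ldiag lam \<and>
        (\<forall>x<n. charged_content k' (s x) = charged_content k' (t x))}"
        unfolding residue_count_def len using cc by (intro arg_cong[where f = card]) auto
      ultimately show "of_rat (at_one (fold (fock_F l k') is (ket (replicate l [])) lam)) * chi l lam g =
        of_nat (card {s \<in> Std l n. shape n s = ldiag lam \<and>
        (\<forall>x<n. charged_content k' (s x) = charged_content k' (t x))}) * chi l lam g" by simp
    qed
  qed
  \<comment> \<open>A nonzero coefficient has a positive count, so the indices are the charged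
    contents along some standard tableau; sequences realised by no tableau give the zero vector,
    which is excluded from the quasimonomial ones.\<close>
  have nonzero: "\<exists>t\<in>Std l n. \<forall>x<n. is ! x = charged_content k' (t x)"
    if len: "length is = n" and nz: "fold (fock_F l k') is (ket (replicate l [])) \<noteq> (\<lambda>_. 0)" for "is"
  proof -
    obtain lam where "fold (fock_F l k') is (ket (replicate l [])) lam \<noteq> 0" using nz by (auto simp: fun_eq_iff)
    then have "residue_count l k' is (ldiag lam) \<noteq> 0" using quasimonomial_coeffs[of l k' "is" lam] by blast
    then obtain t where "t \<in> Std l n" "\<forall>x<n. charged_content k' (t x) = is ! x"
      unfolding residue_count_nonzero len by blast
    then show ?thesis by (intro bexI[of _ t]) simp_all
  qed
  \<comment> \<open>Conversely, t itself is counted at its own shape, so that coefficient has a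
    nonzero value at q = 1 and the vector is nonzero.\<close>
  have quasi: "quasimonomial l k' n (fold (fock_F l k') is (ket (replicate l [])))"
    if t: "t \<in> Std l n" and len: "length is = n" and cc: "\<And>x. x < n \<Longrightarrow> is ! x = charged_content k' (t x)" for "is" t
    unfolding quasimonomial_def
  proof (intro conjI)
    let ?v = "fold (fock_F l k') is (ket (replicate l []))"
    have supp: "{lam. ?v lam \<noteq> 0} \<subseteq> lparts l n" using quasimonomial_coeffs[of l k' "is"] len by blast
    then show "?v \<in> fock_space l n" unfolding fock_space_def using finite_subset[OF supp finite_lparts] by blast
    have "shape n t \<in> ldiag ` lparts l n"
      using shape_in_diags[OF t] unfolding bij_betw_imp_surj_on[OF bij_ldiag] .
    then obtain lam where lam: "shape n t = ldiag lam" "lam \<in> lparts l n" by (rule imageE)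
    have "residue_count l k' is (ldiag lam) \<noteq> 0"
      unfolding residue_count_nonzero len using t lam(1) cc by (intro bexI[of _ t]) simp_all
    moreover have "has_value (?v lam) (of_nat (residue_count l k' is (ldiag lam)))"
      using quasimonomial_coeffs[of l k' "is" lam] lam(2) len by blast
    ultimately have "?v lam \<noteq> 0" using has_value_unique[OF has_value_0, of "of_nat (residue_count l k' is (ldiag lam))"] by auto
    then show "?v \<noteq> (\<lambda>_. 0)" by (metis)
    show "\<exists>is'. length is' = n \<and> ?v = fold (fock_F l k') is' (ket (replicate l []))" using len by blast
  qed
  show ?thesis
    unfolding jm_cellular_characters_eq[where c = c and k = k and k' = k', OF assms(1,2,4)]
  proof (intro subset_antisym subsetI)
    fix \<chi> assume "\<chi> \<in> residue_char l n k' ` Std l n"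
    then obtain t where t: "\<chi> = residue_char l n k' t" "t \<in> Std l n" by (rule imageE)
    define is1 where "is1 = map (\<lambda>x. charged_content k' (t x)) [0..<n]"
    have i: "length is1 = n" "\<And>x. x < n \<Longrightarrow> is1 ! x = charged_content k' (t x)" by (simp_all add: is1_def)
    have "\<chi> = gamma_char l n (fold (fock_F l k') is1 (ket (replicate l [])))"
      unfolding t(1) by (rule gamma[OF i, symmetric])
    then show "\<chi> \<in> {gamma_char l n v | v. quasimonomial l k' n v}" using quasi[OF t(2) i] by blast
  next
    fix \<chi> assume "\<chi> \<in> {gamma_char l n v | v. quasimonomial l k' n v}"
    then obtain v where v: "\<chi> = gamma_char l n v" "quasimonomial l k' n v" by blast
    then obtain is1 where i: "length is1 = n" "v = fold (fock_F l k') is1 (ket (replicate l []))" "v \<noteq> (\<lambda>_. 0)"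
      unfolding quasimonomial_def by blast
    obtain t where t: "t \<in> Std l n" "\<forall>x<n. is1 ! x = charged_content k' (t x)"
      using nonzero[OF i(1)] i(2,3) by blast
    have "\<chi> = residue_char l n k' t"
      unfolding v(1) i(2) by (rule gamma[OF i(1)]) (use t(2) in blast)
    then show "\<chi> \<in> residue_char l n k' ` Std l n" using t(1) by (rule image_eqI)
  qed
qed

end
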